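(* For $g\in U_N$ and $f\otimes h\in\mathscr{SC}(U_N)=\mathscr S\otimes Cl_\tau(U_N)$ put $\rho_g(f\otimes h):=f\otimes h'$ with $h'(x)=h(x-g)e^{\frac i2\omega(g,x)}$, and extend $\rho$ by continuity to a $\tau$-twisted action $\rho$ of $U$ on the $(\mathscr{SC}(U),\mathscr{SC}(U))$-bimodule $\mathscr{SC}(U)$. Then the pair $(\mathscr{SC}(U),0)$, equipped with $\rho$, is a $\tau$-twisted $U$-equivariant Kasparov $(\mathscr{SC}(U),\mathscr{SC}(U))$-module. (Its class $[\widetilde{\sigma_{\not\partial}^{Cl}}]\in KK_U^\tau(\mathscr{SC}(U),\mathscr{SC}(U))$ is called the Clifford symbol element.)
   Context: All tensor products and commutators are $\mathbb Z_2$-graded. $\mathscr S$ is $C_0(\mathbb R)$ graded by $\epsilon(f)(t)=f(-t)$. $\mathrm{Cliff}_+(V)$ is the complex Clifford algebra with $v^2=\|v\|^2$, $v^*=v$; $Cl_\tau(X)=C_0(X,\mathrm{Cliff}_+(T^*X))$. Group. $T$ is the circle, $\mathfrak t\cong\mathbb R$ its Lie algebra with inner product and unit vector $\mathbf 1$; $U=\{f\in C^\infty(S^1,\mathfrak t)\mid\int f\,d\theta=0\}$, additive group with $C^\infty$-topology. $e_k=\frac{\cos k\theta}{\sqrt{k\pi}}\mathbf 1$, $f_k=\frac{\sin k\theta}{\sqrt{k\pi}}\mathbf 1$ ($k\ge1$), taken orthonormal; $U_N=\mathrm{span}(e_1,f_1,\dots,e_N,f_N)$; $x=\sum(x_ke_k+y_kf_k)$;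 $e_k,f_k$ also denote $dx_k,dy_k$. $\omega(f_1,f_2)=\int(f_1|f_2')\,d\theta$, i.e. $\omega(g,x)=\sum(g_ky_k-h_kx_k)$ for $g=\sum(g_ke_k+h_kf_k)$. HKT algebra. Fix $l>\frac32$; $C_N^M=\sum_{k=N}^Mk^{-l}(x_ke_k+y_kf_k)$; $\beta_{N,M}:\mathscr{SC}(U_N)\to\mathscr{SC}(U_M)=\mathscr S\otimes Cl_\tau(U_M\ominus U_N)\otimes Cl_\tau(U_N)$, $\beta_{N,M}(f\otimes h)=f(X\otimes\mathrm{id}+\mathrm{id}\otimes C_{N+1}^M)\otimes h$, $N\le M$ (functional calculus of unbounded self-adjoint multipliers; $X$ the coordinate multiplier on $\mathscr S$); $\mathscr{SC}(U)=\varinjlim\mathscr{SC}(U_N)$. $U$ acts on the $C^*$-algebra $\mathscr{SC}(U)$ by the continuous extension $\sigma$ of translation $\sigma_g(f\otimes h)=f\otimes h(\cdot-g)$. As a bimodule over itself, $\mathscr{SC}(U)$ has left and right multiplication and inner product $(a_1|a_2)=a_1^*a_2$. Being a $\tau$-twisted $U$-equivariant bimodule means: $\rho$ is a (strongly) continuous family of isometries with $\rho_{g_1}\rho_{g_2}=\rho_{g_1+g_2}e^{\frac i2\omega(g_1,g_2)}$, $\rho_g(a\,a_1\,a')=\sigma_g(a)\rho_g(a_1)\sigma_g(a')$ and $\rho_g(a_1)^*\rho_g(a_2)=\sigma_g(a_1^*a_2)$. A $\tau$-twisted $U$-equivariant Kasparov $(A,B)$-module is a countably generated $\mathbb Z_2$-graded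 $\tau$-twisted $U$-equivariant Hilbert $B$-module $E$ with equivariant $*$-homomorphism $A\to\mathcal L_B(E)$ and an odd self-adjoint $F\in\mathcal L_B(E)$ such that $[a,F]$, $a(1-F^2)$, $a(g(F)-F)$ are $B$-compact for all $a\in A$, $g\in U$, and $g\mapsto g(aF)$ is norm-continuous for all $a\in A$. *)

theory Defs
  imports "HOL-Analysis.Analysis"
begin

section \<open>Graded C*-algebras and graded Hilbert modules\<close>

record 'a cvs =
  car :: "'a set"
  zer :: "'a"
  add :: "'a \<Rightarrow> 'a \<Rightarrow> 'a"
  scl :: "complex \<Rightarrow> 'a \<Rightarrow> 'a"

record 'a gcalg = "'a cvs" +
  mul :: "'a \<Rightarrow> 'a \<Rightarrow> 'a"
  str :: "'a \<Rightarrow> 'a"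
  nrm :: "'a \<Rightarrow> real"
  gra :: "'a \<Rightarrow> 'a"

record ('e, 'b) hmod = "'e cvs" +
  act :: "'e \<Rightarrow> 'b \<Rightarrow> 'e"
  inn :: "'e \<Rightarrow> 'e \<Rightarrow> 'b"
  hgr :: "'e \<Rightarrow> 'e"

definition sub :: "('a, 'z) cvs_scheme \<Rightarrow> 'a \<Rightarrow> 'a \<Rightarrow> 'a" where
  "sub V x y = add V x (scl V (-1) y)"

definition complex_vector_space :: "('a, 'z) cvs_scheme \<Rightarrow> bool" where
  "complex_vector_space V \<longleftrightarrow>
     zer V \<in> car V \<and>
     (\<forall>x\<in>car V. \<forall>y\<in>car V. add V x y \<in> car V \<and> add V x y = add V y x) \<and>
     (\<forall>x\<in>car V. \<forall>y\<in>car V. \<forall>z\<in>car V. add V (add V x y) z = add V x (add V y z)) \<and>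
     (\<forall>x\<in>car V. add V (zer V) x = x \<and> sub V x x = zer V) \<and>
     (\<forall>c. \<forall>x\<in>car V. scl V c x \<in> car V) \<and>
     (\<forall>c. \<forall>x\<in>car V. \<forall>y\<in>car V. scl V c (add V x y) = add V (scl V c x) (scl V c y)) \<and>
     (\<forall>c d. \<forall>x\<in>car V. scl V (c + d) x = add V (scl V c x) (scl V d x) \<and>
        scl V (c * d) x = scl V c (scl V d x)) \<and>
     (\<forall>x\<in>car V. scl V 1 x = x)"

definition linear_map ::
    "('a, 'z) cvs_scheme \<Rightarrow> ('b, 'w) cvs_scheme \<Rightarrow> ('a \<Rightarrow> 'b) \<Rightarrow> bool" where
  "linear_map V W T \<longleftrightarrow>
     (\<forall>x\<in>car V. T x \<in> car W) \<and>
     (\<forall>x\<in>car V. \<forall>y\<in>car V. T (add V x y) = add W (T x) (T y)) \<and>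
     (\<forall>c. \<forall>x\<in>car V. T (scl V c x) = scl W c (T x))"

definition norm_complete :: "('a, 'z) cvs_scheme \<Rightarrow> ('a \<Rightarrow> real) \<Rightarrow> bool" where
  "norm_complete V n \<longleftrightarrow>
     (\<forall>s. (\<forall>k::nat. s k \<in> car V) \<and>
          (\<forall>\<epsilon>>0. \<exists>K. \<forall>i\<ge>K. \<forall>j\<ge>K. n (sub V (s i) (s j)) < \<epsilon>) \<longrightarrow>
        (\<exists>x\<in>car V. (\<lambda>k. n (sub V (s k) x)) \<longlonglongrightarrow> 0))"

definition graded_cstar_algebra :: "('a, 'z) gcalg_scheme \<Rightarrow> bool" where
  "graded_cstar_algebra A \<longleftrightarrow>
     complex_vector_space A \<and>
     (\<forall>a\<in>car A. linear_map A A (mul A a) \<and> linear_map A A (\<lambda>b. mul A b a)) \<and>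
     (\<forall>a\<in>car A. \<forall>b\<in>car A. \<forall>c\<in>car A. mul A (mul A a b) c = mul A a (mul A b c)) \<and>
     (\<forall>a\<in>car A. str A a \<in> car A \<and> str A (str A a) = a) \<and>
     (\<forall>a\<in>car A. \<forall>b\<in>car A. str A (add A a b) = add A (str A a) (str A b) \<and>
        str A (mul A a b) = mul A (str A b) (str A a)) \<and>
     (\<forall>c. \<forall>a\<in>car A. str A (scl A c a) = scl A (cnj c) (str A a)) \<and>
     (\<forall>a\<in>car A. 0 \<le> nrm A a \<and> (nrm A a = 0 \<longleftrightarrow> a = zer A)) \<and>
     (\<forall>c. \<forall>a\<in>car A. nrm A (scl A c a) = cmod c * nrm A a) \<and>
     (\<forall>a\<in>car A. \<forall>b\<in>car A. nrm A (add A a b) \<le> nrm A a + nrm A b \<and>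
        nrm A (mul A a b) \<le> nrm A a * nrm A b) \<and>
     (\<forall>a\<in>car A. nrm A (mul A (str A a) a) = (nrm A a)\<^sup>2) \<and>
     norm_complete A (nrm A) \<and>
     linear_map A A (gra A) \<and>
     (\<forall>a\<in>car A. gra A (gra A a) = a \<and> gra A (str A a) = str A (gra A a)) \<and>
     (\<forall>a\<in>car A. \<forall>b\<in>car A. gra A (mul A a b) = mul A (gra A a) (gra A b))"

text \<open>The last clause is automatic between C*-algebras.\<close>

definition star_hom ::
    "('a, 'z) gcalg_scheme \<Rightarrow> ('b, 'w) gcalg_scheme \<Rightarrow> ('a \<Rightarrow> 'b) \<Rightarrow> bool" where
  "star_hom A B \<phi> \<longleftrightarrow>
     linear_map A B \<phi> \<and>
     (\<forall>a\<in>car A. \<forall>b\<in>car A. \<phi> (mul A a b) = mul B (\<phi> a) (\<phi> b)) \<and>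
     (\<forall>a\<in>car A. \<phi> (str A a) = str B (\<phi> a)) \<and>
     (\<forall>a\<in>car A. nrm B (\<phi> a) \<le> nrm A a)"

definition graded_map ::
    "('a, 'z) gcalg_scheme \<Rightarrow> ('b, 'w) gcalg_scheme \<Rightarrow> ('a \<Rightarrow> 'b) \<Rightarrow> bool" where
  "graded_map A B \<phi> \<longleftrightarrow> (\<forall>a\<in>car A. \<phi> (gra A a) = gra B (\<phi> a))"

definition hnorm :: "('b, 'w) gcalg_scheme \<Rightarrow> ('e, 'b, 'z) hmod_scheme \<Rightarrow> 'e \<Rightarrow> real" where
  "hnorm B E x = sqrt (nrm B (inn E x x))"

text \<open>Positivity of \<open>(x|x)\<close> is expressed as \<open>(x|x) = c\<^sup>* c\<close> for some \<open>c \<in> B\<close>.\<close>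

definition graded_hilbert_module ::
    "('b, 'w) gcalg_scheme \<Rightarrow> ('e, 'b, 'z) hmod_scheme \<Rightarrow> bool" where
  "graded_hilbert_module B E \<longleftrightarrow>
     complex_vector_space E \<and>
     (\<forall>b\<in>car B. linear_map E E (\<lambda>x. act E x b)) \<and>
     (\<forall>x\<in>car E. linear_map B E (act E x)) \<and>
     (\<forall>x\<in>car E. \<forall>b\<in>car B. \<forall>c\<in>car B. act E (act E x b) c = act E x (mul B b c)) \<and>
     (\<forall>x\<in>car E. linear_map E B (inn E x)) \<and>
     (\<forall>x\<in>car E. \<forall>y\<in>car E. str B (inn E x y) = inn E y x) \<and>
     (\<forall>x\<in>car E. \<forall>y\<in>car E. \<forall>b\<in>car B. inn E x (act E y b) = mul B (inn E x y) b) \<and>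
     (\<forall>x\<in>car E. \<exists>c\<in>car B. inn E x x = mul B (str B c) c) \<and>
     (\<forall>x\<in>car E. inn E x x = zer B \<longrightarrow> x = zer E) \<and>
     norm_complete E (hnorm B E) \<and>
     linear_map E E (hgr E) \<and>
     (\<forall>x\<in>car E. hgr E (hgr E x) = x) \<and>
     (\<forall>x\<in>car E. \<forall>b\<in>car B. hgr E (act E x b) = act E (hgr E x) (gra B b)) \<and>
     (\<forall>x\<in>car E. \<forall>y\<in>car E. inn E (hgr E x) (hgr E y) = gra B (inn E x y))"

definition countably_generated ::
    "('b, 'w) gcalg_scheme \<Rightarrow> ('e, 'b, 'z) hmod_scheme \<Rightarrow> bool" where
  "countably_generated B E \<longleftrightarrow>
     (\<exists>S\<subseteq>car E. countable S \<and>
        (\<forall>x\<in>car E. \<forall>\<epsilon>>0. \<exists>ps. set ps \<subseteq> S \<times> car B \<and>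
           hnorm B E (sub E x (foldr (\<lambda>(s, b). add E (act E s b)) ps (zer E))) < \<epsilon>))"

definition adjointable :: "('e, 'b, 'z) hmod_scheme \<Rightarrow> ('e \<Rightarrow> 'e) \<Rightarrow> bool" where
  "adjointable E T \<longleftrightarrow>
     (\<forall>x\<in>car E. T x \<in> car E) \<and>
     (\<exists>T'. (\<forall>x\<in>car E. T' x \<in> car E) \<and>
           (\<forall>x\<in>car E. \<forall>y\<in>car E. inn E (T x) y = inn E x (T' y)))"

definition op_dist_le ::
    "('b, 'w) gcalg_scheme \<Rightarrow> ('e, 'b, 'z) hmod_scheme \<Rightarrow> real \<Rightarrow> ('e \<Rightarrow> 'e) \<Rightarrow> ('e \<Rightarrow> 'e) \<Rightarrow> bool"
  where
  "op_dist_le B E \<epsilon> S T \<longleftrightarrow> (\<forall>x\<in>car E. hnorm B E (sub E (S x) (T x)) \<le> \<epsilon> * hnorm B E x)"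

text \<open>The operator \<open>\<Sum>\<^sub>i \<theta>(x\<^sub>i, y\<^sub>i)\<close>, where \<open>\<theta>(x, y) z = x (y|z)\<close>.\<close>

definition finite_rank_op ::
    "('e, 'b, 'z) hmod_scheme \<Rightarrow> ('e \<times> 'e) list \<Rightarrow> 'e \<Rightarrow> 'e" where
  "finite_rank_op E ps z = foldr (\<lambda>(x, y). add E (act E x (inn E y z))) ps (zer E)"

definition compact_op ::
    "('b, 'w) gcalg_scheme \<Rightarrow> ('e, 'b, 'z) hmod_scheme \<Rightarrow> ('e \<Rightarrow> 'e) \<Rightarrow> bool" where
  "compact_op B E T \<longleftrightarrow>
     adjointable E T \<and>
     (\<forall>\<epsilon>>0. \<exists>ps. set ps \<subseteq> car E \<times> car E \<and> op_dist_le B E \<epsilon> T (finite_rank_op E ps))"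

definition self_module :: "('a, 'z) gcalg_scheme \<Rightarrow> ('a, 'a) hmod" where
  "self_module A = \<lparr>car = car A, zer = zer A, add = add A, scl = scl A,
     act = mul A, inn = (\<lambda>a b. mul A (str A a) b), hgr = gra A\<rparr>"


section \<open>The group \<open>U\<close>\<close>

text \<open>Smooth functions on the circle are smooth \<open>2\<pi>\<close>-periodic functions on \<open>\<real>\<close>; the Lie algebra of
  the circle is identified with \<open>\<real>\<close> through its unit vector.\<close>

definition loop_group :: "(real \<Rightarrow> real) set" where
  "loop_group = {f. (\<forall>j \<theta>. ((deriv ^^ j) f) differentiable (at \<theta>)) \<and>
     (\<forall>\<theta>. f (\<theta> + 2 * pi) = f \<theta>) \<and> integral {0..2 * pi} f = 0}"

definition loop_add :: "(real \<Rightarrow> real) \<Rightarrow> (real \<Rightarrow> real) \<Rightarrow> real \<Rightarrow> real" where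
  "loop_add f g = (\<lambda>\<theta>. f \<theta> + g \<theta>)"

definition loop_diff :: "(real \<Rightarrow> real) \<Rightarrow> (real \<Rightarrow> real) \<Rightarrow> real \<Rightarrow> real" where
  "loop_diff f g = (\<lambda>\<theta>. f \<theta> - g \<theta>)"

definition loop_topology :: "(real \<Rightarrow> real) topology" where
  "loop_topology = topology_generated_by
     {{g \<in> loop_group. \<forall>j\<le>k. \<forall>\<theta>. \<bar>(deriv ^^ j) g \<theta> - (deriv ^^ j) f \<theta>\<bar> < \<epsilon>} |f k \<epsilon>.
        f \<in> loop_group \<and> \<epsilon> > 0}"

definition \<omega> :: "(real \<Rightarrow> real) \<Rightarrow> (real \<Rightarrow> real) \<Rightarrow> real" where
  "\<omega> f g = integral {0..2 * pi} (\<lambda>\<theta>. f \<theta> * deriv g \<theta>)"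

definition phase :: "(real \<Rightarrow> real) \<Rightarrow> (real \<Rightarrow> real) \<Rightarrow> complex" where
  "phase f g = exp (\<i> / 2 * complex_of_real (\<omega> f g))"

text \<open>Continuity of a map on \<open>U\<close>, given a family of relations \<open>d \<epsilon>\<close> meaning distance at most
  \<open>\<epsilon>\<close> in the target.\<close>

definition loop_continuous :: "(real \<Rightarrow> 'x \<Rightarrow> 'x \<Rightarrow> bool) \<Rightarrow> ((real \<Rightarrow> real) \<Rightarrow> 'x) \<Rightarrow> bool" where
  "loop_continuous d \<phi> \<longleftrightarrow>
     (\<forall>g\<in>loop_group. \<forall>\<epsilon>>0. \<exists>W. openin loop_topology W \<and> g \<in> W \<and> (\<forall>g'\<in>W. d \<epsilon> (\<phi> g') (\<phi> g)))"

definition strongly_continuous ::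
    "('a, 'z) cvs_scheme \<Rightarrow> ('a \<Rightarrow> real) \<Rightarrow> ((real \<Rightarrow> real) \<Rightarrow> 'a \<Rightarrow> 'a) \<Rightarrow> bool" where
  "strongly_continuous V n \<rho> \<longleftrightarrow>
     (\<forall>x\<in>car V. loop_continuous (\<lambda>\<epsilon> y z. n (sub V y z) \<le> \<epsilon>) (\<lambda>g. \<rho> g x))"


section \<open>Twisted equivariant Kasparov modules\<close>

definition U_cstar_algebra ::
    "('a, 'z) gcalg_scheme \<Rightarrow> ((real \<Rightarrow> real) \<Rightarrow> 'a \<Rightarrow> 'a) \<Rightarrow> bool" where
  "U_cstar_algebra A \<sigma> \<longleftrightarrow>
     graded_cstar_algebra A \<and>
     (\<forall>g\<in>loop_group. star_hom A A (\<sigma> g) \<and> graded_map A A (\<sigma> g) \<and>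
        bij_betw (\<sigma> g) (car A) (car A)) \<and>
     (\<forall>a\<in>car A. \<sigma> (\<lambda>\<theta>. 0) a = a) \<and>
     (\<forall>g\<in>loop_group. \<forall>g'\<in>loop_group. \<forall>a\<in>car A. \<sigma> g (\<sigma> g' a) = \<sigma> (loop_add g g') a) \<and>
     strongly_continuous A (nrm A) \<sigma>"

definition twisted_action ::
    "('e, 'z) cvs_scheme \<Rightarrow> ('e \<Rightarrow> real) \<Rightarrow> ((real \<Rightarrow> real) \<Rightarrow> 'e \<Rightarrow> 'e) \<Rightarrow> bool" where
  "twisted_action V n \<rho> \<longleftrightarrow>
     (\<forall>g\<in>loop_group. linear_map V V (\<rho> g) \<and> (\<forall>x\<in>car V. n (\<rho> g x) = n x)) \<and>
     (\<forall>g\<in>loop_group. \<forall>g'\<in>loop_group. \<forall>x\<in>car V.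
        \<rho> g (\<rho> g' x) = scl V (phase g g') (\<rho> (loop_add g g') x)) \<and>
     strongly_continuous V n \<rho>"

definition twisted_bimodule_action ::
    "('a, 'z) gcalg_scheme \<Rightarrow> ((real \<Rightarrow> real) \<Rightarrow> 'a \<Rightarrow> 'a) \<Rightarrow> ((real \<Rightarrow> real) \<Rightarrow> 'a \<Rightarrow> 'a) \<Rightarrow> bool"
  where
  "twisted_bimodule_action A \<sigma> \<rho> \<longleftrightarrow>
     twisted_action A (nrm A) \<rho> \<and>
     (\<forall>g\<in>loop_group. \<forall>a\<in>car A. \<forall>x\<in>car A. \<forall>a'\<in>car A.
        \<rho> g (mul A (mul A a x) a') = mul A (mul A (\<sigma> g a) (\<rho> g x)) (\<sigma> g a')) \<and>
     (\<forall>g\<in>loop_group. \<forall>x\<in>car A. \<forall>y\<in>car A.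
        mul A (str A (\<rho> g x)) (\<rho> g y) = \<sigma> g (mul A (str A x) y))"

definition twisted_hilbert_module ::
    "('b, 'w) gcalg_scheme \<Rightarrow> ((real \<Rightarrow> real) \<Rightarrow> 'b \<Rightarrow> 'b) \<Rightarrow>
     ('e, 'b, 'z) hmod_scheme \<Rightarrow> ((real \<Rightarrow> real) \<Rightarrow> 'e \<Rightarrow> 'e) \<Rightarrow> bool" where
  "twisted_hilbert_module B \<sigma> E \<rho> \<longleftrightarrow>
     graded_hilbert_module B E \<and>
     twisted_action E (hnorm B E) \<rho> \<and>
     (\<forall>g\<in>loop_group. \<forall>x\<in>car E. \<rho> g (hgr E x) = hgr E (\<rho> g x)) \<and>
     (\<forall>g\<in>loop_group. \<forall>x\<in>car E. \<forall>b\<in>car B. \<rho> g (act E x b) = act E (\<rho> g x) (\<sigma> g b)) \<and>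
     (\<forall>g\<in>loop_group. \<forall>x\<in>car E. \<forall>y\<in>car E. inn E (\<rho> g x) (\<rho> g y) = \<sigma> g (inn E x y))"

definition equivariant_representation ::
    "('a, 'v) gcalg_scheme \<Rightarrow> ((real \<Rightarrow> real) \<Rightarrow> 'a \<Rightarrow> 'a) \<Rightarrow>
     ('e, 'b, 'z) hmod_scheme \<Rightarrow> ((real \<Rightarrow> real) \<Rightarrow> 'e \<Rightarrow> 'e) \<Rightarrow> ('a \<Rightarrow> 'e \<Rightarrow> 'e) \<Rightarrow> bool" where
  "equivariant_representation A \<sigma> E \<rho> \<pi> \<longleftrightarrow>
     (\<forall>x\<in>car E. linear_map A E (\<lambda>a. \<pi> a x)) \<and>
     (\<forall>a\<in>car A. \<forall>b\<in>car A. \<forall>x\<in>car E. \<pi> (mul A a b) x = \<pi> a (\<pi> b x)) \<and>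
     (\<forall>a\<in>car A. adjointable E (\<pi> a)) \<and>
     (\<forall>a\<in>car A. \<forall>x\<in>car E. \<forall>y\<in>car E. inn E (\<pi> a x) y = inn E x (\<pi> (str A a) y)) \<and>
     (\<forall>a\<in>car A. \<forall>x\<in>car E. hgr E (\<pi> a x) = \<pi> (gra A a) (hgr E x)) \<and>
     (\<forall>g\<in>loop_group. \<forall>a\<in>car A. \<forall>x\<in>car E. \<rho> g (\<pi> a x) = \<pi> (\<sigma> g a) (\<rho> g x))"

definition conj_op ::
    "('e, 'z) cvs_scheme \<Rightarrow> ((real \<Rightarrow> real) \<Rightarrow> 'e \<Rightarrow> 'e) \<Rightarrow> (real \<Rightarrow> real) \<Rightarrow> ('e \<Rightarrow> 'e) \<Rightarrow> 'e \<Rightarrow> 'e"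
  where
  "conj_op E \<rho> g T = (\<lambda>x. \<rho> g (T (inv_into (car E) (\<rho> g) x)))"

text \<open>Since \<open>F\<close> is odd, the graded commutator \<open>[a, F]\<close> is \<open>a F - F \<epsilon>(a)\<close>, with \<open>\<epsilon>\<close> the grading
  automorphism.\<close>

definition twisted_kasparov_module ::
    "('a, 'v) gcalg_scheme \<Rightarrow> ((real \<Rightarrow> real) \<Rightarrow> 'a \<Rightarrow> 'a) \<Rightarrow>
     ('b, 'w) gcalg_scheme \<Rightarrow> ((real \<Rightarrow> real) \<Rightarrow> 'b \<Rightarrow> 'b) \<Rightarrow>
     ('e, 'b, 'z) hmod_scheme \<Rightarrow> ((real \<Rightarrow> real) \<Rightarrow> 'e \<Rightarrow> 'e) \<Rightarrow>
     ('a \<Rightarrow> 'e \<Rightarrow> 'e) \<Rightarrow> ('e \<Rightarrow> 'e) \<Rightarrow> bool" where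
  "twisted_kasparov_module A \<sigma>A B \<sigma>B E \<rho> \<pi> F \<longleftrightarrow>
     U_cstar_algebra A \<sigma>A \<and> U_cstar_algebra B \<sigma>B \<and>
     twisted_hilbert_module B \<sigma>B E \<rho> \<and> countably_generated B E \<and>
     equivariant_representation A \<sigma>A E \<rho> \<pi> \<and>
     adjointable E F \<and>
     (\<forall>x\<in>car E. \<forall>y\<in>car E. inn E (F x) y = inn E x (F y)) \<and>
     (\<forall>x\<in>car E. F (hgr E x) = scl E (-1) (hgr E (F x))) \<and>
     (\<forall>a\<in>car A. compact_op B E (\<lambda>x. sub E (\<pi> a (F x)) (F (\<pi> (gra A a) x)))) \<and>
     (\<forall>a\<in>car A. compact_op B E (\<lambda>x. \<pi> a (sub E x (F (F x))))) \<and>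
     (\<forall>a\<in>car A. \<forall>g\<in>loop_group. compact_op B E (\<lambda>x. \<pi> a (sub E (conj_op E \<rho> g F x) (F x)))) \<and>
     (\<forall>a\<in>car A. loop_continuous (op_dist_le B E) (\<lambda>g. conj_op E \<rho> g (\<lambda>x. \<pi> a (F x))))"


section \<open>Clifford algebras\<close>

text \<open>The orthonormal basis vectors \<open>e\<^sub>k\<close> and \<open>f\<^sub>k\<close> get the indices \<open>2 k\<close> and \<open>2 k + 1\<close>.  A Clifford
  element is its coefficient function with respect to the basis of ordered products over finite
  sets of indices; generators are self-adjoint, anticommute, and have square 1.\<close>

type_synonym cliff = "nat set \<Rightarrow> complex"

definition cliff_space :: "nat set \<Rightarrow> cliff set" where
  "cliff_space K = {a. \<forall>S. a S \<noteq> 0 \<longrightarrow> finite S \<and> (\<forall>i\<in>S. i div 2 \<in> K)}"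

definition cliff_sign :: "nat set \<Rightarrow> nat set \<Rightarrow> complex" where
  "cliff_sign S T = (-1) ^ card {(s, t). s \<in> S \<and> t \<in> T \<and> t < s}"

definition cliff_mult :: "cliff \<Rightarrow> cliff \<Rightarrow> cliff" where
  "cliff_mult a b = (\<lambda>R. \<Sum>S | a S \<noteq> 0. cliff_sign S (sym_diff S R) * a S * b (sym_diff S R))"

definition cliff_one :: cliff where
  "cliff_one = (\<lambda>S. if S = {} then 1 else 0)"

definition cliff_star :: "cliff \<Rightarrow> cliff" where
  "cliff_star a = (\<lambda>S. (-1) ^ (card S * (card S - 1) div 2) * cnj (a S))"

definition cliff_even :: "cliff \<Rightarrow> cliff" where
  "cliff_even a = (\<lambda>S. if even (card S) then a S else 0)"

definition cliff_odd :: "cliff \<Rightarrow> cliff" where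
  "cliff_odd a = (\<lambda>S. if odd (card S) then a S else 0)"

text \<open>The Hilbert space norm for which the ordered basis products are orthonormal.\<close>

definition cliff_norm2 :: "cliff \<Rightarrow> real" where
  "cliff_norm2 a = sqrt (\<Sum>S | a S \<noteq> 0. (cmod (a S))\<^sup>2)"


section \<open>Finite-dimensional subspaces of \<open>U\<close>\<close>

definition e_fun :: "nat \<Rightarrow> real \<Rightarrow> real" where
  "e_fun k \<theta> = cos (real k * \<theta>) / sqrt (real k * pi)"

definition f_fun :: "nat \<Rightarrow> real \<Rightarrow> real" where
  "f_fun k \<theta> = sin (real k * \<theta>) / sqrt (real k * pi)"

text \<open>For a finite set \<open>K\<close> of positive integers, \<open>modes K\<close> is the span of all \<open>e\<^sub>k, f\<^sub>k\<close> with
  \<open>k \<in> K\<close>.  Thus \<open>U\<^sub>N = modes {1..N}\<close>, and the orthogonal complement of \<open>U\<^sub>N\<close> in \<open>U\<^sub>M\<close> is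
  \<open>modes {N+1..M}\<close>.\<close>

definition modes :: "nat set \<Rightarrow> (real \<Rightarrow> real) set" where
  "modes K = {(\<lambda>\<theta>. \<Sum>k\<in>K. a k * e_fun k \<theta> + b k * f_fun k \<theta>) |a b. True}"

text \<open>The coordinates \<open>x\<^sub>k\<close> and \<open>y\<^sub>k\<close>: the \<open>L\<^sup>2\<close>-norms of \<open>e\<^sub>k\<close> and \<open>f\<^sub>k\<close> are \<open>1 / sqrt k\<close>.\<close>

definition x_coord :: "nat \<Rightarrow> (real \<Rightarrow> real) \<Rightarrow> real" where
  "x_coord k x = real k * integral {0..2 * pi} (\<lambda>\<theta>. x \<theta> * e_fun k \<theta>)"

definition y_coord :: "nat \<Rightarrow> (real \<Rightarrow> real) \<Rightarrow> real" where
  "y_coord k x = real k * integral {0..2 * pi} (\<lambda>\<theta>. x \<theta> * f_fun k \<theta>)"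

definition modes_proj :: "nat set \<Rightarrow> (real \<Rightarrow> real) \<Rightarrow> real \<Rightarrow> real" where
  "modes_proj K x = (\<lambda>\<theta>. \<Sum>k\<in>K. x_coord k x * e_fun k \<theta> + y_coord k x * f_fun k \<theta>)"

definition modes_norm :: "nat set \<Rightarrow> (real \<Rightarrow> real) \<Rightarrow> real" where
  "modes_norm K x = sqrt (\<Sum>k\<in>K. (x_coord k x)\<^sup>2 + (y_coord k x)\<^sup>2)"


section \<open>The algebras \<open>\<S> \<otimes> Cl\<^sub>\<tau>(V)\<close>\<close>

text \<open>Below, \<open>continuous_on\<close> refers to the topology of pointwise convergence on functions.  On
  the finite-dimensional \<open>modes K\<close> and \<open>cliff_space K\<close> this is the Euclidean topology.  Functions on
  \<open>modes K\<close> are extended by 0.\<close>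

definition S_alg :: "(real \<Rightarrow> complex) gcalg" where
  "S_alg = \<lparr>car = {f. continuous_on UNIV f \<and> (f \<longlongrightarrow> 0) at_infinity},
     zer = (\<lambda>t. 0), add = (\<lambda>f g t. f t + g t), scl = (\<lambda>c f t. c * f t),
     mul = (\<lambda>f g t. f t * g t), str = (\<lambda>f t. cnj (f t)),
     nrm = (\<lambda>f. SUP t. cmod (f t)), gra = (\<lambda>f t. f (- t))\<rparr>"

definition Cl_tau :: "nat set \<Rightarrow> ((real \<Rightarrow> real) \<Rightarrow> cliff) set" where
  "Cl_tau K = {h. continuous_on (modes K) h \<and> (\<forall>x\<in>modes K. h x \<in> cliff_space K) \<and>
     (\<forall>x. x \<notin> modes K \<longrightarrow> h x = (\<lambda>S. 0)) \<and>
     (\<forall>\<epsilon>>0. \<exists>R. \<forall>x\<in>modes K. modes_norm K x > R \<longrightarrow> (\<forall>S. cmod (h x S) < \<epsilon>))}"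

text \<open>As a Banach space up to equivalence of norms, \<open>\<S> \<otimes> Cl\<^sub>\<tau>(V)\<close> is
  \<open>C\<^sub>0(\<real> \<times> V, Cliff(V))\<close> with \<open>(f \<otimes> h)(t, x) = f(t) h(x)\<close>.  The graded product
  \<open>(f \<otimes> h)(f' \<otimes> h') = (-1)^(|h||f'|) f f' \<otimes> h h'\<close> and involution
  \<open>(f \<otimes> h)\<^sup>* = (-1)^(|f||h|) f\<^sup>* \<otimes> h\<^sup>*\<close> become the formulas below because
  \<open>(-1)^|f| f(t) = f(-t)\<close>.  The C*-norm (unique, since the factors are nuclear) is read off from the
  left regular representations on the Hilbert spaces of functions \<open>{t, -t} \<rightarrow> Cliff(V)\<close>.\<close>

type_synonym sc = "real \<times> (real \<Rightarrow> real) \<Rightarrow> cliff"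

definition sc_mult :: "sc \<Rightarrow> sc \<Rightarrow> sc" where
  "sc_mult F G = (\<lambda>(t, x) S. cliff_mult (cliff_even (F (t, x))) (G (t, x)) S +
                              cliff_mult (cliff_odd (F (t, x))) (G (- t, x)) S)"

definition sc_star :: "sc \<Rightarrow> sc" where
  "sc_star F = (\<lambda>(t, x) S. cliff_star (cliff_even (F (t, x))) S +
                            cliff_star (cliff_odd (F (- t, x))) S)"

definition sc_norm :: "nat set \<Rightarrow> sc \<Rightarrow> real" where
  "sc_norm K F = Sup {sqrt ((cliff_norm2 (sc_mult F (\<lambda>(s, y). \<xi> s) (t, x)))\<^sup>2 +
                            (cliff_norm2 (sc_mult F (\<lambda>(s, y). \<xi> s) (- t, x)))\<^sup>2) |t x \<xi>.
     x \<in> modes K \<and> (\<forall>s. \<xi> s \<in> cliff_space K) \<and>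
     (cliff_norm2 (\<xi> t))\<^sup>2 + (cliff_norm2 (\<xi> (- t)))\<^sup>2 \<le> 1}"

definition SC :: "nat set \<Rightarrow> sc gcalg" where
  "SC K = \<lparr>car = {F. continuous_on (UNIV \<times> modes K) F \<and>
        (\<forall>t. \<forall>x\<in>modes K. F (t, x) \<in> cliff_space K) \<and>
        (\<forall>t x. x \<notin> modes K \<longrightarrow> F (t, x) = (\<lambda>S. 0)) \<and>
        (\<forall>\<epsilon>>0. \<exists>R. \<forall>t. \<forall>x\<in>modes K. t\<^sup>2 + (modes_norm K x)\<^sup>2 > R \<longrightarrow>
           (\<forall>S. cmod (F (t, x) S) < \<epsilon>))},
     zer = (\<lambda>p S. 0), add = (\<lambda>F G p S. F p S + G p S), scl = (\<lambda>c F p S. c * F p S),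
     mul = sc_mult, str = sc_star, nrm = sc_norm K,
     gra = (\<lambda>F (t, x) S. (-1) ^ card S * F (- t, x) S)\<rparr>"

definition tensor :: "(real \<Rightarrow> complex) \<Rightarrow> ((real \<Rightarrow> real) \<Rightarrow> cliff) \<Rightarrow> sc" where
  "tensor f h = (\<lambda>(t, x) S. f t * h x S)"

text \<open>The identification of \<open>(\<S> \<otimes> Cl\<^sub>\<tau>(V'')) \<otimes> Cl\<^sub>\<tau>(V')\<close> with \<open>\<S> \<otimes> Cl\<^sub>\<tau>(V'' \<oplus> V')\<close> on elementary
  tensors, for \<open>V'' = modes L\<close> and \<open>V' = modes K\<close>.\<close>

definition tensor_Cl :: "nat set \<Rightarrow> nat set \<Rightarrow> sc \<Rightarrow> ((real \<Rightarrow> real) \<Rightarrow> cliff) \<Rightarrow> sc" where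
  "tensor_Cl L K \<Phi> h = (\<lambda>(t, x). if x \<in> modes (L \<union> K)
     then cliff_mult (\<Phi> (t, modes_proj L x)) (h (modes_proj K x)) else (\<lambda>S. 0))"


section \<open>The HKT algebra\<close>

text \<open>\<open>f(T)\<close> for an unbounded self-adjoint multiplier \<open>T\<close> of \<open>A\<close>, with domain
  \<open>{a \<in> A. T a \<in> A}\<close>, whose resolvents lie in \<open>A\<close>: the value at \<open>f\<close> of the *-homomorphism
  \<open>C\<^sub>0(\<real>) \<rightarrow> A\<close> sending \<open>s \<mapsto> 1 / (s \<plusminus> \<i>)\<close> to the inverse of \<open>T \<plusminus> \<i>\<close>.\<close>

definition functional_calculus ::
    "('a, 'z) gcalg_scheme \<Rightarrow> ('a \<Rightarrow> 'a) \<Rightarrow> (real \<Rightarrow> complex) \<Rightarrow> 'a" where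
  "functional_calculus A T f = (THE b. \<exists>\<phi>. star_hom S_alg A \<phi> \<and>
     (\<forall>z\<in>{\<i>, -\<i>}.
        (\<forall>a\<in>car A. T a \<in> car A \<longrightarrow>
           mul A (\<phi> (\<lambda>s. 1 / (of_real s + z))) (add A (T a) (scl A z a)) = a) \<and>
        (\<forall>a\<in>car A. let r = mul A (\<phi> (\<lambda>s. 1 / (of_real s + z))) a in
           T r \<in> car A \<and> add A (T r) (scl A z r) = a)) \<and>
     b = \<phi> f)"

text \<open>\<open>C\<^sub>K = \<Sum>\<^bsub>k\<in>K\<^esub> k\<^sup>-\<^sup>l (x\<^sub>k e\<^sub>k + y\<^sub>k f\<^sub>k)\<close>\<close>

definition C_field :: "real \<Rightarrow> nat set \<Rightarrow> (real \<Rightarrow> real) \<Rightarrow> cliff" where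
  "C_field l K x = (\<lambda>S. \<Sum>k\<in>K. complex_of_real (real k powr (- l)) *
     (complex_of_real (x_coord k x) * (if S = {2 * k} then 1 else 0) +
      complex_of_real (y_coord k x) * (if S = {2 * k + 1} then 1 else 0)))"

text \<open>The multiplier \<open>X \<otimes> id + id \<otimes> C\<^sub>K\<close>, as an unbounded function acting through the product
  formula of the graded tensor product.\<close>

definition Bott_Dirac :: "real \<Rightarrow> nat set \<Rightarrow> sc \<Rightarrow> sc" where
  "Bott_Dirac l K = sc_mult (\<lambda>(t, x) S. complex_of_real t * cliff_one S + C_field l K x S)"

definition hkt_beta :: "real \<Rightarrow> nat \<Rightarrow> nat \<Rightarrow> sc \<Rightarrow> sc" where
  "hkt_beta l N M F = (THE G. \<exists>\<beta>. star_hom (SC {1..N}) (SC {1..M}) \<beta> \<and>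
     graded_map (SC {1..N}) (SC {1..M}) \<beta> \<and>
     (\<forall>f\<in>car S_alg. \<forall>h\<in>Cl_tau {1..N}. \<beta> (tensor f h) =
        tensor_Cl {N+1..M} {1..N}
          (functional_calculus (SC {N+1..M}) (Bott_Dirac l {N+1..M}) f) h) \<and>
     G = \<beta> F)"

text \<open>The C*-algebraic direct limit of a sequence, i.e. the completion of the algebraic direct
  limit: an element is a class of asymptotically compatible sequences modulo null sequences.\<close>

definition coherent :: "(nat \<Rightarrow> 'a gcalg) \<Rightarrow> (nat \<Rightarrow> nat \<Rightarrow> 'a \<Rightarrow> 'a) \<Rightarrow> (nat \<Rightarrow> 'a) \<Rightarrow> bool" where
  "coherent A \<beta> s \<longleftrightarrow> (\<forall>n. s n \<in> car (A n)) \<and>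
     (\<forall>\<epsilon>>0. \<exists>N. \<forall>n m. N \<le> n \<and> n \<le> m \<longrightarrow> nrm (A m) (sub (A m) (s m) (\<beta> n m (s n))) < \<epsilon>)"

definition limit_class ::
    "(nat \<Rightarrow> 'a gcalg) \<Rightarrow> (nat \<Rightarrow> nat \<Rightarrow> 'a \<Rightarrow> 'a) \<Rightarrow> (nat \<Rightarrow> 'a) \<Rightarrow> (nat \<Rightarrow> 'a) set" where
  "limit_class A \<beta> s =
     {s'. coherent A \<beta> s' \<and> (\<lambda>n. nrm (A n) (sub (A n) (s' n) (s n))) \<longlonglongrightarrow> 0}"

definition rep :: "'x set \<Rightarrow> 'x" where
  "rep X = (SOME s. s \<in> X)"

definition direct_limit ::
    "(nat \<Rightarrow> 'a gcalg) \<Rightarrow> (nat \<Rightarrow> nat \<Rightarrow> 'a \<Rightarrow> 'a) \<Rightarrow> (nat \<Rightarrow> 'a) set gcalg" where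
  "direct_limit A \<beta> = \<lparr>car = limit_class A \<beta> ` {s. coherent A \<beta> s},
     zer = limit_class A \<beta> (\<lambda>n. zer (A n)),
     add = (\<lambda>X Y. limit_class A \<beta> (\<lambda>n. add (A n) (rep X n) (rep Y n))),
     scl = (\<lambda>c X. limit_class A \<beta> (\<lambda>n. scl (A n) c (rep X n))),
     mul = (\<lambda>X Y. limit_class A \<beta> (\<lambda>n. mul (A n) (rep X n) (rep Y n))),
     str = (\<lambda>X. limit_class A \<beta> (\<lambda>n. str (A n) (rep X n))),
     nrm = (\<lambda>X. lim (\<lambda>n. nrm (A n) (rep X n))),
     gra = (\<lambda>X. limit_class A \<beta> (\<lambda>n. gra (A n) (rep X n)))\<rparr>"

definition limit_incl ::
    "(nat \<Rightarrow> 'a gcalg) \<Rightarrow> (nat \<Rightarrow> nat \<Rightarrow> 'a \<Rightarrow> 'a) \<Rightarrow> nat \<Rightarrow> 'a \<Rightarrow> (nat \<Rightarrow> 'a) set" where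
  "limit_incl A \<beta> N a = limit_class A \<beta> (\<lambda>m. if N \<le> m then \<beta> N m a else zer (A m))"

definition SCU :: "real \<Rightarrow> (nat \<Rightarrow> sc) set gcalg" where
  "SCU l = direct_limit (\<lambda>N. SC {1..N}) (hkt_beta l)"

definition SCU_incl :: "real \<Rightarrow> nat \<Rightarrow> sc \<Rightarrow> (nat \<Rightarrow> sc) set" where
  "SCU_incl l = limit_incl (\<lambda>N. SC {1..N}) (hkt_beta l)"


section \<open>The translation action and the twisted action\<close>

definition translate :: "(real \<Rightarrow> real) \<Rightarrow> ((real \<Rightarrow> real) \<Rightarrow> cliff) \<Rightarrow> (real \<Rightarrow> real) \<Rightarrow> cliff" where
  "translate g h = (\<lambda>x. h (loop_diff x g))"

definition twisted_translate ::
    "(real \<Rightarrow> real) \<Rightarrow> ((real \<Rightarrow> real) \<Rightarrow> cliff) \<Rightarrow> (real \<Rightarrow> real) \<Rightarrow> cliff" where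
  "twisted_translate g h = (\<lambda>x S. h (loop_diff x g) S * phase g x)"

text \<open>\<open>\<phi>\<close> is the linear extension by continuity (in the algebra element and in the group element)
  of the operations \<open>f \<otimes> h \<mapsto> f \<otimes> \<tau> g h\<close>, defined for \<open>g \<in> U\<^sub>N\<close> and \<open>f \<otimes> h \<in> SC(U\<^sub>N)\<close>.\<close>

definition extends_by_continuity ::
    "real \<Rightarrow> ((real \<Rightarrow> real) \<Rightarrow> ((real \<Rightarrow> real) \<Rightarrow> cliff) \<Rightarrow> (real \<Rightarrow> real) \<Rightarrow> cliff) \<Rightarrow>
     ((real \<Rightarrow> real) \<Rightarrow> (nat \<Rightarrow> sc) set \<Rightarrow> (nat \<Rightarrow> sc) set) \<Rightarrow> bool" where
  "extends_by_continuity l \<tau> \<phi> \<longleftrightarrow>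
     \<phi> \<in> loop_group \<rightarrow>\<^sub>E (car (SCU l) \<rightarrow>\<^sub>E car (SCU l)) \<and>
     (\<forall>g\<in>loop_group. linear_map (SCU l) (SCU l) (\<phi> g) \<and>
        (\<exists>c. \<forall>a\<in>car (SCU l). nrm (SCU l) (\<phi> g a) \<le> c * nrm (SCU l) a)) \<and>
     strongly_continuous (SCU l) (nrm (SCU l)) \<phi> \<and>
     (\<forall>N. \<forall>g\<in>modes {1..N}. \<forall>f\<in>car S_alg. \<forall>h\<in>Cl_tau {1..N}.
        \<phi> g (SCU_incl l N (tensor f h)) = SCU_incl l N (tensor f (\<tau> g h)))"

end

theory Submission
 imports Defs
begin

text \<open>
 An element of \<open>SC K\<close> is a Clifford-valued function \<open>F\<close> on \<open>\<real> \<times> modes K\<close> with a twisted product that mixes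
 \<open>F (t, x)\<close> and \<open>F (-t, x)\<close>.  Adjoining one more Clifford generator \<open>\<gamma> = gen 0\<close> and putting
 \<open>H F t x = (F (t, x) + F (-t, x)) / 2 + \<gamma> (F (t, x) - F (-t, x)) / 2\<close> turns this product into the pointwise
 Clifford product and the C*-norm into the supremum of the operator norms of \<open>H F t x\<close>.  In this picture the
 multiplier \<open>X\<close> is \<open>t \<gamma>\<close> and the Bott-Dirac multiplier \<open>X + C\<close> is the vector \<open>v = t \<gamma> + C x\<close>, so its functional
 calculus is explicit: the even part of \<open>f\<close> is evaluated at \<open>r = |v|\<close>, and the odd part is evaluated at \<open>r\<close> and multiplied by \<open>v / r\<close>.
 Thus the connecting map \<open>hkt_beta\<close> has the closed form \<open>bet\<close>; moreover there is a unitary \<open>w\<close>, the spin lift of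
 the rotation from \<open>\<gamma>\<close> to \<open>v / r\<close>, with \<open>H (bet F) t x = w (H F r (P x)) w\<^sup>*\<close>, where \<open>P\<close> is the projection to the
 smaller space.  This makes \<open>bet\<close> a contractive *-homomorphism (\<open>bet_star_hom\<close>), and composing two of them is
 again one (\<open>bet_compose\<close>).  Uniqueness, which the definitions by \<open>THE\<close> require, comes from the density of the
 resolvent polynomials in \<open>C\<^sub>0(\<real>)\<close> (\<open>rpoly_dense\<close>) and of the elementary tensors in \<open>SC K\<close> (\<open>tspan_dense\<close>).

 At level \<open>m\<close> a loop \<open>g\<close> acts by \<open>T q {1..m} g\<close>: translation by the truncation of \<open>g\<close> and multiplication by the
 phase \<open>exp (i q \<omega>(g, x) / 2)\<close>, with \<open>q = 0\<close> for \<open>\<sigma>\<close> and \<open>q = 1\<close> for \<open>\<rho>\<close>.  All algebraic identities hold at each level: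
 charges add under multiplication, change sign under \<open>*\<close>, and \<open>T\<close> composes up to the cocycle.  They give the
 bimodule identities, since \<open>0 + 1 = 1 + 0 = 1\<close> and \<open>(-1) + 1 = 0\<close>.

 The analytic point is that these actions pass to the limit, where the dimension is unbounded.  Let \<open>F\<close> be fixed at
 level \<open>N\<close> and let \<open>W(g) = \<Sum> k^(2 l) (g\<^sub>k\<^sup>2 + h\<^sub>k\<^sup>2)\<close>.  Translation by \<open>g\<close> moves the vector \<open>v\<close> by at most \<open>W(g)^(1/2)\<close>,
 and by Cauchy-Schwarz \<open>|\<omega>(g, x)| \<le> W(g)^(1/2) |C x|\<close>, because the weights \<open>k^(-l)\<close> of \<open>C\<close> pair with \<open>k^l\<close>.  The
 image of \<open>F\<close> at level \<open>m\<close> is small when \<open>r \<ge> |C x|\<close> is large, so the phase matters only on a bounded range of \<open>|C x|\<close>,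
 and \<open>T q {1..m} g\<close> moves the image of \<open>F\<close> by an amount that tends to \<open>0\<close> with \<open>W(g)\<close> uniformly in \<open>m\<close>
 (\<open>T_bet_small\<close>, \<open>T_bet_continuous\<close>).  Smooth loops have finite \<open>W(g)\<close>, controlled by the supremum of one derivative
 (\<open>Wn_bound\<close>).  Hence \<open>T\<close> preserves asymptotically compatible sequences (\<open>T_coh\<close>) and the limit action is strongly
 continuous; it is the only continuous extension because trigonometric polynomials are dense in the loop group
 (\<open>modes_dense\<close>, \<open>extends_unique\<close>).

 Finally a graded C*-algebra with a countable approximate unit, taken as a module over itself with operator \<open>0\<close>,
 is a Kasparov module: left multiplication by \<open>a\<close> is a norm limit of the rank one operators
 \<open>x \<mapsto> a u\<^sup>* x\<close>, where \<open>u\<close> runs through the approximate unit (\<open>kasparov_zero\<close>).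
\<close>

section \<open>The Clifford algebra of countably many generators\<close>

text \<open>The algebraic Clifford algebra on generators indexed by \<open>nat\<close>.  A single type for all finite levels lets the
 connecting maps and the extra generator below be written as products in one normed algebra.\<close>

typedef cl = "{a::cliff. finite {S. a S ~= 0} & (ALL S. a S ~= 0 --> finite S)}"
 morphisms cf Cl
 by (rule exI[of _ "%S. 0"]) simp

setup_lifting type_definition_cl

definition supp :: "cl => nat set set" where
 "supp a = {S. cf a S ~= 0}"

lemma finite_supp [simp]: "finite (supp a)"
 using cf[of a] by (simp add: supp_def)

lemma cf_infinite [simp]: "infinite S ==> cf a S = 0"
 using cf[of a] by auto

lemma cf_eqI: "(!!S. finite S ==> cf a S = cf b S) ==> a = b"
 by (metis cf_infinite cf_inject ext)

text \<open>Sums over the supports of several elements are compared by replacing every support by \<open>Pow {..<n}\<close> for a common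
 large \<open>n\<close>.\<close>

lemma eventually_supp: "eventually (%n. supp a <= Pow {..<n}) sequentially"
proof -
 have "finite (\<Union>(supp a))"
  using finite_supp[of a] cf_infinite[of _ a] by (auto simp: supp_def simp del: finite_supp cf_infinite)
 then obtain m where m: "\<Union>(supp a) <= {..<m}"
  using finite_nat_iff_bounded by auto
 show ?thesis
  unfolding eventually_sequentially using m by (intro exI[of _ m]) fastforce
qed

lemma eventually_fin: "finite S ==> eventually (%n. S \<in> Pow {..<n}) sequentially"
 unfolding eventually_sequentially
 by (metis (no_types, lifting) PowI finite_nat_iff_bounded lessThan_subset_iff order_trans)

text \<open>The reordering sign is a product of \<open>\<plusminus>1\<close> over pairs, hence a bicharacter for symmetric difference; this cocycle
 property is what makes the product associative.\<close>

lemma prod_sym_diff: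
 fixes h :: "'a => complex"
 assumes "finite S" "finite T" and "!!s. h s * h s = 1"
 shows "prod h (sym_diff S T) = prod h S * prod h T"
proof -
 have 1: "prod h S = prod h (S - T) * prod h (S Int T)"
  using assms by (metis prod.Int_Diff mult.commute)
 have 2: "prod h T = prod h (T - S) * prod h (S Int T)"
  using assms by (metis prod.Int_Diff mult.commute Int_commute)
 have 3: "prod h (sym_diff S T) = prod h (S - T) * prod h (T - S)"
  using assms by (subst prod.union_disjoint) auto
 have 4: "prod h (S Int T) * prod h (S Int T) = 1"
  using assms by (simp add: prod.distrib[symmetric])
 show ?thesis unfolding 1 2 3 using 4
  by (metis (no_types, lifting) mult.assoc mult.left_commute mult.right_neutral)
qed

lemma sign_prod:
 assumes "finite S" "finite T"
 shows "cliff_sign S T = (\<Prod>s\<in>S. \<Prod>t\<in>T. if t < s then -1 else 1)"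
proof -
 have "(\<Prod>s\<in>S. \<Prod>t\<in>T. if t < s then -1 else 1) =
   (\<Prod>p\<in>S \<times> T. if snd p < fst p then -1 else (1::complex))"
  by (simp add: prod.cartesian_product case_prod_unfold)
 also have "... = (\<Prod>p\<in>{p\<in>S \<times> T. snd p < fst p}. -1)"
  using assms by (subst prod.inter_filter) auto
 also have "... = (-1) ^ card {p\<in>S \<times> T. snd p < fst p}" by simp
 also have "{p\<in>S \<times> T. snd p < fst p} = {(s, t). s \<in> S & t \<in> T & t < s}" by auto
 finally show ?thesis by (simp add: cliff_sign_def)
qed

lemma sign_sq [simp]: "cliff_sign S T * cliff_sign S T = 1"
 by (simp add: cliff_sign_def power_add[symmetric] flip: mult_2)

lemma sign_sq' [simp]: "cliff_sign S T * (cliff_sign S T * x) = x"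
 by (simp add: mult.assoc[symmetric])

lemma sign_left:
 assumes "finite S" "finite S'" "finite T"
 shows "cliff_sign (sym_diff S S') T = cliff_sign S T * cliff_sign S' T"
proof -
 have "(\<Prod>t\<in>T. if t < s then -1 else 1) * (\<Prod>t\<in>T. if t < s then -1 else 1) = (1::complex)" for s :: nat
  by (simp add: prod.distrib[symmetric]) (rule prod.neutral, auto)
 then show ?thesis using assms by (simp add: sign_prod prod_sym_diff)
qed

lemma sign_right:
 assumes "finite S" "finite T" "finite T'"
 shows "cliff_sign S (sym_diff T T') = cliff_sign S T * cliff_sign S T'"
proof -
 have "cliff_sign S (sym_diff T T') = (\<Prod>s\<in>S. (\<Prod>t\<in>T. if t < s then -1 else 1) * (\<Prod>t\<in>T'. if t < s then -1 else 1))"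
  using assms by (subst sign_prod; simp?) (intro prod.cong refl prod_sym_diff; auto)
 then show ?thesis using assms by (simp add: sign_prod prod.distrib)
qed

lemma sign_empty [simp]: "cliff_sign {} T = 1" "cliff_sign S {} = 1"
 by (simp_all add: cliff_sign_def)

lemma sign_self:
 assumes "finite S" shows "cliff_sign S S = (-1) ^ (card S * (card S - 1) div 2)"
proof -
 let ?A = "{(s, t). s \<in> S & t \<in> S & t < s}" and ?B = "{(s, t). s \<in> S & t \<in> S & s < t}"
 have fin: "finite ?A" "finite ?B"
  using assms by (auto intro: finite_subset[of _ "S \<times> S"])
 have "bij_betw prod.swap ?A ?B"
  by (rule bij_betwI[where g = prod.swap]) auto
 then have AB: "card ?A = card ?B" by (rule bij_betw_same_card)
 have "S \<times> S = (?A Un ?B) Un (%s. (s, s)) ` S" by auto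
 then have "card S * card S = card ((?A Un ?B) Un (%s. (s, s)) ` S)"
  by (metis card_cartesian_product)
 also have "... = card (?A Un ?B) + card ((%s. (s, s)) ` S)"
  using fin assms by (intro card_Un_disjoint) auto
 also have "card (?A Un ?B) = card ?A + card ?B"
  using fin by (intro card_Un_disjoint) auto
 also have "card ((%s. (s, s)) ` S) = card S" by (intro card_image inj_onI) auto
 finally have "card S * card S = 2 * card ?A + card S" using AB by simp
 then have "card ?A = card S * (card S - 1) div 2"
  by (simp add: right_diff_distrib')
 then show ?thesis by (simp add: cliff_sign_def)
qed

lemma cliff_mult_sum:
 assumes "finite I" "{S. a S ~= 0} <= I"
 shows "cliff_mult a b R = (\<Sum>S\<in>I. cliff_sign S (sym_diff S R) * a S * b (sym_diff S R))"
 unfolding cliff_mult_def using assms by (intro sum.mono_neutral_left) auto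

instantiation cl :: real_algebra_1
begin

lift_definition zero_cl :: cl is "%S. 0" by simp
lift_definition one_cl :: cl is cliff_one by (auto simp: cliff_one_def)
lift_definition plus_cl :: "cl => cl => cl" is "%a b S. a S + b S"
 subgoal for a b
  by (auto intro: finite_subset[of _ "{S. a S ~= 0} Un {S. b S ~= 0}"]) (metis add_0)+
 done
lift_definition uminus_cl :: "cl => cl" is "%a S. - a S" by simp
lift_definition minus_cl :: "cl => cl => cl" is "%a b S. a S - b S"
 subgoal for a b
  by (auto intro: finite_subset[of _ "{S. a S ~= 0} Un {S. b S ~= 0}"]) (metis diff_self)+
 done
lift_definition scaleR_cl :: "real => cl => cl" is "%r a S. of_real r * a S"
 subgoal for r a by (auto intro: finite_subset[of _ "{S. a S ~= 0}"])
 done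
lift_definition times_cl :: "cl => cl => cl" is cliff_mult
proof -
 fix a b :: cliff
 assume a: "finite {S. a S ~= 0} & (ALL S. a S ~= 0 --> finite S)"
  and b: "finite {S. b S ~= 0} & (ALL S. b S ~= 0 --> finite S)"
 have *: "EX S T. R = sym_diff S T & a S ~= 0 & b T ~= 0" if R: "cliff_mult a b R ~= 0" for R
 proof -
  obtain S where "a S ~= 0" "b (sym_diff S R) ~= 0"
   using R unfolding cliff_mult_def by (auto elim!: sum.not_neutral_contains_not_neutral)
  moreover have "R = sym_diff S (sym_diff S R)" by auto
  ultimately show ?thesis by blast
 qed
 have "R \<in> (%(S, T). sym_diff S T) ` ({S. a S ~= 0} \<times> {S. b S ~= 0})" if "cliff_mult a b R ~= 0" for R
  using *[OF that] by auto
 then have "{R. cliff_mult a b R ~= 0} <= (%(S, T). sym_diff S T) ` ({S. a S ~= 0} \<times> {S. b S ~= 0})"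
  by auto
 moreover have "finite ((%(S, T). sym_diff S T) ` ({S. a S ~= 0} \<times> {S. b S ~= 0}))"
  using a b by simp
 ultimately have "finite {S. cliff_mult a b S ~= 0}" by (rule finite_subset)
 moreover have "finite R" if "cliff_mult a b R ~= 0" for R
  using *[OF that] a b by auto
 ultimately show "finite {S. cliff_mult a b S ~= 0} & (ALL S. cliff_mult a b S ~= 0 --> finite S)"
  by blast
qed

lemma cf_times_sum:
 assumes "finite I" "supp a <= I"
 shows "cf (a * b) R = (\<Sum>S\<in>I. cliff_sign S (sym_diff S R) * cf a S * cf b (sym_diff S R))"
 using cliff_mult_sum[OF assms(1)] assms(2) by (simp add: times_cl.rep_eq supp_def)

lemma sum_reindex_sym_diff:
 assumes "R \<in> Pow {..<n::nat}"
 shows "(\<Sum>S\<in>Pow {..<n}. f (sym_diff R S)) = (\<Sum>S\<in>Pow {..<n}. f S)"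
 by (rule sum.reindex_bij_witness[where i = "%S. sym_diff R S" and j = "%S. sym_diff R S"])
  (use assms in "auto intro!: arg_cong[where f = f]")

lemma sym_diff_cancel: "sym_diff S (sym_diff S T) = T" "sym_diff (sym_diff S T) T = S"
 "sym_diff (sym_diff S T) S = T" "sym_diff T (sym_diff S T) = S"
 by auto

lemma times_cl_assoc: "(a * b) * c = a * (b * (c::cl))"
proof (rule cf_eqI)
 fix R :: "nat set" assume R: "finite R"
 have "eventually (%n. supp a <= Pow {..<n} & supp b <= Pow {..<n} & supp (a * b) <= Pow {..<n}) sequentially"
  by (intro eventually_conj eventually_supp)
 then obtain n where n: "supp a <= Pow {..<n}" "supp b <= Pow {..<n}" "supp (a * b) <= Pow {..<n}"
  by (auto simp: eventually_sequentially)
 let ?I = "Pow {..<n}" and ?s = cliff_sign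
 have f: "finite S" if "S \<in> ?I" for S using that by (auto intro: finite_subset)
 have "cf ((a * b) * c) R = (\<Sum>T\<in>?I. ?s T (sym_diff T R) *
   (\<Sum>S\<in>?I. ?s S (sym_diff S T) * cf a S * cf b (sym_diff S T)) * cf c (sym_diff T R))"
  using n by (simp add: cf_times_sum[of ?I])
 also have "... = (\<Sum>S\<in>?I. \<Sum>T\<in>?I. ?s T (sym_diff T R) *
   (?s S (sym_diff S T) * cf a S * cf b (sym_diff S T)) * cf c (sym_diff T R))"
  by (subst sum.swap) (simp add: sum_distrib_left sum_distrib_right)
 also have "... = (\<Sum>S\<in>?I. \<Sum>T\<in>?I. ?s S (sym_diff S R) * cf a S * (?s (sym_diff S T) (sym_diff (sym_diff S T) (sym_diff S R)) *
   cf b (sym_diff S T) * cf c (sym_diff (sym_diff S T) (sym_diff S R))))"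
 proof (intro sum.cong refl)
  fix S T assume S: "S \<in> ?I" and T: "T \<in> ?I"
  have fin: "finite S" "finite T" using S T f by auto
  have e1: "sym_diff (sym_diff S T) (sym_diff S R) = sym_diff T R" by auto
  show "?s T (sym_diff T R) * (?s S (sym_diff S T) * cf a S * cf b (sym_diff S T)) * cf c (sym_diff T R) =
   ?s S (sym_diff S R) * cf a S * (?s (sym_diff S T) (sym_diff (sym_diff S T) (sym_diff S R)) *
   cf b (sym_diff S T) * cf c (sym_diff (sym_diff S T) (sym_diff S R)))"
   unfolding e1 using fin R by (simp add: sign_left sign_right)
 qed
 also have "... = (\<Sum>S\<in>?I. \<Sum>T\<in>?I. ?s S (sym_diff S R) * cf a S * (?s T (sym_diff T (sym_diff S R)) *
   cf b T * cf c (sym_diff T (sym_diff S R))))"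
  by (intro sum.cong refl sum_reindex_sym_diff)
 also have "... = cf (a * (b * c)) R"
  using n by (simp add: cf_times_sum[of ?I] sum_distrib_left sum_distrib_right)
 finally show "cf ((a * b) * c) R = cf (a * (b * c)) R" .
qed

instance
proof
 fix a b c :: cl and r s :: real
 show "a + b + c = a + (b + c)" by (rule cf_eqI) (simp add: plus_cl.rep_eq)
 show "a + b = b + a" by (rule cf_eqI) (simp add: plus_cl.rep_eq)
 show "0 + a = a" by (rule cf_eqI) (simp add: plus_cl.rep_eq zero_cl.rep_eq)
 show "- a + a = 0" by (rule cf_eqI) (simp add: plus_cl.rep_eq uminus_cl.rep_eq zero_cl.rep_eq)
 show "a - b = a + - b" by (rule cf_eqI) (simp add: plus_cl.rep_eq uminus_cl.rep_eq minus_cl.rep_eq)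
 show "a * b * c = a * (b * c)" by (rule times_cl_assoc)
 show "r *\<^sub>R (a + b) = r *\<^sub>R a + r *\<^sub>R b"
  by (rule cf_eqI) (simp add: plus_cl.rep_eq scaleR_cl.rep_eq algebra_simps)
 show "(r + s) *\<^sub>R a = r *\<^sub>R a + s *\<^sub>R a"
  by (rule cf_eqI) (simp add: plus_cl.rep_eq scaleR_cl.rep_eq algebra_simps)
 show "r *\<^sub>R s *\<^sub>R a = (r * s) *\<^sub>R a"
  by (rule cf_eqI) (simp add: scaleR_cl.rep_eq algebra_simps)
 show "1 *\<^sub>R a = a" by (rule cf_eqI) (simp add: scaleR_cl.rep_eq)
 have I: "finite (supp a Un supp b)" by simp
 show "(a + b) * c = a * c + b * c"
 proof (rule cf_eqI)
  fix R
  have "supp (a + b) <= supp a Un supp b" by (auto simp: supp_def plus_cl.rep_eq)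
  then show "cf ((a + b) * c) R = cf (a * c + b * c) R"
   by (simp add: plus_cl.rep_eq cf_times_sum[OF I] algebra_simps sum.distrib)
 qed
 show "a * (b + c) = a * b + a * c"
  by (rule cf_eqI) (simp add: plus_cl.rep_eq cf_times_sum[OF finite_supp subset_refl] algebra_simps sum.distrib)
 show "r *\<^sub>R a * b = r *\<^sub>R (a * b)"
 proof (rule cf_eqI)
  fix R
  have "supp (r *\<^sub>R a) <= supp a" by (auto simp: supp_def scaleR_cl.rep_eq)
  then show "cf (r *\<^sub>R a * b) R = cf (r *\<^sub>R (a * b)) R"
   by (simp add: scaleR_cl.rep_eq cf_times_sum[OF finite_supp[of a]] sum_distrib_left algebra_simps)
 qed
 show "a * r *\<^sub>R b = r *\<^sub>R (a * b)"
  by (rule cf_eqI) (simp add: scaleR_cl.rep_eq cf_times_sum[OF finite_supp[of a] subset_refl] sum_distrib_left algebra_simps)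
 have s1: "supp 1 <= {{}}" by (auto simp: supp_def one_cl.rep_eq cliff_one_def split: if_splits)
 show "1 * a = a"
  by (rule cf_eqI, subst cf_times_sum[OF _ s1]) (simp_all add: one_cl.rep_eq cliff_one_def)
 show "a * 1 = a"
 proof (rule cf_eqI)
  fix R :: "nat set" assume "finite R"
  have "cf (a * 1) R = (\<Sum>S\<in>insert R (supp a). cliff_sign S (sym_diff S R) * cf a S * cf 1 (sym_diff S R))"
   by (rule cf_times_sum) auto
  also have "... = (\<Sum>S\<in>insert R (supp a). if S = R then cf a R else 0)"
  proof (intro sum.cong refl)
   fix S
   have "sym_diff S R = {} \<longleftrightarrow> S = R" by auto
   then show "cliff_sign S (sym_diff S R) * cf a S * cf 1 (sym_diff S R) = (if S = R then cf a R else 0)"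
    by (auto simp: one_cl.rep_eq cliff_one_def)
  qed
  also have "... = cf a R" by simp
  finally show "cf (a * 1) R = cf a R" .
 qed
 have "cf 0 {} ~= cf 1 {}" by (simp add: zero_cl.rep_eq one_cl.rep_eq cliff_one_def)
 then show "(0::cl) ~= 1" by metis
qed

end

lemmas cf_simps [simp] = zero_cl.rep_eq plus_cl.rep_eq minus_cl.rep_eq uminus_cl.rep_eq scaleR_cl.rep_eq

lemma cf_sum [simp]: "cf (sum f A) S = (\<Sum>i\<in>A. cf (f i) S)"
 by (induction A rule: infinite_finite_induct) auto

lift_definition adj :: "cl => cl" is cliff_star
 subgoal for a by (auto simp: cliff_star_def)
 done

lift_definition par :: "cl => cl" is "%a S. (-1) ^ card S * a S" by simp

lift_definition cs :: "complex => cl" is "%c S. if S = {} then c else 0" by simp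

lift_definition bas :: "nat set => cl" is "%T S. if S = T & finite T then 1 else 0"
 by simp

lemma cnj_sign [simp]: "cnj (cliff_sign S T) = cliff_sign S T"
 by (simp add: cliff_sign_def)

lemma cf_adj: "finite S ==> cf (adj a) S = cliff_sign S S * cnj (cf a S)"
 by (simp add: adj.rep_eq cliff_star_def sign_self)

lemma ex_bound:
 assumes "finite R"
 shows "EX n. supp a <= Pow {..<n} & supp b <= Pow {..<n} & R \<in> Pow {..<n}"
proof -
 have "eventually (%n. supp a <= Pow {..<n} & supp b <= Pow {..<n} & R \<in> Pow {..<n}) sequentially"
  using assms by (intro eventually_conj eventually_supp eventually_fin)
 then show ?thesis by (rule eventually_happens'[OF sequentially_bot])
qed

lemma suppD: "S \<in> supp a ==> finite S"
 using cf_infinite by (auto simp: supp_def simp del: cf_infinite)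

lemma supp_adj [simp]: "supp (adj a) = supp a"
 by (auto simp: supp_def adj.rep_eq cliff_star_def)

lemma supp_par [simp]: "supp (par a) = supp a"
 by (auto simp: supp_def par.rep_eq)

lemma adj_add: "adj (a + b) = adj a + adj b"
 by (rule cf_eqI) (simp add: cf_adj algebra_simps)

lemma adj_diff: "adj (a - b) = adj a - adj b"
 by (rule cf_eqI) (simp add: cf_adj algebra_simps)

lemma adj_zero [simp]: "adj 0 = 0"
 by (rule cf_eqI) (simp add: cf_adj)

lemma adj_scaleR: "adj (r *\<^sub>R a) = r *\<^sub>R adj a"
 by (rule cf_eqI) (simp add: cf_adj)

lemma adj_adj [simp]: "adj (adj a) = a"
 by (rule cf_eqI) (simp add: cf_adj)

lemma adj_cs [simp]: "adj (cs c) = cs (cnj c)"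
 by (rule cf_eqI) (simp add: cf_adj cs.rep_eq)

lemma finite_sym_diff: "finite S ==> finite T ==> finite (sym_diff S T)"
 by simp

text \<open>Both sides are expanded in ordered products; the signs agree since \<open>cliff_star\<close> multiplies the coefficient at \<open>S\<close> by
 the sign of reversing \<open>S\<close>, that is \<open>cliff_sign S S\<close>.\<close>

lemma adj_mult: "adj (a * b) = adj b * adj a"
proof (rule cf_eqI)
 fix R :: "nat set" assume R: "finite R"
 obtain n where n: "supp a <= Pow {..<n}" "supp b <= Pow {..<n}" "R \<in> Pow {..<n}"
  using ex_bound[OF R, of a b] by (elim exE conjE)
 let ?I = "Pow {..<n}" and ?s = cliff_sign
 have "cf (adj b * adj a) R = (\<Sum>S\<in>?I. ?s S (sym_diff S R) * cf (adj b) S * cf (adj a) (sym_diff S R))"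
  using n by (simp add: cf_times_sum[of ?I])
 also have "... = (\<Sum>S\<in>?I. ?s (sym_diff R S) (sym_diff (sym_diff R S) R) * cf (adj b) (sym_diff R S) * cf (adj a) (sym_diff (sym_diff R S) R))"
  using n(3) by (intro sum_reindex_sym_diff[symmetric])
 also have "... = (\<Sum>S\<in>?I. ?s R R * cnj (?s S (sym_diff S R) * cf a S * cf b (sym_diff S R)))"
 proof (intro sum.cong refl)
  fix S assume "S \<in> ?I"
  then have S: "finite S" by (auto intro: finite_subset)
  have e: "sym_diff (sym_diff R S) R = S" by auto
  have e': "cf b (sym_diff R S) = cf b (sym_diff S R)" by (simp add: Un_commute)
  show "?s (sym_diff R S) (sym_diff (sym_diff R S) R) * cf (adj b) (sym_diff R S) * cf (adj a) (sym_diff (sym_diff R S) R) =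
   ?s R R * cnj (?s S (sym_diff S R) * cf a S * cf b (sym_diff S R))"
   unfolding e using S R by (simp add: cf_adj sign_left sign_right e' mult.commute mult.left_commute)
 qed
 also have "... = cf (adj (a * b)) R"
  using n R by (simp add: cf_adj cf_times_sum[of ?I] sum_distrib_left)
 finally show "cf (adj (a * b)) R = cf (adj b * adj a) R" ..
qed

lemma card_sym_diff_parity:
 assumes "finite S" "finite T"
 shows "(-1) ^ card (sym_diff S T) = (-1) ^ card S * ((-1) ^ card T :: complex)"
 using prod_sym_diff[OF assms, of "%_. -1"] by simp

lemma par_mult: "par (a * b) = par a * par b"
proof (rule cf_eqI)
 fix R :: "nat set" assume R: "finite R"
 have "cf (par a * par b) R = (\<Sum>S\<in>supp a. cliff_sign S (sym_diff S R) * cf (par a) S * cf (par b) (sym_diff S R))"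
  by (rule cf_times_sum) auto
 also have "... = (\<Sum>S\<in>supp a. (-1) ^ card R * (cliff_sign S (sym_diff S R) * cf a S * cf b (sym_diff S R)))"
 proof (intro sum.cong refl)
  fix S assume "S \<in> supp a"
  then have S: "finite S" by (rule suppD)
  have "(-1) ^ card R = (-1) ^ card S * ((-1) ^ card (sym_diff S R) :: complex)"
   using card_sym_diff_parity[OF S finite_sym_diff[OF S R]] by (simp add: sym_diff_cancel)
  then show "cliff_sign S (sym_diff S R) * cf (par a) S * cf (par b) (sym_diff S R) =
   (-1) ^ card R * (cliff_sign S (sym_diff S R) * cf a S * cf b (sym_diff S R))"
   by (simp add: par.rep_eq algebra_simps)
 qed
 also have "... = cf (par (a * b)) R"
  by (simp add: par.rep_eq cf_times_sum[OF finite_supp subset_refl] sum_distrib_left)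
 finally show "cf (par (a * b)) R = cf (par a * par b) R" ..
qed

lemma par_add: "par (a + b) = par a + par b"
 by (rule cf_eqI) (simp add: par.rep_eq algebra_simps)

lemma par_diff: "par (a - b) = par a - par b"
 by (rule cf_eqI) (simp add: par.rep_eq algebra_simps)

lemma par_scaleR: "par (r *\<^sub>R a) = r *\<^sub>R par a"
 by (rule cf_eqI) (simp add: par.rep_eq)

lemma par_par [simp]: "par (par a) = a"
 by (rule cf_eqI) (simp add: par.rep_eq flip: power_mult_distrib mult.assoc)

lemma par_cs [simp]: "par (cs c) = cs c"
 by (rule cf_eqI) (simp add: par.rep_eq cs.rep_eq)

lemma par_adj: "par (adj a) = adj (par a)"
 by (rule cf_eqI) (simp add: par.rep_eq cf_adj)

lemma par_sum: "par (sum f A) = (\<Sum>i\<in>A. par (f i))"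
 by (rule cf_eqI) (simp add: par.rep_eq sum_distrib_left)

lemma cf_cs_mult [simp]: "cf (cs c * a) S = c * cf a S"
proof -
 have "supp (cs c) <= {{}}" by (auto simp: supp_def cs.rep_eq split: if_splits)
 then show ?thesis by (subst cf_times_sum[of "{{}}"]) (auto simp: cs.rep_eq)
qed

lemma cs_commute: "a * cs c = cs c * a"
proof -
 have "adj (adj (cs (cnj c)) * adj a) = a * cs (cnj (cnj (cnj c)))" for c
  by (simp add: adj_mult)
 then have "a * cs c = adj (cs (cnj c) * adj a)" by (simp add: adj_mult)
 also have "... = cs c * a" by (rule cf_eqI) (simp add: cf_adj)
 finally show ?thesis .
qed

lemma cs_mult: "cs (c * d) = cs c * cs d"
 by (rule cf_eqI) (simp add: cs.rep_eq)

lemma cs_add: "cs (c + d) = cs c + cs d"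
 by (rule cf_eqI) (simp add: cs.rep_eq)

lemma cs_one [simp]: "cs 1 = 1"
 by (rule cf_eqI) (simp add: cs.rep_eq one_cl.rep_eq cliff_one_def)

lemma cs_zero [simp]: "cs 0 = 0"
 by (rule cf_eqI) (simp add: cs.rep_eq)

lemma cs_of_real: "cs (of_real r) = of_real r"
 by (rule cf_eqI) (simp add: cs.rep_eq of_real_def one_cl.rep_eq cliff_one_def)

lemma cs_of_real_mult: "cs (of_real r) * a = r *\<^sub>R a"
 by (simp add: cs_of_real scaleR_conv_of_real)

lemma cl_expansion: "a = (\<Sum>S\<in>supp a. cs (cf a S) * bas S)"
proof (rule cf_eqI)
 fix R
 have "(\<Sum>S\<in>supp a. cf (cs (cf a S) * bas S) R) = (\<Sum>S\<in>supp a. if S = R then cf a R else 0)"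
  by (intro sum.cong refl) (auto simp: bas.rep_eq supp_def)
 also have "... = (if R \<in> supp a then cf a R else 0)" by (simp add: sum.delta)
 also have "... = cf a R" by (auto simp: supp_def)
 finally show "cf a R = cf (\<Sum>S\<in>supp a. cs (cf a S) * bas S) R" by simp
qed

lemma supp_bas: "finite S ==> supp (bas S) = {S}"
 by (auto simp: supp_def bas.rep_eq)

lemma cf_bas_mult: "finite S ==> cf (bas S * a) R = cliff_sign S (sym_diff S R) * cf a (sym_diff S R)"
 by (subst cf_times_sum[of "{S}"]) (auto simp: supp_bas bas.rep_eq)

lemma bas_unitary: assumes "finite S" shows "adj (bas S) * bas S = 1"
proof -
 have "adj (bas S) = cs (cliff_sign S S) * bas S"
  by (rule cf_eqI) (use assms in "auto simp: cf_adj bas.rep_eq")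
 moreover have "bas S * bas S = cs (cliff_sign S S)"
 proof (rule cf_eqI)
  fix R
  have "sym_diff S R = S \<longleftrightarrow> R = {}" by auto
  then show "cf (bas S * bas S) R = cf (cs (cliff_sign S S)) R"
   using assms by (auto simp: cf_bas_mult bas.rep_eq cs.rep_eq)
 qed
 ultimately show ?thesis by (simp add: mult.assoc flip: cs_mult)
qed


text \<open>The coefficient at the empty set is a faithful trace.  Its inner product is the one that makes the ordered products
 orthonormal.\<close>

definition ip :: "cl => cl => complex" where "ip a b = cf (adj a * b) {}"

definition n2 :: "cl => real" where "n2 a = cliff_norm2 (cf a)"

lemma n2_L2:
 assumes "finite I" "supp a <= I"
 shows "n2 a = L2_set (%S. cmod (cf a S)) I"
 unfolding n2_def cliff_norm2_def L2_set_def
 using assms by (intro arg_cong[where f = sqrt] sum.mono_neutral_left) (auto simp: supp_def)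

lemma ip_sum:
 assumes "finite I" "supp a <= I"
 shows "ip a b = (\<Sum>S\<in>I. cnj (cf a S) * cf b S)"
proof -
 have "ip a b = (\<Sum>S\<in>I. cliff_sign S (sym_diff S {}) * cf (adj a) S * cf b (sym_diff S {}))"
  unfolding ip_def using assms by (intro cf_times_sum) auto
 also have "... = (\<Sum>S\<in>I. cnj (cf a S) * cf b S)"
 proof (intro sum.cong refl)
  fix S
  show "cliff_sign S (sym_diff S {}) * cf (adj a) S * cf b (sym_diff S {}) = cnj (cf a S) * cf b S"
   by (cases "finite S") (simp_all add: cf_adj mult.assoc)
 qed
 finally show ?thesis .
qed

lemma n2_sq: "complex_of_real ((n2 a)^2) = ip a a"
proof -
 have "(n2 a)^2 = (\<Sum>S\<in>supp a. (cmod (cf a S))^2)"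
  by (simp add: n2_L2[OF finite_supp subset_refl] L2_set_def sum_nonneg)
 then show ?thesis
  by (simp add: ip_sum[OF finite_supp subset_refl] complex_norm_square mult.commute del: of_real_power)
qed

lemma n2_nonneg [simp]: "0 <= n2 a" by (simp add: n2_def cliff_norm2_def sum_nonneg)

lemma cmod_cf_le_n2: "cmod (cf a S) <= n2 a"
proof -
 have "n2 a = L2_set (%S. cmod (cf a S)) (insert S (supp a))" by (rule n2_L2) auto
 then show ?thesis using member_le_L2_set[of "insert S (supp a)" S "%S. cmod (cf a S)"] by simp
qed

lemma n2_eq_0 [simp]: "n2 a = 0 \<longleftrightarrow> a = 0"
proof
 assume "n2 a = 0"
 then have "cf a S = 0" for S using cmod_cf_le_n2[of a S] by simp
 then show "a = 0" by (intro cf_eqI) simp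
qed (simp add: n2_def cliff_norm2_def)

lemma n2_zero [simp]: "n2 0 = 0" by simp

lemma n2_triangle: "n2 (a + b) <= n2 a + n2 b"
proof -
 let ?I = "supp a Un supp b"
 have s: "supp (a + b) <= ?I" by (auto simp: supp_def)
 have "n2 (a + b) = L2_set (%S. cmod (cf (a + b) S)) ?I" by (intro n2_L2 s) auto
 also have "... <= L2_set (%S. cmod (cf a S) + cmod (cf b S)) ?I"
  by (intro L2_set_mono) (auto intro: norm_triangle_ineq)
 also have "... <= L2_set (%S. cmod (cf a S)) ?I + L2_set (%S. cmod (cf b S)) ?I"
  by (rule L2_set_triangle_ineq)
 also have "... = n2 a + n2 b" by (simp add: n2_L2[of ?I])
 finally show ?thesis .
qed

lemma n2_cs: "n2 (cs c * a) = cmod c * n2 a"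
proof -
 have s: "supp (cs c * a) <= supp a" by (auto simp: supp_def)
 show ?thesis
  by (simp add: n2_L2[OF finite_supp[of a] s] n2_L2[OF finite_supp[of a] subset_refl] norm_mult L2_set_right_distrib)
qed

lemma n2_scaleR: "n2 (r *\<^sub>R a) = \<bar>r\<bar> * n2 a"
 using n2_cs[of "of_real r" a] by (simp add: cs_of_real_mult)

lemma n2_one [simp]: "n2 1 = 1"
proof -
 have "ip 1 1 = 1" unfolding ip_def by (metis adj_cs cs_one complex_cnj_one mult_1 cs.rep_eq)
 then have "(n2 1)^2 = 1" using n2_sq[of 1] by (metis of_real_eq_1_iff)
 then show ?thesis by (metis n2_nonneg power2_eq_1_iff zero_le_one abs_of_nonneg le_minus_one_simps(3))
qed

lemma ip_cauchy: "cmod (ip a b) <= n2 a * n2 b"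
proof -
 let ?I = "supp a Un supp b"
 have "cmod (ip a b) <= (\<Sum>S\<in>?I. \<bar>cmod (cf a S)\<bar> * \<bar>cmod (cf b S)\<bar>)"
  by (subst ip_sum[of ?I]) (auto intro!: sum_norm_le simp: norm_mult)
 also have "... <= L2_set (%S. cmod (cf a S)) ?I * L2_set (%S. cmod (cf b S)) ?I"
  by (rule L2_set_mult_ineq)
 also have "... = n2 a * n2 b" by (simp add: n2_L2[of ?I])
 finally show ?thesis .
qed

lemma n2_isometry: "adj w * w = 1 ==> n2 (w * a) = n2 a"
proof -
 assume w: "adj w * w = 1"
 have "ip (w * a) (w * a) = ip a a"
  unfolding ip_def adj_mult using w by (metis mult.assoc mult_1)
 then have "(n2 (w * a))^2 = (n2 a)^2" using n2_sq by (metis of_real_eq_iff)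
 then show ?thesis by simp
qed

lemma n2_sum: "n2 (sum f A) <= (\<Sum>i\<in>A. n2 (f i))"
 by (induction A rule: infinite_finite_induct) (auto intro: order_trans[OF n2_triangle])

lemma n2_mult_bound: "n2 (a * x) <= (\<Sum>S\<in>supp a. cmod (cf a S)) * n2 x"
proof -
 have "n2 (a * x) = n2 (\<Sum>S\<in>supp a. cs (cf a S) * (bas S * x))"
  by (subst cl_expansion[of a]) (simp add: sum_distrib_right mult.assoc)
 also have "... <= (\<Sum>S\<in>supp a. n2 (cs (cf a S) * (bas S * x)))" by (rule n2_sum)
 also have "... = (\<Sum>S\<in>supp a. cmod (cf a S) * n2 x)"
 proof (intro sum.cong refl)
  fix S assume "S \<in> supp a"
  then have "finite S" by (rule suppD)
  then show "n2 (cs (cf a S) * (bas S * x)) = cmod (cf a S) * n2 x"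
   by (simp add: n2_cs n2_isometry bas_unitary)
 qed
 finally show ?thesis by (simp add: sum_distrib_right)
qed

text \<open>The norm is that of left multiplication on the inner product space of the trace.\<close>

instantiation cl :: real_normed_algebra_1
begin

definition norm_cl :: "cl => real" where "norm_cl a = Sup {n2 (a * x) |x. n2 x <= 1}"
definition dist_cl :: "cl => cl => real" where "dist_cl a b = norm (a - b)"
definition sgn_cl :: "cl => cl" where "sgn_cl a = inverse (norm a) *\<^sub>R a"
definition uniformity_cl :: "(cl \<times> cl) filter" where
 "uniformity_cl = (INF e\<in>{0 <..}. principal {(x, y). dist x y < e})"
definition open_cl :: "cl set => bool" where
 "open_cl U \<longleftrightarrow> (ALL x:U. eventually (%(x', y). x' = x --> y \<in> U) uniformity)"

lemma cl_bdd: "bdd_above {n2 (a * x) |x. n2 x <= 1}"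
proof (rule bdd_aboveI)
 fix y assume "y \<in> {n2 (a * x) |x. n2 x <= 1}"
 then obtain x where x: "y = n2 (a * x)" "n2 x <= 1" by auto
 have "0 <= (\<Sum>S\<in>supp a. cmod (cf a S))" by (simp add: sum_nonneg)
 then show "y <= (\<Sum>S\<in>supp a. cmod (cf a S))"
  using n2_mult_bound[of a "x"] x by (meson mult_left_le order_trans)
qed

lemma n2_mult_le: "n2 (a * x) <= norm (a::cl) * n2 x"
proof (cases "x = 0")
 case False
 then have p: "n2 x > 0" using n2_nonneg[of x] n2_eq_0[of x] by linarith
 let ?y = "inverse (n2 x) *\<^sub>R x"
 have "n2 ?y <= 1" using p by (simp add: n2_scaleR field_simps)
 then have "n2 (a * ?y) <= norm a" unfolding norm_cl_def by (intro cSup_upper cl_bdd, blast)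
 then show ?thesis using p by (simp add: n2_scaleR field_simps)
qed simp

lemma norm_cl_leI:
 assumes "!!x. n2 (a * x) <= M * n2 x" "M >= 0"
 shows "norm (a::cl) <= M"
 unfolding norm_cl_def
proof (rule cSup_least)
 show "{n2 (a * x) |x. n2 x <= 1} ~= {}" by (auto intro: exI[of _ 0])
 fix y assume "y \<in> {n2 (a * x) |x. n2 x <= 1}"
 then obtain x where x: "y = n2 (a * x)" "n2 x <= 1" by auto
 then show "y <= M" using assms(1)[of x] assms(2) by (meson mult_left_le order_trans)
qed

lemma n2_le_norm: "n2 a <= norm (a::cl)"
 using n2_mult_le[of a 1] by simp

lemma norm_cl_nonneg: "0 <= norm (a::cl)"
 using n2_le_norm[of a] n2_nonneg[of a] by linarith

instance
proof
 fix a b :: cl and r :: real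
 show "dist a b = norm (a - b)" by (rule dist_cl_def)
 show "sgn a = inverse (norm a) *\<^sub>R a" by (rule sgn_cl_def)
 show "uniformity = (INF e\<in>{0<..}. principal {(x::cl, y). dist x y < e})" by (rule uniformity_cl_def)
 show "open U = (ALL x:U. \<forall>\<^sub>F (x', y) in uniformity. x' = x --> y \<in> U)" for U :: "cl set" by (rule open_cl_def)
 show "norm a = 0 \<longleftrightarrow> a = 0"
 proof
  assume "norm a = 0"
  then show "a = 0" using n2_le_norm[of a] n2_nonneg[of a] by (metis n2_eq_0 order_antisym)
 next
  assume "a = 0"
  have "norm (0::cl) <= 0" by (rule norm_cl_leI) simp_all
  then show "norm a = 0" using norm_cl_nonneg[of 0] \<open>a = 0\<close> by simp
 qed
 show "norm (a + b) <= norm a + norm b"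
 proof (rule norm_cl_leI)
  fix x
  show "n2 ((a + b) * x) <= (norm a + norm b) * n2 x"
   using n2_triangle[of "a * x" "b * x"] n2_mult_le[of a x] n2_mult_le[of b x] by (simp add: algebra_simps)
 qed (simp add: norm_cl_nonneg)
 have le: "norm (r *\<^sub>R a) <= \<bar>r\<bar> * norm a" for r and a :: cl
 proof (rule norm_cl_leI)
  fix x show "n2 (r *\<^sub>R a * x) <= \<bar>r\<bar> * norm a * n2 x"
   using mult_left_mono[OF n2_mult_le[of a x], of "\<bar>r\<bar>"] by (simp add: n2_scaleR mult.assoc)
 qed (simp add: norm_cl_nonneg)
 show "norm (r *\<^sub>R a) = \<bar>r\<bar> * norm a"
 proof (cases "r = 0")
  case True
  then show ?thesis using le[of 0 a] norm_cl_nonneg[of "0 *\<^sub>R a"] by simp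
 next
  case False
  have "\<bar>r\<bar> * norm a = \<bar>r\<bar> * norm (inverse r *\<^sub>R (r *\<^sub>R a))" using False by simp
  also have "... <= \<bar>r\<bar> * (\<bar>inverse r\<bar> * norm (r *\<^sub>R a))" by (intro mult_left_mono le) auto
  also have "... = norm (r *\<^sub>R a)" using False by (simp add: field_simps)
  finally show ?thesis using le[of r a] by simp
 qed
 show "norm (a * b) <= norm a * norm b"
 proof (rule norm_cl_leI)
  fix x
  have "n2 (a * b * x) <= norm a * n2 (b * x)" by (simp add: mult.assoc n2_mult_le)
  also have "... <= norm a * (norm b * n2 x)" by (intro mult_left_mono n2_mult_le norm_cl_nonneg)
  finally show "n2 (a * b * x) <= norm a * norm b * n2 x" by (simp add: mult.assoc)
 qed (simp add: norm_cl_nonneg)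
 show "norm (1::cl) = 1"
  using norm_cl_leI[of 1 1] n2_le_norm[of 1] by simp
qed

end

lemma cmod_cf_le_norm: "cmod (cf a S) <= norm a"
 using cmod_cf_le_n2 n2_le_norm order_trans by blast

lemma norm_le_sum_coeffs:
 assumes "finite I" "supp a <= I" shows "norm a <= (\<Sum>S\<in>I. cmod (cf a S))"
proof -
 have "norm a <= (\<Sum>S\<in>supp a. cmod (cf a S))"
  by (rule norm_cl_leI[OF n2_mult_bound]) (simp add: sum_nonneg)
 also have "... <= (\<Sum>S\<in>I. cmod (cf a S))" using assms by (intro sum_mono2) auto
 finally show ?thesis .
qed

lemma norm_cs_mult: "norm (cs c * a) = cmod c * norm a"
proof (cases "c = 0")
 case False
 have le: "norm (cs c * a) <= cmod c * norm a" for c a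
  by (rule norm_cl_leI) (simp_all add: mult.assoc n2_cs mult_left_mono n2_mult_le)
 have "cmod c * norm a = cmod c * norm (cs (inverse c) * (cs c * a))"
  using False by (simp add: mult.assoc[symmetric] flip: cs_mult)
 also have "... <= cmod c * (cmod (inverse c) * norm (cs c * a))" by (intro mult_left_mono le) auto
 also have "... = norm (cs c * a)" using False by (simp add: norm_inverse norm_divide field_simps)
 finally show ?thesis using le[of c a] by simp
qed simp

lemma norm_adj_mult_self_ge: "(norm a)^2 <= norm (adj a * a)"
proof -
 have "norm a <= sqrt (norm (adj a * a))"
 proof (rule norm_cl_leI)
  fix x
  have "(n2 (a * x))^2 = cmod (ip (a * x) (a * x))" by (simp add: n2_sq[symmetric] norm_power)
  also have "ip (a * x) (a * x) = ip x (adj a * a * x)" by (simp add: ip_def adj_mult mult.assoc)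
  also have "cmod ... <= n2 x * n2 (adj a * a * x)" by (rule ip_cauchy)
  also have "... <= n2 x * (norm (adj a * a) * n2 x)" by (intro mult_left_mono n2_mult_le) auto
  finally have "(n2 (a * x))^2 <= norm (adj a * a) * (n2 x)^2" by (simp add: power2_eq_square algebra_simps)
  then have "sqrt ((n2 (a * x))^2) <= sqrt (norm (adj a * a) * (n2 x)^2)" by (rule real_sqrt_le_mono)
  then show "n2 (a * x) <= sqrt (norm (adj a * a)) * n2 x" by (simp add: real_sqrt_mult)
 qed simp
 then show ?thesis using power_mono[OF _ norm_ge_zero, of a "sqrt (norm (adj a * a))" 2] by simp
qed

lemma norm_adj [simp]: "norm (adj a) = norm (a::cl)"
proof -
 have le: "norm a <= norm (adj a)" for a :: cl
 proof (cases "norm a = 0")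
  case False
  have "norm a * norm a <= norm (adj a) * norm a"
   using norm_adj_mult_self_ge[of a] norm_mult_ineq[of "adj a" a] by (simp add: power2_eq_square)
  then show ?thesis using False by simp
 qed simp
 show ?thesis using le[of a] le[of "adj a"] by simp
qed

lemma cstar_cl: "norm (adj a * a) = (norm (a::cl))^2"
 using norm_adj_mult_self_ge[of a] norm_mult_ineq[of "adj a" a] by (simp add: power2_eq_square)

text \<open>Conjugation by a unitary is isometric: the reason why the connecting maps are contractive.\<close>

lemma norm_conj_unitary:
 assumes "adj w * w = 1" "w * adj w = 1"
 shows "norm (w * a * adj w) = norm (a::cl)"
proof -
 have w: "norm w = 1" using cstar_cl[of w] assms
  by (simp add: power2_eq_1_iff) (metis norm_ge_zero one_neq_neg_one le_minus_one_simps(3) abs_norm_cancel)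
 have le: "norm (u * a * adj u) <= norm a" if "norm u = 1" for u a :: cl
  using norm_mult_ineq[of "u * a" "adj u"] norm_mult_ineq[of u a] that by simp
 have "a = adj w * (w * a * adj w) * adj (adj w)" using assms by (metis adj_adj mult.assoc mult_1 mult.right_neutral)
 then have "norm a <= norm (w * a * adj w)" using le[of "adj w" "w * a * adj w"] w by simp
 then show ?thesis using le[OF w, of a] by simp
qed

section \<open>Subalgebras, vectors, and doubling by one generator\<close>

definition cin :: "nat set => cl => bool" where
 "cin I a \<longleftrightarrow> (ALL S. cf a S ~= 0 --> S <= I)"

lemma cin_D: "cin I a ==> \<not> S <= I ==> cf a S = 0"
 by (auto simp: cin_def)

lemma cin_mono: "cin I a ==> I <= J ==> cin J a"
 by (auto simp: cin_def)

lemma cin_0 [simp]: "cin I 0" by (simp add: cin_def)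

lemma cin_cs [simp]: "cin I (cs c)" by (simp add: cin_def cs.rep_eq)

lemma cin_1 [simp]: "cin I 1" using cin_cs[of I 1] by simp

lemma cin_add: "cin I a ==> cin I b ==> cin I (a + b)"
 unfolding cin_def by (metis add_0 cf_simps(2))

lemma cin_diff: "cin I a ==> cin I b ==> cin I (a - b)"
 unfolding cin_def by (metis diff_self cf_simps(3))

lemma cin_minus: "cin I a ==> cin I (- a)"
 unfolding cin_def by simp

lemma cin_scaleR: "cin I a ==> cin I (r *\<^sub>R a)"
 unfolding cin_def by simp

lemma cin_adj: "cin I a ==> cin I (adj a)"
 unfolding cin_def by (simp add: adj.rep_eq cliff_star_def)

lemma cin_par: "cin I a ==> cin I (par a)"
 unfolding cin_def by (simp add: par.rep_eq)

lemma cin_mult: assumes "cin I a" "cin I b" shows "cin I (a * b)"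
 unfolding cin_def
proof (intro allI impI)
 fix R assume "cf (a * b) R ~= 0"
 then obtain S where "cf a S ~= 0" "cf b (sym_diff S R) ~= 0"
  unfolding cf_times_sum[OF finite_supp subset_refl] by (auto elim!: sum.not_neutral_contains_not_neutral)
 then have "S <= I" "sym_diff S R <= I" using assms by (auto simp: cin_def)
 then show "R <= I" by blast
qed

lemma cin_sum: "(!!i. i \<in> A ==> cin I (f i)) ==> cin I (sum f A)"
 by (induction A rule: infinite_finite_induct) (auto intro: cin_add)

lemmas cin_intros = cin_add cin_diff cin_minus cin_scaleR cin_adj cin_par cin_mult cin_sum

lemma supp_cin: "cin I a ==> supp a <= Pow I"
 by (auto simp: cin_def supp_def)

lemma n2_sq_sum: "finite A ==> supp a <= A ==> (n2 a)^2 = (\<Sum>S\<in>A. (cmod (cf a S))^2)"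
 by (simp add: n2_L2 L2_set_def sum_nonneg)

text \<open>The algebra is the orthogonal sum of the right translates of the subalgebra over \<open>I\<close> by ordered products of generators
 outside \<open>I\<close>.  Left multiplication by \<open>a\<close> preserves each summand and acts on all of them in the same way, so its norm
 can be computed on the subalgebra alone.  This identifies the norm of \<open>SC K\<close>, defined with vectors in
 \<open>cliff_space K\<close>, with the norm of the ambient algebra.\<close>

lemma norm_restrict:
 assumes a: "cin I a" and M: "M >= 0" and le: "!!x. cin I x ==> n2 (a * x) <= M * n2 x"
 shows "norm a <= M"
proof (rule norm_cl_leI[OF _ M])
 fix x
 have "eventually (%n. supp a <= Pow {..<n} & supp x <= Pow {..<n} & supp (a * x) <= Pow {..<n}) sequentially"
  by (intro eventually_conj eventually_supp)
 then have "EX n. supp a <= Pow {..<n} & supp x <= Pow {..<n} & supp (a * x) <= Pow {..<n}"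
  by (rule eventually_happens'[OF sequentially_bot])
 then obtain n where n: "supp a <= Pow {..<n}" "supp x <= Pow {..<n}" "supp (a * x) <= Pow {..<n}"
  by (elim exE conjE)
 define J J' where "J = I Int {..<n}" and "J' = {..<n} - I"
 have fin [simp]: "finite J" "finite J'" by (auto simp: J_def J'_def)
 have finJ: "S <= J ==> finite S" and finJ': "S <= J' ==> finite S" for S
  using fin finite_subset by blast+
 have aJ: "supp a <= Pow J" using supp_cin[OF a] n(1) by (auto simp: J_def)
 define y where "y T = Cl (%Q. if Q <= J then cliff_sign Q T * cf x (Q Un T) else 0)" for T
 have cy: "cf (y T) = (%Q. if Q <= J then cliff_sign Q T * cf x (Q Un T) else 0)" for T
  unfolding y_def
  by (rule Cl_inverse) (auto intro!: finite_subset[of _ "Pow J"] finJ split: if_splits)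
 have yI: "cin I (y T)" for T by (auto simp: cin_def cy J_def split: if_splits)
 have ysupp: "supp (y T) <= Pow J" for T by (auto simp: supp_def cy split: if_splits)
 have split: "(\<Sum>R\<in>Pow {..<n}. f R) = (\<Sum>T\<in>Pow J'. \<Sum>Q\<in>Pow J. f (Q Un T))" for f :: "nat set => real"
  unfolding sum.cartesian_product
  by (rule sum.reindex_bij_witness[where j = "%R. (R Int J', R Int J)" and i = "%(T, Q). Q Un T"])
   (auto simp: J_def J'_def intro!: arg_cong[where f = f])
 have key: "cf (a * x) (Q Un T) = cliff_sign Q T * cf (a * y T) Q" if Q: "Q <= J" and T: "T <= J'" for Q T
 proof -
  have "cf (a * x) (Q Un T) = (\<Sum>S\<in>Pow J. cliff_sign S (sym_diff S (Q Un T)) * cf a S * cf x (sym_diff S (Q Un T)))"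
   using aJ by (intro cf_times_sum) auto
  also have "... = (\<Sum>S\<in>Pow J. cliff_sign Q T * (cliff_sign S (sym_diff S Q) * cf a S * cf (y T) (sym_diff S Q)))"
  proof (intro sum.cong refl)
   fix S assume "S \<in> Pow J"
   then have S: "S <= J" by simp
   have d: "J Int J' = {}" by (auto simp: J_def J'_def)
   have e1: "sym_diff S (Q Un T) = sym_diff (sym_diff S Q) T" "sym_diff S Q Un T = sym_diff (sym_diff S Q) T"
    using S Q T d by blast+
   have sub: "sym_diff S Q <= J" using S Q by blast
   show "cliff_sign S (sym_diff S (Q Un T)) * cf a S * cf x (sym_diff S (Q Un T)) =
    cliff_sign Q T * (cliff_sign S (sym_diff S Q) * cf a S * cf (y T) (sym_diff S Q))"
    using sub finJ[OF S] finJ[OF Q] finJ'[OF T] unfolding e1(1) cy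
    by (simp add: e1(2) sign_left sign_right mult.commute mult.left_commute)
  qed
  also have "... = cliff_sign Q T * cf (a * y T) Q"
   using aJ by (simp add: cf_times_sum[of "Pow J"] sum_distrib_left)
  finally show ?thesis .
 qed
 have cm: "cmod (cliff_sign Q T * z) = cmod z" for Q T z
  by (simp add: cliff_sign_def norm_mult norm_power)
 have ay: "supp (a * y T) <= Pow J" for T
 proof -
  have "cin J a" "cin J (y T)" using aJ ysupp by (auto simp: cin_def supp_def)
  then show ?thesis by (intro supp_cin cin_mult)
 qed
 have "(n2 (a * x))^2 = (\<Sum>T\<in>Pow J'. \<Sum>Q\<in>Pow J. (cmod (cf (a * x) (Q Un T)))^2)"
  using n(3) by (subst n2_sq_sum[of "Pow {..<n}"]) (auto simp: split)
 also have "... = (\<Sum>T\<in>Pow J'. (n2 (a * y T))^2)"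
  using ay by (intro sum.cong refl) (simp add: n2_sq_sum[of "Pow J"] key cm)
 also have "... <= (\<Sum>T\<in>Pow J'. (M * n2 (y T))^2)"
  by (intro sum_mono power_mono le yI) simp
 also have "... = M^2 * (\<Sum>T\<in>Pow J'. \<Sum>Q\<in>Pow J. (cmod (cf x (Q Un T)))^2)"
  using ysupp by (simp add: n2_sq_sum[of "Pow J"] cy cm power_mult_distrib sum_distrib_left)
 also have "... = (M * n2 x)^2"
  using n(2) by (simp add: n2_sq_sum[of "Pow {..<n}" x] split power_mult_distrib)
 finally show "n2 (a * x) <= M * n2 x" by (rule power2_le_imp_le) (use M in simp)
qed

definition gen :: "nat => cl" where "gen i = bas {i}"

lemma cf_gen: "cf (gen i) S = (if S = {i} then 1 else 0)"
 by (simp add: gen_def bas.rep_eq)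

lemma cin_gen: "i \<in> I ==> cin I (gen i)"
 by (auto simp: cin_def cf_gen)

lemma adj_gen [simp]: "adj (gen i) = gen i"
 by (rule cf_eqI) (simp add: adj.rep_eq cliff_star_def cf_gen)

lemma par_gen [simp]: "par (gen i) = - gen i"
 by (rule cf_eqI) (simp add: par.rep_eq cf_gen)

lemma gen_sq [simp]: "gen i * gen i = 1"
 using bas_unitary[of "{i}"] by (simp add: gen_def[symmetric])

lemma cf_gen_mult: "cf (gen i * a) R = cliff_sign {i} (sym_diff {i} R) * cf a (sym_diff {i} R)"
 by (simp add: gen_def cf_bas_mult)

lemma sign_commute:
 assumes "finite T" "i ~: T" shows "cliff_sign T {i} = (-1) ^ card T * cliff_sign {i} T"
proof -
 have "cliff_sign T {i} * cliff_sign {i} T = (\<Prod>s\<in>T. (if i < s then -1 else 1) * (if s < i then -1 else 1))"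
  using assms by (simp add: sign_prod prod.distrib)
 also have "... = (\<Prod>s\<in>T. -1)" using assms by (intro prod.cong refl) (auto simp: not_less le_less)
 finally have "cliff_sign T {i} * cliff_sign {i} T * cliff_sign {i} T = (-1) ^ card T * cliff_sign {i} T" by simp
 then show ?thesis by (simp add: mult.assoc)
qed

lemma gen_commute:
 assumes a: "cin I a" "i ~: I" shows "a * gen i = gen i * par a"
proof (rule cf_eqI)
 fix R :: "nat set" assume R: "finite R"
 let ?T = "sym_diff {i} R"
 have "cf (a * gen i) R = (\<Sum>S\<in>insert ?T (supp a). cliff_sign S (sym_diff S R) * cf a S * cf (gen i) (sym_diff S R))"
  by (rule cf_times_sum) auto
 also have "... = (\<Sum>S\<in>insert ?T (supp a). if S = ?T then cliff_sign ?T {i} * cf a ?T else 0)"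
 proof (intro sum.cong refl)
  fix S
  have 1: "sym_diff S R = {i} \<longleftrightarrow> S = ?T" by blast
  have 2: "sym_diff ?T R = {i}" by blast
  show "cliff_sign S (sym_diff S R) * cf a S * cf (gen i) (sym_diff S R) = (if S = ?T then cliff_sign ?T {i} * cf a ?T else 0)"
   by (cases "S = ?T") (simp_all only: cf_gen 1 2 if_True if_False mult_1_right mult_zero_right refl simp_thms)
 qed
 also have "... = cliff_sign ?T {i} * cf a ?T" by (subst sum.delta) auto
 also have "... = cliff_sign {i} ?T * cf (par a) ?T"
 proof (cases "i \<in> ?T")
  case True
  then have "cf a ?T = 0" using a by (intro cin_D[OF a(1)]) blast
  then show ?thesis by (simp add: par.rep_eq)
 next
  case False
  then have "cliff_sign ?T {i} = (-1) ^ card ?T * cliff_sign {i} ?T" using R by (intro sign_commute) auto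
  then show ?thesis by (simp add: par.rep_eq)
 qed
 also have "... = cf (gen i * par a) R" by (simp add: cf_gen_mult)
 finally show "cf (a * gen i) R = cf (gen i * par a) R" .
qed

definition vect :: "nat set => (nat => real) => cl" where
 "vect A r = (\<Sum>i\<in>A. r i *\<^sub>R gen i)"

lemma cin_vect: "A <= I ==> cin I (vect A r)"
 unfolding vect_def by (intro cin_sum cin_scaleR cin_gen) auto

lemma par_vect [simp]: "par (vect A r) = - vect A r"
 by (simp add: vect_def par_sum par_scaleR sum_negf)

lemma adj_vect [simp]: "adj (vect A r) = vect A r"
proof -
 have "adj (sum f A) = (\<Sum>i\<in>A. adj (f i))" for f
  by (induction A rule: infinite_finite_induct) (simp_all add: adj_add)
 then show ?thesis by (simp add: vect_def adj_scaleR)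
qed

lemma vect_commute:
 assumes "cin I a" "A Int I = {}" shows "a * vect A r = vect A r * par a"
proof -
 have "a * gen i = gen i * par a" if "i \<in> A" for i using assms that by (intro gen_commute) auto
 then show ?thesis by (simp add: vect_def sum_distrib_left sum_distrib_right)
qed

lemma vect_sq: "finite A ==> vect A r * vect A r = of_real (\<Sum>i\<in>A. (r i)^2)"
proof (induction A rule: finite_induct)
 case empty
 then show ?case by (simp add: vect_def)
next
 case (insert i A)
 have v: "vect (insert i A) r = r i *\<^sub>R gen i + vect A r" using insert by (simp add: vect_def)
 have c: "vect A r * gen i = - (gen i * vect A r)"
  using gen_commute[OF cin_vect[OF subset_refl, of A r] insert(2)] by simp
 show ?case unfolding v using insert
  by (simp add: algebra_simps c) (simp add: of_real_def power2_eq_square scaleR_add_left)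
qed

lemma norm_vect: assumes "finite A" shows "norm (vect A r) = sqrt (\<Sum>i\<in>A. (r i)^2)"
proof -
 have "(norm (vect A r))^2 = (\<Sum>i\<in>A. (r i)^2)"
  using cstar_cl[of "vect A r"] sum_nonneg[of A "%i. (r i)^2"]
  unfolding adj_vect vect_sq[OF assms] norm_of_real by simp
 then show ?thesis by (metis norm_ge_zero real_sqrt_unique)
qed

lemma cf_vect: "finite A ==> cf (vect A r) S = (\<Sum>i\<in>A. if S = {i} then of_real (r i) else 0)"
 by (simp add: vect_def cf_gen if_distrib cong: if_cong)


definition ev :: "cl => cl" where "ev a = (1/2) *\<^sub>R (a + par a)"
definition od :: "cl => cl" where "od a = (1/2) *\<^sub>R (a - par a)"

lemma cf_ev: "cf (ev a) = cliff_even (cf a)"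
 by (rule ext) (simp add: ev_def cliff_even_def par.rep_eq)

lemma cf_od: "cf (od a) = cliff_odd (cf a)"
 by (rule ext) (simp add: od_def cliff_odd_def par.rep_eq)

text \<open>A pair of values at \<open>t\<close> and \<open>-t\<close>, seen as one Clifford element.  The generator with index \<open>0\<close> is free for this
 purpose because all modes have \<open>k \<ge> 1\<close>, hence indices at least \<open>2\<close>.\<close>

definition hat :: "cl => cl => cl" where
 "hat a b = (1/2) *\<^sub>R ((a + b) + gen 0 * (a - b))"

lemma hat_add: "hat (a + a') (b + b') = hat a b + hat a' b'"
 by (simp add: hat_def algebra_simps)

lemma hat_diff: "hat (a - a') (b - b') = hat a b - hat a' b'"
 by (simp add: hat_def algebra_simps)

lemma hat_cs: "hat (cs c * a) (cs c * b) = cs c * hat a b"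
proof -
 have "gen 0 * (cs c * x) = cs c * (gen 0 * x)" for x by (metis cs_commute mult.assoc)
 then show ?thesis by (simp add: hat_def algebra_simps)
qed

lemma hat_zero [simp]: "hat 0 0 = 0" by (simp add: hat_def)

lemma cin_hat: "cin I a ==> cin I b ==> cin (insert 0 I) (hat a b)"
 unfolding hat_def
 by (intro cin_scaleR cin_add cin_mult cin_gen cin_diff insertI1) (auto intro: cin_mono)

text \<open>The generator \<open>gen 0\<close> anticommutes with odd elements, which reproduces the exchange of \<open>t\<close> and \<open>-t\<close> in the graded
 product formula.\<close>

lemma hat_mult:
 assumes "cin I a" "cin I a'" "0 ~: I"
 shows "hat (ev a * b + od a * b') (ev a' * b' + od a' * b) = hat a a' * hat b b'"
proof -
 have c: "x * gen 0 = gen 0 * par x" if "cin I x" for x using that assms(3) by (rule gen_commute)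
 have c1: "a * gen 0 = gen 0 * par a" "a' * gen 0 = gen 0 * par a'" using c assms by auto
 have c2: "a * (gen 0 * z) = gen 0 * (par a * z)" "a' * (gen 0 * z) = gen 0 * (par a' * z)" for z
  using c1 by (simp_all add: mult.assoc[symmetric])
 have g: "gen 0 * (gen 0 * z) = z" for z by (simp add: mult.assoc[symmetric])
 have "4 *\<^sub>R hat (ev a * b + od a * b') (ev a' * b' + od a' * b) = 4 *\<^sub>R (hat a a' * hat b b')"
  unfolding hat_def ev_def od_def
  by (simp add: algebra_simps c2 g flip: scaleR_add_right)
 then show ?thesis by simp
qed

lemma hat_adj:
 assumes "cin I a" "cin I b" "0 ~: I"
 shows "hat (adj (ev a) + adj (od b)) (adj (ev b) + adj (od a)) = adj (hat a b)"
proof -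
 have c: "x * gen 0 = gen 0 * par x" if "cin I x" for x using that assms(3) by (rule gen_commute)
 have c1: "adj a * gen 0 = gen 0 * adj (par a)" "adj b * gen 0 = gen 0 * adj (par b)"
  using c[of "adj a"] c[of "adj b"] assms by (auto simp: par_adj cin_adj)
 have "4 *\<^sub>R hat (adj (ev a) + adj (od b)) (adj (ev b) + adj (od a)) = 4 *\<^sub>R adj (hat a b)"
  unfolding hat_def ev_def od_def
  by (simp add: adj_add adj_diff adj_scaleR adj_mult algebra_simps c1) (simp add: scaleR_2 flip: scaleR_add_left)
 then show ?thesis by simp
qed

lemma par_hat: "par (hat a b) = hat (par b) (par a)"
 by (simp add: hat_def par_scaleR par_add par_mult par_diff algebra_simps)

lemma cf_gen0_mult: "finite S ==> cf (gen 0 * a) S = cf a (sym_diff {0} S)"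
proof -
 have "{(s, t). s \<in> {0::nat} & t \<in> T & t < s} = {}" for T by auto
 then have "cliff_sign {0} T = 1" for T by (simp only: cliff_sign_def card.empty power_0)
 then show ?thesis by (simp add: cf_gen_mult)
qed

lemma cf_hat:
 assumes "cin I a" "cin I b" "0 ~: I"
 shows "cf (hat a b) S = (if 0 \<in> S then (cf a (S - {0}) - cf b (S - {0})) / 2 else (cf a S + cf b S) / 2)"
proof (cases "finite S")
 case fin: True
 have z: "cf a S = 0" "cf b S = 0" if "0 \<in> S" for S
  using that assms(3) by (auto intro!: cin_D[OF assms(1)] cin_D[OF assms(2)])
 have "sym_diff {0} S = (if 0 \<in> S then S - {0} else insert 0 S)" by auto
 then show ?thesis using fin by (auto simp: hat_def cf_gen0_mult z)
qed simp

lemma hat_inject: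
 assumes "cin I a" "cin I b" "cin I a'" "cin I b'" "0 ~: I" and eq: "hat a b = hat a' b'"
 shows "a = a' & b = b'"
proof -
 have *: "cf a S = cf a' S & cf b S = cf b' S" for S
 proof (cases "S <= I")
  case True
  then have "0 ~: S" using assms(5) by auto
  then have h: "cf (hat a b) S = (cf a S + cf b S) / 2" "cf (hat a b) (insert 0 S) = (cf a S - cf b S) / 2"
   "cf (hat a' b') S = (cf a' S + cf b' S) / 2" "cf (hat a' b') (insert 0 S) = (cf a' S - cf b' S) / 2"
   using assms(1-5) by (simp_all add: cf_hat[of I])
  have half: "x = (x + y) / 2 + (x - y) / 2" "y = (x + y) / 2 - (x - y) / 2" for x y :: complex
   by (simp_all add: field_simps)
  show ?thesis using half[where x = "cf a S" and y = "cf b S"] half[where x = "cf a' S" and y = "cf b' S"] by (metis h eq)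
 next
  case False
  then show ?thesis using assms by (simp add: cin_D)
 qed
 show ?thesis using * by (auto intro: cf_eqI)
qed

lemma n2_parallelogram: "(n2 (a + b))^2 + (n2 (a - b))^2 = 2 * ((n2 a)^2 + (n2 b)^2)"
proof -
 have "complex_of_real ((n2 (a + b))^2 + (n2 (a - b))^2) = of_real (2 * ((n2 a)^2 + (n2 b)^2))"
  unfolding of_real_add of_real_mult n2_sq by (simp add: ip_def adj_add adj_diff algebra_simps)
 then show ?thesis unfolding of_real_eq_iff .
qed

lemma n2_hat:
 assumes "cin I a" "cin I b" "0 ~: I"
 shows "2 * (n2 (hat a b))^2 = (n2 a)^2 + (n2 b)^2"
proof -
 let ?u = "a + b" and ?v = "a - b"
 have u: "cin I ?u" "cin I ?v" using assms by (auto intro: cin_intros)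
 have ip0: "ip ?u (gen 0 * ?v) = 0"
  unfolding ip_sum[OF finite_supp subset_refl]
 proof (rule sum.neutral, intro ballI)
  fix S assume S: "S \<in> supp ?u"
  then have "S <= I" using supp_cin[OF u(1)] by auto
  then have "0 ~: S" using assms(3) by auto
  then have "cf ?v (sym_diff {0} S) = 0" using assms(3) by (intro cin_D[OF u(2)]) auto
  then show "cnj (cf ?u S) * cf (gen 0 * ?v) S = 0" using suppD[OF S] by (simp only: cf_gen0_mult mult_zero_right)
 qed
 have "cnj (ip x y) = ip y x" for x y
  unfolding ip_def by (metis adj_adj adj_mult cf_adj finite.emptyI mult_1 sign_empty(1))
 then have ip1: "ip (gen 0 * ?v) ?u = 0" using ip0 by (metis complex_cnj_zero)
 have ipadd: "ip (x + y) (x + y) = ip x x + ip x y + ip y x + ip y y" for x y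
  by (simp add: ip_def adj_add algebra_simps)
 have "of_real ((n2 (?u + gen 0 * ?v))^2) = complex_of_real ((n2 ?u)^2 + (n2 (gen 0 * ?v))^2)"
  unfolding of_real_add n2_sq ipadd ip0 ip1 by simp
 then have "(n2 (?u + gen 0 * ?v))^2 = (n2 ?u)^2 + (n2 (gen 0 * ?v))^2" unfolding of_real_eq_iff .
 also have "n2 (gen 0 * ?v) = n2 ?v" by (rule n2_isometry) simp
 also have "(n2 ?u)^2 + (n2 ?v)^2 = 2 * ((n2 a)^2 + (n2 b)^2)" by (rule n2_parallelogram)
 finally have "4 * (n2 (hat a b))^2 = 2 * ((n2 a)^2 + (n2 b)^2)"
  by (simp add: hat_def n2_scaleR power_mult_distrib power_divide)
 then show ?thesis by simp
qed

lemma hat_surj: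
 assumes c: "cin (insert 0 I) c" and I: "0 ~: I"
 obtains a b where "cin I a" "cin I b" "c = hat a b"
proof -
 let ?u = "%S. if 0 \<in> S then 0 else cf c S" and ?v = "%S. if 0 \<in> S then 0 else cf c (insert 0 S)"
 have u: "cf (Cl ?u) = ?u"
  by (rule Cl_inverse) (auto simp: finite_supp[unfolded supp_def] intro: finite_subset[OF _ finite_supp[of c]] ccontr simp: supp_def)
 have "S = insert 0 S - {0} & insert 0 S \<in> supp c" if "?v S ~= 0" for S
  using that by (auto simp: supp_def split: if_splits)
 then have "{S. ?v S ~= 0} <= (%S. S - {0}) ` supp c" by blast
 then have "finite {S. ?v S ~= 0}" by (rule finite_subset) simp
 then have v: "cf (Cl ?v) = ?v"
  by (intro Cl_inverse) (auto intro: ccontr)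
 have uI: "cin I (Cl ?u)" "cin I (Cl ?v)" using c unfolding cin_def u v by (auto split: if_splits)
 have "c = hat (Cl ?u + Cl ?v) (Cl ?u - Cl ?v)"
 proof (rule cf_eqI)
  fix S
  show "cf c S = cf (hat (Cl ?u + Cl ?v) (Cl ?u - Cl ?v)) S"
   by (subst cf_hat[OF cin_add[OF uI] cin_diff[OF uI] I]) (auto simp: u v insert_absorb)
 qed
 then show ?thesis by (rule that[OF cin_add[OF uI] cin_diff[OF uI]])
qed

section \<open>Fourier modes and their coordinates\<close>

text \<open>Both coordinates of mode \<open>k\<close> are addressed by the Clifford indices \<open>2 k\<close> and \<open>2 k + 1\<close>.\<close>

definition idx :: "nat set => nat set" where "idx K = {i. i div 2 \<in> K}"

definition bfun :: "nat => real => real" where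
 "bfun i = (if even i then e_fun (i div 2) else f_fun (i div 2))"

definition crd :: "nat => (real => real) => real" where
 "crd i x = real (i div 2) * integral {0..2 * pi} (%th. x th * bfun i th)"

definition comb :: "nat set => (nat => real) => real => real" where
 "comb K c = (%th. \<Sum>i\<in>idx K. c i * bfun i th)"

lemma crd_even: "crd (2 * k) = x_coord k" and crd_odd: "crd (Suc (2 * k)) = y_coord k"
 by (auto simp: crd_def x_coord_def y_coord_def bfun_def)

lemma bfun_even: "bfun (2 * k) = e_fun k" and bfun_odd: "bfun (Suc (2 * k)) = f_fun k"
 by (auto simp: bfun_def)

lemma idx_eq: "idx K = (%k. 2 * k) ` K Un (%k. Suc (2 * k)) ` K"
proof -
 have "i = 2 * (i div 2) \<or> i = Suc (2 * (i div 2))" for i :: nat by linarith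
 then show ?thesis unfolding idx_def by (auto simp: image_iff)
qed

lemma finite_idx [simp]: "finite K ==> finite (idx K)"
 by (simp add: idx_eq)

lemma idx_empty [simp]: "idx {} = {}" by (simp add: idx_def)

lemma idx_Un: "idx (K Un L) = idx K Un idx L" by (auto simp: idx_def)

lemma idx_disjoint: "K Int L = {} ==> idx K Int idx L = {}" by (auto simp: idx_def)

lemma sum_idx:
 assumes "finite K" shows "sum f (idx K) = (\<Sum>k\<in>K. f (2 * k) + f (Suc (2 * k)))"
proof -
 have "sum f (idx K) = sum f ((%k. 2 * k) ` K) + sum f ((%k. Suc (2 * k)) ` K)"
  unfolding idx_eq using assms by (intro sum.union_disjoint) (auto, presburger)
 then show ?thesis by (simp add: sum.reindex inj_on_def sum.distrib)
qed

lemma modes_eq: assumes "finite K" shows "modes K = range (comb K)"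
proof -
 have A: "comb K c = (%th. \<Sum>k\<in>K. c (2 * k) * e_fun k th + c (Suc (2 * k)) * f_fun k th)" for c
  using assms by (simp add: comb_def sum_idx bfun_even bfun_odd)
 have B: "(%th. \<Sum>k\<in>K. a k * e_fun k th + b k * f_fun k th) = comb K (%i. if even i then a (i div 2) else b (i div 2))" for a b
  using assms by (simp add: comb_def sum_idx bfun_even bfun_odd)
 show ?thesis
 proof (intro set_eqI iffI)
  fix x assume "x \<in> modes K"
  then obtain a b where "x = (%th. \<Sum>k\<in>K. a k * e_fun k th + b k * f_fun k th)"
   unfolding modes_def by (elim CollectE exE conjE)
  then show "x \<in> range (comb K)" unfolding B by (simp only: rangeI)
 next
  fix x assume "x \<in> range (comb K)"
  then obtain c where "x = comb K c" by (elim rangeE)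
  then show "x \<in> modes K" unfolding A modes_def by (intro CollectI exI conjI TrueI)
 qed
qed

lemma modes_proj_eq: "finite K ==> modes_proj K x = comb K (%i. crd i x)"
 by (simp add: modes_proj_def comb_def sum_idx bfun_even bfun_odd crd_even crd_odd)

lemma modes_norm_eq: "finite K ==> modes_norm K x = sqrt (\<Sum>i\<in>idx K. (crd i x)^2)"
 by (simp add: modes_norm_def sum_idx crd_even crd_odd)

lemma C_field_eq:
 assumes "finite K"
 shows "C_field l K x = cf (vect (idx K) (%i. real (i div 2) powr (- l) * crd i x))"
proof (rule ext)
 fix S
 show "C_field l K x S = cf (vect (idx K) (%i. real (i div 2) powr (- l) * crd i x)) S"
  using assms unfolding cf_vect[OF finite_idx[OF assms]] C_field_def sum_idx[OF assms]
  by (intro sum.cong refl) (auto simp: crd_even crd_odd)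
qed


lemma continuous_bfun [continuous_intros]: "continuous_on A (bfun i)"
 unfolding bfun_def
 by (auto simp: e_fun_def[abs_def] f_fun_def[abs_def] divide_inverse intro!: continuous_intros)

lemma integral_cos_int:
 "integral {0..2 * pi} (%th. cos (of_int p * th)) = (if p = 0 then 2 * pi else 0)"
proof (cases "p = 0")
 case False
 have "((%th. cos (of_int p * th)) has_integral (sin (of_int p * (2 * pi)) / of_int p - sin (of_int p * 0) / of_int p)) {0..2 * pi}"
  using False by (intro fundamental_theorem_of_calculus)
   (auto intro!: derivative_eq_intros simp flip: has_real_derivative_iff_has_vector_derivative)
 moreover have "sin (of_int p * (2 * pi)) = 0" using sin_int_2pin[of p] by (simp add: mult.commute)
 ultimately show ?thesis using False by (simp add: integral_unique)
qed simp

lemma integral_sin_int: "integral {0..2 * pi} (%th. sin (of_int p * th)) = 0"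
proof (cases "p = 0")
 case False
 have "((%th. sin (of_int p * th)) has_integral (- cos (of_int p * (2 * pi)) / of_int p - (- cos (of_int p * 0) / of_int p))) {0..2 * pi}"
  using False by (intro fundamental_theorem_of_calculus)
   (auto intro!: derivative_eq_intros simp flip: has_real_derivative_iff_has_vector_derivative)
 moreover have "cos (of_int p * (2 * pi)) = 1" using cos_int_2pin[of p] by (simp add: mult.commute)
 ultimately show ?thesis using False by (simp add: integral_unique)
qed simp

text \<open>The rectangle rule with \<open>M\<close> nodes is exact on trigonometric polynomials of degree below \<open>M\<close>.  It expresses the
 coordinates of a mode through finitely many point values, so they are continuous for pointwise convergence.\<close>

lemma quad_cis:
 assumes "\<bar>p\<bar> < int M" "p ~= 0"
 shows "(\<Sum>j<M. cis (of_int p * (2 * pi * real j / real M))) = 0"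
proof -
 let ?z = "cis (2 * pi * of_int p / real M)"
 have M: "M > 0" using assms by auto
 have zj: "cis (of_int p * (2 * pi * real j / real M)) = ?z ^ j" for j
  unfolding Complex.DeMoivre by (rule arg_cong[where f = cis]) (simp add: field_simps)
 have zM: "?z ^ M = 1"
 proof -
  have "?z ^ M = cis (2 * pi * of_int p)" using M by (simp add: Complex.DeMoivre)
  then show ?thesis by simp
 qed
 have "?z ~= 1"
 proof
  assume "?z = 1"
  then have "cos (2 * pi * of_int p / real M) = 1" by (metis cis.sel(1) one_complex.sel(1))
  then obtain n :: int where "2 * pi * of_int p / real M = of_int n * 2 * pi"
   unfolding cos_one_2pi_int by auto
  then have "real_of_int p = of_int n * real M" using M by (simp add: field_simps)
  then have "p = n * int M" by (metis of_int_eq_iff of_int_mult of_int_of_nat_eq)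
  then show False using assms by (cases "n = 0") (auto simp: abs_mult)
 qed
 then show ?thesis unfolding zj using geometric_sum[of ?z M] zM by simp
qed

definition quad :: "nat => (real => real) => bool" where
 "quad M u \<longleftrightarrow> continuous_on UNIV u \<and>
   integral {0..2 * pi} u = 2 * pi / real M * (\<Sum>j<M. u (2 * pi * real j / real M))"

lemma quad_cos: assumes "\<bar>p\<bar> < int M" shows "quad M (%th. cos (of_int p * th))"
proof -
 have M: "M > 0" using assms by auto
 have "(\<Sum>j<M. cos (of_int p * (2 * pi * real j / real M))) = (if p = 0 then real M else 0)"
 proof (cases "p = 0")
  case False
  have "Re (\<Sum>j<M. cis (of_int p * (2 * pi * real j / real M))) = 0"
   using quad_cis[OF assms False] by simp
  then show ?thesis using False by simp
 qed simp
 then show ?thesis unfolding quad_def integral_cos_int using M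
  by (auto intro!: continuous_intros)
qed

lemma quad_sin: assumes "\<bar>p\<bar> < int M" shows "quad M (%th. sin (of_int p * th))"
proof -
 have "(\<Sum>j<M. sin (of_int p * (2 * pi * real j / real M))) = 0"
 proof (cases "p = 0")
  case False
  have "Im (\<Sum>j<M. cis (of_int p * (2 * pi * real j / real M))) = 0"
   using quad_cis[OF assms False] by simp
  then show ?thesis using False by simp
 qed simp
 then show ?thesis unfolding quad_def integral_sin_int
  by (auto intro!: continuous_intros)
qed

lemma continuous_integrable: "continuous_on UNIV u ==> u integrable_on {a..b::real}" for u :: "real => real"
 by (rule integrable_continuous_real) (rule continuous_on_subset, auto)

lemma quad_add: "quad M u ==> quad M v ==> quad M (%th. u th + v th)"
 unfolding quad_def
 by (auto intro!: continuous_intros simp: integral_add continuous_integrable sum.distrib distrib_left)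

lemma quad_scale: "quad M u ==> quad M (%th. c * u th)"
 unfolding quad_def
 by (auto intro!: continuous_intros simp: sum_distrib_left mult.left_commute)

lemma quad_sum: "finite A ==> (!!i. i \<in> A ==> quad M (u i)) ==> quad M (%th. \<Sum>i\<in>A. u i th)"
proof (induction A rule: finite_induct)
 case empty
 then show ?case by (simp add: quad_def)
qed (simp add: quad_add)

lemma bfun_product:
 fixes i j :: nat
 defines "p \<equiv> int (i div 2) - int (j div 2)" and "q \<equiv> int (i div 2) + int (j div 2)"
  and "w \<equiv> 1 / (2 * pi * sqrt (real (i div 2) * real (j div 2)))"
 shows "even i ==> even j ==> bfun i th * bfun j th = w * cos (of_int p * th) + w * cos (of_int q * th)"
  and "odd i ==> odd j ==> bfun i th * bfun j th = w * cos (of_int p * th) + (- w) * cos (of_int q * th)"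
  and "odd i ==> even j ==> bfun i th * bfun j th = w * sin (of_int p * th) + w * sin (of_int q * th)"
  and "even i ==> odd j ==> bfun i th * bfun j th = (- w) * sin (of_int p * th) + w * sin (of_int q * th)"
proof -
 have W: "1 / (sqrt (real (i div 2) * pi) * sqrt (real (j div 2) * pi)) = 2 * w"
  by (simp add: w_def real_sqrt_mult)
 have den: "a / sqrt (real (i div 2) * pi) * (b / sqrt (real (j div 2) * pi)) = (a * b) * (2 * w)" for a b
  unfolding W[symmetric] by simp
 have arg: "real (i div 2) * th - real (j div 2) * th = of_int p * th"
  "real (i div 2) * th + real (j div 2) * th = of_int q * th"
  by (simp_all add: p_def q_def left_diff_distrib distrib_right)
 show "even i ==> even j ==> bfun i th * bfun j th = w * cos (of_int p * th) + w * cos (of_int q * th)"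
  by (simp only: bfun_def e_fun_def f_fun_def den cos_times_cos arg simp_thms if_True if_False) (simp add: field_simps)
 show "odd i ==> odd j ==> bfun i th * bfun j th = w * cos (of_int p * th) + (- w) * cos (of_int q * th)"
  by (simp only: bfun_def e_fun_def f_fun_def den sin_times_sin arg simp_thms if_True if_False) (simp add: field_simps)
 show "odd i ==> even j ==> bfun i th * bfun j th = w * sin (of_int p * th) + w * sin (of_int q * th)"
  by (simp only: bfun_def e_fun_def f_fun_def den sin_times_cos arg simp_thms if_True if_False) (simp add: field_simps)
 show "even i ==> odd j ==> bfun i th * bfun j th = (- w) * sin (of_int p * th) + w * sin (of_int q * th)"
  by (simp only: bfun_def e_fun_def f_fun_def den cos_times_sin arg simp_thms if_True if_False) (simp add: field_simps)
qed

lemma quad_bfun: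
 assumes "i div 2 <= n" "j div 2 <= n"
 shows "quad (2 * n + 1) (%th. bfun i th * bfun j th)"
proof -
 have p: "\<bar>int (i div 2) - int (j div 2)\<bar> < int (2 * n + 1)" "\<bar>int (i div 2) + int (j div 2)\<bar> < int (2 * n + 1)"
  using assms by linarith+
 note q = quad_add[OF quad_scale[OF quad_cos[OF p(1)]] quad_scale[OF quad_cos[OF p(2)]]]
  quad_add[OF quad_scale[OF quad_sin[OF p(1)]] quad_scale[OF quad_sin[OF p(2)]]]
 show ?thesis
  by (cases "even i"; cases "even j") (simp_all only: bfun_product q not_False_eq_True simp_thms)
qed

lemma integral_bfun:
 assumes "i div 2 >= 1" "j div 2 >= 1"
 shows "integral {0..2 * pi} (%th. bfun i th * bfun j th) = (if i = j then 1 / real (i div 2) else 0)"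
proof -
 have q: "int (i div 2) + int (j div 2) ~= 0" using assms by linarith
 have lin: "integral {0..2 * pi} (%th. c * u th + d * v th) = c * integral {0..2 * pi} u + d * integral {0..2 * pi} v"
  if "continuous_on UNIV u" "continuous_on UNIV v" for c d and u v :: "real => real"
  using that by (simp add: integral_add continuous_integrable continuous_on_mult_left)
 have lc: "integral {0..2 * pi} (%th. c * cos (of_int p * th) + d * cos (of_int q * th)) =
  c * (if p = 0 then 2 * pi else 0) + d * (if q = 0 then 2 * pi else 0)" for c d and p q :: int
  by (subst lin) (auto intro!: continuous_intros simp only: integral_cos_int)
 have ls: "integral {0..2 * pi} (%th. c * sin (of_int p * th) + d * sin (of_int q * th)) = 0" for c d and p q :: int
  by (subst lin) (auto intro!: continuous_intros simp: integral_sin_int)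
 have par: "i = j \<longleftrightarrow> i div 2 = j div 2 & even i = even j" by presburger
 show ?thesis
 proof (cases "even i = even j")
  case True
  have "integral {0..2 * pi} (%th. bfun i th * bfun j th) =
   1 / (2 * pi * sqrt (real (i div 2) * real (j div 2))) * (if int (i div 2) - int (j div 2) = 0 then 2 * pi else 0)"
   using True q by (cases "even i"; cases "even j") (simp_all only: bfun_product lc if_False mult_zero_right add_0_right simp_thms)
  also have "... = (if i = j then 1 / real (i div 2) else 0)"
   using True assms by (auto simp: par)
  finally show ?thesis .
 next
  case False
  then have "integral {0..2 * pi} (%th. bfun i th * bfun j th) = 0"
   by (cases "even i"; cases "even j") (simp_all only: bfun_product ls simp_thms)
  then show ?thesis using False by auto
 qed
qed

lemma continuous_comb [continuous_intros]: "continuous_on A (comb K c)"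
 unfolding comb_def by (intro continuous_intros)

lemma crd_comb:
 assumes K: "finite K" "0 ~: K" and i: "i div 2 >= 1"
 shows "crd i (comb K c) = (if i \<in> idx K then c i else 0)"
proof -
 have *: "integral {0..2 * pi} (%th. c j * (bfun j th * bfun i th)) = (if j = i then c i / real (i div 2) else 0)" if "j \<in> idx K" for j
 proof -
  have "j div 2 >= 1" using that K(2) by (auto simp: idx_def intro: ccontr)
  then show ?thesis using i by (simp add: integral_bfun)
 qed
 have "integral {0..2 * pi} (%th. comb K c th * bfun i th) = integral {0..2 * pi} (%th. \<Sum>j\<in>idx K. c j * (bfun j th * bfun i th))"
  by (simp add: comb_def sum_distrib_right mult.assoc)
 also have "... = (\<Sum>j\<in>idx K. integral {0..2 * pi} (%th. c j * (bfun j th * bfun i th)))"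
  using K by (intro integral_sum continuous_integrable continuous_intros) auto
 also have "... = (\<Sum>j\<in>idx K. if j = i then c i / real (i div 2) else 0)"
  by (intro sum.cong refl *)
 finally show ?thesis using K i by (auto simp: crd_def)
qed

lemma comb_crd: assumes K: "finite K" "0 ~: K" and x: "x \<in> modes K" shows "comb K (%i. crd i x) = x"
proof -
 obtain c where c: "x = comb K c" using x K by (auto simp: modes_eq)
 have "1 <= i div 2" if "i \<in> idx K" for i
  using that K(2) unfolding idx_def by (metis One_nat_def Suc_leI mem_Collect_eq neq0_conv)
 then show ?thesis unfolding c using K unfolding comb_def[of K "%i. crd i (comb K c)"]
  by (simp add: crd_comb) (simp add: comb_def)
qed

lemma modes_crd_eqI:
 assumes "finite K" "0 ~: K" "x \<in> modes K" "y \<in> modes K" "!!i. i \<in> idx K ==> crd i x = crd i y"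
 shows "x = y"
proof -
 have "comb K (%i. crd i x) = comb K (%i. crd i y)" using assms(5) unfolding comb_def by simp
 then show ?thesis using comb_crd[OF assms(1,2)] assms(3,4) by metis
qed

lemma continuous_modes: "finite K ==> x \<in> modes K ==> continuous_on UNIV x"
 by (auto simp: modes_eq intro: continuous_intros)

lemma crd_add: "continuous_on UNIV x ==> continuous_on UNIV y ==> crd i (%th. x th + y th) = crd i x + crd i y"
 unfolding crd_def distrib_right
 by (subst integral_add) (auto intro!: continuous_integrable continuous_intros simp: distrib_left)

lemma crd_diff: "continuous_on UNIV x ==> continuous_on UNIV y ==> crd i (loop_diff x y) = crd i x - crd i y"
 unfolding crd_def left_diff_distrib loop_diff_def
 by (subst integral_diff) (auto intro!: continuous_integrable continuous_intros simp: right_diff_distrib)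

lemma crd_zero [simp]: "crd i (%th. 0) = 0" by (simp add: crd_def)

lemma continuous_on_crd [continuous_intros]:
 assumes K: "finite K" "0 ~: K" shows "continuous_on (modes K) (crd i)"
proof -
 obtain n where n: "!!k. k \<in> insert (i div 2) K ==> k <= n"
  using finite_nat_set_iff_bounded_le[of "insert (i div 2) K"] K by auto
 let ?M = "2 * n + 1"
 let ?f = "%x. real (i div 2) * (2 * pi / real ?M * (\<Sum>j<?M. x (2 * pi * real j / real ?M) * bfun i (2 * pi * real j / real ?M)))"
 have eq: "crd i x = ?f x" if x: "x \<in> modes K" for x
 proof -
  obtain c where c: "x = comb K c" using x K by (auto simp: modes_eq)
  have "quad ?M (%th. \<Sum>j\<in>idx K. c j * (bfun j th * bfun i th))"
   using n K finite_idx[OF K(1), unfolded idx_def] by (intro quad_sum quad_scale quad_bfun) (auto simp: idx_def)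
  then have "quad ?M (%th. x th * bfun i th)"
   unfolding c comb_def by (simp add: sum_distrib_right mult.assoc)
  then show ?thesis by (simp add: quad_def crd_def)
 qed
 have ev: "continuous_on (modes K) (%x. x s)" for s :: real
  by (rule continuous_on_subset[OF continuous_on_product_coordinates]) simp
 have "continuous_on (modes K) ?f" by (intro continuous_intros ev)
 then show ?thesis using eq by (simp cong: continuous_on_cong)
qed

lemma continuous_on_comb:
 assumes "!!i. i \<in> idx K ==> continuous_on A (%p. c p i)"
 shows "continuous_on A (%p. comb K (c p))"
 unfolding comb_def by (intro continuous_on_coordinatewise_then_product continuous_intros assms)

section \<open>Functions vanishing at infinity\<close>

definition good :: "nat set => bool" where "good K \<longleftrightarrow> finite K & 0 ~: K"

lemma good_simps [simp]: "good {}" "good {Suc N..M}"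
 by (auto simp: good_def)

lemma goodD: "good K ==> finite K" "good K ==> 0 ~: K" "good K ==> finite (idx K)" "good K ==> 0 ~: idx K"
 by (simp_all add: good_def) (simp add: idx_def)

abbreviation nsq :: "nat set => real => (real => real) => real" where
 "nsq K t x \<equiv> t\<^sup>2 + (modes_norm K x)^2"

definition C0 :: "nat set => (real \<times> (real => real) => complex) => bool" where
 "C0 K \<phi> \<longleftrightarrow> continuous_on (UNIV \<times> modes K) \<phi> \<and>
  (\<forall>eps>0. EX R. ALL t. ALL x:modes K. nsq K t x > R --> cmod (\<phi> (t, x)) < eps)"

lemma C0_tail: "C0 K \<phi> ==> eps > 0 ==> EX R. ALL t. ALL x:modes K. nsq K t x > R --> cmod (\<phi> (t, x)) < eps"
 by (simp add: C0_def)

lemma C0_tailE: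
 assumes "C0 K \<phi>" "eps > 0"
 obtains R where "!!t x. x \<in> modes K ==> nsq K t x > R ==> cmod (\<phi> (t, x)) < eps"
 using C0_tail[OF assms] by auto

lemma C0_cont: "C0 K \<phi> ==> continuous_on (UNIV \<times> modes K) \<phi>"
 by (simp add: C0_def)

lemma C0_cong:
 assumes "!!t x. x \<in> modes K ==> \<phi> (t, x) = \<psi> (t, x)" shows "C0 K \<phi> \<longleftrightarrow> C0 K \<psi>"
proof -
 have "continuous_on (UNIV \<times> modes K) \<phi> \<longleftrightarrow> continuous_on (UNIV \<times> modes K) \<psi>"
  using assms by (intro continuous_on_cong) auto
 then show ?thesis unfolding C0_def using assms by simp
qed

lemma C0_zero [simp]: "C0 K (%p. 0)" by (simp add: C0_def)

lemma C0_add: assumes "C0 K \<phi>" "C0 K \<psi>" shows "C0 K (%p. \<phi> p + \<psi> p)"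
 unfolding C0_def
proof (intro conjI allI impI)
 show "continuous_on (UNIV \<times> modes K) (%p. \<phi> p + \<psi> p)"
  using assms by (intro continuous_intros C0_cont)
 fix e :: real assume "e > 0"
 then have e2: "e / 2 > 0" by simp
 obtain R where R: "!!t x. x \<in> modes K ==> nsq K t x > R ==> cmod (\<phi> (t, x)) < e / 2"
  by (rule C0_tailE[OF assms(1) e2]) blast
 obtain R' where R': "!!t x. x \<in> modes K ==> nsq K t x > R' ==> cmod (\<psi> (t, x)) < e / 2"
  by (rule C0_tailE[OF assms(2) e2]) blast
 have "cmod (\<phi> (t, x) + \<psi> (t, x)) < e" if "x \<in> modes K" "nsq K t x > max R R'" for t x
  using norm_triangle_ineq[of "\<phi> (t, x)" "\<psi> (t, x)"] R[of x t] R'[of x t] that by auto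
 then show "EX R. ALL t. ALL x:modes K. R < nsq K t x --> cmod (\<phi> (t, x) + \<psi> (t, x)) < e" by blast
qed

lemma C0_mult_bounded:
 assumes "C0 K \<phi>" "continuous_on (UNIV \<times> modes K) \<psi>" "!!t x. x \<in> modes K ==> cmod (\<psi> (t, x)) <= B"
 shows "C0 K (%p. \<psi> p * \<phi> p)"
 unfolding C0_def
proof (intro conjI allI impI)
 show "continuous_on (UNIV \<times> modes K) (%p. \<psi> p * \<phi> p)"
  by (intro continuous_on_mult assms(2) C0_cont[OF assms(1)])
 fix e :: real assume e: "e > 0"
 let ?B = "\<bar>B\<bar> + 1"
 obtain R where R: "!!t x. x \<in> modes K ==> nsq K t x > R ==> cmod (\<phi> (t, x)) < e / ?B"
  using C0_tail[OF assms(1), of "e / ?B"] e by auto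
 have "cmod (\<psi> (t, x) * \<phi> (t, x)) < e" if x: "x \<in> modes K" and "nsq K t x > R" for t x
 proof -
  have "cmod (\<psi> (t, x) * \<phi> (t, x)) <= ?B * cmod (\<phi> (t, x))"
   unfolding norm_mult using assms(3)[OF x, of t] by (intro mult_right_mono) auto
  also have "... < ?B * (e / ?B)" using R[OF that] by (intro mult_strict_left_mono) auto
  finally show ?thesis by simp
 qed
 then show "EX R. ALL t. ALL x:modes K. R < nsq K t x --> cmod (\<psi> (t, x) * \<phi> (t, x)) < e" by blast
qed

lemma C0_cmul: "C0 K \<phi> ==> C0 K (%p. c * \<phi> p)"
 by (rule C0_mult_bounded[where B = "cmod c"]) auto

lemma C0_minus: "C0 K \<phi> ==> C0 K (%p. - \<phi> p)"
 using C0_cmul[of K \<phi> "-1"] by simp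

lemma C0_diff: "C0 K \<phi> ==> C0 K \<psi> ==> C0 K (%p. \<phi> p - \<psi> p)"
 using C0_add[of K \<phi> "%p. - \<psi> p"] C0_minus[of K \<psi>] by simp

lemma C0_sum: "(!!i. i \<in> A ==> C0 K (f i)) ==> C0 K (%p. \<Sum>i\<in>A. f i p)"
 by (induction A rule: infinite_finite_induct) (auto intro: C0_add)

lemma C0_cnj: "C0 K \<phi> ==> C0 K (%p. cnj (\<phi> p))"
 unfolding C0_def by (auto intro: continuous_intros)

lemma C0_reflect: assumes "C0 K \<phi>" shows "C0 K (%(t, x). \<phi> (- t, x))"
proof -
 have "continuous_on (UNIV \<times> modes K) (%p. \<phi> (- fst p, snd p))"
  by (rule continuous_on_compose2[OF C0_cont[OF assms]]) (auto intro!: continuous_on_Pair continuous_on_minus continuous_on_fst continuous_on_snd continuous_on_id)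
 moreover have "EX R. ALL t. ALL x:modes K. R < nsq K t x --> cmod (\<phi> (- t, x)) < e" if e: "e > 0" for e
 proof -
  obtain R where R: "!!t x. x \<in> modes K ==> nsq K t x > R ==> cmod (\<phi> (t, x)) < e"
   by (rule C0_tailE[OF assms e]) blast
  then show ?thesis using R[of _ "- _"] by (metis power2_minus)
 qed
 ultimately show ?thesis unfolding C0_def by (simp add: case_prod_unfold)
qed

definition cbx :: "nat set => real => (real \<times> (nat => real)) set" where
 "cbx K R = {-R..R} \<times> {c. ALL i. c i \<in> (if i \<in> idx K then {-R..R} else {0})}"

lemma compact_box: "compact (cbx K R)"
proof -
 have e: "{c. ALL i. c i \<in> (if i \<in> idx K then {-R..R} else {0})} = (\<Pi>\<^sub>E i\<in>UNIV. if i \<in> idx K then {-R..R} else {0::real})"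
  by (auto simp: PiE_def Pi_def)
 have "compactin (product_topology (%i. euclidean) UNIV) (\<Pi>\<^sub>E i\<in>UNIV. if i \<in> idx K then {-R..R} else {0::real})"
  by (subst compactin_PiE) auto
 then have "compact {c. ALL i. c i \<in> (if i \<in> idx K then {-R..R} else {0})}"
  unfolding e by (simp add: euclidean_product_topology)
 then show ?thesis unfolding cbx_def by (intro compact_Times) auto
qed

definition crds :: "nat set => (real => real) => nat => real" where
 "crds K x = (%i. if i \<in> idx K then crd i x else 0)"

lemma comb_crds: "good K ==> x \<in> modes K ==> comb K (crds K x) = x"
 using comb_crd[of K x] by (simp add: goodD comb_def crds_def)

lemma comb_in_modes [simp]: "good K ==> comb K c \<in> modes K"
 by (simp add: modes_eq goodD)

lemma not_box:
 assumes K: "good K" and x: "x \<in> modes K" and nb: "(t, crds K x) ~: cbx K R" and R: "R >= 0"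
 shows "R^2 < nsq K t x"
proof -
 have m: "(modes_norm K x)^2 = (\<Sum>i\<in>idx K. (crd i x)^2)"
  using K by (simp add: modes_norm_eq goodD sum_nonneg)
 consider "t ~: {-R..R}" | i where "i \<in> idx K" "crd i x ~: {-R..R}"
  using nb by (auto simp: cbx_def crds_def split: if_splits)
 then show ?thesis
 proof cases
  case 1
  then have "R < \<bar>t\<bar>" by auto
  then have "R^2 < \<bar>t\<bar>\<^sup>2" using R by (intro power_strict_mono) auto
  then show ?thesis using sum_nonneg[of "idx K" "%i. (crd i x)^2"] by (simp add: m)
 next
  case 2
  then have "R < \<bar>crd i x\<bar>" by auto
  then have "R^2 < \<bar>crd i x\<bar>\<^sup>2" using R by (intro power_strict_mono) auto
  also have "\<bar>crd i x\<bar>\<^sup>2 <= (\<Sum>i\<in>idx K. (crd i x)^2)"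
   unfolding power2_abs using 2 K by (intro member_le_sum) (auto simp: goodD)
  finally show ?thesis using m zero_le_power2[of t] by linarith
 qed
qed

lemma C0_box:
 assumes K: "good K" and \<phi>: "C0 K \<phi>" and e: "e > 0"
 obtains R where "R >= 0" "!!t x. x \<in> modes K ==> (t, crds K x) ~: cbx K R ==> cmod (\<phi> (t, x)) < e"
proof -
 obtain R where R: "!!t x. x \<in> modes K ==> nsq K t x > R ==> cmod (\<phi> (t, x)) < e"
  using C0_tail[OF \<phi> e] by auto
 have "R <= (\<bar>R\<bar> + 1)^2" using abs_ge_self[of R] abs_ge_zero[of R] zero_le_power2[of R] unfolding power2_sum power2_abs power_one mult_1_right by linarith
 then show ?thesis using R not_box[OF K, of _ _ "\<bar>R\<bar> + 1"]
  by (intro that[of "\<bar>R\<bar> + 1"]) (auto, fastforce)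
qed

lemma C0_box_cont:
 assumes K: "good K" and \<phi>: "C0 K \<phi>"
 shows "continuous_on A (%(t, c). \<phi> (t, comb K c))"
proof -
 have "continuous_on A (%p. comb K (snd p))"
  by (rule continuous_on_comb)
   (rule continuous_on_compose2[OF continuous_on_product_coordinates], auto intro: continuous_intros)
 then have "continuous_on A (%p. \<phi> (fst p, comb K (snd p)))"
  using K by (intro continuous_on_compose2[OF C0_cont[OF \<phi>]]) (auto intro!: continuous_on_Pair continuous_on_fst continuous_on_id)
 then show ?thesis by (simp add: case_prod_unfold)
qed

lemma C0_bounded:
 assumes K: "good K" and \<phi>: "C0 K \<phi>"
 obtains B where "!!t x. x \<in> modes K ==> cmod (\<phi> (t, x)) <= B"
proof -
 obtain R where R: "R >= 0" "!!t x. x \<in> modes K ==> (t, crds K x) ~: cbx K R ==> cmod (\<phi> (t, x)) < 1"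
  using C0_box[OF K \<phi>, of 1] by auto
 have "bounded ((%(t, c). \<phi> (t, comb K c)) ` cbx K R)"
  by (intro compact_imp_bounded compact_continuous_image C0_box_cont K \<phi> compact_box)
 then obtain B where B0: "ALL y:(%(t, c). \<phi> (t, comb K c)) ` cbx K R. cmod y <= B"
  unfolding bounded_iff by blast
 have B: "cmod (\<phi> (t, comb K c)) <= B" if "(t, c) \<in> cbx K R" for t c
  using B0[rule_format, OF imageI[OF that]] by simp
 have "cmod (\<phi> (t, x)) <= max B 1" if x: "x \<in> modes K" for t x
  using R(2)[OF x, of t] B[of t "crds K x"] comb_crds[OF K x] by (cases "(t, crds K x) \<in> cbx K R") auto
 then show ?thesis by (rule that)
qed

lemma C0_mult: "good K ==> C0 K \<phi> ==> C0 K \<psi> ==> C0 K (%p. \<phi> p * \<psi> p)"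
 by (rule C0_bounded[of K \<phi>]) (auto intro: C0_mult_bounded C0_cont)

lemma dist_fun_le:
 assumes "!!i. dist (c i) (c' i) <= d" shows "dist (c :: nat => real) c' <= 2 * d"
proof -
 have d: "d >= 0" using assms[of 0] zero_le_dist[of "c 0" "c' 0"] by linarith
 have s: "summable (%n. (1 / 2 :: real) ^ n * d)" by (intro summable_mult2 summable_geometric) auto
 have "dist c c' = (\<Sum>n. (1/2)^n * min (dist (c (from_nat n)) (c' (from_nat n))) 1)"
  by (simp add: dist_fun_def)
 also have "... <= (\<Sum>n. (1/2)^n * d)"
 proof (rule suminf_le)
  show "(1/2)^n * min (dist (c (from_nat n)) (c' (from_nat n))) 1 <= (1/2)^n * d" for n
   using assms[of "from_nat n"] by (intro mult_left_mono) auto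
  show "summable (%n. (1/2)^n * min (dist (c (from_nat n)) (c' (from_nat n))) 1)"
   by (rule summable_comparison_test[OF _ s], rule exI[of _ 0])
    (use assms in "auto intro!: mult_left_mono simp: abs_mult power_abs min.coboundedI1")
 qed (rule s)
 also have "... = 2 * d" by (simp add: suminf_mult2[symmetric] suminf_geometric summable_geometric)
 finally show ?thesis .
qed

text \<open>Outside a large box the function is small, and on a compact box continuity is uniform.\<close>

lemma C0_uniform:
 assumes K: "good K" and \<phi>: "C0 K \<phi>" and e: "e > 0"
 obtains d where "d > 0" "!!t t' x x'. x \<in> modes K ==> x' \<in> modes K ==> \<bar>t - t'\<bar> <= d ==>
  (!!i. i \<in> idx K ==> \<bar>crd i x - crd i x'\<bar> <= d) ==> cmod (\<phi> (t, x) - \<phi> (t', x')) < e"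
proof -
 obtain R where R: "R >= 0" "!!t x. x \<in> modes K ==> (t, crds K x) ~: cbx K R ==> cmod (\<phi> (t, x)) < e / 2"
  using C0_box[OF K \<phi>, of "e / 2"] e by auto
 have "uniformly_continuous_on (cbx K (R + 1)) (%(t, c). \<phi> (t, comb K c))"
  by (intro compact_uniformly_continuous C0_box_cont K \<phi> compact_box)
 then obtain d where d: "d > 0" "!!p p'. p \<in> cbx K (R + 1) ==> p' \<in> cbx K (R + 1) ==> dist p' p < d ==>
  dist (\<phi> (fst p', comb K (snd p'))) (\<phi> (fst p, comb K (snd p))) < e"
  using e unfolding uniformly_continuous_on_def case_prod_unfold by metis
 let ?d = "min 1 (d / 4)"
 have "cmod (\<phi> (t, x) - \<phi> (t', x')) < e"
  if x: "x \<in> modes K" "x' \<in> modes K" and tt: "\<bar>t - t'\<bar> <= ?d" and cc: "!!i. i \<in> idx K ==> \<bar>crd i x - crd i x'\<bar> <= ?d" for t t' x x'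
 proof (cases "(t, crds K x) \<in> cbx K (R + 1) & (t', crds K x') \<in> cbx K (R + 1)")
  case True
  have "dist (crds K x) (crds K x') <= 2 * ?d"
   using cc d(1) by (intro dist_fun_le) (auto simp: crds_def dist_real_def)
  moreover have "sqrt ((dist t t')^2 + (dist (crds K x) (crds K x'))^2) <= \<bar>t - t'\<bar> + dist (crds K x) (crds K x')"
   by (rule order_trans[OF sqrt_sum_squares_le_sum_abs]) (simp add: dist_real_def)
  ultimately have "dist (t, crds K x) (t', crds K x') < d"
   using tt d(1) min.cobounded2[of 1 "d / 4"] unfolding dist_Pair_Pair by linarith
  then show ?thesis
   using d(2)[of "(t', crds K x')" "(t, crds K x)"] True comb_crds[OF K x(1)] comb_crds[OF K x(2)]
   by (simp add: dist_norm)
 next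
  case False
  have *: "(t, crds K x) \<in> cbx K (R + 1)" if "(t', crds K x') \<in> cbx K R" "\<bar>t - t'\<bar> <= 1"
   "!!i. i \<in> idx K ==> \<bar>crd i x - crd i x'\<bar> <= 1" for t t' x x'
  proof -
   have t: "\<bar>t\<bar> <= R + 1" using that(1,2) by (auto simp: cbx_def)
   have c: "\<bar>crd i x\<bar> <= R + 1" if i: "i \<in> idx K" for i
   proof -
    have "\<bar>crd i x'\<bar> <= R" using \<open>(t', crds K x') \<in> cbx K R\<close> i by (auto simp: cbx_def crds_def abs_le_iff dest!: spec[of _ i])
    then show ?thesis using that(1) i \<open>!!i. i \<in> idx K ==> \<bar>crd i x - crd i x'\<bar> <= 1\<close>[OF i] by linarith
   qed
   have "- R - 1 <= crd i x & crd i x <= R + 1" if "i \<in> idx K" for i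
    using c[OF that] by linarith
   then show ?thesis using t by (auto simp: cbx_def crds_def)
  qed
  have "(t, crds K x) ~: cbx K R & (t', crds K x') ~: cbx K R"
  proof (rule ccontr)
   assume a: "\<not> ?thesis"
   have "cbx K R <= cbx K (R + 1)" by (auto simp: cbx_def split: if_splits)
   then show False using a False *[of t' x' t x] *[of t x t' x'] tt cc by (auto simp: abs_minus_commute)
  qed
  then have "cmod (\<phi> (t, x)) < e / 2" "cmod (\<phi> (t', x')) < e / 2" using R x by auto
  then show ?thesis using norm_triangle_ineq4[of "\<phi> (t, x)" "\<phi> (t', x')"] by linarith
 qed
 then show ?thesis using d(1) by (intro that[of ?d]) auto
qed

lemma C0_uniform_limit:
 assumes C: "!!k::nat. C0 K (s k)"
  and lim: "!!e. e > 0 ==> EX N. \<forall>k\<ge>N. ALL t. ALL x:modes K. cmod (s k (t, x) - \<phi> (t, x)) <= e"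
 shows "C0 K \<phi>"
 unfolding C0_def
proof (intro conjI allI impI)
 have "uniform_limit (UNIV \<times> modes K) s \<phi> sequentially"
 proof (rule uniform_limitI)
  fix e :: real assume "e > 0"
  then obtain N where N: "\<forall>k\<ge>N. ALL t. ALL x:modes K. cmod (s k (t, x) - \<phi> (t, x)) <= e / 2"
   using lim[of "e / 2"] by auto
  have "dist (s k (t, x)) (\<phi> (t, x)) < e" if "k >= N" "x \<in> modes K" for k t x
  proof -
   have "cmod (s k (t, x) - \<phi> (t, x)) <= e / 2" using N that by blast
   then show ?thesis using \<open>e > 0\<close> by (simp add: dist_norm)
  qed
  then have "\<forall>k\<ge>N. ALL p:UNIV \<times> modes K. dist (s k p) (\<phi> p) < e" by auto
  then show "\<forall>\<^sub>F k in sequentially. ALL p:UNIV \<times> modes K. dist (s k p) (\<phi> p) < e"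
   unfolding eventually_sequentially by blast
 qed
 then show "continuous_on (UNIV \<times> modes K) \<phi>"
  by (rule uniform_limit_theorem[rotated]) (auto intro: always_eventually C0_cont C)
 fix e :: real assume e: "e > 0"
 then obtain N where N: "!!t x. x \<in> modes K ==> cmod (s N (t, x) - \<phi> (t, x)) <= e / 2"
  using lim[of "e / 2"] by auto
 obtain R where R: "!!t x. x \<in> modes K ==> nsq K t x > R ==> cmod (s N (t, x)) < e / 2"
  using C0_tail[OF C[of N], of "e / 2"] e by auto
 have "cmod (\<phi> (t, x)) < e" if "x \<in> modes K" "nsq K t x > R" for t x
  using N[OF that(1), of t] R[OF that] norm_triangle_ineq4[of "s N (t, x)" "s N (t, x) - \<phi> (t, x)"] by simp
 then show "EX R. ALL t. ALL x:modes K. R < nsq K t x --> cmod (\<phi> (t, x)) < e" by blast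
qed

section \<open>Elements of \<open>SC K\<close> as functions into a Clifford algebra\<close>

lemma norm_par [simp]: "norm (par a) = norm (a::cl)"
proof -
 have n2p: "n2 (par a) = n2 a" for a
  unfolding n2_L2[OF finite_supp subset_refl] by (simp add: par.rep_eq norm_mult norm_power)
 have le: "norm (par a) <= norm a" for a :: cl
 proof (rule norm_cl_leI)
  fix x
  have "n2 (par a * x) = n2 (a * par x)" using n2p[of "a * par x"] by (simp add: par_mult)
  then show "n2 (par a * x) <= norm a * n2 x" using n2_mult_le[of a "par x"] by (simp add: n2p)
 qed simp
 show ?thesis using le[of a] le[of "par a"] by simp
qed

lemma n2_hat_mult:
 assumes "cin I a" "cin I b" "cin I x" "cin I y" "0 ~: I"
 shows "2 * (n2 (hat a b * hat x y))^2 = (n2 (ev a * x + od a * y))^2 + (n2 (ev b * y + od b * x))^2"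
proof -
 have "cin I (ev a)" "cin I (od a)" "cin I (ev b)" "cin I (od b)"
  using assms by (auto simp: ev_def od_def intro: cin_intros)
 then have "cin I (ev a * x + od a * y)" "cin I (ev b * y + od b * x)"
  using assms by (auto intro: cin_intros)
 then show ?thesis using assms by (simp add: hat_mult[OF assms(1,2,5), symmetric] n2_hat)
qed

lemma cin_ev: "cin I a ==> cin I (ev a)" and cin_od: "cin I a ==> cin I (od a)"
 by (auto simp: ev_def od_def intro: cin_intros)

text \<open>Swapping the two values both in the operator and in the vector changes no length.  Hence norms need to be tested for
 \<open>t \<ge> 0\<close> only.\<close>

lemma norm_hat_swap:
 assumes "cin I a" "cin I b" "0 ~: I" shows "norm (hat b a) = norm (hat a b)"
proof -
 have le: "norm (hat b a) <= norm (hat a b)" if ab: "cin I a" "cin I b" for a b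
 proof (rule norm_restrict[of "insert 0 I"])
  show "cin (insert 0 I) (hat b a)" using ab by (intro cin_hat)
  fix c assume "cin (insert 0 I) c"
  then obtain x y where xy: "cin I x" "cin I y" "c = hat x y" using assms(3) by (rule hat_surj)
  have "2 * (n2 (hat b a * hat x y))^2 = 2 * (n2 (hat a b * hat y x))^2"
   using ab xy assms(3) by (simp add: n2_hat_mult)
  then have "n2 (hat b a * hat x y) = n2 (hat a b * hat y x)" by simp
  moreover have "2 * (n2 (hat x y))^2 = 2 * (n2 (hat y x))^2"
   using xy assms(3) by (simp add: n2_hat)
  then have "n2 (hat x y) = n2 (hat y x)" by simp
  ultimately show "n2 (hat b a * c) <= norm (hat a b) * n2 c"
   using n2_mult_le[of "hat a b" "hat y x"] xy(3) by simp
 qed simp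
 show ?thesis using le[of a b] le[of b a] assms by simp
qed

lemma hat_same [simp]: "hat a a = a"
 by (simp add: hat_def flip: scaleR_2)


lemma cliff_space_cl:
 assumes "good K" "a \<in> cliff_space K" shows "cf (Cl a) = a" "cin (idx K) (Cl a)"
proof -
 have "{S. a S ~= 0} <= Pow (idx K)" using assms by (auto simp: cliff_space_def idx_def)
 then have "finite {S. a S ~= 0}" by (rule finite_subset) (simp add: goodD assms(1))
 then show *: "cf (Cl a) = a" using assms(2) by (intro Cl_inverse) (auto simp: cliff_space_def)
 show "cin (idx K) (Cl a)" using assms(2) unfolding cin_def * by (auto simp: cliff_space_def idx_def)
qed

lemma cf_cliff_space: "good K ==> cin (idx K) a ==> cf a \<in> cliff_space K"
proof (unfold cliff_space_def, intro CollectI allI impI conjI ballI)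
 fix S assume a: "cin (idx K) a" "cf a S ~= 0"
 show "finite S" using a(2) cf_infinite by blast
 fix i assume "i \<in> S"
 then show "i div 2 \<in> K" using a unfolding cin_def idx_def by blast
qed

lemma zero_cliff_space [simp]: "(%S. 0) \<in> cliff_space K" by (simp add: cliff_space_def)

abbreviation SCc :: "nat set => sc set" where "SCc K \<equiv> car (SC K)"

lemma SC_sel [simp]: "zer (SC K) = (%p S. 0)" "add (SC K) = (%F G p S. F p S + G p S)"
 "scl (SC K) = (%c F p S. c * F p S)" "mul (SC K) = sc_mult" "str (SC K) = sc_star" "nrm (SC K) = sc_norm K"
 "gra (SC K) = (%F (t, x) S. (-1) ^ card S * F (- t, x) S)"
 by (simp_all add: SC_def)

lemma sub_SC [simp]: "sub (SC K) F G = (%p S. F p S - G p S)"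
 by (simp add: sub_def)

lemma SC_tail:
 assumes "F \<in> SCc K" "e > 0"
 obtains R where "!!t x S. x \<in> modes K ==> nsq K t x > R ==> cmod (F (t, x) S) < e"
proof -
 have "\<forall>e>0. EX R. ALL t. ALL x:modes K. R < nsq K t x --> (ALL S. cmod (F (t, x) S) < e)"
  using assms(1) by (simp add: SC_def)
 then have "EX R. ALL t. ALL x:modes K. R < nsq K t x --> (ALL S. cmod (F (t, x) S) < e)" using assms(2) by (elim allE impE)
 then obtain R where "ALL t. ALL x:modes K. R < nsq K t x --> (ALL S. cmod (F (t, x) S) < e)" by (rule exE)
 then show ?thesis using that[of R] by simp
qed

lemma car_SC:
 assumes K: "good K"
 shows "F \<in> SCc K \<longleftrightarrow> (ALL S. C0 K (%p. F p S)) & (ALL t. ALL x:modes K. F (t, x) \<in> cliff_space K) \<and>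
  (ALL t x. x ~: modes K --> F (t, x) = (%S. 0))"
proof
 assume F: "F \<in> SCc K"
 have "C0 K (%p. F p S)" for S
  unfolding C0_def
 proof (intro conjI)
  show "continuous_on (UNIV \<times> modes K) (%p. F p S)"
   using F by (intro continuous_on_product_then_coordinatewise[of _ F]) (simp add: SC_def)
  show "\<forall>e>0. EX R. ALL t. ALL x:modes K. R < nsq K t x --> cmod (F (t, x) S) < e"
   by (intro allI impI, rule SC_tail[OF F], assumption) blast
 qed
 then show "(ALL S. C0 K (%p. F p S)) & (ALL t. ALL x:modes K. F (t, x) \<in> cliff_space K) \<and>
  (ALL t x. x ~: modes K --> F (t, x) = (%S. 0))" using F by (simp add: SC_def)
next
 assume *: "(ALL S. C0 K (%p. F p S)) & (ALL t. ALL x:modes K. F (t, x) \<in> cliff_space K) \<and>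
  (ALL t x. x ~: modes K --> F (t, x) = (%S. 0))"
 have "EX R. ALL t. ALL x:modes K. nsq K t x > R --> (ALL S. cmod (F (t, x) S) < e)" if e: "e > 0" for e
 proof -
  have "EX R. ALL t. ALL x:modes K. nsq K t x > R --> cmod (F (t, x) S) < e" for S
   using * e by (intro C0_tail[of K "%p. F p S"]) auto
  then obtain R where R: "!!S t x. x \<in> modes K ==> nsq K t x > R S ==> cmod (F (t, x) S) < e"
   by metis
  let ?R = "Max (R ` Pow (idx K))"
  have fin: "finite (R ` Pow (idx K))" using K by (simp add: goodD)
  have "cmod (F (t, x) S) < e" if x: "x \<in> modes K" and r: "nsq K t x > ?R" for t x S
  proof (cases "S \<in> Pow (idx K)")
   case True
   then have "R S <= ?R" using fin by (intro Max_ge) auto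
   then show ?thesis using R[OF x, of S t] r by simp
  next
   case False
   then have "F (t, x) S = 0" using * x by (auto simp: cliff_space_def idx_def)
   then show ?thesis using e by simp
  qed
  then show ?thesis by blast
 qed
 moreover have "continuous_on (UNIV \<times> modes K) F"
  using * by (intro continuous_on_coordinatewise_then_product C0_cont) auto
 ultimately show "F \<in> SCc K" using * by (simp add: SC_def)
qed

definition atc :: "sc => real => (real => real) => cl" where "atc F t x = Cl (F (t, x))"

text \<open>The key device: \<open>F \<mapsto> H F t x\<close> is a *-homomorphism for each \<open>(t, x)\<close>, jointly injective, and \<open>sc_norm\<close> is the supremum
 of the norms of its values.\<close>

definition H :: "sc => real => (real => real) => cl" where
 "H F t x = hat (atc F t x) (atc F (- t) x)"

lemma SC_space: "good K ==> F \<in> SCc K ==> F (t, x) \<in> cliff_space K"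
 by (cases "x \<in> modes K") (auto simp: car_SC)

lemma SC_C0: "good K ==> F \<in> SCc K ==> C0 K (%p. F p S)"
 by (auto simp: car_SC)

lemma cf_atc: "good K ==> F \<in> SCc K ==> cf (atc F t x) = F (t, x)"
 unfolding atc_def by (intro cliff_space_cl SC_space)

lemma cin_atc: "good K ==> F \<in> SCc K ==> cin (idx K) (atc F t x)"
 unfolding atc_def by (intro cliff_space_cl SC_space)

lemma atc_eqI: "F (t, x) = cf a ==> atc F t x = a"
 by (simp add: atc_def cf_inverse)

lemma cin_H: "good K ==> F \<in> SCc K ==> cin (insert 0 (idx K)) (H F t x)"
 unfolding H_def by (intro cin_hat cin_atc)

lemma SC_I:
 assumes K: "good K"
  and in_m: "!!t x. x \<in> modes K ==> F (t, x) = cf (a t x)"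
  and cin: "!!t x. x \<in> modes K ==> cin (idx K) (a t x)"
  and out: "!!t x. x ~: modes K ==> F (t, x) = (%S. 0)"
  and C: "!!S. S <= idx K ==> C0 K (%(t, x). cf (a t x) S)"
 shows "F \<in> SCc K"
 unfolding car_SC[OF K]
proof (intro conjI allI ballI impI)
 fix S
 show "C0 K (%p. F p S)"
 proof (cases "S <= idx K")
  case True
  have "C0 K (%p. F p S) \<longleftrightarrow> C0 K (%(t, x). cf (a t x) S)"
   by (rule C0_cong) (simp add: in_m)
  then show ?thesis using C[OF True] by simp
 next
  case False
  then have "C0 K (%p. F p S) \<longleftrightarrow> C0 K (%p. 0)"
   by (intro C0_cong) (auto simp: in_m intro: cin_D[OF cin])
  then show ?thesis by simp
 qed
qed (auto simp: in_m out intro: cf_cliff_space K cin)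

lemma SC_eqI:
 assumes K: "good K" and F: "F \<in> SCc K" "G \<in> SCc K"
  and eq: "!!t x. x \<in> modes K ==> H F t x = H G t x"
 shows "F = G"
proof -
 have "F (t, x) = G (t, x)" for t x
 proof (cases "x \<in> modes K")
  case True
  have "atc F t x = atc G t x"
   using hat_inject[of "idx K" "atc F t x" "atc F (- t) x" "atc G t x" "atc G (- t) x"] eq[OF True, of t] K F
   by (simp add: H_def cin_atc goodD)
  then show ?thesis using cf_atc[OF K F(1)] cf_atc[OF K F(2)] by metis
 next
  case False
  then show ?thesis using F by (simp add: car_SC[OF K])
 qed
 then show ?thesis by auto
qed

lemma atc_add: "good K ==> F \<in> SCc K ==> G \<in> SCc K ==> atc (%p S. F p S + G p S) t x = atc F t x + atc G t x"
 by (rule atc_eqI, rule ext) (simp add: cf_atc)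

lemma atc_sub: "good K ==> F \<in> SCc K ==> G \<in> SCc K ==> atc (%p S. F p S - G p S) t x = atc F t x - atc G t x"
 by (rule atc_eqI, rule ext) (simp add: cf_atc)

lemma atc_scl: "good K ==> F \<in> SCc K ==> atc (%p S. c * F p S) t x = cs c * atc F t x"
 by (rule atc_eqI, rule ext) (simp add: cf_atc)

lemma sc_mult_cf:
 assumes "F (t, x) = cf a" "G (t, x) = cf b" "G (- t, x) = cf b'"
 shows "sc_mult F G (t, x) = cf (ev a * b + od a * b')"
 by (rule ext) (simp add: sc_mult_def assms times_cl.rep_eq cf_ev cf_od)

lemma sc_star_cf:
 assumes "F (t, x) = cf a" "F (- t, x) = cf b"
 shows "sc_star F (t, x) = cf (adj (ev a) + adj (od b))"
 by (rule ext) (simp add: sc_star_def assms adj.rep_eq cf_ev cf_od)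

lemma atc_mul: "good K ==> F \<in> SCc K ==> G \<in> SCc K ==>
  atc (sc_mult F G) t x = ev (atc F t x) * atc G t x + od (atc F t x) * atc G (- t) x"
 by (rule atc_eqI, rule sc_mult_cf) (simp_all add: cf_atc)

lemma atc_star: "good K ==> F \<in> SCc K ==> atc (sc_star F) t x = adj (ev (atc F t x)) + adj (od (atc F (- t) x))"
 by (rule atc_eqI, rule sc_star_cf) (simp_all add: cf_atc)

lemma atc_gra: "good K ==> F \<in> SCc K ==> atc (gra (SC K) F) t x = par (atc F (- t) x)"
 by (rule atc_eqI, rule ext) (simp add: cf_atc par.rep_eq)

lemma H_add: "good K ==> F \<in> SCc K ==> G \<in> SCc K ==> H (%p S. F p S + G p S) t x = H F t x + H G t x"
 by (simp add: H_def atc_add hat_add)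

lemma H_sub: "good K ==> F \<in> SCc K ==> G \<in> SCc K ==> H (%p S. F p S - G p S) t x = H F t x - H G t x"
 by (simp add: H_def atc_sub hat_diff)

lemma H_scl: "good K ==> F \<in> SCc K ==> H (%p S. c * F p S) t x = cs c * H F t x"
 by (simp add: H_def atc_scl hat_cs)

lemma H_mul: "good K ==> F \<in> SCc K ==> G \<in> SCc K ==> H (sc_mult F G) t x = H F t x * H G t x"
 unfolding H_def by (subst hat_mult[symmetric, of "idx K"]) (auto simp: atc_mul cin_atc goodD)

lemma H_star: "good K ==> F \<in> SCc K ==> H (sc_star F) t x = adj (H F t x)"
 unfolding H_def by (subst hat_adj[symmetric, of "idx K"]) (auto simp: atc_star cin_atc goodD)

lemma H_gra: "good K ==> F \<in> SCc K ==> H (gra (SC K) F) t x = par (H F t x)"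
 unfolding H_def by (simp only: atc_gra par_hat minus_minus)

lemma H_zero [simp]: "H (%p S. 0) t x = 0"
proof -
 have "atc (%p S. 0) t x = 0" for t by (rule atc_eqI) (simp add: fun_eq_iff)
 then show ?thesis by (simp add: H_def)
qed


lemma C0_atc: "good K ==> F \<in> SCc K ==> C0 K (%(t, x). cf (atc F t x) S)"
 by (simp add: cf_atc SC_C0 case_prod_unfold)

lemma C0_atc_neg: "good K ==> F \<in> SCc K ==> C0 K (%(t, x). cf (atc F (- t) x) S)"
 using C0_reflect[OF C0_atc[of K F S]] by (simp add: case_prod_unfold)

lemma C0_ev: "C0 K (%(t, x). cf (a t x) S) ==> C0 K (%(t, x). cf (ev (a t x)) S)"
 and C0_od: "C0 K (%(t, x). cf (a t x) S) ==> C0 K (%(t, x). cf (od (a t x)) S)"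
 by (cases "even (card S)"; simp add: cf_ev cf_od cliff_even_def cliff_odd_def case_prod_unfold)+

lemma C0_times:
 assumes K: "good K" and cin: "!!t x. cin (idx K) (a t x)"
  and a: "!!S. C0 K (%(t, x). cf (a t x) S)" and b: "!!S. C0 K (%(t, x). cf (b t x) S)"
 shows "C0 K (%(t, x). cf (a t x * b t x) S)"
proof -
 have e: "cf (a t x * b t x) S = (\<Sum>T\<in>Pow (idx K). cliff_sign T (sym_diff T S) * (cf (a t x) T * cf (b t x) (sym_diff T S)))" for t x
  using K supp_cin[OF cin] by (subst cf_times_sum[of "Pow (idx K)"]) (auto simp: goodD mult.assoc)
 show ?thesis unfolding e using C0_mult[OF K a b]
  by (simp add: case_prod_unfold) (intro C0_sum C0_cmul)
qed

lemma C0_plus: "C0 K (%(t, x). cf (a t x) S) ==> C0 K (%(t, x). cf (b t x) S) ==> C0 K (%(t, x). cf (a t x + b t x) S)"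
 by (simp add: case_prod_unfold C0_add)

lemma C0_cf_adj: "C0 K (%(t, x). cf (a t x) S) ==> C0 K (%(t, x). cf (adj (a t x)) S)"
 by (cases "finite S") (auto simp: cf_adj case_prod_unfold intro: C0_cmul C0_cnj)

lemma C0_cf_par: "C0 K (%(t, x). cf (a t x) S) ==> C0 K (%(t, x). cf (par (a t x)) S)"
 by (auto simp: par.rep_eq case_prod_unfold intro: C0_cmul)

lemma SC_out: "good K ==> F \<in> SCc K ==> x ~: modes K ==> F (t, x) = (%S. 0)"
 by (simp add: car_SC)

lemma atc_out: "good K ==> F \<in> SCc K ==> x ~: modes K ==> atc F t x = 0"
 by (rule atc_eqI) (simp add: SC_out fun_eq_iff)

lemma SC_zero: "good K ==> (%p S. 0) \<in> SCc K"
 by (simp add: car_SC)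

lemma SC_add: "good K ==> F \<in> SCc K ==> G \<in> SCc K ==> (%p S. F p S + G p S) \<in> SCc K"
 unfolding car_SC by (auto intro: C0_add simp: cliff_space_def) (metis add_0)+

lemma SC_scl: "good K ==> F \<in> SCc K ==> (%p S. c * F p S) \<in> SCc K"
 unfolding car_SC by (auto intro: C0_cmul simp: cliff_space_def)

lemma SC_sub: "good K ==> F \<in> SCc K ==> G \<in> SCc K ==> (%p S. F p S - G p S) \<in> SCc K"
 using SC_add[of K F "%p S. -1 * G p S"] SC_scl[of K G "-1"] by simp

lemma SC_mul:
 assumes K: "good K" and F: "F \<in> SCc K" "G \<in> SCc K" shows "sc_mult F G \<in> SCc K"
proof (rule SC_I[OF K])
 let ?a = "%t x. ev (atc F t x) * atc G t x + od (atc F t x) * atc G (- t) x"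
 have *: "sc_mult F G (t, x) = cf (?a t x)" for t x
  by (rule sc_mult_cf) (simp_all add: cf_atc[OF K F(1)] cf_atc[OF K F(2)])
 then show "sc_mult F G (t, x) = cf (?a t x)" for t x .
 show "cin (idx K) (?a t x)" for t x
  using K F by (intro cin_intros cin_ev cin_od cin_atc)
 show "sc_mult F G (t, x) = (%S. 0)" if "x ~: modes K" for t x
  unfolding * using that by (simp add: atc_out[OF K F(1)] atc_out[OF K F(2)] fun_eq_iff)
 show "C0 K (%(t, x). cf (?a t x) S)" for S
  by (intro C0_plus C0_times K cin_ev cin_od cin_atc F C0_ev C0_od C0_atc C0_atc_neg)
qed

lemma SC_star:
 assumes K: "good K" and F: "F \<in> SCc K" shows "sc_star F \<in> SCc K"
proof (rule SC_I[OF K])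
 let ?a = "%t x. adj (ev (atc F t x)) + adj (od (atc F (- t) x))"
 have *: "sc_star F (t, x) = cf (?a t x)" for t x
  by (rule sc_star_cf) (simp_all add: cf_atc[OF K F])
 then show "sc_star F (t, x) = cf (?a t x)" for t x .
 show "cin (idx K) (?a t x)" for t x
  using K F by (intro cin_intros cin_ev cin_od cin_atc)
 show "sc_star F (t, x) = (%S. 0)" if "x ~: modes K" for t x
  unfolding * using that by (simp add: atc_out[OF K F] fun_eq_iff ev_def od_def par_diff[of 0 0, simplified])
 show "C0 K (%(t, x). cf (?a t x) S)" for S
  by (intro C0_plus C0_cf_adj K F C0_ev C0_od C0_atc C0_atc_neg)
qed

lemma SC_gra:
 assumes K: "good K" and F: "F \<in> SCc K" shows "gra (SC K) F \<in> SCc K"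
proof (rule SC_I[OF K])
 let ?a = "%t x. par (atc F (- t) x)"
 have *: "gra (SC K) F (t, x) = cf (?a t x)" for t x
  by (rule ext) (simp add: cf_atc[OF K F] par.rep_eq)
 then show "gra (SC K) F (t, x) = cf (?a t x)" for t x .
 show "cin (idx K) (?a t x)" for t x
  using K F by (intro cin_intros cin_atc)
 show "gra (SC K) F (t, x) = (%S. 0)" if "x ~: modes K" for t x
  unfolding * using that by (simp add: atc_out[OF K F] fun_eq_iff par.rep_eq)
 show "C0 K (%(t, x). cf (?a t x) S)" for S
  by (intro C0_cf_par K F C0_atc_neg)
qed


lemma cf_atc_le_H:
 assumes K: "good K" and F: "F \<in> SCc K"
 shows "cmod (F (t, x) S) <= 2 * norm (H F t x)"
proof (cases "S <= idx K")
 case True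
 then have "0 ~: S" using goodD(4)[OF K] by auto
 then have "F (t, x) S = cf (H F t x) S + cf (H F t x) (insert 0 S)"
  unfolding H_def cf_hat[OF cin_atc[OF K F] cin_atc[OF K F] goodD(4)[OF K]]
  by (simp add: cf_atc[OF K F] field_simps)
 then have "cmod (F (t, x) S) <= cmod (cf (H F t x) S) + cmod (cf (H F t x) (insert 0 S))"
  by (simp add: norm_triangle_ineq)
 then show ?thesis using cmod_cf_le_norm[of "H F t x" S] cmod_cf_le_norm[of "H F t x" "insert 0 S"] by linarith
next
 case False
 then have "F (t, x) S = 0" using cin_D[OF cin_atc[OF K F]] by (simp add: cf_atc[OF K F])
 then show ?thesis by simp
qed

definition dimc :: "nat set => real" where "dimc K = 2 * 2 ^ card (idx K)"

lemma norm_H_le_sup: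
 assumes K: "good K" and F: "F \<in> SCc K" and B: "!!t S. cmod (F (t, x) S) <= B"
 shows "norm (H F t x) <= dimc K * B"
proof -
 have "supp (H F t x) <= Pow (insert 0 (idx K))" by (intro supp_cin cin_H K F)
 then have "norm (H F t x) <= (\<Sum>S\<in>Pow (insert 0 (idx K)). cmod (cf (H F t x) S))"
  using K by (intro norm_le_sum_coeffs) (auto simp: goodD)
 also have "... <= (\<Sum>S\<in>Pow (insert 0 (idx K)). B)"
 proof (intro sum_mono)
  fix S
  have tri: "cmod (z - w) <= B * 2" "cmod (z + w) <= B * 2" if "cmod z <= B" "cmod w <= B" for z w :: complex
   using norm_triangle_ineq4[of z w] norm_triangle_ineq[of z w] that by auto
  show "cmod (cf (H F t x) S) <= B"
   unfolding H_def cf_hat[OF cin_atc[OF K F] cin_atc[OF K F] goodD(4)[OF K]] cf_atc[OF K F]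
   using B by (auto simp: norm_divide intro!: tri)
 qed
 also have "... = dimc K * B" using K by (simp add: goodD card_Pow dimc_def)
 finally show ?thesis .
qed

lemma atc_norm_diff_le:
 assumes K: "good K" and F: "F \<in> SCc K"
 shows "norm (atc F t x - atc F t' x') <= (\<Sum>S\<in>Pow (idx K). cmod (F (t, x) S - F (t', x') S))"
proof -
 have "cin (idx K) (atc F t x - atc F t' x')" by (intro cin_intros cin_atc[OF K F])
 then have "supp (atc F t x - atc F t' x') <= Pow (idx K)" by (auto simp: supp_def cin_def)
 then have "norm (atc F t x - atc F t' x') <= (\<Sum>S\<in>Pow (idx K). cmod (cf (atc F t x - atc F t' x') S))"
  by (rule norm_le_sum_coeffs[rotated]) (simp add: goodD K)
 then show ?thesis by (simp add: cf_atc[OF K F])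
qed

text \<open>Only the finitely many coefficients in \<open>Pow (idx K)\<close> are involved, so their moduli of continuity can be combined.\<close>

lemma atc_uniform:
 assumes K: "good K" and F: "F \<in> SCc K" and e: "e > 0"
 obtains d where "d > 0" "!!t t' x x'. x \<in> modes K ==> x' \<in> modes K ==> \<bar>t - t'\<bar> <= d ==>
  (!!i. i \<in> idx K ==> \<bar>crd i x - crd i x'\<bar> <= d) ==> norm (atc F t x - atc F t' x') <= e"
proof -
 let ?P = "Pow (idx K)"
 have P: "finite ?P" "card ?P > 0" using goodD(3)[OF K] by (auto simp: card_gt_0_iff)
 define e1 where "e1 = e / card ?P"
 have e1: "e1 > 0" using e P by (simp add: e1_def)
 have "\<exists>d>0. ALL t t' x x'. x \<in> modes K --> x' \<in> modes K --> \<bar>t - t'\<bar> <= d -->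
  (ALL i:idx K. \<bar>crd i x - crd i x'\<bar> <= d) --> cmod (F (t, x) S - F (t', x') S) < e1" for S
  by (rule C0_uniform[OF K SC_C0[OF K F, of S] e1]) blast
 then obtain d where d: "!!S. d S > 0" "!!S t t' x x'. x \<in> modes K ==> x' \<in> modes K ==> \<bar>t - t'\<bar> <= d S ==>
  (!!i. i \<in> idx K ==> \<bar>crd i x - crd i x'\<bar> <= d S) ==> cmod (F (t, x) S - F (t', x') S) < e1" by metis
 define m where "m = Min (d ` ?P)"
 have m: "m > 0" "!!S. S \<in> ?P ==> m <= d S" unfolding m_def using P d(1) by (subst Min_gr_iff; auto; fail | auto)+
 have "norm (atc F t x - atc F t' x') <= e"
  if x: "x \<in> modes K" "x' \<in> modes K" "\<bar>t - t'\<bar> <= m" "!!i. i \<in> idx K ==> \<bar>crd i x - crd i x'\<bar> <= m" for t t' x x'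
 proof -
  have "(\<Sum>S\<in>?P. cmod (F (t, x) S - F (t', x') S)) <= (\<Sum>S\<in>?P. e1)"
  proof (intro sum_mono)
   fix S assume S: "S \<in> ?P"
   have "\<bar>t - t'\<bar> <= d S" using x(3) m(2)[OF S] by linarith
   moreover have "\<bar>crd i x - crd i x'\<bar> <= d S" if "i \<in> idx K" for i using x(4)[OF that] m(2)[OF S] by linarith
   ultimately show "cmod (F (t, x) S - F (t', x') S) <= e1" using d(2)[OF x(1,2)] less_imp_le by blast
  qed
  also have "... = e" using P Pow_not_empty[of "idx K"] by (simp add: e1_def)
  finally show ?thesis using atc_norm_diff_le[OF K F, of t x t' x'] by simp
 qed
 then show ?thesis using that m(1) by blast
qed

lemma atc_bound:
 assumes K: "good K" and F: "F \<in> SCc K" obtains B where "B > 0" "!!t x. x \<in> modes K ==> norm (atc F t x) <= B"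
  "!!e. e > 0 ==> \<exists>R\<ge>0. ALL t. ALL x:modes K. nsq K t x > R --> norm (atc F t x) <= e"
proof -
 let ?P = "Pow (idx K)"
 have P: "finite ?P" "card ?P > 0" using goodD(3)[OF K] by (auto simp: card_gt_0_iff)
 have le: "norm (atc F t x) <= (\<Sum>S\<in>?P. cmod (F (t, x) S))" for t x
  using norm_le_sum_coeffs[OF P(1) supp_cin[OF cin_atc[OF K F]], of t x] by (simp add: cf_atc[OF K F])
 have "\<exists>R\<ge>0. ALL t. ALL x:modes K. nsq K t x > R --> norm (atc F t x) <= e" if e: "e > 0" for e
 proof -
  have e1: "e / card ?P > 0" using e P by simp
  obtain R where R: "!!t x S. x \<in> modes K ==> nsq K t x > R ==> cmod (F (t, x) S) < e / card ?P"
   by (rule SC_tail[OF F e1]) blast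
  have "norm (atc F t x) <= e" if "x \<in> modes K" "nsq K t x > \<bar>R\<bar>" for t x
  proof -
   have "(\<Sum>S\<in>?P. cmod (F (t, x) S)) <= (\<Sum>S\<in>?P. e / card ?P)"
    using that(2) by (intro sum_mono order_less_imp_le R[OF that(1)]) linarith
   also have "... = e" using P Pow_not_empty[of "idx K"] by simp
   finally show ?thesis using le[of t x] by simp
  qed
  then show ?thesis by (intro exI[of _ "\<bar>R\<bar>"]) auto
 qed
 moreover have "EX b. ALL t. ALL x:modes K. cmod (F (t, x) S) <= b" for S
  using C0_bounded[OF K SC_C0[OF K F, of S]] by metis
 then obtain b where b: "!!S t x. x \<in> modes K ==> cmod (F (t, x) S) <= b S" by metis
 have "norm (atc F t x) <= 1 + (\<Sum>S\<in>?P. \<bar>b S\<bar>)" if "x \<in> modes K" for t x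
  using le[of t x] sum_mono[of ?P "%S. cmod (F (t, x) S)" "%S. \<bar>b S\<bar>"] order_trans[OF b[OF that] abs_ge_self] by fastforce
 moreover have "1 + (\<Sum>S\<in>?P. \<bar>b S\<bar>) > 0" by (simp add: add_pos_nonneg sum_nonneg)
 ultimately show ?thesis using that by blast
qed

lemma SC_bounded:
 assumes K: "good K" and F: "F \<in> SCc K"
 obtains B where "B >= 0" "!!t x. x \<in> modes K ==> norm (H F t x) <= B"
proof -
 obtain B where B: "B > 0" "!!t x. x \<in> modes K ==> norm (atc F t x) <= B" by (rule atc_bound[OF K F]) blast
 have "norm (H F t x) <= dimc K * B" if x: "x \<in> modes K" for t x
 proof (rule norm_H_le_sup[OF K F])
  show "cmod (F (t, x) S) <= B" for t S
   using cmod_cf_le_norm[of "atc F t x" S] B(2)[OF x, of t] by (simp add: cf_atc[OF K F])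
 qed
 moreover have "0 <= dimc K * B" using B(1) by (simp add: dimc_def)
 ultimately show ?thesis by (intro that) auto
qed

definition nset :: "nat set => sc => real set" where
 "nset K F = {sqrt ((cliff_norm2 (sc_mult F (%(s, y). \<xi> s) (t, x)))^2 +
              (cliff_norm2 (sc_mult F (%(s, y). \<xi> s) (- t, x)))\<^sup>2) |t x \<xi>.
   x \<in> modes K & (ALL s. \<xi> s \<in> cliff_space K) \<and>
   (cliff_norm2 (\<xi> t))\<^sup>2 + (cliff_norm2 (\<xi> (- t)))^2 <= 1}"

lemma sc_norm_nset: "sc_norm K F = Sup (nset K F)" by (simp add: sc_norm_def nset_def)

lemma nset_elem:
 assumes K: "good K" and F: "F \<in> SCc K" and \<xi>: "!!s. \<xi> s \<in> cliff_space K"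
 shows "sqrt ((cliff_norm2 (sc_mult F (%(s, y). \<xi> s) (t, x)))^2 + (cliff_norm2 (sc_mult F (%(s, y). \<xi> s) (- t, x)))^2)
  = sqrt 2 * n2 (H F t x * hat (Cl (\<xi> t)) (Cl (\<xi> (- t))))"
  and "(cliff_norm2 (\<xi> t))^2 + (cliff_norm2 (\<xi> (- t)))^2 = 2 * (n2 (hat (Cl (\<xi> t)) (Cl (\<xi> (- t)))))^2"
proof -
 note c = cliff_space_cl[OF K \<xi>] and a = cin_atc[OF K F] and z = goodD(4)[OF K]
 let ?x = "Cl (\<xi> t)" and ?y = "Cl (\<xi> (- t))"
 have 1: "sc_mult F (%(s, y). \<xi> s) (t, x) = cf (ev (atc F t x) * ?x + od (atc F t x) * ?y)"
  by (rule sc_mult_cf) (simp_all add: cf_atc[OF K F] c)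
 have 2: "sc_mult F (%(s, y). \<xi> s) (- t, x) = cf (ev (atc F (- t) x) * ?y + od (atc F (- t) x) * ?x)"
  by (rule sc_mult_cf) (simp_all add: cf_atc[OF K F] c)
 have "(cliff_norm2 (sc_mult F (%(s, y). \<xi> s) (t, x)))^2 + (cliff_norm2 (sc_mult F (%(s, y). \<xi> s) (- t, x)))^2 =
  2 * (n2 (H F t x * hat ?x ?y))^2"
  unfolding 1 2 H_def n2_hat_mult[OF a a c(2) c(2) z] by (simp add: n2_def)
 then show "sqrt ((cliff_norm2 (sc_mult F (%(s, y). \<xi> s) (t, x)))^2 + (cliff_norm2 (sc_mult F (%(s, y). \<xi> s) (- t, x)))^2)
  = sqrt 2 * n2 (H F t x * hat ?x ?y)"
  by (simp add: real_sqrt_mult)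
 show "(cliff_norm2 (\<xi> t))^2 + (cliff_norm2 (\<xi> (- t)))^2 = 2 * (n2 (hat ?x ?y))^2"
  unfolding n2_hat[OF c(2) c(2) z] by (simp add: n2_def c)
qed

lemma sqrt2_le_1: "2 * (r::real)^2 <= 1 ==> 0 <= r ==> sqrt 2 * r <= 1"
 by (metis real_sqrt_le_mono real_sqrt_mult real_sqrt_one real_sqrt_abs abs_of_nonneg)

lemma nset_le:
 assumes K: "good K" and F: "F \<in> SCc K" and B: "!!t x. x \<in> modes K ==> norm (H F t x) <= B" and v: "v \<in> nset K F"
 shows "v <= B"
proof -
 obtain t x \<xi> where v: "v = sqrt ((cliff_norm2 (sc_mult F (%(s, y). \<xi> s) (t, x)))^2 + (cliff_norm2 (sc_mult F (%(s, y). \<xi> s) (- t, x)))^2)"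
  and x: "x \<in> modes K" and \<xi>: "!!s. \<xi> s \<in> cliff_space K"
  and le: "(cliff_norm2 (\<xi> t))^2 + (cliff_norm2 (\<xi> (- t)))^2 <= 1"
  using v unfolding nset_def by blast
 let ?h = "hat (Cl (\<xi> t)) (Cl (\<xi> (- t)))"
 have h: "sqrt 2 * n2 ?h <= 1" using le nset_elem(2)[where \<xi> = \<xi> and t = t, OF K F \<xi>] by (intro sqrt2_le_1) auto
 have "v = sqrt 2 * n2 (H F t x * ?h)" unfolding v by (rule nset_elem(1)[where \<xi> = \<xi>, OF K F \<xi>])
 also have "... <= sqrt 2 * (norm (H F t x) * n2 ?h)" by (intro mult_left_mono n2_mult_le) auto
 also have "... = norm (H F t x) * (sqrt 2 * n2 ?h)" by simp
 also have "... <= norm (H F t x) * 1" by (intro mult_left_mono h) auto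
 finally show ?thesis using B[OF x, of t] by simp
qed

lemma zero_in_modes [simp]: "(%th. 0) \<in> modes K"
 unfolding modes_def by (rule CollectI, rule exI[of _ "%_. 0"], rule exI[of _ "%_. 0"]) simp

lemma nset_nonempty: "nset K F ~= {}"
proof -
 have "sqrt ((cliff_norm2 (sc_mult F (%(s, y). (%S. 0)) (0, %th. 0)))^2 + (cliff_norm2 (sc_mult F (%(s, y). (%S. 0)) (- 0, %th. 0)))^2) \<in> nset K F"
  unfolding nset_def
  by (rule CollectI, rule exI[of _ 0], rule exI[of _ "%th. 0"], rule exI[of _ "%s S. 0"]) (simp add: cliff_norm2_def)
 then show ?thesis by auto
qed

lemma sc_norm_leI:
 assumes "good K" "F \<in> SCc K" "!!t x. x \<in> modes K ==> norm (H F t x) <= B" shows "sc_norm K F <= B"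
 unfolding sc_norm_nset using nset_nonempty by (rule cSup_least) (rule nset_le[OF assms])

lemma nset_bdd: assumes "good K" "F \<in> SCc K" shows "bdd_above (nset K F)"
proof -
 obtain B where "!!t x. x \<in> modes K ==> norm (H F t x) <= B" using SC_bounded[OF assms] by metis
 then show ?thesis by (intro bdd_aboveI) (rule nset_le[OF assms])
qed

text \<open>The definition of \<open>sc_norm\<close> tests vectors \<open>\<xi>\<close> on \<open>{t, -t}\<close>; under \<open>hat\<close> these are the vectors of the doubled algebra,
 up to a factor \<open>sqrt 2\<close> in length.  For \<open>t = 0\<close> the two points coincide and only diagonal pairs arise.\<close>

lemma norm_H_le:
 assumes K: "good K" and F: "F \<in> SCc K" and x: "x \<in> modes K" shows "norm (H F t x) <= sc_norm K F"
proof -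
 have bound: "sqrt 2 * n2 (H F t x * hat (Cl (\<xi> t)) (Cl (\<xi> (- t)))) <= sc_norm K F"
  if \<xi>: "!!s. \<xi> s \<in> cliff_space K" and 1: "2 * (n2 (hat (Cl (\<xi> t)) (Cl (\<xi> (- t)))))^2 <= 1" for \<xi>
 proof -
  have "sqrt 2 * n2 (H F t x * hat (Cl (\<xi> t)) (Cl (\<xi> (- t)))) \<in> nset K F"
   unfolding nset_def
   by (rule CollectI, rule exI[of _ t], rule exI[of _ x], rule exI[of _ \<xi>])
    (use x \<xi> 1 nset_elem(1)[where \<xi> = \<xi> and t = t and x = x, OF K F \<xi>] nset_elem(2)[where \<xi> = \<xi> and t = t, OF K F \<xi>] in simp)
  then show ?thesis unfolding sc_norm_nset by (intro cSup_upper nset_bdd K F)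
 qed
 have "0 <= sqrt 2 * n2 (H F t x * hat (Cl (%S. 0)) (Cl (%S. 0)))" by simp
 also have "... <= sc_norm K F"
 proof -
  have "Cl (%S. 0) = 0" by (metis cf_inverse cf_simps(1) ext)
  then show ?thesis using bound[of "%s S. 0"] by simp
 qed
 finally have nn: "0 <= sc_norm K F" .
 have main: "n2 (H F t x * c) <= sc_norm K F * n2 c"
  if c: "c = hat (cf' t) (cf' (- t))" and ci: "!!s. cin (idx K) (cf' s)" for c cf'
 proof (cases "c = 0")
  case False
  then have p: "n2 c > 0" using n2_nonneg[of c] n2_eq_0[of c] by linarith
  let ?r = "inverse (sqrt 2 * n2 c)"
  let ?\<xi> = "%s. cf (?r *\<^sub>R cf' s)"
  have "hat (?r *\<^sub>R a) (?r *\<^sub>R b) = ?r *\<^sub>R hat a b" for a b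
   using hat_cs[of "of_real ?r" a b] by (simp only: cs_of_real_mult)
  then have h: "hat (Cl (?\<xi> t)) (Cl (?\<xi> (- t))) = ?r *\<^sub>R c"
   by (simp only: cf_inverse c[symmetric])
  have "sqrt 2 * n2 (H F t x * hat (Cl (?\<xi> t)) (Cl (?\<xi> (- t)))) <= sc_norm K F"
  proof (rule bound)
   show "?\<xi> s \<in> cliff_space K" for s by (intro cf_cliff_space K cin_scaleR ci)
   show "2 * (n2 (hat (Cl (?\<xi> t)) (Cl (?\<xi> (- t)))))^2 <= 1"
    unfolding h n2_scaleR using p by (simp add: power_mult_distrib power_inverse field_simps)
  qed
  then show ?thesis unfolding h using p by (simp add: n2_scaleR field_simps)
 qed simp
 show ?thesis
 proof (cases "t = 0")
  case True
  then have e: "H F t x = atc F t x" by (simp add: H_def)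
  show ?thesis
  proof (rule norm_restrict[OF _ nn])
   show "cin (idx K) (H F t x)" unfolding e by (rule cin_atc[OF K F])
   show "n2 (H F t x * c) <= sc_norm K F * n2 c" if "cin (idx K) c" for c
    using that by (intro main[of c "%s. c"]) auto
  qed
 next
  case False
  show ?thesis
  proof (rule norm_restrict[OF cin_H[OF K F] nn])
   fix c assume "cin (insert 0 (idx K)) c"
   then obtain a b where ab: "cin (idx K) a" "cin (idx K) b" "c = hat a b" using goodD(4)[OF K] by (rule hat_surj)
   have "t ~= - t" using False by simp
   then show "n2 (H F t x * c) <= sc_norm K F * n2 c"
    using ab by (intro main[of c "%s. if s = t then a else b"]) auto
  qed
 qed
qed

lemma sc_norm_nonneg: "good K ==> F \<in> SCc K ==> 0 <= sc_norm K F"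
 using norm_H_le[OF _ _ zero_in_modes] norm_ge_zero order_trans by metis

lemma sc_norm_leI_nonneg:
 assumes K: "good K" and F: "F \<in> SCc K" and B: "!!t x. x \<in> modes K ==> t >= 0 ==> norm (H F t x) <= B"
 shows "sc_norm K F <= B"
proof (rule sc_norm_leI[OF K F])
 fix t x assume x: "x \<in> modes K"
 have "norm (H F (- t) x) = norm (H F t x)"
  unfolding H_def using norm_hat_swap[OF cin_atc[OF K F] cin_atc[OF K F] goodD(4)[OF K]] by simp
 then show "norm (H F t x) <= B" using B[OF x, of t] B[OF x, of "- t"] by (cases "t >= 0") auto
qed

text \<open>Coefficients converge uniformly, and a uniform limit of functions vanishing at infinity vanishes at infinity.\<close>

lemma SC_complete: assumes K: "good K" shows "norm_complete (SC K) (sc_norm K)"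
 unfolding norm_complete_def
proof (intro allI impI, elim conjE)
 fix s :: "nat => sc"
 assume s: "ALL k. s k \<in> SCc K"
  and C: "\<forall>e>0. EX N. \<forall>i\<ge>N. \<forall>j\<ge>N. sc_norm K (sub (SC K) (s i) (s j)) < e"
 have diff: "cmod (s i (t, x) S - s j (t, x) S) <= 2 * sc_norm K (sub (SC K) (s i) (s j))" for i j t x S
 proof (cases "x \<in> modes K")
  case True
  have d: "(%p S. s i p S - s j p S) \<in> SCc K" using s by (intro SC_sub K) auto
  show ?thesis
   using cf_atc_le_H[OF K d, of t x S] norm_H_le[OF K d True, of t] by simp
 next
  case False
  have d: "(%p S. s i p S - s j p S) \<in> SCc K" using s by (intro SC_sub K) auto
  show ?thesis using False s sc_norm_nonneg[OF K d] by (simp add: SC_out[OF K])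
 qed
 have cau: "Cauchy (%k. s k (t, x) S)" for t x S
 proof (rule CauchyI)
  fix e :: real assume "0 < e"
  then obtain N where N: "\<forall>i\<ge>N. \<forall>j\<ge>N. sc_norm K (sub (SC K) (s i) (s j)) < e / 2"
   using C[THEN spec, THEN mp, of "e / 2"] by (auto simp del: sub_SC)
  show "EX M. \<forall>m\<ge>M. \<forall>n\<ge>M. norm (s m (t, x) S - s n (t, x) S) < e"
  proof (intro exI[of _ N] allI impI)
   fix m n assume "m >= N" "n >= N"
   then show "norm (s m (t, x) S - s n (t, x) S) < e" using N diff[of m t x S n] by fastforce
  qed
 qed
 define G where "G = (%p S. lim (%k. s k p S))"
 have G: "(%k. s k (t, x) S) \<longlonglongrightarrow> G (t, x) S" for t x S
  using cau[of t x S] unfolding G_def by (simp add: Cauchy_convergent_iff convergent_LIMSEQ_iff)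
 have unif: "EX N. \<forall>k\<ge>N. ALL t x S. cmod (s k (t, x) S - G (t, x) S) <= e" if e: "e > 0" for e
 proof -
  obtain N where N: "\<forall>i\<ge>N. \<forall>j\<ge>N. sc_norm K (sub (SC K) (s i) (s j)) < e / 2"
   using C[THEN spec, THEN mp, of "e / 2"] e by (auto simp del: sub_SC)
  have "cmod (s k (t, x) S - G (t, x) S) <= e" if k: "k >= N" for k t x S
  proof (rule LIMSEQ_le_const2)
   show "(%j. cmod (s k (t, x) S - s j (t, x) S)) \<longlonglongrightarrow> cmod (s k (t, x) S - G (t, x) S)"
    by (intro tendsto_intros G)
   show "EX M. \<forall>j\<ge>M. cmod (s k (t, x) S - s j (t, x) S) <= e"
   proof (intro exI[of _ N] allI impI)
    fix j assume "j >= N"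
    then have "sc_norm K (sub (SC K) (s k) (s j)) < e / 2" using N k by blast
    then show "cmod (s k (t, x) S - s j (t, x) S) <= e" using diff[of k t x S j] by linarith
   qed
  qed
  then show ?thesis by blast
 qed
 have Gzero: "G (t, x) S = 0" if "!!k. s k (t, x) S = 0" for t x S
  using G[of t x S] that by (simp add: LIMSEQ_const_iff)
 have GC: "G \<in> SCc K"
  unfolding car_SC[OF K]
 proof (intro conjI allI ballI impI)
  show "C0 K (%p. G p S)" for S
   by (rule C0_uniform_limit[of K "%k p. s k p S"])
    (use s SC_C0[OF K] in blast, use unif in blast)
  show "G (t, x) \<in> cliff_space K" for t x
   unfolding cliff_space_def
  proof (intro CollectI allI impI)
   fix S assume "G (t, x) S ~= 0"
   then obtain k where "s k (t, x) S ~= 0" using Gzero by blast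
   then show "finite S & (ALL i:S. i div 2 \<in> K)" using SC_space[OF K, of "s k" t x] s by (auto simp: cliff_space_def)
  qed
  show "G (t, x) = (%S. 0)" if "x ~: modes K" for t x
   using that s by (intro ext Gzero) (simp add: SC_out[OF K])
 qed
 have "(%k. sc_norm K (sub (SC K) (s k) G)) \<longlonglongrightarrow> 0"
 proof (rule LIMSEQ_I)
  fix e :: real assume e: "e > 0"
  have d: "dimc K > 0" by (simp add: dimc_def)
  have "e / (2 * dimc K) > 0" using e d by simp
  from unif[OF this] obtain N where N: "\<forall>k\<ge>N. ALL t x S. cmod (s k (t, x) S - G (t, x) S) <= e / (2 * dimc K)"
   by (rule exE)
  show "EX N. \<forall>k\<ge>N. norm (sc_norm K (sub (SC K) (s k) G) - 0) < e"
  proof (intro exI[of _ N] allI impI)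
   fix k assume k: "k >= N"
   have dC: "(%p S. s k p S - G p S) \<in> SCc K" using s GC by (intro SC_sub K) auto
   have "sc_norm K (%p S. s k p S - G p S) <= dimc K * (e / (2 * dimc K))"
    by (intro sc_norm_leI K dC norm_H_le_sup) (use N k in auto)
   then have "sc_norm K (%p S. s k p S - G p S) <= e / 2" using d by simp
   then show "norm (sc_norm K (sub (SC K) (s k) G) - 0) < e"
    using sc_norm_nonneg[OF K dC] e by simp
  qed
 qed
 then show "EX x:SCc K. (%k. sc_norm K (sub (SC K) (s k) x)) \<longlonglongrightarrow> 0" using GC by blast
qed

lemma pre_eqI:
 assumes K: "good K"
  and F: "!!t x. F (t, x) \<in> cliff_space K" "!!t x. x ~: modes K ==> F (t, x) = (%S. 0)"
  and G: "!!t x. G (t, x) \<in> cliff_space K" "!!t x. x ~: modes K ==> G (t, x) = (%S. 0)"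
  and eq: "!!t x. x \<in> modes K ==> t >= 0 ==> H F t x = H G t x"
 shows "F = G"
proof -
 have c: "cf (atc F t x) = F (t, x)" "cin (idx K) (atc F t x)" "cf (atc G t x) = G (t, x)" "cin (idx K) (atc G t x)" for t x
  unfolding atc_def using cliff_space_cl[OF K F(1)] cliff_space_cl[OF K G(1)] by blast+
 have p: "F (t, x) = G (t, x) & F (- t, x) = G (- t, x)" if x: "x \<in> modes K" "t >= 0" for t x
 proof -
  have "atc F t x = atc G t x & atc F (- t) x = atc G (- t) x"
   by (rule hat_inject[OF c(2) c(2) c(4) c(4) goodD(4)[OF K]]) (use eq[OF x] in "simp add: H_def")
  then show ?thesis using c by metis
 qed
 have "F (t, x) = G (t, x)" for t x
 proof (cases "x \<in> modes K")
  case True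
  then show ?thesis using p[OF True, of t] p[OF True, of "- t"] by (cases "t >= 0") auto
 qed (simp add: F G)
 then show ?thesis by auto
qed

lemma SC_eqI_nonneg:
 assumes K: "good K" and F: "F \<in> SCc K" "G \<in> SCc K"
  and eq: "!!t x. x \<in> modes K ==> t >= 0 ==> H F t x = H G t x"
 shows "F = G"
 by (rule pre_eqI[OF K]) (use SC_space[OF K] SC_out[OF K] F eq in auto)

text \<open>Every identity and the C*-property are transported from the Clifford algebra through \<open>H\<close>.\<close>

lemma SC_cstar: assumes K: "good K" shows "graded_cstar_algebra (SC K)"
proof -
 note cl = SC_add[OF K] SC_scl[OF K] SC_mul[OF K] SC_star[OF K] SC_gra[OF K, simplified] SC_zero[OF K]
 note hh = H_add[OF K] H_scl[OF K] H_mul[OF K] H_star[OF K] H_gra[OF K, simplified]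
 note eq = SC_eqI[OF K]
 have cc: "cs c * a * b = cs c * (a * b)" "a * (cs c * b) = cs c * (a * b)" for a b c
  by (metis cs_commute mult.assoc)+
 have vs: "complex_vector_space (SC K)"
  unfolding complex_vector_space_def using cl by (auto simp: fun_eq_iff algebra_simps)
 have n0: "sc_norm K F = 0 \<longleftrightarrow> F = (%p S. 0)" if F: "F \<in> SCc K" for F
 proof
  assume "sc_norm K F = 0"
  then have "H F t x = 0" if "x \<in> modes K" for t x using norm_H_le[OF K F that, of t] by simp
  then show "F = (%p S. 0)" by (intro eq F) (auto simp: cl)
 next
  assume "F = (%p S. 0)"
  then show "sc_norm K F = 0" using sc_norm_nonneg[OF K F] by (intro antisym sc_norm_leI[OF K F]) auto
 qed
 have tri: "sc_norm K (%p S. F p S + G p S) <= sc_norm K F + sc_norm K G" if "F \<in> SCc K" "G \<in> SCc K" for F G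
  using that
  by (intro sc_norm_leI[OF K cl(1)]) (auto simp: hh intro!: order_trans[OF norm_triangle_ineq] add_mono norm_H_le[OF K])
 have mul: "sc_norm K (sc_mult F G) <= sc_norm K F * sc_norm K G" if "F \<in> SCc K" "G \<in> SCc K" for F G
  using that
  by (intro sc_norm_leI[OF K cl(3)]) (auto simp: hh intro!: order_trans[OF norm_mult_ineq] mult_mono norm_H_le[OF K] sc_norm_nonneg[OF K])
 have scl_le: "sc_norm K (%p S. c * F p S) <= cmod c * sc_norm K F" if "F \<in> SCc K" for c F
  using that
  by (intro sc_norm_leI[OF K cl(2)]) (auto simp: hh norm_cs_mult intro!: mult_left_mono norm_H_le[OF K])
 have scl: "sc_norm K (%p S. c * F p S) = cmod c * sc_norm K F" if F: "F \<in> SCc K" for c F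
 proof (cases "c = 0")
  case True
  have "sc_norm K (%p S. 0) = 0" using n0[OF cl(6)] by blast
  then show ?thesis using True by simp
 next
  case False
  have "sc_norm K F = sc_norm K (%p S. inverse c * (c * F p S))" using False by (simp flip: mult.assoc)
  also have "... <= cmod (inverse c) * sc_norm K (%p S. c * F p S)" by (intro scl_le cl F)
  finally have "cmod c * sc_norm K F <= sc_norm K (%p S. c * F p S)"
   using False by (simp add: norm_inverse norm_divide field_simps)
  then show ?thesis using scl_le[OF F, of c] by simp
 qed
 have star_sq: "sc_norm K (sc_mult (sc_star F) F) = (sc_norm K F)^2" if F: "F \<in> SCc K" for F
 proof (rule antisym)
  have Fs: "sc_mult (sc_star F) F \<in> SCc K" using F cl by simp
  have h: "H (sc_mult (sc_star F) F) t x = adj (H F t x) * H F t x" for t x using F by (simp add: hh cl)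
  show "sc_norm K (sc_mult (sc_star F) F) <= (sc_norm K F)^2"
   by (intro sc_norm_leI[OF K Fs]) (simp add: h cstar_cl power_mono norm_H_le[OF K F])
  have "norm (H F t x) <= sqrt (sc_norm K (sc_mult (sc_star F) F))" if "x \<in> modes K" for t x
   using norm_H_le[OF K Fs that, of t] by (intro real_le_rsqrt) (simp add: h cstar_cl)
  then have "sc_norm K F <= sqrt (sc_norm K (sc_mult (sc_star F) F))" by (rule sc_norm_leI[OF K F])
  then have "(sc_norm K F)^2 <= (sqrt (sc_norm K (sc_mult (sc_star F) F)))^2"
   by (intro power_mono sc_norm_nonneg K F)
  then show "(sc_norm K F)^2 <= sc_norm K (sc_mult (sc_star F) F)"
   using sc_norm_nonneg[OF K Fs] by simp
 qed
 show ?thesis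
  unfolding graded_cstar_algebra_def linear_map_def SC_sel
 proof (intro conjI ballI allI)
  show "complex_vector_space (SC K)" by (rule vs)
  show "norm_complete (SC K) (sc_norm K)" by (rule SC_complete[OF K])
  fix a b c d
  assume a: "a \<in> SCc K"
  show "sc_star a \<in> SCc K" using a cl by simp
  show "sc_star (sc_star a) = a" by (rule eq) (use a in "simp_all add: cl hh")
  show "0 <= sc_norm K a" "(sc_norm K a = 0) = (a = (%p S. 0))" using a sc_norm_nonneg[OF K] n0 by auto
  show "sc_norm K (sc_mult (sc_star a) a) = (sc_norm K a)^2" by (rule star_sq[OF a])
  show "sc_norm K (%p S. d * a p S) = cmod d * sc_norm K a" by (rule scl[OF a])
  show "sc_star (%p S. d * a p S) = (%p S. cnj d * sc_star a p S)"
   by (rule eq) (use a in "simp_all add: cl hh adj_mult cs_commute")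
 qed ((simp add: fun_eq_iff algebra_simps split: prod.splits; fail) |
   (auto intro!: tri mul eq simp: cl hh algebra_simps cc adj_add adj_mult par_add par_mult par_adj; fail))+
qed

lemma modes_proj_in [simp]: "good K ==> modes_proj K x \<in> modes K"
 by (simp add: modes_proj_eq goodD)

lemma idx_div: "good K ==> i \<in> idx K ==> i div 2 >= 1"
 by (auto simp: idx_def good_def) (metis One_nat_def Suc_leI neq0_conv)

lemma crd_modes_proj: "good K ==> i \<in> idx K ==> crd i (modes_proj K x) = crd i x"
 using idx_div[of K i] by (simp add: modes_proj_eq goodD crd_comb)

lemma modes_proj_proj:
 assumes "good K" "L <= K" shows "modes_proj L (modes_proj K x) = modes_proj L x"
proof -
 have "finite L" using assms goodD(1) finite_subset by blast
 moreover have "idx L <= idx K" using assms by (auto simp: idx_def)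
 ultimately show ?thesis using assms(1)
  unfolding modes_proj_eq[OF \<open>finite L\<close>] comb_def by (auto intro!: sum.cong simp: crd_modes_proj fun_eq_iff)
qed

lemma modes_proj_id: "good K ==> x \<in> modes K ==> modes_proj K x = x"
 by (simp add: modes_proj_eq goodD comb_crd)

lemma good_Un [simp]: "good K ==> good L ==> good (L Un K)" by (simp add: good_def)

lemma continuous_on_modes_proj:
 assumes "good M" "good K" shows "continuous_on (modes M) (modes_proj K)"
 unfolding modes_proj_eq[OF goodD(1)[OF assms(2)]]
 by (intro continuous_on_comb continuous_on_crd goodD assms)

section \<open>The connecting map in closed form\<close>

definition wt :: "real => nat => real" where "wt l i = real (i div 2) powr (- l)"

definition cvec :: "real => nat set => (real => real) => cl" where
 "cvec l L x = vect (idx L) (%i. wt l i * crd i x)"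

definition csq :: "real => nat set => (real => real) => real" where
 "csq l L x = (\<Sum>i\<in>idx L. (wt l i * crd i x)^2)"

definition rad :: "real => nat set => real => (real => real) => real" where
 "rad l L t x = sqrt (t^2 + csq l L x)"

lemma csq_nonneg [simp]: "0 <= csq l L x" by (simp add: csq_def sum_nonneg)

lemma rad_nonneg [simp]: "0 <= rad l L t x" by (simp add: rad_def)

lemma rad_sq [simp]: "(rad l L t x)^2 = t^2 + csq l L x" by (simp add: rad_def)

lemma rad_minus [simp]: "rad l L (- t) x = rad l L t x" by (simp add: rad_def)

lemma abs_le_rad: "\<bar>t\<bar> <= rad l L t x"
 unfolding rad_def by (rule real_le_rsqrt) simp

lemma cvec_sq: "finite L ==> cvec l L x * cvec l L x = of_real (csq l L x)"
 by (simp add: cvec_def csq_def vect_sq)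

lemma crd_le_rad: assumes "finite L" "i \<in> idx L" shows "\<bar>wt l i * crd i x\<bar> <= rad l L t x"
proof -
 have "(wt l i * crd i x)^2 <= csq l L x"
  unfolding csq_def using assms by (intro member_le_sum) auto
 then have "(wt l i * crd i x)^2 <= t^2 + csq l L x" using zero_le_power2[of t] by linarith
 then show ?thesis unfolding rad_def by (intro real_le_rsqrt) simp
qed

lemma csq_proj: "good L ==> csq l L (modes_proj L x) = csq l L x"
 by (simp add: csq_def crd_modes_proj)

lemma cvec_proj: "good L ==> cvec l L (modes_proj L x) = cvec l L x"
 by (simp add: cvec_def vect_def crd_modes_proj)

lemma wt_pos: "good L ==> i \<in> idx L ==> wt l i > 0"
 using idx_div[of L i] by (simp add: wt_def)

definition Evn :: "sc => real => (real => real) => cl" where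
 "Evn F r y = (1/2) *\<^sub>R (atc F r y + atc F (- r) y)"
definition Odn :: "sc => real => (real => real) => cl" where
 "Odn F r y = (1/2) *\<^sub>R (atc F r y - atc F (- r) y)"

lemma H_EO: "H F t x = Evn F t x + gen 0 * Odn F t x"
 by (simp add: H_def hat_def Evn_def Odn_def algebra_simps)

definition bet_cl :: "real => nat set => nat set => sc => real => (real => real) => cl" where
 "bet_cl l K L F t x = (let r = rad l L t x; y = modes_proj K x in
   Evn F r y + (inverse r *\<^sub>R (t *\<^sub>R 1 + cvec l L x)) * Odn F r y)"

text \<open>\<open>f (X + C)\<close> for the odd vector \<open>X + C\<close> with square \<open>r\<^sup>2\<close> is \<open>f\<^sub>e r + ((X + C) / r) f\<^sub>o r\<close>, where \<open>f\<^sub>e\<close> and \<open>f\<^sub>o\<close> are the even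
 and odd parts; at \<open>r = 0\<close> the quotient is \<open>0\<close>, consistent with \<open>f\<^sub>o 0 = 0\<close>.\<close>

definition bet :: "real => nat set => nat set => sc => sc" where
 "bet l K L F = (%(t, x). if x \<in> modes (L Un K) then cf (bet_cl l K L F t x) else (%S. 0))"

definition uvec :: "real => nat set => real => (real => real) => cl" where
 "uvec l L t x = inverse (rad l L t x) *\<^sub>R (t *\<^sub>R gen 0 + cvec l L x)"

lemma atc_bet: "x \<in> modes (L Un K) ==> atc (bet l K L F) t x = bet_cl l K L F t x"
 by (rule atc_eqI) (simp add: bet_def)

lemma H_bet:
 assumes x: "x \<in> modes (L Un K)"
 shows "H (bet l K L F) t x = Evn F (rad l L t x) (modes_proj K x) + uvec l L t x * Odn F (rad l L t x) (modes_proj K x)"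
proof -
 have hat_EO: "hat (e + (\<rho> *\<^sub>R (s *\<^sub>R 1 + v)) * q) (e + (\<rho> *\<^sub>R ((- s) *\<^sub>R 1 + v)) * q) = e + (\<rho> *\<^sub>R (s *\<^sub>R gen 0 + v)) * q" for e v q \<rho> s
 proof -
  have A: "(\<rho> *\<^sub>R (s *\<^sub>R 1 + v)) * q = (\<rho> * s) *\<^sub>R q + \<rho> *\<^sub>R (v * q)" for s
   by (simp add: algebra_simps)
  have g: "(e + (p + z)) + (e + (- p + z)) = 2 *\<^sub>R (e + z)" "(e + (p + z)) - (e + (- p + z)) = 2 *\<^sub>R p" for p z
   by (simp_all add: scaleR_2)
  have m: "(\<rho> * - s) *\<^sub>R q = - ((\<rho> * s) *\<^sub>R q)" by simp
  show ?thesis unfolding hat_def A m g by (simp add: algebra_simps)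
 qed
 show ?thesis unfolding H_def atc_bet[OF x] bet_cl_def Let_def uvec_def rad_minus by (rule hat_EO)
qed

lemma cin_Evn: "good K ==> F \<in> SCc K ==> cin (idx K) (Evn F r y)"
 and cin_Odn: "good K ==> F \<in> SCc K ==> cin (idx K) (Odn F r y)"
 unfolding Evn_def Odn_def by (intro cin_intros cin_atc; assumption)+

lemma Odn_0 [simp]: "Odn F 0 y = 0" by (simp add: Odn_def)

lemma cvec_commute: "K Int L = {} ==> cin (idx K) p ==> p * cvec l L x = cvec l L x * par p"
 unfolding cvec_def using idx_disjoint[of K L] by (intro vect_commute) auto

lemma gen0_cvec: "good L ==> cvec l L x * gen 0 = - (gen 0 * cvec l L x)"
 using gen_commute[of "idx L" "cvec l L x" 0] by (simp add: goodD cvec_def cin_vect)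

lemma adj_uvec [simp]: "adj (uvec l L t x) = uvec l L t x"
 by (simp add: uvec_def adj_scaleR adj_add cvec_def)

lemma par_uvec [simp]: "par (uvec l L t x) = - uvec l L t x"
 by (simp add: uvec_def par_scaleR par_add cvec_def algebra_simps)

lemma bvec_sq: "good L ==> (t *\<^sub>R gen 0 + cvec l L x) * (t *\<^sub>R gen 0 + cvec l L x) = of_real (t^2 + csq l L x)"
 by (simp add: algebra_simps cvec_sq goodD gen0_cvec) (simp add: of_real_def power2_eq_square)

lemma uvec_sq: "good L ==> rad l L t x ~= 0 ==> uvec l L t x * uvec l L t x = 1"
proof -
 assume L: "good L" and r: "rad l L t x ~= 0"
 have "uvec l L t x * uvec l L t x = (inverse (rad l L t x) * inverse (rad l L t x)) *\<^sub>R of_real ((rad l L t x)^2)"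
  unfolding uvec_def using bvec_sq[OF L, of t l x] by simp
 also have "... = (inverse (rad l L t x) * inverse (rad l L t x) * (rad l L t x * rad l L t x)) *\<^sub>R 1"
  unfolding of_real_def power2_eq_square scaleR_scaleR ..
 also have "inverse (rad l L t x) * inverse (rad l L t x) * (rad l L t x * rad l L t x) = 1"
  using r by (simp add: field_simps)
 finally have "uvec l L t x * uvec l L t x = 1 *\<^sub>R 1" .
 then show ?thesis by simp
qed

lemma uvec_commute:
 assumes "good K" "good L" "K Int L = {}" "cin (idx K) p" shows "p * uvec l L t x = uvec l L t x * par p"
 using gen_commute[OF assms(4) goodD(4)[OF assms(1)]] cvec_commute[OF assms(3,4), of l x]
 by (simp add: uvec_def algebra_simps)

text \<open>Both \<open>gen 0\<close> and \<open>u = uvec l L t x\<close> are unit vectors.  The normalised element \<open>1 + u gen 0\<close> is the spin lift of the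
 rotation taking \<open>gen 0\<close> to \<open>u\<close>; for \<open>t \<ge> 0\<close> the two vectors are not antipodal, so the normalisation is possible.  It
 commutes with the Clifford algebra over \<open>K\<close> because it is even and involves other generators.\<close>

lemma uvec_unitary:
 assumes KL: "good K" "good L" "K Int L = {}" and t: "t >= 0" and r: "rad l L t x ~= 0"
 obtains w where "adj w * w = 1" "w * adj w = 1" "w * gen 0 = uvec l L t x * w"
  "!!p. cin (idx K) p ==> w * p = p * w"
proof -
 define u where "u = uvec l L t x"
 define g where "g = gen 0"
 define a where "a = t / rad l L t x"
 have uu: "u * u = 1" unfolding u_def by (rule uvec_sq[OF KL(2) r])
 have gg: "g * g = 1" by (simp add: g_def)
 have ug: "u * g + g * u = (2 * a) *\<^sub>R 1"
  unfolding u_def uvec_def g_def a_def using gen0_cvec[OF KL(2), of l x]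
  by (simp add: algebra_simps divide_inverse flip: scaleR_add_left)
 have a: "a >= 0" using t by (simp add: a_def)
 define s where "s = 1 / sqrt (2 + 2 * a)"
 have ss: "s * (s * (2 + 2 * a)) = 1" using a by (simp add: s_def)
 define w where "w = s *\<^sub>R (1 + u * g)"
 have aw: "adj w = s *\<^sub>R (1 + g * u)" by (simp add: w_def adj_scaleR adj_add adj_mult u_def g_def) (metis adj_cs complex_cnj_one cs_one)
 have x: "x * (x * y) = y" if "x * x = 1" for x y :: cl using that by (simp flip: mult.assoc)
 have e1: "(1 + g * u) * (1 + u * g) = (2 + 2 * a) *\<^sub>R 1" and e2: "(1 + u * g) * (1 + g * u) = (2 + 2 * a) *\<^sub>R 1"
  using ug by (simp_all add: algebra_simps x[OF uu] x[OF gg] uu gg scaleR_2[symmetric] scaleR_add_left[of 2])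
 show ?thesis
 proof (rule that[of w])
  show "adj w * w = 1" "w * adj w = 1" unfolding aw unfolding w_def using ss by (simp_all add: e1 e2)
  show "w * gen 0 = uvec l L t x * w"
   unfolding w_def u_def[symmetric] g_def[symmetric] by (simp add: algebra_simps x[OF uu] gg)
  fix p assume p: "cin (idx K) p"
  have 1: "p * u = u * par p" "par p * g = g * p"
   using uvec_commute[OF KL p, of l t x] gen_commute[OF cin_par[OF p] goodD(4)[OF KL(1)]] by (simp_all add: u_def g_def)
  have "p * (u * g) = u * g * p" by (metis 1 mult.assoc)
  then show "w * p = p * w" unfolding w_def by (simp add: algebra_simps)
 qed
qed


text \<open>The connecting map is pointwise conjugation by a unitary that does not depend on \<open>F\<close>, composed with the change of
 variables \<open>(t, x) \<mapsto> (r, P x)\<close>.  Multiplicativity, compatibility with \<open>*\<close> and contractivity are immediate from this.\<close>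

lemma H_bet_conj:
 assumes KL: "good K" "good L" "K Int L = {}" and t: "t >= 0" and x: "x \<in> modes (L Un K)"
 obtains w where "adj w * w = 1" "w * adj w = 1"
  "!!F. F \<in> SCc K ==> H (bet l K L F) t x = w * H F (rad l L t x) (modes_proj K x) * adj w"
proof (cases "rad l L t x = 0")
 case True
 show ?thesis
 proof (rule that[of 1])
  have "adj 1 = (1::cl)" by (metis adj_cs complex_cnj_one cs_one)
  then show "adj 1 * 1 = (1::cl)" "1 * adj 1 = (1::cl)"
   "H (bet l K L F) t x = 1 * H F (rad l L t x) (modes_proj K x) * adj 1" for F
   unfolding H_bet[OF x] using True by (simp_all add: H_EO)
 qed
next
 case False
 obtain w where w: "adj w * w = 1" "w * adj w = 1" "w * gen 0 = uvec l L t x * w"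
  "!!p. cin (idx K) p ==> w * p = p * w" using uvec_unitary[OF KL t False] by metis
 show ?thesis
 proof (rule that[of w])
  fix F assume F: "F \<in> SCc K"
  let ?e = "Evn F (rad l L t x) (modes_proj K x)" and ?o = "Odn F (rad l L t x) (modes_proj K x)"
  have e: "w * ?e = ?e * w" and o: "w * ?o = ?o * w" using w(4) cin_Evn[OF KL(1) F] cin_Odn[OF KL(1) F] by blast+
  have "w * H F (rad l L t x) (modes_proj K x) = (?e + uvec l L t x * ?o) * w"
   unfolding H_EO distrib_left distrib_right e mult.assoc[symmetric] w(3) by (simp add: mult.assoc o)
  then show "H (bet l K L F) t x = w * H F (rad l L t x) (modes_proj K x) * adj w"
   unfolding H_bet[OF x] using w(2) by (simp add: mult.assoc)
 qed (use w in auto)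
qed


lemma continuous_rad:
 assumes "good L" "good M" shows "continuous_on (UNIV \<times> modes M) (%p. rad l L (fst p) (snd p))"
proof -
 have "continuous_on (UNIV \<times> modes M) (%p. crd i (snd p))" for i
  by (rule continuous_on_compose2[OF continuous_on_crd[of M i]]) (use assms in "auto simp: goodD intro: continuous_on_snd continuous_on_id")
 then show ?thesis unfolding rad_def csq_def
  by (intro continuous_intros continuous_on_fst continuous_on_id) auto
qed

lemma modes_norm_sq: "good K ==> (modes_norm K x)^2 = (\<Sum>i\<in>idx K. (crd i x)^2)"
 by (simp add: modes_norm_eq goodD sum_nonneg)

text \<open>The map \<open>(t, x) \<mapsto> (r, P x)\<close> is continuous and proper, since all weights are positive.\<close>

lemma C0_rad:
 assumes KL: "good K" "good L" and \<phi>: "C0 K \<phi>"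
 shows "C0 (L Un K) (%(t, x). \<phi> (rad l L t x, modes_proj K x))"
 unfolding C0_def
proof (intro conjI allI impI)
 have g: "good (L Un K)" using KL by simp
 have "continuous_on (UNIV \<times> modes (L Un K)) (%p. modes_proj K (snd p))"
  by (rule continuous_on_compose2[OF continuous_on_modes_proj[OF g KL(1)]]) (auto intro: continuous_on_snd continuous_on_id)
 then have "continuous_on (UNIV \<times> modes (L Un K)) (%p. \<phi> (rad l L (fst p) (snd p), modes_proj K (snd p)))"
  using KL g by (intro continuous_on_compose2[OF C0_cont[OF \<phi>]] continuous_on_Pair continuous_rad) auto
 then show "continuous_on (UNIV \<times> modes (L Un K)) (%(t, x). \<phi> (rad l L t x, modes_proj K x))"
  by (simp add: case_prod_unfold)
 fix e :: real assume e: "e > 0"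
 obtain R where R: "!!t x. x \<in> modes K ==> nsq K t x > R ==> cmod (\<phi> (t, x)) < e"
  by (rule C0_tailE[OF \<phi> e]) blast
 define m where "m = Min (insert 1 ((%i. (wt l i)^2) ` idx L))"
 have fin: "finite (insert 1 ((%i. (wt l i)^2) ` idx L))" using KL by (simp add: goodD)
 have m0: "m > 0" unfolding m_def using fin wt_pos[OF KL(2), of _ l] by (subst Min_gr_iff) (auto simp: less_imp_neq[THEN not_sym])
 have m1: "m <= 1" and mw: "!!i. i \<in> idx L ==> m <= (wt l i)^2" unfolding m_def using fin by (auto intro: Min_le)
 have "cmod (\<phi> (rad l L t x, modes_proj K x)) < e" if x: "t^2 + (modes_norm (L Un K) x)^2 > R / m" for t x
 proof -
  have "(modes_norm (L Un K) x)^2 <= (\<Sum>i\<in>idx L. (crd i x)^2) + (\<Sum>i\<in>idx K. (crd i x)^2)"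
   unfolding modes_norm_sq[OF g] idx_Un using KL by (simp add: sum_Un goodD sum_nonneg)
  then have "m * (t^2 + (modes_norm (L Un K) x)^2) <= m * t^2 + (\<Sum>i\<in>idx L. m * (crd i x)^2) + m * (\<Sum>i\<in>idx K. (crd i x)^2)"
   using m0 by (simp add: distrib_left sum_distrib_left[symmetric] mult_left_mono flip: add.assoc)
    (simp add: distrib_left[symmetric] mult_left_mono)
  also have "... <= t^2 + csq l L x + (\<Sum>i\<in>idx K. (crd i x)^2)"
   unfolding csq_def using m1 m0
   by (intro add_mono sum_mono) (auto simp: power_mult_distrib mult_left_le_one_le sum_nonneg intro!: mult_right_mono mw)
  also have "... = (rad l L t x)^2 + (modes_norm K (modes_proj K x))^2"
   using KL by (simp add: modes_norm_sq crd_modes_proj)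
  finally have "(rad l L t x)^2 + (modes_norm K (modes_proj K x))^2 > R"
   using x m0 by (simp add: field_simps)
  then show ?thesis using KL by (intro R) auto
 qed
 then show "EX R. ALL t. ALL x:modes (L Un K). R < t^2 + (modes_norm (L Un K) x)^2 -->
   cmod (case (t, x) of (t, x) => \<phi> (rad l L t x, modes_proj K x)) < e" by auto
qed

text \<open>Continuity at \<open>r = 0\<close>: the factor \<open>g / r\<close> is bounded and the odd part tends to \<open>0\<close> there.\<close>

lemma C0_rad_odd:
 assumes KL: "good K" "good L" and \<phi>: "C0 K \<phi>" and z: "!!y. \<phi> (0, y) = 0"
  and g: "continuous_on (UNIV \<times> modes (L Un K)) g" "!!t x. \<bar>g (t, x)\<bar> <= rad l L t x"
 shows "C0 (L Un K) (%(t, x). complex_of_real (inverse (rad l L t x) * g (t, x)) * \<phi> (rad l L t x, modes_proj K x))"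
  (is "C0 _ ?f")
proof -
 let ?M = "L Un K"
 have M: "good ?M" using KL by simp
 note C = C0_rad[OF KL \<phi>, of l]
 let ?\<psi> = "%(t, x). \<phi> (rad l L t x, modes_proj K x)"
 have le: "cmod (?f p) <= cmod (?\<psi> p)" for p
 proof (cases p)
  case (Pair t x)
  have "\<bar>inverse (rad l L t x) * g (t, x)\<bar> <= 1"
   using g(2)[of t x] rad_nonneg[of l L t x] by (cases "rad l L t x = 0") (auto simp: abs_mult field_simps)
  then show ?thesis unfolding Pair by (simp add: norm_mult mult_left_le_one_le del: of_real_mult)
 qed
 have "continuous_on (UNIV \<times> modes ?M) ?f"
  unfolding continuous_on_def
 proof
  fix p :: "real \<times> (real => real)" assume p: "p \<in> UNIV \<times> modes ?M"
  let ?A = "at p within UNIV \<times> modes ?M"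
  have c\<psi>: "(?\<psi> \<longlongrightarrow> ?\<psi> p) ?A"
   using C0_cont[OF C] p unfolding continuous_on_def by blast
  have cr: "((%p. rad l L (fst p) (snd p)) \<longlongrightarrow> rad l L (fst p) (snd p)) ?A"
   using continuous_rad[OF KL(2) M] p unfolding continuous_on_def by blast
  have cg: "(g \<longlongrightarrow> g p) ?A"
   using g(1) p unfolding continuous_on_def by blast
  show "(?f \<longlongrightarrow> ?f p) ?A"
  proof (cases "rad l L (fst p) (snd p) = 0")
   case True
   then have 0: "?\<psi> p = 0" "?f p = 0" by (simp_all add: case_prod_unfold z)
   have "((%p. cmod (?\<psi> p)) \<longlongrightarrow> 0) ?A"
    using c\<psi> unfolding 0 by (rule tendsto_norm_zero)
   then have "(?f \<longlongrightarrow> 0) ?A"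
    by (rule Lim_null_comparison[rotated]) (rule always_eventually, intro allI le)
   then show ?thesis unfolding 0 .
  next
   case False
   have "((%p. complex_of_real (inverse (rad l L (fst p) (snd p)) * g p) * ?\<psi> p) \<longlongrightarrow>
     complex_of_real (inverse (rad l L (fst p) (snd p)) * g p) * ?\<psi> p) ?A"
    using False by (intro tendsto_intros cr cg c\<psi>)
   then show ?thesis by (simp add: case_prod_unfold)
  qed
 qed
 then show ?thesis
  unfolding C0_def
 proof (intro conjI allI impI)
  fix e :: real assume "e > 0"
  from C0_tail[OF C this] show "EX R. ALL t. ALL x:modes ?M. R < t^2 + (modes_norm ?M x)^2 --> cmod (?f (t, x)) < e"
   using le by (meson le_less_trans)
 qed
qed

lemma cf_vect_mult: "finite A ==> cf (vect A r * a) S = (\<Sum>i\<in>A. of_real (r i) * cf (gen i * a) S)"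
 by (simp add: vect_def sum_distrib_right)

lemma SC_bet:
 assumes KL: "good K" "good L" and F: "F \<in> SCc K"
 shows "bet l K L F \<in> SCc (L Un K)"
proof (rule SC_I)
 show M: "good (L Un K)" using KL by simp
 show "bet l K L F (t, x) = cf (bet_cl l K L F t x)" if "x \<in> modes (L Un K)" for t x
  using that by (simp add: bet_def)
 show "bet l K L F (t, x) = (%S. 0)" if "x ~: modes (L Un K)" for t x
  using that by (simp add: bet_def)
 have sub: "idx K <= idx (L Un K)" "idx L <= idx (L Un K)" by (auto simp: idx_Un)
 show "cin (idx (L Un K)) (bet_cl l K L F t x)" for t x
  unfolding bet_cl_def Let_def cvec_def
  by (intro cin_add cin_mult cin_scaleR cin_1 cin_vect sub cin_mono[OF cin_Evn[OF KL(1) F] sub(1)] cin_mono[OF cin_Odn[OF KL(1) F] sub(1)])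
 fix S
 have CE: "C0 K (%(t, x). cf (Evn F t x) S)" and CO: "C0 K (%(t, x). cf (Odn F t x) S)" for S
  using C0_cmul[OF C0_add[OF C0_atc[OF KL(1) F, of S] C0_atc_neg[OF KL(1) F, of S]], of "1/2"]
   C0_cmul[OF C0_diff[OF C0_atc[OF KL(1) F, of S] C0_atc_neg[OF KL(1) F, of S]], of "1/2"]
  by (simp_all add: Evn_def Odn_def case_prod_unfold)
 have CE': "C0 (L Un K) (%(t, x). cf (Evn F (rad l L t x) (modes_proj K x)) S)"
  using C0_rad[OF KL CE] by simp
 have g1: "C0 (L Un K) (%(t, x). complex_of_real (inverse (rad l L t x) * t) * cf (Odn F (rad l L t x) (modes_proj K x)) S)"
  using C0_rad_odd[OF KL CO, where g = fst and l = l and S1 = S] abs_le_rad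
  by (simp add: continuous_on_fst continuous_on_id zero_cl.rep_eq)
 have ccrd: "continuous_on (UNIV \<times> modes (L Un K)) (%p. crd i (snd p))" for i
  by (rule continuous_on_compose2[OF continuous_on_crd[of "L Un K" i]])
   (use goodD[OF M] in "auto intro: continuous_on_snd continuous_on_id")
 have g2: "C0 (L Un K) (%(t, x). complex_of_real (inverse (rad l L t x) * (wt l i * crd i x)) * cf (Odn F (rad l L t x) (modes_proj K x)) S)"
  if i: "i \<in> idx L" for i S
  using C0_rad_odd[OF KL CO, where g = "%p. wt l i * crd i (snd p)" and l = l and S1 = S] crd_le_rad[OF goodD(1)[OF KL(2)] i]
  by (simp add: continuous_on_mult_left ccrd)
 have e: "cf (bet_cl l K L F t x) S = cf (Evn F (rad l L t x) (modes_proj K x)) S +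
   complex_of_real (inverse (rad l L t x) * t) * cf (Odn F (rad l L t x) (modes_proj K x)) S +
   (\<Sum>i\<in>idx L. cliff_sign {i} (sym_diff {i} S) * (complex_of_real (inverse (rad l L t x) * (wt l i * crd i x)) *
    cf (Odn F (rad l L t x) (modes_proj K x)) (sym_diff {i} S)))" for t x
  unfolding bet_cl_def Let_def cvec_def using KL
  by (simp add: scaleR_add_right distrib_right cf_vect_mult goodD cf_gen_mult sum_distrib_left mult.assoc mult.left_commute)
 have "C0 (L Un K) (%p. cf (Evn F (rad l L (fst p) (snd p)) (modes_proj K (snd p))) S +
   complex_of_real (inverse (rad l L (fst p) (snd p)) * (fst p)) * cf (Odn F (rad l L (fst p) (snd p)) (modes_proj K (snd p))) S +
   (\<Sum>i\<in>idx L. cliff_sign {i} (sym_diff {i} S) * (complex_of_real (inverse (rad l L (fst p) (snd p)) * (wt l i * crd i (snd p))) *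
    cf (Odn F (rad l L (fst p) (snd p)) (modes_proj K (snd p))) (sym_diff {i} S))))"
  by (intro C0_add C0_sum C0_cmul CE'[unfolded case_prod_unfold] g1[unfolded case_prod_unfold] g2[unfolded case_prod_unfold])
 then show "C0 (L Un K) (%(t, x). cf (bet_cl l K L F t x) S)" unfolding e by (simp only: case_prod_unfold)
qed

section \<open>Density of the resolvents\<close>

inductive rpoly :: "(real => complex) => bool" where
 res: "z \<in> {\<i>, - \<i>} ==> rpoly (%s. 1 / (of_real s + z))"
| add: "rpoly f ==> rpoly g ==> rpoly (%s. f s + g s)"
| mul: "rpoly f ==> rpoly g ==> rpoly (%s. f s * g s)"
| scl: "rpoly f ==> rpoly (%s. c * f s)"

text \<open>The Cayley transform identifies \<open>\<real>\<close> with the unit circle without \<open>1\<close>; resolvents become polynomials in \<open>zet\<close> and its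
 conjugate, and \<open>cay\<close> inverts it.\<close>

definition zet :: "real => complex" where "zet s = (of_real s - \<i>) / (of_real s + \<i>)"
definition cay :: "complex => real" where "cay z = Re (\<i> * (1 + z) / (1 - z))"

lemma si_nz: "complex_of_real s + \<i> ~= 0" "complex_of_real s - \<i> ~= 0"
 by (auto simp: complex_eq_iff)

lemma zet_eq: "zet s = 1 - 2 * \<i> * (1 / (of_real s + \<i>))"
 using si_nz by (simp add: zet_def field_simps)

lemma norm_zet: "cmod (zet s) = 1"
proof -
 have "cmod (of_real s - \<i>) = cmod (of_real s + \<i>)" by (simp add: cmod_def)
 then show ?thesis using si_nz by (simp add: zet_def norm_divide)
qed

lemma zet_ne_1: "zet s ~= 1"
 using si_nz by (simp add: zet_eq)

lemma cay_zet: "cay (zet s) = s"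
proof -
 have "\<i> * (1 + zet s) / (1 - zet s) = of_real s"
  using si_nz[of s] zet_ne_1[of s] by (simp add: zet_def field_simps)
 then show ?thesis by (simp add: cay_def)
qed

lemma zet_cay:
 assumes z: "cmod z = 1" "z ~= 1" shows "zet (cay z) = z"
proof -
 have n: "1 - z ~= 0" using z by auto
 have "z * cnj z = 1" using z by (simp add: complex_norm_square[symmetric])
 moreover from this have nz: "z ~= 0" by auto
 ultimately have c: "cnj z = 1 / z" by (simp add: field_simps)
 have "cnj (\<i> * (1 + z) / (1 - z)) = - \<i> * (1 + 1 / z) / (1 - 1 / z)" by (simp add: c)
 also have "... = \<i> * (1 + z) / (1 - z)" using nz n by (simp add: field_simps)
 finally have "\<i> * (1 + z) / (1 - z) \<in> \<real>" by (simp add: Reals_cnj_iff)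
 then have e: "complex_of_real (cay z) = \<i> * (1 + z) / (1 - z)" by (simp add: cay_def)
 have "of_real (cay z) - \<i> = 2 * \<i> * z / (1 - z)" "of_real (cay z) + \<i> = 2 * \<i> / (1 - z)"
  unfolding e using n by (simp_all add: field_simps)
 then show ?thesis using n by (simp add: zet_def)
qed

lemma dist_zet: "(dist (zet s) 1)^2 = 4 / (s^2 + 1)"
proof -
 have "dist (zet s) 1 = 2 / cmod (of_real s + \<i>)"
  by (simp add: zet_eq dist_norm norm_mult norm_divide)
 then show ?thesis by (simp add: cmod_power2 power_divide)
qed

lemma S_alg_sel [simp]: "zer S_alg = (%t. 0)" "add S_alg = (%f g t. f t + g t)" "scl S_alg = (%c f t. c * f t)"
 "mul S_alg = (%f g t. f t * g t)" "str S_alg = (%f t. cnj (f t))" "nrm S_alg = (%f. SUP t. cmod (f t))"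
 "gra S_alg = (%f t. f (- t))"
 by (simp_all add: S_alg_def)

lemma car_S: "f \<in> car S_alg \<longleftrightarrow> continuous_on UNIV f & (f \<longlongrightarrow> 0) at_infinity"
 by (simp add: S_alg_def)

lemma S_tailE:
 assumes "f \<in> car S_alg" "e > 0" obtains R where "!!t. \<bar>t\<bar> > R ==> cmod (f t) < e"
proof -
 have "\<forall>\<^sub>F t in at_infinity. dist (f t) 0 < e" using assms by (auto simp: car_S tendsto_iff)
 then obtain b where "ALL t. norm t >= b --> dist (f t) 0 < e" unfolding eventually_at_infinity by blast
 then show ?thesis by (intro that[of b]) simp
qed

lemma continuous_cayley:
 assumes f: "f \<in> car S_alg"
 shows "continuous_on (sphere 0 1) (%z. if z = 1 then 0 else f (cay z))"
 unfolding continuous_on_def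
proof
 fix z0 :: complex assume z0: "z0 \<in> sphere 0 1"
 let ?F = "%z. if z = 1 then 0 else f (cay z)"
 let ?A = "at z0 within sphere 0 1"
 show "(?F \<longlongrightarrow> ?F z0) ?A"
 proof (cases "z0 = 1")
  case False
  have "continuous_on (- {1}) (%z. f (cay z))"
   by (rule continuous_on_compose2[of UNIV f]) (use f in "auto simp: car_S cay_def intro!: continuous_intros")
  then have "isCont (%z. f (cay z)) z0" using False by (simp add: continuous_on_eq_continuous_at open_Compl)
  then have "((%z. f (cay z)) \<longlongrightarrow> f (cay z0)) ?A"
   using continuous_at_imp_continuous_at_within continuous_within by blast
  moreover have "\<forall>\<^sub>F z in ?A. z ~= 1"
   unfolding eventually_at using False
   by (intro exI[of _ "dist z0 1"]) (auto simp: dist_commute)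
  then have "\<forall>\<^sub>F z in ?A. f (cay z) = ?F z" by eventually_elim simp
  ultimately show ?thesis using False by (simp add: tendsto_cong)
 next
  case True
  have "\<forall>\<^sub>F z in ?A. dist (?F z) 0 < e" if e: "e > 0" for e
  proof -
   obtain R where R: "!!t. \<bar>t\<bar> > R ==> cmod (f t) < e" by (rule S_tailE[OF f e]) blast
   let ?d = "sqrt (4 / (R^2 + 1))"
   have d: "?d > 0" by (simp add: add_nonneg_pos)
   have "dist (?F z) 0 < e" if z: "z \<in> sphere 0 1" "dist z 1 < ?d" for z
   proof (cases "z = 1")
    case False
    let ?s = "cay z"
    have zs: "z = zet ?s" using zet_cay[of z] z False by simp
    have "(dist z 1)^2 < ?d\<^sup>2" using z(2) by (intro power_strict_mono) auto
    then have "4 / (?s\<^sup>2 + 1) < 4 / (R^2 + 1)" using dist_zet[of ?s] zs by simp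
    moreover have "4 / (R^2 + 1) <= 4 / (?s\<^sup>2 + 1)" if "?s\<^sup>2 <= R^2"
     using that by (intro divide_left_mono) (auto simp: add_nonneg_pos)
    ultimately have "R^2 < ?s\<^sup>2" by linarith
    then have "\<bar>R\<bar> < \<bar>?s\<bar>" by (metis power2_abs power2_less_imp_less abs_ge_zero)
    then have "cmod (f ?s) < e" by (intro R) auto
    then show ?thesis using False by simp
   qed (use e in simp)
   then show ?thesis unfolding eventually_at True using d by blast
  qed
  then show ?thesis using True by (simp add: tendsto_iff)
 qed
qed

lemma rpoly_real_poly:
 assumes "real_polynomial_function h"
 shows "EX g. rpoly g & (ALL s. complex_of_real (h (zet s)) = of_real (h 1) + g s)"
 using assms
proof (induction h rule: real_polynomial_function.induct)
 case (linear h)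
 then interpret h: bounded_linear h .
 have h: "h z = Re z * h 1 + Im z * h \<i>" for z
 proof -
  have "z = Re z *\<^sub>R 1 + Im z *\<^sub>R \<i>" by (simp add: complex_eq_iff)
  then show ?thesis by (metis h.add h.scaleR real_scaleR_def)
 qed
 let ?p = "%s. 1 / (complex_of_real s + \<i>)" and ?m = "%s. 1 / (complex_of_real s + (- \<i>))"
 let ?g = "%s. (- \<i> * h 1 - h \<i>) * ?p s + (\<i> * h 1 - h \<i>) * ?m s"
 have "rpoly ?g" by (intro rpoly.add rpoly.scl rpoly.res) auto
 moreover have "complex_of_real (h (zet s)) = of_real (h 1) + ?g s" for s
 proof -
  have c: "cnj (zet s) = 1 + 2 * \<i> * ?m s" by (simp add: zet_eq)
  have re: "complex_of_real (Re (zet s)) = (zet s + cnj (zet s)) / 2" and im: "complex_of_real (Im (zet s)) = (zet s - cnj (zet s)) / (2 * \<i>)"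
   by (simp_all add: complex_eq_iff)
  have "complex_of_real (h (zet s)) = (zet s + cnj (zet s)) / 2 * h 1 + (zet s - cnj (zet s)) / (2 * \<i>) * h \<i>"
   unfolding h[of "zet s"] of_real_add of_real_mult re im ..
  also have "... = of_real (h 1) + ?g s"
  proof -
   have "((1 - 2 * \<i> * p) + (1 + 2 * \<i> * m)) / 2 * a + ((1 - 2 * \<i> * p) - (1 + 2 * \<i> * m)) / (2 * \<i>) * b =
    a + ((- \<i> * a - b) * p + (\<i> * a - b) * m)" for p m a b :: complex
    by (simp add: field_simps)
   then show ?thesis unfolding c unfolding zet_eq .
  qed
  finally show ?thesis .
 qed
 ultimately show ?case by (intro exI[of _ ?g] conjI allI)
next
 case (const c)
 have "rpoly (%s. 0 * (1 / (of_real s + \<i>)))" by (intro rpoly.scl rpoly.res) simp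
 then show ?case by (intro exI[of _ "%s. 0 * (1 / (of_real s + \<i>))"]) simp
next
 case (add h k)
 then obtain g g' where "rpoly g" "rpoly g'" "!!s. complex_of_real (h (zet s)) = of_real (h 1) + g s"
  "!!s. complex_of_real (k (zet s)) = of_real (k 1) + g' s" by metis
 then show ?case by (intro exI[of _ "%s. g s + g' s"]) (auto intro: rpoly.add)
next
 case (mult h k)
 then obtain g g' where g: "rpoly g" "rpoly g'" "!!s. complex_of_real (h (zet s)) = of_real (h 1) + g s"
  "!!s. complex_of_real (k (zet s)) = of_real (k 1) + g' s" by metis
 have "rpoly (%s. (of_real (h 1) * g' s + of_real (k 1) * g s) + g s * g' s)" using g by (intro rpoly.intros)
 then show ?case using g by (intro exI[of _ "%s. (of_real (h 1) * g' s + of_real (k 1) * g s) + g s * g' s"]) (simp add: algebra_simps)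
qed

text \<open>A function in \<open>C\<^sub>0(\<real>)\<close> extends continuously to the circle with value \<open>0\<close> at \<open>1\<close>.  By Stone-Weierstrass it is close to a
 polynomial in the real and imaginary parts, and subtracting its value at \<open>1\<close> makes that a combination of products of
 resolvents without constant term.\<close>

lemma rpoly_dense:
 assumes f: "f \<in> car S_alg" and e: "e > 0"
 shows "EX g. rpoly g & (ALL s. cmod (f s - g s) <= e)"
proof -
 let ?F = "%z. if z = 1 then 0 else f (cay z)"
 have "EX g. polynomial_function g & (ALL z:sphere 0 1. norm (?F z - g z) < e / 2)"
  using e by (intro Stone_Weierstrass_polynomial_function continuous_cayley f) auto
 then obtain p where p: "polynomial_function p" and pe: "!!z. cmod z = 1 ==> cmod (?F z - p z) < e / 2" by auto
 have "real_polynomial_function (Re \<circ> p)" "real_polynomial_function (Im \<circ> p)"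
  using p bounded_linear_Re bounded_linear_Im unfolding polynomial_function_def by blast+
 from this[THEN rpoly_real_poly] obtain g g' where g: "rpoly g" "rpoly g'"
  "!!s. complex_of_real (Re (p (zet s))) = of_real (Re (p 1)) + g s"
  "!!s. complex_of_real (Im (p (zet s))) = of_real (Im (p 1)) + g' s" by auto
 let ?g = "%s. g s + \<i> * g' s"
 have "p (zet s) = p 1 + ?g s" for s
 proof -
  have "p (zet s) = of_real (Re (p (zet s))) + \<i> * of_real (Im (p (zet s)))" by (rule complex_eq)
  also have "... = (of_real (Re (p 1)) + \<i> * of_real (Im (p 1))) + ?g s" unfolding g(3,4) by (simp add: algebra_simps)
  also have "of_real (Re (p 1)) + \<i> * of_real (Im (p 1)) = p 1" by (rule complex_eq[symmetric])
  finally show ?thesis .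
 qed
 note pz = this
 have "cmod (f s - ?g s) <= e" for s
 proof -
  have "cmod (f s - p (zet s)) < e / 2" using pe[OF norm_zet[of s]] zet_ne_1[of s] by (simp add: cay_zet)
  moreover have "cmod (p 1) < e / 2" using pe[of 1] by simp
  moreover have "f s - ?g s = (f s - p (zet s)) + p 1" by (simp add: pz)
  then have "cmod (f s - ?g s) <= cmod (f s - p (zet s)) + cmod (p 1)" by (metis norm_triangle_ineq)
  ultimately show ?thesis by linarith
 qed
 moreover have "rpoly ?g" using g by (intro rpoly.add rpoly.scl)
 ultimately show ?thesis by (intro exI[of _ ?g]) blast
qed

lemma S_res: assumes "z \<in> {\<i>, - \<i>}" shows "(%s. 1 / (complex_of_real s + z)) \<in> car S_alg"
 unfolding car_S
proof
 have nz: "complex_of_real s + z ~= 0" for s using assms by (auto simp: complex_eq_iff)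
 show "continuous_on UNIV (%s. 1 / (complex_of_real s + z))" using nz by (intro continuous_intros) auto
 show "((%s. 1 / (complex_of_real s + z)) \<longlongrightarrow> 0) at_infinity"
 proof (rule tendsto_norm_zero_cancel, rule Lim_null_comparison)
  show "((%s. norm (inverse s)) \<longlongrightarrow> 0) (at_infinity :: real filter)"
   by (intro tendsto_norm_zero tendsto_inverse_0)
  have "norm (norm (1 / (complex_of_real s + z))) <= norm (inverse s)" if "s ~= 0" for s :: real
  proof -
   have "\<bar>s\<bar> <= cmod (of_real s + z)" using abs_Re_le_cmod[of "of_real s + z"] assms by auto
   then show ?thesis using that nz[of s] by (simp add: norm_divide norm_inverse field_simps)
  qed
  moreover have "\<forall>\<^sub>F s in (at_infinity :: real filter). s ~= 0"
   unfolding eventually_at_infinity by (intro exI[of _ 1]) auto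
  ultimately show "\<forall>\<^sub>F s in at_infinity. norm (norm (1 / (complex_of_real s + z))) <= norm (inverse s)"
   by (auto elim: eventually_mono)
 qed
qed

lemma S_bounded: assumes "f \<in> car S_alg" obtains B where "!!t. cmod (f t) <= B"
proof -
 obtain R where R: "!!t. \<bar>t\<bar> > R ==> cmod (f t) < 1" by (rule S_tailE[OF assms, of 1]) auto
 have "compact (f ` {-R..R})"
  using assms by (intro compact_continuous_image) (auto simp: car_S intro: continuous_on_subset)
 then obtain B where B: "ALL y:f ` {-R..R}. cmod y <= B" using compact_imp_bounded bounded_iff by blast
 have "cmod (f t) <= max B 1" for t
 proof (cases "\<bar>t\<bar> > R")
  case False
  then have "t \<in> {-R..R}" by auto
  then show ?thesis using B by (auto simp: le_max_iff_disj)
 qed (use R[of t] in auto)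
 then show ?thesis by (rule that)
qed

lemma S_norm_ge: "f \<in> car S_alg ==> cmod (f t) <= nrm S_alg f"
proof -
 assume "f \<in> car S_alg"
 then obtain B where "!!t. cmod (f t) <= B" by (rule S_bounded) blast
 then have "bdd_above (range (%t. cmod (f t)))" by (intro bdd_aboveI2) blast
 then show ?thesis unfolding S_alg_sel by (intro cSUP_upper) auto
qed

lemma S_norm_le: "(!!t. cmod (f t) <= B) ==> nrm S_alg f <= B"
 unfolding S_alg_sel by (rule cSUP_least) auto

lemma S_add: "f \<in> car S_alg ==> g \<in> car S_alg ==> (%t. f t + g t) \<in> car S_alg"
 by (auto simp: car_S intro: continuous_intros tendsto_add_zero)

lemma S_mul: "f \<in> car S_alg ==> g \<in> car S_alg ==> (%t. f t * g t) \<in> car S_alg"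
 by (auto simp: car_S intro: continuous_intros tendsto_mult_zero)

lemma S_scl: "f \<in> car S_alg ==> (%t. c * f t) \<in> car S_alg"
 by (auto simp: car_S intro: continuous_intros tendsto_mult_right_zero)

lemma rpoly_S: "rpoly f ==> f \<in> car S_alg"
 by (induction rule: rpoly.induct) (auto intro: S_res S_add S_mul S_scl simp del: insert_iff)

section \<open>Functoriality of the connecting map, and elementary tensors\<close>

lemma bet_star_hom:
 assumes KL: "good K" "good L" "K Int L = {}"
 shows "star_hom (SC K) (SC (L Un K)) (bet l K L)" and "graded_map (SC K) (SC (L Un K)) (bet l K L)"
  and "!!F. F \<in> SCc K ==> sc_norm (L Un K) (bet l K L F) <= sc_norm K F"
proof -
 have M: "good (L Un K)" using KL by simp
 note B = SC_bet[OF KL(1,2), of _ l] and K = KL(1)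
 note clK = SC_add[OF K] SC_scl[OF K] SC_mul[OF K] SC_star[OF K] SC_gra[OF K, simplified]
 note clM = SC_add[OF M] SC_scl[OF M] SC_mul[OF M] SC_star[OF M] SC_gra[OF M, simplified]
 note hK = H_add[OF K] H_scl[OF K] H_mul[OF K] H_star[OF K]
 note hM = H_add[OF M] H_scl[OF M] H_mul[OF M] H_star[OF M]
 have le: "sc_norm (L Un K) (bet l K L F) <= sc_norm K F" if F: "F \<in> SCc K" for F
 proof (rule sc_norm_leI_nonneg[OF M B[OF F]])
  fix t :: real and x assume x: "x \<in> modes (L Un K)" and t: "0 <= t"
  obtain w where w: "adj w * w = 1" "w * adj w = 1"
   "!!F. F \<in> SCc K ==> H (bet l K L F) t x = w * H F (rad l L t x) (modes_proj K x) * adj w"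
   by (rule H_bet_conj[OF KL t x]) blast
  show "norm (H (bet l K L F) t x) <= sc_norm K F"
   unfolding w(3)[OF F] norm_conj_unitary[OF w(1,2)] using K by (intro norm_H_le F) auto
 qed
 then show "!!F. F \<in> SCc K ==> sc_norm (L Un K) (bet l K L F) <= sc_norm K F" .
 have conj: "bet l K L F = G" if "F \<in> SCc K" "G \<in> SCc (L Un K)"
  "!!t x w. adj w * w = 1 ==> w * adj w = 1 ==> x \<in> modes (L Un K) ==>
   (!!F. F \<in> SCc K ==> H (bet l K L F) t x = w * H F (rad l L t x) (modes_proj K x) * adj w) ==>
   w * H F (rad l L t x) (modes_proj K x) * adj w = H G t x" for F G
 proof (rule SC_eqI_nonneg[OF M B])
  fix t :: real and x assume x: "x \<in> modes (L Un K)" and t: "0 <= t"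
  obtain w where w: "adj w * w = 1" "w * adj w = 1"
   "!!F. F \<in> SCc K ==> H (bet l K L F) t x = w * H F (rad l L t x) (modes_proj K x) * adj w"
   by (rule H_bet_conj[OF KL t x]) blast
  show "H (bet l K L F) t x = H G t x" using that(3)[OF w(1,2) x w(3)] w(3)[OF that(1)] by simp
 qed (use that in auto)
 have cc: "cs c * a * b = cs c * (a * b)" "a * (cs c * b) = cs c * (a * b)" for a b c
  by (metis cs_commute mult.assoc)+
 show "star_hom (SC K) (SC (L Un K)) (bet l K L)"
  unfolding star_hom_def linear_map_def SC_sel
 proof (intro conjI ballI allI)
  fix F G c assume F: "F \<in> SCc K" "G \<in> SCc K"
  show "bet l K L (%p S. F p S + G p S) = (%p S. bet l K L F p S + bet l K L G p S)"
   using F by (intro conj) (simp_all add: clK clM B hK hM algebra_simps)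
  show "bet l K L (sc_mult F G) = sc_mult (bet l K L F) (bet l K L G)"
  proof (intro conj clK clM B F)
   fix t x w
   assume w: "adj w * w = 1" "!!F. F \<in> SCc K ==> H (bet l K L F) t x = w * H F (rad l L t x) (modes_proj K x) * adj w"
   have "adj w * (w * z) = z" for z using w(1) by (simp flip: mult.assoc)
   then show "w * H (sc_mult F G) (rad l L t x) (modes_proj K x) * adj w = H (sc_mult (bet l K L F) (bet l K L G)) t x"
    using F by (simp add: hK hM B w(2) mult.assoc)
  qed
 next
  fix F c assume F: "F \<in> SCc K"
  show "bet l K L F \<in> SCc (L Un K)" by (rule B[OF F])
  show "sc_norm (L Un K) (bet l K L F) <= sc_norm K F" by (rule le[OF F])
  show "bet l K L (%p S. c * F p S) = (%p S. c * bet l K L F p S)"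
   using F by (intro conj) (simp_all add: clK clM B hK hM cc)
  show "bet l K L (sc_star F) = sc_star (bet l K L F)"
   using F by (intro conj) (simp_all add: clK clM B hK hM adj_mult mult.assoc)
 qed
 show "graded_map (SC K) (SC (L Un K)) (bet l K L)"
  unfolding graded_map_def
 proof
  fix F assume F: "F \<in> SCc K"
  show "bet l K L (gra (SC K) F) = gra (SC (L Un K)) (bet l K L F)"
  proof (rule SC_eqI_nonneg[OF M B[OF SC_gra[OF K F]] SC_gra[OF M B[OF F]]])
   fix t :: real and x assume x: "x \<in> modes (L Un K)"
   have "Evn (gra (SC K) F) r y = par (Evn F r y)" "Odn (gra (SC K) F) r y = - par (Odn F r y)" for r y
    unfolding Evn_def Odn_def atc_gra[OF K F] by (simp_all add: par_scaleR par_add par_diff algebra_simps)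
   then show "H (bet l K L (gra (SC K) F)) t x = H (gra (SC (L Un K)) (bet l K L F)) t x"
    unfolding H_gra[OF M B[OF F]] H_bet[OF x] by (simp add: par_add par_mult)
  qed
 qed
qed

lemma rad_uvec: assumes "good L" shows "rad l L t x *\<^sub>R uvec l L t x = t *\<^sub>R gen 0 + cvec l L x"
proof (cases "rad l L t x = 0")
 case True
 then have "t^2 + csq l L x = 0" by (metis rad_sq zero_power2)
 then have "t = 0" "csq l L x = 0" using csq_nonneg[of l L x] zero_le_power2[of t] by (auto simp: add_nonneg_eq_0_iff)
 moreover have "norm (cvec l L x) = sqrt (csq l L x)" using assms by (simp add: cvec_def csq_def norm_vect goodD)
 ultimately show ?thesis using True by simp
qed (simp add: uvec_def)

lemma csq_Un: "good K ==> good L ==> K Int L = {} ==> csq l (K Un L) x = csq l K x + csq l L x"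
 unfolding csq_def idx_Un by (intro sum.union_disjoint) (auto simp: goodD idx_disjoint)

lemma cvec_Un: "good K ==> good L ==> K Int L = {} ==> cvec l (K Un L) x = cvec l K x + cvec l L x"
 unfolding cvec_def vect_def idx_Un by (intro sum.union_disjoint) (auto simp: goodD idx_disjoint)

lemma csq_proj_sub: "good K ==> L <= K ==> csq l L (modes_proj K x) = csq l L x"
 unfolding csq_def by (intro sum.cong refl) (auto simp: idx_def intro!: arg_cong[where f = "%r. (wt l _ * r)^2"] crd_modes_proj)

lemma cvec_proj_sub: "good K ==> L <= K ==> cvec l L (modes_proj K x) = cvec l L x"
 unfolding cvec_def vect_def by (intro sum.cong refl) (auto simp: idx_def intro!: arg_cong[where f = "%r. (wt l _ * r) *\<^sub>R _"] crd_modes_proj)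

lemma bet_EO:
 assumes KL: "good K" "good L" and y: "y \<in> modes (L Un K)"
 shows "Evn (bet l K L F) s y = Evn F (rad l L s y) (modes_proj K y) + (inverse (rad l L s y) *\<^sub>R cvec l L y) * Odn F (rad l L s y) (modes_proj K y)"
  and "Odn (bet l K L F) s y = (inverse (rad l L s y) * s) *\<^sub>R Odn F (rad l L s y) (modes_proj K y)"
 unfolding Evn_def[of "bet l K L F"] Odn_def[of "bet l K L F"] atc_bet[OF y] bet_cl_def Let_def rad_minus
 by (simp_all add: algebra_simps flip: scaleR_add_left)

text \<open>Radii combine as \<open>(t\<^sup>2 + c\<^sup>2) + c'\<^sup>2\<close>, and the radius of the first step times its unit vector is the vector of the combined
 step, so the two formulas agree, also where an intermediate radius vanishes.\<close>

lemma bet_compose: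
 assumes K: "good K" "good L" "good L'" and d: "K Int L = {}" "(L Un K) Int L' = {}" and F: "F \<in> SCc K"
 shows "bet l (L Un K) L' (bet l K L F) = bet l K (L' Un L) F"
proof (rule SC_eqI_nonneg)
 have u: "L' Un L Un K = L' Un (L Un K)" by auto
 show M: "good (L' Un (L Un K))" using K by simp
 show "bet l (L Un K) L' (bet l K L F) \<in> SCc (L' Un (L Un K))"
  by (intro SC_bet good_Un K F)
 show "bet l K (L' Un L) F \<in> SCc (L' Un (L Un K))"
  using SC_bet[of K "L' Un L" F l] K F by (simp add: u)
 fix t :: real and x assume x: "x \<in> modes (L' Un (L Un K))"
 define y r' r where "y = modes_proj (L Un K) x" and "r' = rad l L' t x" and "r = rad l (L' Un L) t x"
 have y: "y \<in> modes (L Un K)" using K by (simp add: y_def)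
 have ry: "rad l L r' y = r"
  unfolding rad_def[of l L] r'_def rad_sq r_def rad_def[of l "L' Un L"] y_def using K d
  by (subst csq_Un) (auto simp: csq_proj_sub algebra_simps)
 have cy: "cvec l L y = cvec l L x" and py: "modes_proj K y = modes_proj K x"
  using K by (simp_all add: y_def cvec_proj_sub modes_proj_proj)
 have "H (bet l (L Un K) L' (bet l K L F)) t x = Evn (bet l K L F) r' y + uvec l L' t x * Odn (bet l K L F) r' y"
  unfolding H_bet[OF x] r'_def y_def ..
 also have "... = Evn F r (modes_proj K x) + (inverse r *\<^sub>R (cvec l L x + r' *\<^sub>R uvec l L' t x)) * Odn F r (modes_proj K x)"
  unfolding bet_EO[OF K(1,2) y] ry cy py by (simp add: algebra_simps)
 also have "cvec l L x + r' *\<^sub>R uvec l L' t x = t *\<^sub>R gen 0 + cvec l (L' Un L) x"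
  unfolding r'_def rad_uvec[OF K(3)] using K d by (subst cvec_Un) (auto simp: algebra_simps)
 also have "Evn F r (modes_proj K x) + (inverse r *\<^sub>R (t *\<^sub>R gen 0 + cvec l (L' Un L) x)) * Odn F r (modes_proj K x) = H (bet l K (L' Un L) F) t x"
  using x by (subst H_bet) (simp_all add: u r_def uvec_def)
 finally show "H (bet l (L Un K) L' (bet l K L F)) t x = H (bet l K (L' Un L) F) t x" .
qed

lemma bet_id:
 assumes K: "good K" and F: "F \<in> SCc K" shows "bet l K {} F = F"
proof (rule SC_eqI_nonneg[OF K])
 show "bet l K {} F \<in> SCc K" using SC_bet[OF K _ F, of "{}" l] by simp
 fix t :: real and x assume x: "x \<in> modes K" and t: "0 <= t"
 have r: "rad l {} t x = t" using t by (simp add: rad_def csq_def)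
 have e: "H (bet l K {} F) t x = Evn F t x + uvec l {} t x * Odn F t x"
  using H_bet[of x "{}" K l F t] x by (simp add: r modes_proj_id K)
 show "H (bet l K {} F) t x = H F t x"
  unfolding e unfolding H_EO by (cases "t = 0") (simp_all add: uvec_def r cvec_def vect_def)
qed (rule F)


lemma Cl_tau_space: "h \<in> Cl_tau K ==> h x \<in> cliff_space K"
 by (cases "x \<in> modes K") (auto simp: Cl_tau_def)

text \<open>A product \<open>f(t) h(x)\<close> vanishes at infinity because each factor is bounded and one of them is small.\<close>

lemma tensor_SC:
 assumes K: "good K" and f: "f \<in> car S_alg" and h: "h \<in> Cl_tau K"
 shows "tensor f h \<in> SCc K"
 unfolding car_SC[OF K]
proof (intro conjI allI ballI impI)
 have hc: "continuous_on (modes K) (%x. h x S)" for S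
  using h by (intro continuous_on_product_then_coordinatewise[of _ h]) (simp add: Cl_tau_def)
 have htail: "EX R. ALL x:modes K. modes_norm K x > R --> cmod (h x S) < e" if "e > 0" for e S
  using h that unfolding Cl_tau_def by fast
 show "tensor f h (t, x) \<in> cliff_space K" for t x
  using Cl_tau_space[OF h, of x] by (auto simp: tensor_def cliff_space_def)
 show "tensor f h (t, x) = (%S. 0)" if "x ~: modes K" for t x
  using h that by (simp add: tensor_def Cl_tau_def)
 fix S
 have nn: "0 <= modes_norm K x" for x using K by (simp add: modes_norm_eq goodD sum_nonneg)
 obtain Bf where Bf: "!!t. cmod (f t) <= Bf" by (rule S_bounded[OF f]) blast
 obtain Bh where Bh: "!!x. x \<in> modes K ==> cmod (h x S) <= Bh"
 proof -
  obtain R where R: "!!x. x \<in> modes K ==> modes_norm K x > R ==> cmod (h x S) < 1"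
   using htail[of 1 S] by auto
  have "continuous_on UNIV (comb K)"
   using continuous_on_comb[of K UNIV "%c. c"] by (simp add: continuous_on_product_coordinates)
  then have "continuous_on (cbx K \<bar>R\<bar>) (%p. comb K (snd p))"
   by (rule continuous_on_compose2) (auto intro: continuous_on_snd continuous_on_id)
  then have "continuous_on (cbx K \<bar>R\<bar>) (%p. h (comb K (snd p)) S)"
   using K by (intro continuous_on_compose2[OF hc]) auto
  then have "compact ((%p. h (comb K (snd p)) S) ` cbx K \<bar>R\<bar>)"
   by (intro compact_continuous_image compact_box)
  then obtain B where B: "ALL z:(%p. h (comb K (snd p)) S) ` cbx K \<bar>R\<bar>. cmod z <= B"
   using compact_imp_bounded bounded_iff by blast
  have "cmod (h x S) <= max B 1" if x: "x \<in> modes K" for x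
  proof (cases "(0, crds K x) \<in> cbx K \<bar>R\<bar>")
   case True
   have "cmod (h (comb K (snd (0::real, crds K x))) S) <= B" using B True by blast
   then show ?thesis by (simp add: comb_crds[OF K x])
  next
   case False
   have "\<bar>R\<bar>\<^sup>2 < (modes_norm K x)^2" using not_box[OF K x False] by simp
   then have "\<bar>R\<bar> < modes_norm K x" using nn[of x] by (rule power2_less_imp_less)
   then have "cmod (h x S) < 1" using R[OF x] by simp
   then show ?thesis by (simp add: le_max_iff_disj)
  qed
  then show ?thesis by (rule that)
 qed
 show "C0 K (%p. tensor f h p S)"
  unfolding C0_def
 proof (intro conjI allI impI)
  have "continuous_on (UNIV \<times> modes K) (%p. f (fst p) * h (snd p) S)"
  proof (rule continuous_on_mult)
   show "continuous_on (UNIV \<times> modes K) (%p. f (fst p))"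
    by (rule continuous_on_compose2[of UNIV f]) (use f in "auto simp: car_S intro: continuous_on_fst continuous_on_id")
   show "continuous_on (UNIV \<times> modes K) (%p. h (snd p) S)"
    by (rule continuous_on_compose2[OF hc]) (auto intro: continuous_on_snd continuous_on_id)
  qed
  then show "continuous_on (UNIV \<times> modes K) (%p. tensor f h p S)" by (simp add: tensor_def case_prod_unfold)
  fix e :: real assume e: "e > 0"
  define Bf' Bh' where "Bf' = \<bar>Bf\<bar> + 1" and "Bh' = \<bar>Bh\<bar> + 1"
  have p: "Bf' > 0" "Bh' > 0" by (auto simp: Bf'_def Bh'_def)
  obtain R1 where R1: "!!t. \<bar>t\<bar> > R1 ==> cmod (f t) < e / Bh'" by (rule S_tailE[OF f, of "e / Bh'"]) (use e p in auto)
  obtain R2 where R2: "!!x. x \<in> modes K ==> modes_norm K x > R2 ==> cmod (h x S) < e / Bf'"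
   using htail[of "e / Bf'" S] e p by auto
  have "cmod (tensor f h (t, x) S) < e" if x: "x \<in> modes K" and r: "nsq K t x > R1\<^sup>2 + R2^2" for t x
  proof (cases "\<bar>t\<bar> > R1")
   case True
   have "cmod (f t * h x S) <= cmod (f t) * Bh'"
    unfolding norm_mult using Bh[OF x] by (intro mult_left_mono) (auto simp: Bh'_def)
   also have "... < e / Bh' * Bh'" using R1[OF True] p by (intro mult_strict_right_mono) auto
   finally show ?thesis using p by (simp add: tensor_def)
  next
   case False
   then have "t^2 <= R1^2" using abs_le_square_iff[of t R1] by auto
   then have "R2^2 < (modes_norm K x)^2" using r by linarith
   then have "R2 < modes_norm K x" using nn[of x] by (rule power2_less_imp_less)
   then have hx: "cmod (h x S) < e / Bf'" by (rule R2[OF x])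
   have "cmod (f t * h x S) <= Bf' * cmod (h x S)"
    unfolding norm_mult using Bf[of t] by (intro mult_right_mono) (auto simp: Bf'_def)
   also have "... < Bf' * (e / Bf')" using hx p by (intro mult_strict_left_mono) auto
   finally show ?thesis using p by (simp add: tensor_def)
  qed
  then show "EX R. ALL t. ALL x:modes K. R < nsq K t x --> cmod (tensor f h (t, x) S) < e" by blast
 qed
qed

inductive tspan :: "nat set => sc => bool" for K where
 zero: "tspan K (%p S. 0)"
| tensor: "f \<in> car S_alg ==> h \<in> Cl_tau K ==> tspan K (tensor f h)"
| add: "tspan K F ==> tspan K G ==> tspan K (%p S. F p S + G p S)"

lemma tspan_SC: "good K ==> tspan K F ==> F \<in> SCc K"
 by (rule tspan.induct[of K F]) (auto intro: SC_zero tensor_SC SC_add)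

lemma tspan_sum: "finite A ==> (!!j. j \<in> A ==> tspan K (F j)) ==> tspan K (%p S. \<Sum>j\<in>A. F j p S)"
 by (induction A rule: finite_induct) (auto intro: tspan.zero tspan.add)

definition tent :: "real => int => real => real" where
 "tent d j t = max 0 (1 - \<bar>t / d - of_int j\<bar>)"

lemma tent_S: assumes d: "d > 0" shows "(%t. complex_of_real (tent d j t)) \<in> car S_alg"
 unfolding car_S
proof
 show "continuous_on UNIV (%t. complex_of_real (tent d j t))"
  unfolding tent_def using d by (intro continuous_intros) auto
 have "tent d j t = 0" if "\<bar>t\<bar> >= d * (\<bar>of_int j\<bar> + 1)" for t
 proof -
  have "\<bar>t / d\<bar> >= \<bar>of_int j\<bar> + 1" using that d by (simp add: abs_div field_simps)
  then show ?thesis unfolding tent_def by linarith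
 qed
 then have "\<forall>\<^sub>F t in at_infinity. complex_of_real (tent d j t) = 0"
  unfolding eventually_at_infinity by (intro exI[of _ "d * (\<bar>of_int j\<bar> + 1)"]) auto
 then show "((%t. complex_of_real (tent d j t)) \<longlongrightarrow> 0) at_infinity" by (rule tendsto_eventually)
qed

text \<open>Piecewise linear interpolation in \<open>t\<close> on a fine grid is a finite sum of tensors, and uniform continuity bounds the
 error.\<close>

lemma tspan_dense:
 assumes K: "good K" and F: "F \<in> SCc K" and e: "e > 0"
 shows "EX G. tspan K G & sc_norm K (%p S. F p S - G p S) <= e"
proof -
 define e' where "e' = e / (2 * dimc K)"
 have dK: "dimc K > 0" by (simp add: dimc_def)
 then have e': "e' > 0" using e by (simp add: e'_def)
 obtain d where d: "d > 0" and du: "!!t t' x x'. x \<in> modes K ==> x' \<in> modes K ==> \<bar>t - t'\<bar> <= d ==>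
  (!!i. i \<in> idx K ==> \<bar>crd i x - crd i x'\<bar> <= d) ==> norm (atc F t x - atc F t' x') <= e'"
  by (rule atc_uniform[OF K F e']) blast
 have unif: "cmod (F (t, x) S - F (t', x) S) <= e'" if "x \<in> modes K" "\<bar>t - t'\<bar> <= d" for t t' x S
  using cmod_cf_le_norm[of "atc F t x - atc F t' x" S] du[OF that(1,1,2)] d by (simp add: cf_atc[OF K F])
 obtain r where r: "!!t x S. x \<in> modes K ==> nsq K t x > r ==> cmod (F (t, x) S) < e'"
  by (rule SC_tail[OF F e']) blast
 have sq: "r < s^2" if "\<bar>r\<bar> + 1 < \<bar>s\<bar>" for r s :: real
  using that abs_le_square_iff[of "\<bar>r\<bar> + 1" s] mult_mono[of 1 "\<bar>r\<bar> + 1" "\<bar>r\<bar> + 1" "\<bar>r\<bar> + 1"] by (simp add: power2_eq_square)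
 define R where "R = \<bar>r\<bar> + 1"
 have R: "cmod (F (t, x) S) < e'" if "x \<in> modes K" "\<bar>t\<bar> > R" for t x S
  using sq[of r t] that(2) zero_le_power2[of "modes_norm K x"] unfolding R_def by (intro r[OF that(1)]) linarith
 define J where "J = \<lceil>\<bar>R\<bar> / d\<rceil>"
 have JR: "\<bar>R\<bar> <= of_int J * d" using le_of_int_ceiling[of "\<bar>R\<bar> / d"] unfolding pos_divide_le_eq[OF d] J_def .
 define G where "G = (%p S. \<Sum>j\<in>{-J..J}. tensor (%t. complex_of_real (tent d j t)) (%x. F (of_int j * d, x)) p S)"
 have hC: "(%x. F (s, x)) \<in> Cl_tau K" for s
 proof -
  have "continuous_on (modes K) (%x. F (s, x))"
  proof (rule continuous_on_compose2[of "UNIV \<times> modes K" F])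
   show "continuous_on (UNIV \<times> modes K) F" using F by (simp add: SC_def)
   show "continuous_on (modes K) (%x. (s, x))" by (intro continuous_on_Pair continuous_on_const continuous_on_id)
  qed auto
  moreover have "EX R. ALL x:modes K. modes_norm K x > R --> (ALL S. cmod (F (s, x) S) < eps)" if ep: "eps > 0" for eps
  proof -
   obtain r where r: "!!t x S. x \<in> modes K ==> nsq K t x > r ==> cmod (F (t, x) S) < eps"
    by (rule SC_tail[OF F ep]) blast
   have "r < s^2 + (modes_norm K x)^2" if "modes_norm K x > \<bar>r\<bar> + 1" for x
    using sq[of r "modes_norm K x"] that zero_le_power2[of s] by linarith
   then show ?thesis using r by blast
  qed
  ultimately show ?thesis unfolding Cl_tau_def using SC_space[OF K F] SC_out[OF K F] by auto
 qed
 have G: "tspan K G" unfolding G_def by (intro tspan_sum tspan.tensor tent_S d hC) auto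
 have D: "(%p S. F p S - G p S) \<in> SCc K" by (intro SC_sub K F tspan_SC G)
 have pt: "cmod (F (t, x) S - G (t, x) S) <= 2 * e'" if x: "x \<in> modes K" for t x S
 proof -
  define n where "n = \<lfloor>t / d\<rfloor>"
  define a where "a = t / d - of_int n"
  have a: "0 <= a" "a < 1" unfolding a_def n_def by linarith+
  have tz: "tent d j t = 0" if "j ~= n" "j ~= n + 1" for j
  proof -
   have "j <= n - 1 \<or> j >= n + 2" using that by linarith
   then have "real_of_int j <= of_int n - 1 \<or> real_of_int j >= of_int n + 2" by linarith
   then show ?thesis using a unfolding tent_def a_def by linarith
  qed
  have t1: "tent d n t = 1 - a" "tent d (n + 1) t = a" using a by (auto simp: tent_def a_def)
  define b where "b j = (if j \<in> {-J..J} then F (of_int j * d, x) S else 0)" for j :: int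
  have "G (t, x) S = (\<Sum>j\<in>{-J..J}. of_real (tent d j t) * b j)"
   unfolding G_def tensor_def by (simp add: b_def)
  also have "... = (\<Sum>j\<in>{-J..J} Un {n, n + 1}. of_real (tent d j t) * b j)"
   by (rule sum.mono_neutral_left) (auto simp: b_def)
  also have "... = (\<Sum>j\<in>{n, n + 1}. of_real (tent d j t) * b j)"
   by (rule sum.mono_neutral_right) (auto simp: tz)
  also have "... = of_real (1 - a) * b n + of_real a * b (n + 1)" by (simp add: t1)
  finally have Gt: "G (t, x) S = of_real (1 - a) * b n + of_real a * b (n + 1)" .
  have bd: "cmod (F (t, x) S - b j) <= 2 * e'" if j: "j = n \<or> j = n + 1" for j
  proof -
   have ta: "t = d * (a + of_int n)" using d by (simp add: a_def)
   have "\<bar>t - of_int j * d\<bar> = d * \<bar>a + of_int n - of_int j\<bar>"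
    using d unfolding ta by (simp add: abs_mult flip: left_diff_distrib mult.commute[of d])
     (metis abs_mult abs_of_pos mult.commute right_diff_distrib)
   also have "... <= d * 1" using j a d by (intro mult_left_mono) auto
   finally have c: "cmod (F (t, x) S - F (of_int j * d, x) S) <= e'" by (intro unif x) simp
   show ?thesis
   proof (cases "j \<in> {-J..J}")
    case True
    then show ?thesis using c e' by (simp add: b_def)
   next
    case False
    then have "of_int \<bar>j\<bar> > real_of_int J" by auto
    then have "R < \<bar>of_int j * d\<bar>" using JR d by (simp add: abs_mult) (smt (verit) mult_right_less_imp_less mult_strict_right_mono)
    then have "cmod (F (of_int j * d, x) S) < e'" by (rule R[OF x])
    then have "cmod (F (t, x) S) <= 2 * e'" using c norm_triangle_ineq2[of "F (t, x) S" "F (of_int j * d, x) S"] by linarith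
    then show ?thesis using False by (auto simp: b_def)
   qed
  qed
  have "F (t, x) S - G (t, x) S = of_real (1 - a) * (F (t, x) S - b n) + of_real a * (F (t, x) S - b (n + 1))"
   unfolding Gt by (simp add: algebra_simps)
  then have "cmod (F (t, x) S - G (t, x) S) <= (1 - a) * cmod (F (t, x) S - b n) + a * cmod (F (t, x) S - b (n + 1))"
   using norm_triangle_ineq[of "of_real (1 - a) * (F (t, x) S - b n)" "of_real a * (F (t, x) S - b (n + 1))"] a
   by (simp add: norm_mult del: of_real_diff)
  also have "... <= (1 - a) * (2 * e') + a * (2 * e')"
   using a by (intro add_mono mult_left_mono bd) auto
  finally show ?thesis by (simp add: algebra_simps)
 qed
 have "sc_norm K (%p S. F p S - G p S) <= dimc K * (2 * e')"
  by (intro sc_norm_leI K D norm_H_le_sup pt)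
 then have "sc_norm K (%p S. F p S - G p S) <= e" using dK by (simp add: e'_def)
 then show ?thesis using G by blast
qed

section \<open>The functional calculus of the Bott-Dirac multiplier\<close>

definition one0 :: "(real => real) => cliff" where
 "one0 = (%x. if x \<in> modes {} then cliff_one else (%S. 0))"

lemma modes_empty: "modes {} = {%th. 0}" by (auto simp: modes_def)

lemma one0_Cl: "one0 \<in> Cl_tau {}"
 unfolding Cl_tau_def
 by (auto simp: one0_def modes_empty cliff_space_def cliff_one_def modes_norm_def intro!: exI[of _ 0])

lemma atc_one0: "x \<in> modes {} ==> atc (tensor f one0) t x = cs (f t)"
 by (rule atc_eqI, rule ext) (auto simp: tensor_def one0_def cliff_one_def cs.rep_eq)

lemma H_one0: "x \<in> modes {} ==> H (tensor f one0) t x = hat (cs (f t)) (cs (f (- t)))"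
 by (simp add: H_def atc_one0)

lemma ev_cs [simp]: "ev (cs c) = cs c" and od_cs [simp]: "od (cs c) = 0"
 by (simp_all add: ev_def od_def flip: scaleR_2)

lemma norm_hat_cs: assumes "cmod a <= B" "cmod b <= B" shows "norm (hat (cs a) (cs b)) <= B"
proof (rule norm_restrict[of "insert 0 {}"])
 show B: "B >= 0" using assms norm_ge_zero[of a] by linarith
 show "cin (insert 0 {}) (hat (cs a) (cs b))" by (intro cin_hat) auto
 fix c assume "cin (insert 0 {}) c"
 then obtain x y where xy: "cin {} x" "cin {} y" "c = hat x y" by (rule hat_surj) auto
 have "2 * (n2 (hat (cs a) (cs b) * hat x y))^2 = (cmod a * n2 x)^2 + (cmod b * n2 y)^2"
  using n2_hat_mult[of "{}" "cs a" "cs b" x y] xy by (simp add: n2_cs)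
 also have "... <= (B * n2 x)^2 + (B * n2 y)^2"
  using assms by (intro add_mono power_mono mult_right_mono) auto
 also have "... = B^2 * ((n2 x)^2 + (n2 y)^2)" by (simp add: power_mult_distrib distrib_left)
 also have "(n2 x)^2 + (n2 y)^2 = 2 * (n2 (hat x y))^2" using n2_hat[of "{}" x y] xy by simp
 also have "B^2 * (2 * (n2 (hat x y))^2) = 2 * (B * n2 (hat x y))^2" by (simp add: power_mult_distrib)
 finally have "(n2 (hat (cs a) (cs b) * hat x y))^2 <= (B * n2 (hat x y))^2" by simp
 then show "n2 (hat (cs a) (cs b) * c) <= B * n2 c" unfolding xy(3) by (rule power2_le_imp_le) (use B in simp)
qed

lemma S_cnj: "f \<in> car S_alg ==> (%t. cnj (f t)) \<in> car S_alg"
 unfolding car_S by (auto intro: continuous_intros) (metis complex_cnj_zero tendsto_cnj)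

lemma one0_star_hom: "star_hom S_alg (SC {}) (%f. tensor f one0)"
 unfolding star_hom_def linear_map_def
proof (intro conjI ballI allI)
 note T = tensor_SC[OF good_simps(1) _ one0_Cl]
 note eq = SC_eqI[OF good_simps(1)]
 fix f g c assume f: "f \<in> car S_alg" and g: "g \<in> car S_alg"
 show "tensor (add S_alg f g) one0 = add (SC {}) (tensor f one0) (tensor g one0)"
  by (simp add: tensor_def fun_eq_iff algebra_simps)
 show "tensor (mul S_alg f g) one0 = mul (SC {}) (tensor f one0) (tensor g one0)"
 proof (rule eq)
  fix t :: real and x assume x: "x \<in> modes {}"
  show "H (tensor (mul S_alg f g) one0) t x = H (mul (SC {}) (tensor f one0) (tensor g one0)) t x"
   using hat_mult[of "{}" "cs (f t)" "cs (f (- t))" "cs (g t)" "cs (g (- t))"]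
   by (simp add: H_mul[OF good_simps(1) T[OF f] T[OF g]] H_one0[OF x] cs_mult)
 qed (use f g in "simp_all add: T S_mul SC_mul")
next
 note T = tensor_SC[OF good_simps(1) _ one0_Cl]
 fix f c assume f: "f \<in> car S_alg"
 show "tensor f one0 \<in> SCc {}" by (rule T[OF f])
 show "tensor (scl S_alg c f) one0 = scl (SC {}) c (tensor f one0)"
  by (simp add: tensor_def fun_eq_iff algebra_simps)
 show "tensor (str S_alg f) one0 = str (SC {}) (tensor f one0)"
 proof (rule SC_eqI[OF good_simps(1)])
  fix t :: real and x assume x: "x \<in> modes {}"
  show "H (tensor (str S_alg f) one0) t x = H (str (SC {}) (tensor f one0)) t x"
   using hat_adj[of "{}" "cs (f t)" "cs (f (- t))"]
   by (simp add: H_star[OF good_simps(1) T[OF f]] H_one0[OF x])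
 qed (use f in "simp_all add: T S_cnj SC_star")
 show "nrm (SC {}) (tensor f one0) <= nrm S_alg f"
  unfolding SC_sel
  by (rule sc_norm_leI[OF good_simps(1) T[OF f]])
   (simp only: H_one0, intro norm_hat_cs S_norm_ge f)
qed

lemma star_hom_comp:
 "star_hom A B \<phi> ==> star_hom B C \<psi> ==> star_hom A C (%a. \<psi> (\<phi> a))"
 unfolding star_hom_def linear_map_def by (auto, meson order_trans)

text \<open>The connecting map starting from the zero-dimensional level, where \<open>SC {}\<close> is \<open>C\<^sub>0(\<real>)\<close>.\<close>

definition fc :: "real => nat set => (real => complex) => sc" where
 "fc l L f = bet l {} L (tensor f one0)"

lemma fc_star_hom: "good L ==> star_hom S_alg (SC L) (fc l L)"
 unfolding fc_def using star_hom_comp[OF one0_star_hom bet_star_hom(1)[of "{}" L l]] by simp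

lemma fc_SC: "good L ==> f \<in> car S_alg ==> fc l L f \<in> SCc L"
 using fc_star_hom[of L l] by (simp add: star_hom_def linear_map_def)

lemma cs_half: "(1/2) *\<^sub>R (cs a + cs b) = cs ((a + b) / 2)" "(1/2) *\<^sub>R (cs a - cs b) = cs ((a - b) / 2)"
 by (rule cf_eqI; simp add: cs.rep_eq)+

lemma EO_one0: "y \<in> modes {} ==> Evn (tensor f one0) r y = cs ((f r + f (- r)) / 2)"
 "y \<in> modes {} ==> Odn (tensor f one0) r y = cs ((f r - f (- r)) / 2)"
 unfolding Evn_def Odn_def by (simp_all only: atc_one0 cs_half)

lemma proj_empty [simp]: "modes_proj {} x \<in> modes {}" by simp

lemma H_fc: "x \<in> modes L ==> H (fc l L f) t x =
  cs ((f (rad l L t x) + f (- rad l L t x)) / 2) + uvec l L t x * cs ((f (rad l L t x) - f (- rad l L t x)) / 2)"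
 unfolding fc_def using H_bet[of x L "{}" l "tensor f one0" t] by (simp only: EO_one0 proj_empty Un_empty_right simp_thms)

text \<open>A resolvent of an odd vector \<open>v\<close> with \<open>v\<^sup>2 = r\<^sup>2\<close> is \<open>(v - z) / (r\<^sup>2 - z\<^sup>2)\<close>.\<close>

lemma H_fc_res:
 assumes L: "good L" and x: "x \<in> modes L" and z: "z \<in> {\<i>, -\<i>}"
 shows "H (fc l L (%s. 1 / (of_real s + z))) t x =
  (1 / (t^2 + csq l L x + 1)) *\<^sub>R ((t *\<^sub>R gen 0 + cvec l L x) - cs z)"
proof -
 define r where "r = rad l L t x"
 have r2: "r^2 = t^2 + csq l L x" by (simp add: r_def)
 have nz: "of_real r + z ~= 0" "of_real (- r) + z ~= 0" using z by (auto simp: complex_eq_iff)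
 have zz: "z * z = -1" using z by auto
 have p: "r^2 + 1 > 0" by (simp add: add_nonneg_pos)
 have n: "complex_of_real (r^2 + 1) ~= 0" using p unfolding of_real_eq_0_iff by linarith
 have prod: "(of_real r + z) * (of_real (- r) + z) = - complex_of_real (r^2 + 1)"
  using zz by (simp add: algebra_simps power2_eq_square)
 have gen: "(2 * z) / (- q) / 2 = 1 / q * (- z)" "(- 2 * w) / (- q) / 2 = 1 / q * w" if "q ~= 0" for q w
  using that by (simp_all add: field_simps)
 have e1: "1 / (of_real r + z) + 1 / (of_real (- r) + z) = (2 * z) / ((of_real r + z) * (of_real (- r) + z))"
  using nz by (simp add: add_frac_eq)
 have e: "(1 / (of_real r + z) + 1 / (of_real (- r) + z)) / 2 = complex_of_real (1 / (r^2 + 1)) * (- z)"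
  unfolding e1 prod of_real_divide of_real_1 by (rule gen(1)[OF n])
 have o1: "1 / (of_real r + z) - 1 / (of_real (- r) + z) = (- 2 * of_real r) / ((of_real r + z) * (of_real (- r) + z))"
  using nz by (simp add: diff_frac_eq)
 have o: "(1 / (of_real r + z) - 1 / (of_real (- r) + z)) / 2 = complex_of_real (1 / (r^2 + 1) * r)"
  unfolding o1 prod of_real_mult of_real_divide of_real_1 by (rule gen(2)[OF n])
 have "H (fc l L (%s. 1 / (of_real s + z))) t x = cs (of_real (1 / (r^2 + 1)) * (- z)) + uvec l L t x * cs (of_real (1 / (r^2 + 1) * r))"
  unfolding H_fc[OF x] r_def[symmetric] e o ..
 also have "... = (1 / (r^2 + 1)) *\<^sub>R (cs (- z) + r *\<^sub>R uvec l L t x)"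
  unfolding cs_mult[of "of_real _"] cs_of_real_mult cs_of_real by (simp add: algebra_simps of_real_def)
 also have "r *\<^sub>R uvec l L t x = t *\<^sub>R gen 0 + cvec l L x" unfolding r_def by (rule rad_uvec[OF L])
 also have "cs (- z) + (t *\<^sub>R gen 0 + cvec l L x) = (t *\<^sub>R gen 0 + cvec l L x) - cs z"
 proof -
  have "cs (- z) = - cs z" by (rule cf_eqI) (simp add: cs.rep_eq)
  then show ?thesis by simp
 qed
 finally show ?thesis unfolding r2 .
qed

lemma Bott_cf:
 assumes L: "good L" and F: "F (t, x) = cf a" "F (- t, x) = cf a'"
 shows "Bott_Dirac l L F (t, x) = cf (t *\<^sub>R a + cvec l L x * a')"
proof -
 have "(%S. complex_of_real t * cliff_one S + C_field l L x S) = cf (t *\<^sub>R 1 + cvec l L x)"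
  using goodD(1)[OF L] by (simp add: C_field_eq cvec_def wt_def fun_eq_iff one_cl.rep_eq)
 then have "Bott_Dirac l L F (t, x) = cf (ev (t *\<^sub>R 1 + cvec l L x) * a + od (t *\<^sub>R 1 + cvec l L x) * a')"
  unfolding Bott_Dirac_def using F by (intro sc_mult_cf) auto
 moreover have "par 1 = (1::cl)" by (metis cs_one par_cs)
 then have "ev (t *\<^sub>R 1 + cvec l L x) = t *\<^sub>R 1" "od (t *\<^sub>R 1 + cvec l L x) = cvec l L x"
  by (simp_all add: ev_def od_def par_add par_scaleR cvec_def flip: scaleR_2)
 ultimately show ?thesis by simp
qed

lemma H_Bott:
 assumes L: "good L" and F: "F \<in> SCc L"
 shows "H (Bott_Dirac l L F) t x = (t *\<^sub>R gen 0 + cvec l L x) * H F t x"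
proof -
 let ?c = "cvec l L x"
 have a: "atc (Bott_Dirac l L F) t x = t *\<^sub>R atc F t x + ?c * atc F (- t) x" for t
  by (rule atc_eqI, rule Bott_cf[OF L]) (simp_all add: cf_atc[OF L F])
 have c: "cin (idx L) (t *\<^sub>R 1 + ?c)" for t unfolding cvec_def by (intro cin_intros cin_1 cin_vect) auto
 have p1: "par 1 = (1::cl)" by (metis cs_one par_cs)
 have eo: "ev (t *\<^sub>R 1 + ?c) = t *\<^sub>R 1" "od (t *\<^sub>R 1 + ?c) = ?c" for t
  using p1 by (simp_all add: ev_def od_def par_add par_scaleR cvec_def flip: scaleR_2)
 have "hat (t *\<^sub>R 1 + ?c) ((- t) *\<^sub>R 1 + ?c) = t *\<^sub>R gen 0 + ?c"
 proof -
  have "(p + c) + (- p + c) = 2 *\<^sub>R c" "(p + c) - (- p + c) = 2 *\<^sub>R p" for p c :: cl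
   by (simp_all add: scaleR_2)
  then show ?thesis unfolding hat_def scaleR_minus_left by (simp add: algebra_simps)
 qed
 then show ?thesis
  using hat_mult[OF c[of t] c[of "- t"] goodD(4)[OF L], of "atc F t x" "atc F (- t) x"]
  unfolding H_def a eo by simp
qed

lemma fc_res_left:
 assumes L: "good L" and z: "z \<in> {\<i>, -\<i>}" and F: "F \<in> SCc L" and BF: "Bott_Dirac l L F \<in> SCc L"
 shows "sc_mult (fc l L (%s. 1 / (of_real s + z))) (%p S. Bott_Dirac l L F p S + z * F p S) = F"
proof (rule SC_eqI[OF L])
 note R = fc_SC[OF L S_res[OF z], of l]
 have zF: "(%p S. z * F p S) \<in> SCc L" by (intro SC_scl L F)
 have S: "(%p S. Bott_Dirac l L F p S + z * F p S) \<in> SCc L"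
  using SC_add[OF L BF zF] .
 show "sc_mult (fc l L (%s. 1 / (of_real s + z))) (%p S. Bott_Dirac l L F p S + z * F p S) \<in> SCc L"
  by (intro SC_mul L R S)
 fix t :: real and x assume x: "x \<in> modes L"
 let ?b = "t *\<^sub>R gen 0 + cvec l L x" and ?q = "t^2 + csq l L x"
 have q: "?q + 1 > 0" using csq_nonneg[of l L x] zero_le_power2[of t] by linarith
 have zz: "z * z = -1" using z by auto
 have b2: "?b * (?b * y) = ?q *\<^sub>R y" for y using bvec_sq[OF L, of t l x] by (simp add: scaleR_conv_of_real flip: mult.assoc)
 have z2: "cs z * (cs z * y) = - y" for y
 proof -
  have "cs (-1) = -1" by (rule cf_eqI) (simp add: cs.rep_eq one_cl.rep_eq cliff_one_def)
  then show ?thesis by (simp add: zz flip: mult.assoc cs_mult)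
 qed
 have zc: "?b * (cs z * y) = cs z * (?b * y)" for y by (metis cs_commute mult.assoc)
 have "H (sc_mult (fc l L (%s. 1 / (of_real s + z))) (%p S. Bott_Dirac l L F p S + z * F p S)) t x =
  (1 / (?q + 1)) *\<^sub>R ((?b - cs z) * (?b * H F t x + cs z * H F t x))"
  unfolding H_mul[OF L R S] H_fc_res[OF L x z] H_add[OF L BF zF] H_Bott[OF L F] H_scl[OF L F] by simp
 also have "(?b - cs z) * (?b * H F t x + cs z * H F t x) = ?b * (?b * H F t x) - cs z * (cs z * H F t x)"
  unfolding left_diff_distrib distrib_left zc by simp
 also have "... = (?q + 1) *\<^sub>R H F t x" unfolding b2 z2 by (simp add: scaleR_add_left)
 finally show "H (sc_mult (fc l L (%s. 1 / (of_real s + z))) (%p S. Bott_Dirac l L F p S + z * F p S)) t x = H F t x"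
  using q by simp
qed (rule F)

lemma fc_res_right:
 fixes l :: real
 assumes L: "good L" and z: "z \<in> {\<i>, -\<i>}" and F: "F \<in> SCc L"
 defines "r \<equiv> sc_mult (fc l L (%s. 1 / (of_real s + z))) F"
 shows "Bott_Dirac l L r \<in> SCc L" and "(%p S. Bott_Dirac l L r p S + z * r p S) = F"
proof -
 note R = fc_SC[OF L S_res[OF z], of l]
 have r: "r \<in> SCc L" unfolding r_def by (intro SC_mul L R F)
 have zr: "(%p S. z * r p S) \<in> SCc L" by (intro SC_scl L r)
 have G: "(%p S. F p S - z * r p S) \<in> SCc L" by (rule SC_sub[OF L F zr])
 have cinr: "cin (idx L) (t *\<^sub>R atc r t x + cvec l L x * atc r (- t) x)" for t x
  unfolding cvec_def by (intro cin_intros cin_vect cin_atc[OF L r]) auto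
 have Bcf: "Bott_Dirac l L r (t, x) = cf (t *\<^sub>R atc r t x + cvec l L x * atc r (- t) x)" for t x
  by (rule Bott_cf[OF L]) (simp_all add: cf_atc[OF L r])
 have eq: "Bott_Dirac l L r = (%p S. F p S - z * r p S)"
 proof (rule pre_eqI[OF L])
  show "Bott_Dirac l L r (t, x) \<in> cliff_space L" for t x unfolding Bcf by (rule cf_cliff_space[OF L cinr])
  show "Bott_Dirac l L r (t, x) = (%S. 0)" if "x ~: modes L" for t x
   unfolding Bcf by (simp add: atc_out[OF L r that] fun_eq_iff)
  show "(%S. F (t, x) S - z * r (t, x) S) \<in> cliff_space L" for t x using SC_space[OF L G, of t x] by simp
  show "(%S. F (t, x) S - z * r (t, x) S) = (%S. 0)" if "x ~: modes L" for t x using SC_out[OF L G that, of t] by simp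
  fix t :: real and x assume x: "x \<in> modes L"
  let ?b = "t *\<^sub>R gen 0 + cvec l L x" and ?q = "t^2 + csq l L x" and ?h = "H F t x"
  have q: "?q + 1 > 0" using csq_nonneg[of l L x] zero_le_power2[of t] by linarith
  have zz: "z * z = -1" using z by auto
  have b2: "?b * (?b * y) = ?q *\<^sub>R y" for y using bvec_sq[OF L, of t l x] by (simp add: scaleR_conv_of_real flip: mult.assoc)
  have z2: "cs z * (cs z * y) = - y" for y
  proof -
   have "cs (-1) = -1" by (rule cf_eqI) (simp add: cs.rep_eq one_cl.rep_eq cliff_one_def)
   then show ?thesis by (simp add: zz flip: mult.assoc cs_mult)
  qed
  have zc: "?b * (cs z * y) = cs z * (?b * y)" for y by (metis cs_commute mult.assoc)
  have Hr: "H r t x = (1 / (?q + 1)) *\<^sub>R (?b * ?h - cs z * ?h)"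
   unfolding r_def H_mul[OF L R F] H_fc_res[OF L x z] by (simp add: left_diff_distrib)
  have "H (Bott_Dirac l L r) t x + cs z * H r t x = (?b + cs z) * H r t x"
   unfolding H_Bott[OF L r] by (simp add: distrib_right)
  also have "... = (1 / (?q + 1)) *\<^sub>R (?b * (?b * ?h) - cs z * (cs z * ?h))"
  proof -
   have "(b + c) * (b * h - c * h) = b * (b * h) - c * (c * h)" if "b * (c * h) = c * (b * h)" for b c h :: cl
    using that by (simp add: algebra_simps)
   from this[OF zc] show ?thesis unfolding Hr mult_scaleR_right by simp
  qed
  also have "... = ?h" unfolding b2 z2 using q by (simp flip: scaleR_add_left[of _ 1, simplified])
  finally show "H (Bott_Dirac l L r) t x = H (%p S. F p S - z * r p S) t x"
   unfolding H_sub[OF L F zr] H_scl[OF L r] by (simp add: eq_diff_eq)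
 qed
 show "Bott_Dirac l L r \<in> SCc L" unfolding eq by (rule G)
 show "(%p S. Bott_Dirac l L r p S + z * r p S) = F" unfolding eq by simp
qed

lemma star_hom_dense_eq:
 assumes K: "good K" and \<phi>: "star_hom A (SC K) \<phi>" and \<psi>: "star_hom A (SC K) \<psi>"
  and a: "a \<in> car A"
  and dense: "!!e. e > 0 ==> EX g. g \<in> car A & scl A (-1) g \<in> car A & sub A a g \<in> car A & nrm A (sub A a g) <= e & \<phi> g = \<psi> g"
 shows "\<phi> a = \<psi> a"
proof -
 have in_K: "\<phi> b \<in> SCc K" "\<psi> b \<in> SCc K" if "b \<in> car A" for b
  using \<phi> \<psi> that by (auto simp: star_hom_def linear_map_def)
 have D: "(%p S. \<phi> a p S - \<psi> a p S) \<in> SCc K" by (intro SC_sub K in_K a)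
 have "sc_norm K (%p S. \<phi> a p S - \<psi> a p S) <= e" if e: "e > 0" for e
 proof -
  obtain g where g: "g \<in> car A" "scl A (-1) g \<in> car A" "sub A a g \<in> car A" "nrm A (sub A a g) <= e / 2" "\<phi> g = \<psi> g"
   using dense[of "e / 2"] e by auto
  have \<phi>s: "\<phi> (sub A a g) = (%p S. \<phi> a p S - \<phi> g p S)" and \<psi>s: "\<psi> (sub A a g) = (%p S. \<psi> a p S - \<psi> g p S)"
   using \<phi> \<psi> a g by (simp_all add: star_hom_def linear_map_def sub_def)
  have n: "sc_norm K (\<phi> (sub A a g)) <= e / 2" "sc_norm K (\<psi> (sub A a g)) <= e / 2"
   using \<phi> \<psi> g(3,4) by (fastforce simp: star_hom_def)+
  show ?thesis
  proof (rule sc_norm_leI[OF K D])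
   fix t :: real and x assume x: "x \<in> modes K"
   have "H (%p S. \<phi> a p S - \<psi> a p S) t x = H (\<phi> (sub A a g)) t x - H (\<psi> (sub A a g)) t x"
    unfolding \<phi>s \<psi>s using a g by (simp add: H_sub[OF K] in_K)
   then have "norm (H (%p S. \<phi> a p S - \<psi> a p S) t x) <= norm (H (\<phi> (sub A a g)) t x) + norm (H (\<psi> (sub A a g)) t x)"
    by (simp add: norm_triangle_ineq4)
   then show "norm (H (%p S. \<phi> a p S - \<psi> a p S) t x) <= e"
    using norm_H_le[OF K in_K(1)[OF g(3)] x, of t] norm_H_le[OF K in_K(2)[OF g(3)] x, of t] n by linarith
  qed
 qed
 then have "sc_norm K (%p S. \<phi> a p S - \<psi> a p S) <= 0" by (meson dense_ge)
 then have 0: "norm (H (%p S. \<phi> a p S - \<psi> a p S) t x) <= 0" if "x \<in> modes K" for t x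
  using norm_H_le[OF K D that, of t] by linarith
 show ?thesis
 proof (rule SC_eqI[OF K in_K(1)[OF a] in_K(2)[OF a]])
  show "H (\<phi> a) t x = H (\<psi> a) t x" if "x \<in> modes K" for t x
   using 0[OF that, of t] H_sub[OF K in_K(1)[OF a] in_K(2)[OF a], of t x] by simp
 qed
qed

text \<open>The two resolvent identities determine the images of \<open>1 / (s \<plusminus> \<i>)\<close>, as an inverse is unique; density of the
 resolvent polynomials and contractivity determine the rest.\<close>

lemma fc_unique:
 assumes L: "good L" and \<phi>: "star_hom S_alg (SC L) \<phi>"
  and res: "!!z a. z \<in> {\<i>, -\<i>} ==> a \<in> SCc L ==> Bott_Dirac l L a \<in> SCc L ==>
   sc_mult (\<phi> (%s. 1 / (of_real s + z))) (%p S. Bott_Dirac l L a p S + z * a p S) = a"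
  and f: "f \<in> car S_alg"
 shows "\<phi> f = fc l L f"
proof -
 note \<psi> = fc_star_hom[OF L, of l]
 have in_L: "\<phi> b \<in> SCc L" "fc l L b \<in> SCc L" if "b \<in> car S_alg" for b
  using \<phi> \<psi> that by (auto simp: star_hom_def linear_map_def)
 have eqr: "\<phi> (%s. 1 / (of_real s + z)) = fc l L (%s. 1 / (of_real s + z))" if z: "z \<in> {\<i>, -\<i>}" for z
 proof -
  let ?b = "\<phi> (%s. 1 / (of_real s + z))" and ?c = "fc l L (%s. 1 / (of_real s + z))"
  note b = in_L(1)[OF S_res[OF z]] and c = in_L(2)[OF S_res[OF z]]
  have "sc_mult ?b a = sc_mult ?c a" if a: "a \<in> SCc L" for a
   using res[OF z, of "sc_mult ?c a"] fc_res_right[OF L z a, of l] SC_mul[OF L c a] by simp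
  note e = this
  let ?d = "%p S. ?b p S - ?c p S"
  have d: "?d \<in> SCc L" by (rule SC_sub[OF L b c])
  have ds: "sc_star ?d \<in> SCc L" by (rule SC_star[OF L d])
  show ?thesis
  proof (rule SC_eqI[OF L b c])
   fix t :: real and x assume x: "x \<in> modes L"
   have "H ?d t x * adj (H ?d t x) = H (sc_mult ?b (sc_star ?d)) t x - H (sc_mult ?c (sc_star ?d)) t x"
    unfolding H_mul[OF L b ds] H_mul[OF L c ds] H_star[OF L d] H_sub[OF L b c] by (simp add: left_diff_distrib)
   also have "... = 0" unfolding e[OF ds] by simp
   finally have "norm (adj (adj (H ?d t x)) * adj (H ?d t x)) = 0" by simp
   then have "H ?d t x = 0" unfolding cstar_cl by simp
   then show "H ?b t x = H ?c t x" unfolding H_sub[OF L b c] by simp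
  qed
 qed
 have eqp: "\<phi> g = fc l L g" if "rpoly g" for g
  using that
 proof (induction rule: rpoly.induct)
  case (res z)
  then show ?case by (rule eqr)
 next
  case (add g h)
  have "\<gamma> (%s. g s + h s) = (%p S. \<gamma> g p S + \<gamma> h p S)" if "star_hom S_alg (SC L) \<gamma>" for \<gamma>
   using that rpoly_S[OF add(1)] rpoly_S[OF add(2)] unfolding star_hom_def linear_map_def SC_sel S_alg_sel by blast
  then show ?case using \<phi> \<psi> add.IH by simp
 next
  case (mul g h)
  have "\<gamma> (%s. g s * h s) = sc_mult (\<gamma> g) (\<gamma> h)" if "star_hom S_alg (SC L) \<gamma>" for \<gamma>
   using that rpoly_S[OF mul(1)] rpoly_S[OF mul(2)] unfolding star_hom_def SC_sel S_alg_sel by blast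
  then show ?case using \<phi> \<psi> mul.IH by simp
 next
  case (scl g c)
  have "\<gamma> (%s. c * g s) = (%p S. c * \<gamma> g p S)" if "star_hom S_alg (SC L) \<gamma>" for \<gamma>
   using that rpoly_S[OF scl(1)] unfolding star_hom_def linear_map_def SC_sel S_alg_sel by blast
  then show ?case using \<phi> \<psi> scl.IH by simp
 qed
 show ?thesis
 proof (rule star_hom_dense_eq[OF L \<phi> \<psi> f])
  fix e :: real assume "e > 0"
  then obtain g where g: "rpoly g" "!!s. cmod (f s - g s) <= e" using rpoly_dense[OF f] by metis
  have sub: "sub S_alg f g = (%t. f t + -1 * g t)" by (simp add: sub_def)
  have "sub S_alg f g \<in> car S_alg" unfolding sub by (intro S_add S_scl f rpoly_S g)
  moreover have "nrm S_alg (sub S_alg f g) <= e" unfolding sub by (intro S_norm_le) (use g in simp)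
  moreover have "scl S_alg (- 1) g \<in> car S_alg" unfolding S_alg_sel by (intro S_scl rpoly_S g)
  ultimately show "EX g. g \<in> car S_alg & scl S_alg (- 1) g \<in> car S_alg & sub S_alg f g \<in> car S_alg & nrm S_alg (sub S_alg f g) <= e & \<phi> g = fc l L g"
   using rpoly_S[OF g(1)] eqp[OF g(1)] by (intro exI[of _ g] conjI)
 qed
qed

lemma functional_calculus_fc:
 assumes L: "good L" and f: "f \<in> car S_alg"
 shows "functional_calculus (SC L) (Bott_Dirac l L) f = fc l L f"
 unfolding functional_calculus_def
proof (rule the_equality, goal_cases)
 case 1
 show ?case
  by (rule exI[of _ "fc l L"])
   (auto simp: fc_star_hom[OF L] Let_def fc_res_left[OF L] fc_res_right[OF L])
next
 case (2 b)
 then obtain \<phi> where \<phi>: "star_hom S_alg (SC L) \<phi>"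
  "ALL z:{\<i>, - \<i>}. (ALL a:SCc L. Bott_Dirac l L a \<in> SCc L -->
    mul (SC L) (\<phi> (%s. 1 / (complex_of_real s + z))) (add (SC L) (Bott_Dirac l L a) (scl (SC L) z a)) = a)"
  and b: "b = \<phi> f" by blast
 show ?case unfolding b
 proof (rule fc_unique[OF L \<phi>(1) _ f])
  fix z a assume z: "z \<in> {\<i>, - \<i>}" and a: "a \<in> SCc L" "Bott_Dirac l L a \<in> SCc L"
  show "sc_mult (\<phi> (%s. 1 / (of_real s + z))) (%p S. Bott_Dirac l L a p S + z * a p S) = a"
   using bspec[OF \<phi>(2) z] a by simp
 qed
qed

lemma bet_tensor:
 assumes KL: "good K" "good L" and f: "f \<in> car S_alg" and h: "h \<in> Cl_tau K"
 shows "bet l K L (tensor f h) = tensor_Cl L K (fc l L f) h"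
proof -
 have "bet_cl l K L (tensor f h) t x = bet_cl l {} L (tensor f one0) t (modes_proj L x) * Cl (h (modes_proj K x))" for t x
 proof -
  have a: "atc (tensor f h) r y = cs (f r) * Cl (h y)" for r y
   by (rule atc_eqI, rule ext) (simp add: tensor_def cliff_space_cl(1)[OF KL(1) Cl_tau_space[OF h]])
  have E: "Evn (tensor f h) r y = cs ((f r + f (- r)) / 2) * Cl (h y)" "Odn (tensor f h) r y = cs ((f r - f (- r)) / 2) * Cl (h y)" for r y
   unfolding Evn_def Odn_def a by (simp_all add: cs_half[symmetric] algebra_simps)
  have r: "rad l L t (modes_proj L x) = rad l L t x" using KL by (simp add: rad_def csq_proj)
  show ?thesis unfolding bet_cl_def Let_def r E EO_one0[OF proj_empty] cvec_proj[OF KL(2)]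
   by (simp add: distrib_right mult.assoc)
 qed
 note e = this
 show ?thesis
 proof (rule ext, clarify)
  fix t x
  show "bet l K L (tensor f h) (t, x) = tensor_Cl L K (fc l L f) h (t, x)"
  proof (cases "x \<in> modes (L Un K)")
   case True
   have m: "modes_proj L x \<in> modes (L Un {})" using KL by simp
   have "fc l L f (t, modes_proj L x) = cf (bet_cl l {} L (tensor f one0) t (modes_proj L x))"
    unfolding fc_def bet_def using m by simp
   then show ?thesis
    using True by (simp add: bet_def tensor_Cl_def e times_cl.rep_eq cliff_space_cl(1)[OF KL(1) Cl_tau_space[OF h]])
  qed (simp add: bet_def tensor_Cl_def)
 qed
qed

text \<open>\<open>bet\<close> has the properties that define \<open>hkt_beta\<close>, and they pin it down because elementary tensors span a dense
 subspace.\<close>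

lemma hkt_beta_bet:
 assumes NM: "N <= M" and F: "F \<in> SCc {1..N}"
 shows "hkt_beta l N M F = bet l {1..N} {N+1..M} F"
proof -
 have g: "good {1..N}" "good {N+1..M}" "good {1..M}" using good_simps(2)[of 0] good_simps(2)[of N] by simp_all
 have u: "{N+1..M} Un {1..N} = {1..M}" using NM by auto
 have d: "{1..N} Int {N+1..M} = {}" by auto
 note B = bet_star_hom(1,2)[OF g(1,2) d, of l, unfolded u]
 have T: "bet l {1..N} {N+1..M} (tensor f h) = tensor_Cl {N+1..M} {1..N} (functional_calculus (SC {N+1..M}) (Bott_Dirac l {N+1..M}) f) h"
  if "f \<in> car S_alg" "h \<in> Cl_tau {1..N}" for f h
  using bet_tensor[OF g(1,2) that] functional_calculus_fc[OF g(2) that(1)] by simp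
 show ?thesis
  unfolding hkt_beta_def
 proof (rule the_equality, goal_cases)
  case 1
  show ?case using B T by (intro exI[of _ "bet l {1..N} {N+1..M}"]) blast
 next
  case (2 G)
  then obtain \<beta> where \<beta>: "star_hom (SC {1..N}) (SC {1..M}) \<beta>"
   "!!f h. f \<in> car S_alg ==> h \<in> Cl_tau {1..N} ==> \<beta> (tensor f h) =
    tensor_Cl {N+1..M} {1..N} (functional_calculus (SC {N+1..M}) (Bott_Dirac l {N+1..M}) f) h"
   and G: "G = \<beta> F" by blast
  have ag: "\<beta> P = bet l {1..N} {N+1..M} P" if "tspan {1..N} P" for P
   using that
  proof (induction rule: tspan.induct)
   case zero
   have "\<gamma> (%p S. 0) = (%p S. 0)" if "star_hom (SC {1..N}) (SC {1..M}) \<gamma>" for \<gamma>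
   proof -
    have "\<gamma> (scl (SC {1..N}) 0 (%p S. 0)) = scl (SC {1..M}) 0 (\<gamma> (%p S. 0))"
     using that SC_zero[OF g(1)] unfolding star_hom_def linear_map_def by blast
    then show ?thesis by simp
   qed
   then show ?case using \<beta>(1) B(1) by metis
  next
   case (tensor f h)
   then show ?case using \<beta>(2) T by simp
  next
   case (add P Q)
   have PQ: "P \<in> SCc {1..N}" "Q \<in> SCc {1..N}" using add tspan_SC[OF g(1)] by auto
   have "\<gamma> (%p S. P p S + Q p S) = (%p S. \<gamma> P p S + \<gamma> Q p S)" if "star_hom (SC {1..N}) (SC {1..M}) \<gamma>" for \<gamma>
    using that PQ unfolding star_hom_def linear_map_def SC_sel by blast
   then show ?case using \<beta>(1) B(1) add.IH by simp
  qed
  show ?case unfolding G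
  proof (rule star_hom_dense_eq[OF g(3) \<beta>(1) B(1) F])
   fix e :: real assume "e > 0"
   then obtain P where P: "tspan {1..N} P" "sc_norm {1..N} (%p S. F p S - P p S) <= e" using tspan_dense[OF g(1) F] by metis
   note PS = tspan_SC[OF g(1) P(1)]
   show "EX P. P \<in> SCc {1..N} & scl (SC {1..N}) (- 1) P \<in> SCc {1..N} & sub (SC {1..N}) F P \<in> SCc {1..N} \<and>
     nrm (SC {1..N}) (sub (SC {1..N}) F P) <= e & \<beta> P = bet l {1..N} {N + 1..M} P"
    using PS P ag[OF P(1)] SC_scl[OF g(1) PS, of "-1"] SC_sub[OF g(1) F PS]
    by (intro exI[of _ P]) simp
  qed
 qed
qed

section \<open>Direct limits of graded C*-algebras\<close>

locale gca = fixes A :: "'a gcalg" (structure)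
 assumes gca: "graded_cstar_algebra A"
begin

lemma cvs: "complex_vector_space A" using gca by (simp add: graded_cstar_algebra_def)

lemma zero_in [simp, intro]: "zer A \<in> car A"
 and add_in [simp, intro]: "x \<in> car A ==> y \<in> car A ==> add A x y \<in> car A"
 and scl_in [simp, intro]: "x \<in> car A ==> scl A c x \<in> car A"
 and add_comm: "x \<in> car A ==> y \<in> car A ==> add A x y = add A y x"
 and add_assoc: "x \<in> car A ==> y \<in> car A ==> z \<in> car A ==> add A (add A x y) z = add A x (add A y z)"
 and add_0: "x \<in> car A ==> add A (zer A) x = x"
 and sub_self: "x \<in> car A ==> sub A x x = zer A"
 and scl_add: "x \<in> car A ==> y \<in> car A ==> scl A c (add A x y) = add A (scl A c x) (scl A c y)"
 and scl_plus: "x \<in> car A ==> scl A (c + d) x = add A (scl A c x) (scl A d x)"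
 and scl_times: "x \<in> car A ==> scl A (c * d) x = scl A c (scl A d x)"
 and scl_1: "x \<in> car A ==> scl A 1 x = x"
 using cvs unfolding complex_vector_space_def by blast+

lemma mul_linear: "x \<in> car A ==> linear_map A A (mul A x)" "x \<in> car A ==> linear_map A A (%y. mul A y x)"
 using gca unfolding graded_cstar_algebra_def by blast+

lemma mul_in [simp, intro]: "x \<in> car A ==> y \<in> car A ==> mul A x y \<in> car A"
 and mul_addR: "x \<in> car A ==> y \<in> car A ==> z \<in> car A ==> mul A x (add A y z) = add A (mul A x y) (mul A x z)"
 and mul_sclR: "x \<in> car A ==> y \<in> car A ==> mul A x (scl A c y) = scl A c (mul A x y)"
 using mul_linear(1)[of x] unfolding linear_map_def by blast+

lemma mul_addL: "x \<in> car A ==> y \<in> car A ==> z \<in> car A ==> mul A (add A y z) x = add A (mul A y x) (mul A z x)"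
 and mul_sclL: "x \<in> car A ==> y \<in> car A ==> mul A (scl A c y) x = scl A c (mul A y x)"
 using mul_linear(2)[of x] unfolding linear_map_def by blast+

lemma mul_assoc: "x \<in> car A ==> y \<in> car A ==> z \<in> car A ==> mul A (mul A x y) z = mul A x (mul A y z)"
 and str_in [simp, intro]: "x \<in> car A ==> str A x \<in> car A"
 and str_str: "x \<in> car A ==> str A (str A x) = x"
 and str_add: "x \<in> car A ==> y \<in> car A ==> str A (add A x y) = add A (str A x) (str A y)"
 and str_mul: "x \<in> car A ==> y \<in> car A ==> str A (mul A x y) = mul A (str A y) (str A x)"
 and str_scl: "x \<in> car A ==> str A (scl A c x) = scl A (cnj c) (str A x)"
 using gca unfolding graded_cstar_algebra_def by blast+

lemma nrm_nonneg [simp]: "x \<in> car A ==> 0 <= nrm A x"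
 and nrm_0_iff: "x \<in> car A ==> nrm A x = 0 \<longleftrightarrow> x = zer A"
 and nrm_scl: "x \<in> car A ==> nrm A (scl A c x) = cmod c * nrm A x"
 and nrm_add: "x \<in> car A ==> y \<in> car A ==> nrm A (add A x y) <= nrm A x + nrm A y"
 and nrm_mul: "x \<in> car A ==> y \<in> car A ==> nrm A (mul A x y) <= nrm A x * nrm A y"
 and nrm_cstar: "x \<in> car A ==> nrm A (mul A (str A x) x) = (nrm A x)^2"
 and complete: "norm_complete A (nrm A)"
 using gca unfolding graded_cstar_algebra_def by blast+

lemma gra_in [simp, intro]: "x \<in> car A ==> gra A x \<in> car A"
 and gra_add: "x \<in> car A ==> y \<in> car A ==> gra A (add A x y) = add A (gra A x) (gra A y)"
 and gra_scl: "x \<in> car A ==> gra A (scl A c x) = scl A c (gra A x)"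
 and gra_gra: "x \<in> car A ==> gra A (gra A x) = x"
 and gra_str: "x \<in> car A ==> gra A (str A x) = str A (gra A x)"
 and gra_mul: "x \<in> car A ==> y \<in> car A ==> gra A (mul A x y) = mul A (gra A x) (gra A y)"
 using gca unfolding graded_cstar_algebra_def linear_map_def by blast+

lemma add_lcomm: "x \<in> car A ==> y \<in> car A ==> z \<in> car A ==> add A x (add A y z) = add A y (add A x z)"
 by (metis add_assoc add_comm)

lemmas add_ac = add_assoc add_comm add_lcomm

lemma add_0R: "x \<in> car A ==> add A x (zer A) = x"
 by (simp add: add_comm[of x] add_0)

lemma sub_in [simp, intro]: "x \<in> car A ==> y \<in> car A ==> sub A x y \<in> car A"
 by (simp add: sub_def)

lemma neg_self: "x \<in> car A ==> add A x (scl A (-1) x) = zer A"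
 using sub_self by (simp add: sub_def)

lemma sub_split: "x \<in> car A ==> y \<in> car A ==> z \<in> car A ==> sub A x z = add A (sub A x y) (sub A y z)"
proof -
 assume *: "x \<in> car A" "y \<in> car A" "z \<in> car A"
 then have "add A (sub A x y) (sub A y z) = add A x (add A (add A y (scl A (-1) y)) (scl A (-1) z))"
  unfolding sub_def by (simp add: add_ac)
 then show ?thesis using * by (simp add: neg_self add_0 sub_def)
qed

lemma sub_add_add: "x \<in> car A ==> y \<in> car A ==> x' \<in> car A ==> y' \<in> car A ==>
  sub A (add A x y) (add A x' y') = add A (sub A x x') (sub A y y')"
 unfolding sub_def by (simp add: scl_add add_ac)

lemma sub_scl: "x \<in> car A ==> y \<in> car A ==> sub A (scl A c x) (scl A c y) = scl A c (sub A x y)"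
 unfolding sub_def by (simp add: scl_add flip: scl_times)

lemma sub_swap: "x \<in> car A ==> y \<in> car A ==> sub A x y = scl A (-1) (sub A y x)"
 unfolding sub_def by (simp add: scl_add scl_1 add_comm flip: scl_times)

lemma sub_str: "x \<in> car A ==> y \<in> car A ==> sub A (str A x) (str A y) = str A (sub A x y)"
 unfolding sub_def by (simp add: str_add str_scl)

lemma sub_gra: "x \<in> car A ==> y \<in> car A ==> sub A (gra A x) (gra A y) = gra A (sub A x y)"
 unfolding sub_def by (simp add: gra_add gra_scl)

lemma mul_subL: "x \<in> car A ==> y \<in> car A ==> z \<in> car A ==> mul A (sub A x y) z = sub A (mul A x z) (mul A y z)"
 unfolding sub_def by (simp add: mul_addL mul_sclL)

lemma mul_subR: "x \<in> car A ==> y \<in> car A ==> z \<in> car A ==> mul A z (sub A x y) = sub A (mul A z x) (mul A z y)"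
 unfolding sub_def by (simp add: mul_addR mul_sclR)

lemma sub_mul_mul: "x \<in> car A ==> y \<in> car A ==> x' \<in> car A ==> y' \<in> car A ==>
  sub A (mul A x y) (mul A x' y') = add A (mul A (sub A x x') y) (mul A x' (sub A y y'))"
 by (simp add: mul_subL mul_subR) (intro sub_split; simp)

lemma scl_0: "x \<in> car A ==> scl A 0 x = zer A"
 using nrm_scl[of x 0] nrm_0_iff[of "scl A 0 x"] by simp

lemma scl_zero: "scl A c (zer A) = zer A"
 using nrm_scl[of "zer A" c] nrm_0_iff[of "scl A c (zer A)"] nrm_0_iff[of "zer A"] by simp

lemma nrm_zero [simp]: "nrm A (zer A) = 0" by (simp add: nrm_0_iff)

lemma sub_zero: "x \<in> car A ==> sub A x (zer A) = x"
 by (simp add: sub_def scl_zero add_0R)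

lemma sub_eq_0: "x \<in> car A ==> y \<in> car A ==> sub A x y = zer A \<longleftrightarrow> x = y"
proof
 assume *: "x \<in> car A" "y \<in> car A" "sub A x y = zer A"
 have "add A (sub A x y) y = x"
  unfolding sub_def using *(1,2) by (simp add: add_assoc add_comm[of "scl A (-1) y" y] neg_self add_0R)
 then show "x = y" using * by (simp add: add_0)
qed (simp add: sub_self)

lemma nrm_sub_commute: "x \<in> car A ==> y \<in> car A ==> nrm A (sub A x y) = nrm A (sub A y x)"
 by (subst sub_swap) (simp_all add: nrm_scl)

lemma nrm_sub_tri: "x \<in> car A ==> y \<in> car A ==> z \<in> car A ==> nrm A (sub A x z) <= nrm A (sub A x y) + nrm A (sub A y z)"
 by (subst sub_split[of x y z]) (auto intro: nrm_add)

lemma nrm_le_sub: "x \<in> car A ==> y \<in> car A ==> nrm A x <= nrm A (sub A x y) + nrm A y"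
 using nrm_sub_tri[of x y "zer A"] by (simp add: sub_zero)

lemma nrm_str: "x \<in> car A ==> nrm A (str A x) = nrm A x"
proof -
 have le: "nrm A x <= nrm A (str A x)" if x: "x \<in> car A" for x
 proof (cases "nrm A x = 0")
  case False
  then have p: "nrm A x > 0" using nrm_nonneg[OF x] by simp
  have "nrm A x * nrm A x <= nrm A (str A x) * nrm A x"
   using nrm_cstar[OF x] nrm_mul[of "str A x" x] x by (simp add: power2_eq_square)
  then show ?thesis using p by simp
 qed (use x in simp)
 assume x: "x \<in> car A"
 show ?thesis using le[OF x] le[of "str A x"] x by (simp add: str_str)
qed

end

text \<open>Contractivity of the connecting maps suffices for the limit; the norm of a class is the limit of the norms of a
 representing sequence.  The grading is a *-automorphism and hence isometric, which lets it act on classes.\<close>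

locale dsys =
 fixes A :: "nat => 'a gcalg" and \<beta> :: "nat => nat => 'a => 'a"
 assumes cst: "!!n. graded_cstar_algebra (A n)"
  and hom: "!!n m. n <= m ==> star_hom (A n) (A m) (\<beta> n m)"
  and grd: "!!n m. n <= m ==> graded_map (A n) (A m) (\<beta> n m)"
  and comp: "!!n m p a. n <= m ==> m <= p ==> a \<in> car (A n) ==> \<beta> m p (\<beta> n m a) = \<beta> n p a"
  and ident: "!!n a. a \<in> car (A n) ==> \<beta> n n a = a"
  and nrm_gra: "!!n a. a \<in> car (A n) ==> nrm (A n) (gra (A n) a) = nrm (A n) a"
begin

sublocale A: gca "A n" for n by unfold_locales (rule cst)

lemma \<beta>_in [simp, intro]: "n <= m ==> a \<in> car (A n) ==> \<beta> n m a \<in> car (A m)"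
 and \<beta>_add: "n <= m ==> a \<in> car (A n) ==> b \<in> car (A n) ==> \<beta> n m (add (A n) a b) = add (A m) (\<beta> n m a) (\<beta> n m b)"
 and \<beta>_scl: "n <= m ==> a \<in> car (A n) ==> \<beta> n m (scl (A n) c a) = scl (A m) c (\<beta> n m a)"
 and \<beta>_mul: "n <= m ==> a \<in> car (A n) ==> b \<in> car (A n) ==> \<beta> n m (mul (A n) a b) = mul (A m) (\<beta> n m a) (\<beta> n m b)"
 and \<beta>_str: "n <= m ==> a \<in> car (A n) ==> \<beta> n m (str (A n) a) = str (A m) (\<beta> n m a)"
 and \<beta>_nrm: "n <= m ==> a \<in> car (A n) ==> nrm (A m) (\<beta> n m a) <= nrm (A n) a"
 using hom[of n m] unfolding star_hom_def linear_map_def by blast+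

lemma \<beta>_gra: "n <= m ==> a \<in> car (A n) ==> \<beta> n m (gra (A n) a) = gra (A m) (\<beta> n m a)"
 using grd[of n m] unfolding graded_map_def by blast

lemma \<beta>_zero: "n <= m ==> \<beta> n m (zer (A n)) = zer (A m)"
 using \<beta>_scl[of n m "zer (A n)" 0] by (simp add: A.scl_0)

lemma \<beta>_sub: "n <= m ==> a \<in> car (A n) ==> b \<in> car (A n) ==> \<beta> n m (sub (A n) a b) = sub (A m) (\<beta> n m a) (\<beta> n m b)"
 unfolding sub_def by (simp add: \<beta>_add \<beta>_scl)

abbreviation coh where "coh \<equiv> coherent A \<beta>"
abbreviation cls where "cls \<equiv> limit_class A \<beta>"
abbreviation D where "D \<equiv> direct_limit A \<beta>"
abbreviation incl where "incl \<equiv> limit_incl A \<beta>"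

definition dist_n :: "nat => 'a => 'a => real" where "dist_n n a b = nrm (A n) (sub (A n) a b)"

lemma coh_in [simp]: "coh s ==> s n \<in> car (A n)" by (simp add: coherent_def)

lemma cohD: "coh s ==> eps > 0 ==> EX N. ALL n m. N <= n & n <= m --> dist_n m (s m) (\<beta> n m (s n)) < eps"
 unfolding coherent_def dist_n_def by blast

lemma cohI:
 assumes "!!n. s n \<in> car (A n)"
  and "!!eps. eps > 0 ==> EX N. ALL n m. N <= n & n <= m --> dist_n m (s m) (\<beta> n m (s n)) <= eps"
 shows "coh s"
 unfolding coherent_def
proof (intro conjI allI impI assms(1))
 fix eps :: real assume e: "eps > 0"
 then have "eps / 2 > 0" by simp
 from assms(2)[OF this] obtain N where N: "!!n m. N <= n ==> n <= m ==> dist_n m (s m) (\<beta> n m (s n)) <= eps / 2" by blast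
 have "dist_n m (s m) (\<beta> n m (s n)) < eps" if "N <= n" "n <= m" for n m using N[OF that] e by linarith
 then show "EX N. ALL n m. N <= n & n <= m --> nrm (A m) (sub (A m) (s m) (\<beta> n m (s n))) < eps"
  unfolding dist_n_def by blast
qed

lemma coh_bounded: assumes "coh s" obtains B where "B > 0" "!!n. nrm (A n) (s n) <= B"
proof -
 obtain N where N: "!!n m. N <= n ==> n <= m ==> dist_n m (s m) (\<beta> n m (s n)) < 1" using cohD[OF assms, of 1] by auto
 define B where "B = Max ((%n. nrm (A n) (s n)) ` {..N}) + 1"
 have le: "nrm (A n) (s n) <= B - 1" if "n <= N" for n
  unfolding B_def using that by (simp add: Max_ge)
 have "nrm (A n) (s n) <= B" for n
 proof (cases "n <= N")
  case False
  then have n: "N <= n" by simp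
  have "nrm (A n) (s n) <= dist_n n (s n) (\<beta> N n (s N)) + nrm (A n) (\<beta> N n (s N))"
   unfolding dist_n_def using n assms by (intro A.nrm_le_sub) auto
  also have "... <= 1 + nrm (A N) (s N)" using N[of N n] n assms by (intro add_mono \<beta>_nrm) auto
  also have "... <= B" using le[of N] by simp
  finally show ?thesis .
 qed (use le in fastforce)
 moreover have "B > 0" using le[of 0] A.nrm_nonneg[of "s 0" 0] assms by (simp add: coherent_def) (metis A.nrm_nonneg add.commute le_add_same_cancel2 le_iff_add le_less_trans less_add_one linorder_not_less diff_add_cancel order_trans zero_le)
 ultimately show ?thesis by (intro that) auto
qed

lemma coh_zero: "coh (%n. zer (A n))"
 by (rule cohI) (auto simp: dist_n_def \<beta>_zero A.sub_zero intro: less_imp_le)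

lemma coh_add: assumes "coh s" "coh s'" shows "coh (%n. add (A n) (s n) (s' n))"
proof (rule cohI)
 fix eps :: real assume e: "eps > 0"
 then obtain N N' where N: "!!n m. N <= n ==> n <= m ==> dist_n m (s m) (\<beta> n m (s n)) < eps / 2"
  "!!n m. N' <= n ==> n <= m ==> dist_n m (s' m) (\<beta> n m (s' n)) < eps / 2"
  using cohD[OF assms(1), of "eps / 2"] cohD[OF assms(2), of "eps / 2"] by (metis half_gt_zero)
 show "EX N. ALL n m. N <= n & n <= m --> dist_n m (add (A m) (s m) (s' m)) (\<beta> n m (add (A n) (s n) (s' n))) <= eps"
 proof (intro exI[of _ "max N N'"] allI impI)
  fix n m assume *: "max N N' <= n & n <= m"
  then have "dist_n m (add (A m) (s m) (s' m)) (\<beta> n m (add (A n) (s n) (s' n))) <= dist_n m (s m) (\<beta> n m (s n)) + dist_n m (s' m) (\<beta> n m (s' n))"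
   unfolding dist_n_def using assms by (simp add: \<beta>_add A.sub_add_add A.nrm_add)
  then show "dist_n m (add (A m) (s m) (s' m)) (\<beta> n m (add (A n) (s n) (s' n))) <= eps"
   using N(1)[of n m] N(2)[of n m] * by simp
 qed
qed (use assms in auto)

lemma coh_lip:
 assumes s: "coh s" and T: "!!n. T n (s n) \<in> car (A n)" and L: "L > 0"
  and lip: "!!n m. n <= m ==> dist_n m (T m (s m)) (\<beta> n m (T n (s n))) <= L * dist_n m (s m) (\<beta> n m (s n))"
 shows "coh (%n. T n (s n))"
proof (rule cohI)
 fix eps :: real assume e: "eps > 0"
 then have "eps / L > 0" using L by simp
 from cohD[OF s this] obtain N where N: "!!n m. N <= n ==> n <= m ==> dist_n m (s m) (\<beta> n m (s n)) < eps / L" by blast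
 show "EX N. ALL n m. N <= n & n <= m --> dist_n m (T m (s m)) (\<beta> n m (T n (s n))) <= eps"
 proof (intro exI[of _ N] allI impI, elim conjE)
  fix n m assume *: "N <= n" "n <= m"
  have "L * dist_n m (s m) (\<beta> n m (s n)) <= L * (eps / L)" using N[OF *] L by (intro mult_left_mono) auto
  then show "dist_n m (T m (s m)) (\<beta> n m (T n (s n))) <= eps" using lip[OF *(2)] L by simp
 qed
qed (rule T)

lemma coh_scl: assumes "coh s" shows "coh (%n. scl (A n) c (s n))"
proof (rule coh_lip[OF assms, where L = "cmod c + 1"])
 fix n m :: nat assume "n <= m"
 then have "dist_n m (scl (A m) c (s m)) (\<beta> n m (scl (A n) c (s n))) = cmod c * dist_n m (s m) (\<beta> n m (s n))"
  unfolding dist_n_def using assms by (simp add: \<beta>_scl A.sub_scl A.nrm_scl)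
 then show "dist_n m (scl (A m) c (s m)) (\<beta> n m (scl (A n) c (s n))) <= (cmod c + 1) * dist_n m (s m) (\<beta> n m (s n))"
  using assms \<open>n <= m\<close> by (simp add: distrib_right dist_n_def)
qed (use assms in "auto intro: add_nonneg_pos")

lemma coh_str: assumes "coh s" shows "coh (%n. str (A n) (s n))"
 by (rule coh_lip[OF assms, where L = 1]) (use assms in \<open>auto simp: dist_n_def \<beta>_str[symmetric] A.sub_str A.nrm_str\<close>,
  simp add: \<beta>_str A.sub_str A.nrm_str)

lemma coh_gra: assumes "coh s" shows "coh (%n. gra (A n) (s n))"
 by (rule coh_lip[OF assms, where L = 1]) (use assms in \<open>auto simp: dist_n_def \<beta>_gra A.sub_gra nrm_gra\<close>)

lemma coh_sub: "coh s ==> coh s' ==> coh (%n. sub (A n) (s n) (s' n))"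
 unfolding sub_def by (intro coh_add coh_scl)

lemma coh_mul: assumes s: "coh s" "coh s'" shows "coh (%n. mul (A n) (s n) (s' n))"
proof (rule cohI)
 fix eps :: real assume e: "eps > 0"
 obtain B where B: "B > 0" "!!n. nrm (A n) (s n) <= B" by (rule coh_bounded[OF s(1)]) blast
 obtain B' where B': "B' > 0" "!!n. nrm (A n) (s' n) <= B'" by (rule coh_bounded[OF s(2)]) blast
 have p: "eps / (2 * B') > 0" "eps / (2 * B) > 0" using e B B' by auto
 obtain N where N: "!!n m. N <= n ==> n <= m ==> dist_n m (s m) (\<beta> n m (s n)) < eps / (2 * B')"
  using cohD[OF s(1) p(1)] by blast
 obtain N' where N': "!!n m. N' <= n ==> n <= m ==> dist_n m (s' m) (\<beta> n m (s' n)) < eps / (2 * B)"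
  using cohD[OF s(2) p(2)] by blast
 show "EX N. ALL n m. N <= n & n <= m --> dist_n m (mul (A m) (s m) (s' m)) (\<beta> n m (mul (A n) (s n) (s' n))) <= eps"
 proof (intro exI[of _ "max N N'"] allI impI)
  fix n m assume *: "max N N' <= n & n <= m"
  let ?a = "s m" and ?b = "s' m" and ?a' = "\<beta> n m (s n)" and ?b' = "\<beta> n m (s' n)"
  have c: "?a \<in> car (A m)" "?b \<in> car (A m)" "?a' \<in> car (A m)" "?b' \<in> car (A m)" using s * by auto
  have "dist_n m (mul (A m) ?a ?b) (mul (A m) ?a' ?b') <= nrm (A m) (mul (A m) (sub (A m) ?a ?a') ?b) + nrm (A m) (mul (A m) ?a' (sub (A m) ?b ?b'))"
   unfolding dist_n_def A.sub_mul_mul[OF c] using c by (intro A.nrm_add) auto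
  also have "... <= dist_n m ?a ?a' * nrm (A m) ?b + nrm (A m) ?a' * dist_n m ?b ?b'"
   unfolding dist_n_def using c by (intro add_mono A.nrm_mul) auto
  also have "... <= eps / (2 * B') * B' + B * (eps / (2 * B))"
  proof (intro add_mono mult_mono)
   show "nrm (A m) ?a' <= B" using \<beta>_nrm[of n m "s n"] B(2)[of n] s * by simp
   show "dist_n m ?a ?a' <= eps / (2 * B')" "dist_n m ?b ?b' <= eps / (2 * B)" using N[of n m] N'[of n m] * by auto
  qed (use B B' p c in "auto simp: dist_n_def")
  also have "... = eps" using B B' by simp
  finally show "dist_n m (mul (A m) (s m) (s' m)) (\<beta> n m (mul (A n) (s n) (s' n))) <= eps"
   using s * by (simp add: \<beta>_mul)
 qed
qed (use s in auto)

text \<open>Connecting maps are contractive, so up to small errors the norms along a compatible sequence decrease.\<close>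

lemma coh_convergent: assumes s: "coh s" shows "convergent (%n. nrm (A n) (s n))"
proof -
 let ?a = "%n. nrm (A n) (s n)"
 have nn: "0 <= ?a n" for n using s by simp
 have dec: "?a m <= ?a n + dist_n m (s m) (\<beta> n m (s n))" if "n <= m" for n m
  using A.nrm_le_sub[of "s m" m "\<beta> n m (s n)"] \<beta>_nrm[OF that, of "s n"] s that by (simp add: dist_n_def)
 have "Cauchy ?a"
 proof (rule CauchyI)
  fix e :: real assume e: "0 < e"
  then obtain N where N: "!!n m. N <= n ==> n <= m ==> dist_n m (s m) (\<beta> n m (s n)) < e / 2"
   using cohD[OF s, of "e / 2"] by auto
  have bdd: "bdd_below (?a ` {N..})" using nn by (intro bdd_belowI2[of _ 0]) auto
  have "EX n:{N..}. ?a n < Inf (?a ` {N..}) + e / 2"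
   using cInf_lessD[of "?a ` {N..}" "Inf (?a ` {N..}) + e / 2"] e by auto
  then obtain n0 where n0: "n0 >= N" "?a n0 < Inf (?a ` {N..}) + e / 2" by auto
  have rng: "Inf (?a ` {N..}) <= ?a m & ?a m < Inf (?a ` {N..}) + e" if "m >= n0" for m
  proof
   show "Inf (?a ` {N..}) <= ?a m" using bdd that n0 by (intro cINF_lower) auto
   show "?a m < Inf (?a ` {N..}) + e" using dec[OF that] N[OF n0(1) that] n0(2) by linarith
  qed
  show "EX M. \<forall>m\<ge>M. \<forall>n\<ge>M. norm (?a m - ?a n) < e"
   by (intro exI[of _ n0] allI impI) (smt (verit) rng real_norm_def)
 qed
 then show ?thesis by (simp add: Cauchy_convergent_iff)
qed

definition nul :: "(nat => 'a) => (nat => 'a) => bool" where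
 "nul s s' \<longleftrightarrow> (%n. dist_n n (s n) (s' n)) \<longlonglongrightarrow> 0"

lemma mem_cls: "s' \<in> cls s \<longleftrightarrow> coh s' & nul s' s"
 by (simp add: limit_class_def nul_def dist_n_def)

lemma nul_bound:
 assumes "!!n. 0 <= dist_n n (s n) (s' n)" "!!n. dist_n n (s n) (s' n) <= f n" "f \<longlonglongrightarrow> 0" shows "nul s s'"
 unfolding nul_def by (rule tendsto_sandwich[OF _ _ tendsto_const assms(3)]) (use assms in auto)

lemma dist_nonneg: "a \<in> car (A n) ==> b \<in> car (A n) ==> 0 <= dist_n n a b" by (simp add: dist_n_def)

lemma nul_refl: "coh s ==> nul s s" by (simp add: nul_def dist_n_def A.sub_self)

lemma nul_sym: assumes "coh s" "coh s'" "nul s s'" shows "nul s' s"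
proof -
 have "dist_n n (s' n) (s n) = dist_n n (s n) (s' n)" for n
  unfolding dist_n_def using assms by (intro A.nrm_sub_commute) auto
 then show ?thesis using assms by (simp add: nul_def)
qed

lemma nul_trans: assumes "coh s" "coh s'" "coh s''" "nul s s'" "nul s' s''" shows "nul s s''"
proof (rule nul_bound)
 show "(%n. dist_n n (s n) (s' n) + dist_n n (s' n) (s'' n)) \<longlonglongrightarrow> 0"
  using tendsto_add[OF assms(4,5)[unfolded nul_def]] by simp
 show "dist_n n (s n) (s'' n) <= dist_n n (s n) (s' n) + dist_n n (s' n) (s'' n)" for n
  unfolding dist_n_def using assms by (intro A.nrm_sub_tri) auto
qed (use assms in "auto intro: dist_nonneg")

lemma cls_eq: assumes "coh s" "coh s'" shows "cls s = cls s' \<longleftrightarrow> nul s s'"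
proof
 assume "cls s = cls s'"
 then have "s \<in> cls s'" using assms nul_refl[of s] by (auto simp: mem_cls)
 then show "nul s s'" by (simp add: mem_cls)
next
 assume *: "nul s s'"
 show "cls s = cls s'"
  unfolding set_eq_iff mem_cls using * assms nul_trans nul_sym by meson
qed

lemma rep_cls: assumes "coh s" shows "coh (rep (cls s))" "nul (rep (cls s)) s"
proof -
 have "s \<in> cls s" using assms by (simp add: mem_cls nul_refl)
 then have "rep (cls s) \<in> cls s" unfolding rep_def by (rule someI[where P = "%x. x \<in> cls s"])
 then show "coh (rep (cls s))" "nul (rep (cls s)) s" by (auto simp: mem_cls)
qed

lemma D_sel: "car D = cls ` {s. coh s}" "zer D = cls (%n. zer (A n))"
 "add D X Y = cls (%n. add (A n) (rep X n) (rep Y n))"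
 "scl D c X = cls (%n. scl (A n) c (rep X n))"
 "mul D X Y = cls (%n. mul (A n) (rep X n) (rep Y n))"
 "str D X = cls (%n. str (A n) (rep X n))"
 "nrm D X = lim (%n. nrm (A n) (rep X n))"
 "gra D X = cls (%n. gra (A n) (rep X n))"
 by (simp_all add: direct_limit_def)

lemma cls_in [simp, intro]: "coh s ==> cls s \<in> car D" by (auto simp: D_sel)

lemma D_cases: assumes "X \<in> car D" obtains s where "coh s" "X = cls s"
 using assms by (auto simp: D_sel)

lemma add_cls: assumes s: "coh s" "coh s'" shows "add D (cls s) (cls s') = cls (%n. add (A n) (s n) (s' n))"
proof -
 note r = rep_cls[OF s(1)] rep_cls[OF s(2)]
 show ?thesis unfolding D_sel
 proof (subst cls_eq)
  show "nul (%n. add (A n) (rep (cls s) n) (rep (cls s') n)) (%n. add (A n) (s n) (s' n))"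
  proof (rule nul_bound)
   show "(%n. dist_n n (rep (cls s) n) (s n) + dist_n n (rep (cls s') n) (s' n)) \<longlonglongrightarrow> 0"
    using tendsto_add[OF r(2,4)[unfolded nul_def]] by simp
  qed (use r s in "auto simp: dist_n_def A.sub_add_add intro: A.nrm_add")
 qed (use r s in "auto intro: coh_add")
qed

lemma mul_cls: assumes s: "coh s" "coh s'" shows "mul D (cls s) (cls s') = cls (%n. mul (A n) (s n) (s' n))"
proof -
 note r = rep_cls[OF s(1)] rep_cls[OF s(2)]
 obtain B where B: "B > 0" "!!n. nrm (A n) (s n) <= B" by (rule coh_bounded[OF s(1)]) blast
 obtain B' where B': "B' > 0" "!!n. nrm (A n) (rep (cls s') n) <= B'" by (rule coh_bounded[OF r(3)]) blast
 show ?thesis unfolding D_sel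
 proof (subst cls_eq)
  show "nul (%n. mul (A n) (rep (cls s) n) (rep (cls s') n)) (%n. mul (A n) (s n) (s' n))"
  proof (rule nul_bound)
   show "(%n. dist_n n (rep (cls s) n) (s n) * B' + B * dist_n n (rep (cls s') n) (s' n)) \<longlonglongrightarrow> 0"
    using tendsto_add[OF tendsto_mult_left_zero[OF r(2)[unfolded nul_def]] tendsto_mult_right_zero[OF r(4)[unfolded nul_def]]] by simp
   fix n
   let ?a = "rep (cls s) n" and ?b = "rep (cls s') n"
   have c: "?a \<in> car (A n)" "?b \<in> car (A n)" "s n \<in> car (A n)" "s' n \<in> car (A n)" using r s by auto
   have "dist_n n (mul (A n) ?a ?b) (mul (A n) (s n) (s' n)) <= nrm (A n) (mul (A n) (sub (A n) ?a (s n)) ?b) + nrm (A n) (mul (A n) (s n) (sub (A n) ?b (s' n)))"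
    unfolding dist_n_def A.sub_mul_mul[OF c] using c by (intro A.nrm_add) auto
   also have "... <= dist_n n ?a (s n) * nrm (A n) ?b + nrm (A n) (s n) * dist_n n ?b (s' n)"
    unfolding dist_n_def using c by (intro add_mono A.nrm_mul) auto
   also have "... <= dist_n n ?a (s n) * B' + B * dist_n n ?b (s' n)"
    using B(2)[of n] B'(2)[of n] c by (intro add_mono mult_left_mono mult_right_mono) (auto simp: dist_n_def)
   finally show "dist_n n (mul (A n) ?a ?b) (mul (A n) (s n) (s' n)) <= dist_n n ?a (s n) * B' + B * dist_n n ?b (s' n)" .
  qed (use r s in "auto simp: dist_n_def")
 qed (use r s in "auto intro: coh_mul")
qed

lemma lip_cls:
 assumes s: "coh s" and c: "!!s. coh s ==> coh (%n. T n (s n))"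
  and lip: "!!n a b. a \<in> car (A n) ==> b \<in> car (A n) ==> dist_n n (T n a) (T n b) <= L * dist_n n a b"
 shows "cls (%n. T n (rep (cls s) n)) = cls (%n. T n (s n))"
proof -
 note r = rep_cls[OF s]
 show ?thesis
 proof (subst cls_eq)
  show "nul (%n. T n (rep (cls s) n)) (%n. T n (s n))"
  proof (rule nul_bound)
   show "(%n. L * dist_n n (rep (cls s) n) (s n)) \<longlonglongrightarrow> 0"
    by (rule tendsto_mult_right_zero[OF r(2)[unfolded nul_def]])
  qed (use r s c[OF s] c[OF r(1)] lip in "auto intro!: dist_nonneg simp: coherent_def")
 qed (use r s c in auto)
qed

lemma scl_cls: "coh s ==> scl D c (cls s) = cls (%n. scl (A n) c (s n))"
 unfolding D_sel by (rule lip_cls[where L = "cmod c"]) (auto intro: coh_scl simp: dist_n_def A.sub_scl A.nrm_scl)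

lemma str_cls: "coh s ==> str D (cls s) = cls (%n. str (A n) (s n))"
 unfolding D_sel by (rule lip_cls[where L = 1]) (auto intro: coh_str simp: dist_n_def A.sub_str A.nrm_str)

lemma gra_cls: "coh s ==> gra D (cls s) = cls (%n. gra (A n) (s n))"
 unfolding D_sel by (rule lip_cls[where L = 1]) (auto intro: coh_gra simp: dist_n_def A.sub_gra nrm_gra)

lemma sub_cls: "coh s ==> coh s' ==> sub D (cls s) (cls s') = cls (%n. sub (A n) (s n) (s' n))"
 unfolding sub_def by (simp add: scl_cls add_cls coh_scl)

lemma nrm_cls: assumes s: "coh s" shows "(%n. nrm (A n) (s n)) \<longlonglongrightarrow> nrm D (cls s)"
proof -
 note r = rep_cls[OF s]
 have lim: "(%n. nrm (A n) (rep (cls s) n)) \<longlonglongrightarrow> nrm D (cls s)"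
  unfolding D_sel using coh_convergent[OF r(1)] by (simp add: convergent_LIMSEQ_iff)
 have le: "\<bar>nrm (A n) (s n) - nrm (A n) (rep (cls s) n)\<bar> <= dist_n n (rep (cls s) n) (s n)" for n
 proof -
  have c: "s n \<in> car (A n)" "rep (cls s) n \<in> car (A n)" using s r by auto
  show ?thesis
   using A.nrm_le_sub[OF c] A.nrm_le_sub[OF c(2,1)] A.nrm_sub_commute[OF c] by (simp add: dist_n_def)
 qed
 have "(%n. nrm (A n) (s n) - nrm (A n) (rep (cls s) n)) \<longlonglongrightarrow> 0"
  by (rule Lim_null_comparison[OF _ r(2)[unfolded nul_def]]) (simp add: le)
 from tendsto_add[OF this lim] show ?thesis by simp
qed

lemma nrm_cls_le: assumes "coh s" "!!n. n >= N ==> nrm (A n) (s n) <= B" shows "nrm D (cls s) <= B"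
 by (rule LIMSEQ_le_const2[OF nrm_cls[OF assms(1)]]) (use assms(2) in blast)

definition isq :: "nat => 'a => nat => 'a" where
 "isq N a = (%m. if N <= m then \<beta> N m a else zer (A m))"

lemma incl_isq: "incl N a = cls (isq N a)" by (simp add: limit_incl_def isq_def)

lemma coh_isq: assumes a: "a \<in> car (A N)" shows "coh (isq N a)"
proof (rule cohI)
 fix eps :: real assume "eps > 0"
 then show "EX N'. ALL n m. N' <= n & n <= m --> dist_n m (isq N a m) (\<beta> n m (isq N a n)) <= eps"
  using a by (intro exI[of _ N]) (auto simp: isq_def dist_n_def comp A.sub_self)
qed (use a in "auto simp: isq_def")

lemma incl_in [simp]: "a \<in> car (A N) ==> incl N a \<in> car D"
 by (simp add: incl_isq coh_isq)

lemma dense_incl: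
 assumes s: "coh s" and e: "eps > 0"
 obtains N where "!!n. n >= N ==> dist_n n (s n) (\<beta> N n (s N)) < eps"
 using cohD[OF s e] by blast

lemma cls_eqI: "(!!n. s n = s' n) ==> cls s = cls s'" by (metis ext)

end

context dsys begin

lemmas coh_ops [simp] = coh_zero coh_add coh_scl coh_mul coh_str coh_gra coh_sub
lemmas cls_ops = add_cls scl_cls mul_cls str_cls gra_cls sub_cls

lemma zer_D: "zer D = cls (%n. zer (A n))" by (rule D_sel)

lemma nrm_D_0: assumes "coh s" shows "nrm D (cls s) = 0 \<longleftrightarrow> cls s = zer D"
proof -
 have "dist_n n (s n) (zer (A n)) = nrm (A n) (s n)" for n using assms by (simp add: dist_n_def A.sub_zero)
 then have "cls s = zer D \<longleftrightarrow> (%n. nrm (A n) (s n)) \<longlonglongrightarrow> 0"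
  unfolding zer_D using assms by (simp add: cls_eq nul_def)
 then show ?thesis using nrm_cls[OF assms] LIMSEQ_unique by metis
qed

lemma nrm_cls_mono:
 assumes "coh s" "coh s'" "!!n. nrm (A n) (s n) <= nrm (A n) (s' n)" shows "nrm D (cls s) <= nrm D (cls s')"
 by (rule LIMSEQ_le[OF nrm_cls[OF assms(1)] nrm_cls[OF assms(2)]]) (use assms(3) in blast)

lemma D_vs: "complex_vector_space D"
 unfolding complex_vector_space_def
proof (intro conjI ballI allI)
 show "zer D \<in> car D" by (simp add: zer_D)
 fix X Y Z c d assume "X \<in> car D"
 then obtain s where s: "coh s" "X = cls s" by (rule D_cases)
 show "add D (zer D) X = X" "sub D X X = zer D" "scl D c X \<in> car D" "scl D 1 X = X"
  "scl D (c + d) X = add D (scl D c X) (scl D d X)" "scl D (c * d) X = scl D c (scl D d X)"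
  using s(1) unfolding s(2) zer_D by (simp_all add: cls_ops A.add_0 A.sub_self A.scl_1 A.scl_plus A.scl_times)
 assume "Y \<in> car D"
 then obtain s' where s': "coh s'" "Y = cls s'" by (rule D_cases)
 show "add D X Y \<in> car D" "add D X Y = add D Y X" "scl D c (add D X Y) = add D (scl D c X) (scl D c Y)"
  using s(1) s'(1) unfolding s(2) s'(2) by (auto simp: cls_ops A.scl_add intro!: cls_eqI A.add_comm)
 assume "Z \<in> car D"
 then obtain s'' where s'': "coh s''" "Z = cls s''" by (rule D_cases)
 show "add D (add D X Y) Z = add D X (add D Y Z)"
  using s(1) s'(1) s''(1) unfolding s(2) s'(2) s''(2) by (simp add: cls_ops A.add_assoc)
qed

text \<open>Given a Cauchy sequence of classes, its \<open>k\<close>-th member is frozen at a level \<open>M k\<close> beyond which its representative is almost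
 compatible and its distances to earlier members are almost the limit distances.  Pushing the frozen elements forward
 along these levels gives a compatible sequence that represents the limit.\<close>

lemma D_complete: "norm_complete D (nrm D)"
 unfolding norm_complete_def
proof (intro allI impI, elim conjE)
 fix X :: "nat => (nat => 'a) set"
 assume X: "ALL k. X k \<in> car D" and C: "\<forall>e>0. EX K. \<forall>i\<ge>K. \<forall>j\<ge>K. nrm D (sub D (X i) (X j)) < e"
 have "EX s. coh s & X k = cls s" for k using X D_cases by metis
 then obtain s where s: "!!k. coh (s k)" "!!k. X k = cls (s k)" by metis
 define e where "e k = (1/2::real) ^ k" for k
 have e: "e k > 0" for k by (simp add: e_def)
 have e0: "e \<longlonglongrightarrow> 0" unfolding e_def by (rule LIMSEQ_power_zero) simp
 have nX: "(%n. dist_n n (s j n) (s k n)) \<longlonglongrightarrow> nrm D (sub D (X j) (X k))" for j k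
  unfolding s(2) sub_cls[OF s(1) s(1)] dist_n_def by (intro nrm_cls coh_sub s(1))
 have "EX N. \<forall>n\<ge>N. (\<forall>m\<ge>n. dist_n m (s k m) (\<beta> n m (s k n)) < e k) \<and>
   (\<forall>i\<le>k. dist_n n (s k n) (s i n) <= nrm D (sub D (X k) (X i)) + e k)" for k
 proof -
  obtain N1 where N1: "!!n m. N1 <= n ==> n <= m ==> dist_n m (s k m) (\<beta> n m (s k n)) < e k"
   using cohD[OF s(1) e] by blast
  have "\<forall>\<^sub>F n in sequentially. dist_n n (s k n) (s i n) <= nrm D (sub D (X k) (X i)) + e k" for i
  proof -
   have "\<forall>\<^sub>F n in sequentially. dist_n n (s k n) (s i n) < nrm D (sub D (X k) (X i)) + e k"
    by (rule order_tendstoD(2)[OF nX]) (use e in simp)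
   then show ?thesis by (rule eventually_mono) simp
  qed
  then have "\<forall>\<^sub>F n in sequentially. ALL i:{..k}. dist_n n (s k n) (s i n) <= nrm D (sub D (X k) (X i)) + e k"
   by (intro eventually_ball_finite) auto
  then obtain N2 where N2: "!!n i. n >= N2 ==> i <= k ==> dist_n n (s k n) (s i n) <= nrm D (sub D (X k) (X i)) + e k"
   unfolding eventually_sequentially by auto
  show ?thesis using N1 N2 by (intro exI[of _ "max N1 N2"]) auto
 qed
 then obtain N where N: "!!k n m. n >= N k ==> m >= n ==> dist_n m (s k m) (\<beta> n m (s k n)) < e k"
  "!!k n i. n >= N k ==> i <= k ==> dist_n n (s k n) (s i n) <= nrm D (sub D (X k) (X i)) + e k" by metis
 define M where "M k = k + (\<Sum>i\<le>k. N i)" for k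
 have MN: "N k <= M k" for k unfolding M_def using member_le_sum[of k "{..k}" N] by simp
 have Mk: "k <= M k" for k by (simp add: M_def)
 have Mmono: "M j <= M k" if "j <= k" for j k
  unfolding M_def using that by (intro add_mono sum_mono2) auto
 define F where "F k = s k (M k)" for k
 have Fin: "F k \<in> car (A (M k))" for k using s(1) by (simp add: F_def)
 define kk where "kk n = Max {k. M k <= n}" for n
 have finM: "finite {k. M k <= n}" for n by (rule finite_subset[of _ "{..n}"]) (use Mk in "auto intro: order_trans")
 have kk: "M (kk n) <= n" if "M 0 <= n" for n
  using Max_in[OF finM, of n] that unfolding kk_def by blast
 have kk_ge: "k <= kk n" if "M k <= n" for n k
  unfolding kk_def by (rule Max_ge[OF finM]) (use that in simp)
 define t where "t n = (if M 0 <= n then \<beta> (M (kk n)) n (F (kk n)) else zer (A n))" for n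
 have tin: "t n \<in> car (A n)" for n unfolding t_def using kk Fin by auto
 have FF: "dist_n (M j) (F j) (\<beta> (M k) (M j) (F k)) <= nrm D (sub D (X j) (X k)) + e j + e k" if "k <= j" for j k
 proof -
  have "dist_n (M j) (F j) (\<beta> (M k) (M j) (F k)) <= dist_n (M j) (s j (M j)) (s k (M j)) + dist_n (M j) (s k (M j)) (\<beta> (M k) (M j) (F k))"
   unfolding dist_n_def F_def using s(1) Mmono[OF that] by (intro A.nrm_sub_tri) auto
  also have "dist_n (M j) (s k (M j)) (\<beta> (M k) (M j) (F k)) <= e k"
   unfolding F_def using N(1)[OF MN Mmono[OF that]] by (rule less_imp_le)
  also have "dist_n (M j) (s j (M j)) (s k (M j)) <= nrm D (sub D (X j) (X k)) + e j"
   by (rule N(2)[OF MN that])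
  finally show ?thesis by simp
 qed
 have main: "EX k0. \<forall>k\<ge>k0. \<forall>n\<ge>M k. dist_n n (t n) (\<beta> (M k) n (F k)) <= eps" if eps: "eps > 0" for eps
 proof -
  have "eps / 3 > 0" using eps by simp
  from C[THEN spec, THEN mp, OF this] obtain K where K: "!!i j. i >= K ==> j >= K ==> nrm D (sub D (X i) (X j)) < eps / 3" by blast
  have "\<forall>\<^sub>F k in sequentially. e k < eps / 3" using order_tendstoD(2)[OF e0, of "eps / 3"] eps by simp
  then obtain K' where K': "!!k. k >= K' ==> e k < eps / 3" unfolding eventually_sequentially by blast
  have "dist_n n (t n) (\<beta> (M k) n (F k)) <= eps" if k: "k >= max K K'" and n: "n >= M k" for k n
  proof -
   have m0: "M 0 <= n" using Mmono[of 0 k] n by simp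
   let ?j = "kk n"
   have j: "k <= ?j" "M ?j <= n" using kk_ge[OF n] kk[OF m0] by auto
   have "\<beta> (M k) n (F k) = \<beta> (M ?j) n (\<beta> (M k) (M ?j) (F k))"
    using comp[OF Mmono[OF j(1)] j(2) Fin] by simp
   then have "dist_n n (t n) (\<beta> (M k) n (F k)) = nrm (A n) (\<beta> (M ?j) n (sub (A (M ?j)) (F ?j) (\<beta> (M k) (M ?j) (F k))))"
    unfolding dist_n_def t_def using m0 j Mmono[OF j(1)] Fin by (simp add: \<beta>_sub)
   also have "... <= dist_n (M ?j) (F ?j) (\<beta> (M k) (M ?j) (F k))"
    unfolding dist_n_def using j Mmono[OF j(1)] Fin by (intro \<beta>_nrm) auto
   also have "... <= nrm D (sub D (X ?j) (X k)) + e ?j + e k" by (rule FF[OF j(1)])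
   also have "... <= eps" using K[of ?j k] K'[of k] K'[of ?j] k j by simp
   finally show ?thesis .
  qed
  then show ?thesis by blast
 qed
 have tcoh: "coh t"
 proof (rule cohI[OF tin])
  fix eps :: real assume "eps > 0"
  then have "eps / 2 > 0" by simp
  from main[OF this] obtain k where k: "!!n. n >= M k ==> dist_n n (t n) (\<beta> (M k) n (F k)) <= eps / 2" by blast
  have "dist_n m (t m) (\<beta> n m (t n)) <= eps" if n: "M k <= n" "n <= m" for n m
  proof -
   have b: "\<beta> (M k) m (F k) = \<beta> n m (\<beta> (M k) n (F k))" using comp[OF n Fin] by simp
   have "dist_n m (t m) (\<beta> n m (t n)) <= dist_n m (t m) (\<beta> (M k) m (F k)) + dist_n m (\<beta> (M k) m (F k)) (\<beta> n m (t n))"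
    unfolding dist_n_def using tin n Fin by (intro A.nrm_sub_tri) auto
   also have "dist_n m (\<beta> (M k) m (F k)) (\<beta> n m (t n)) = nrm (A m) (\<beta> n m (sub (A n) (\<beta> (M k) n (F k)) (t n)))"
    unfolding b dist_n_def using tin n Fin by (simp add: \<beta>_sub)
   also have "... <= nrm (A n) (sub (A n) (\<beta> (M k) n (F k)) (t n))" using tin n Fin by (intro \<beta>_nrm) auto
   also have "... = dist_n n (t n) (\<beta> (M k) n (F k))" unfolding dist_n_def using tin n Fin by (intro A.nrm_sub_commute) auto
   finally show ?thesis using k[of n] k[of m] n by simp
  qed
  then show "EX N. ALL n m. N <= n & n <= m --> dist_n m (t m) (\<beta> n m (t n)) <= eps" by blast
 qed
 have "(%k. nrm D (sub D (X k) (cls t))) \<longlonglongrightarrow> 0"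
 proof (rule LIMSEQ_I)
  fix eps :: real assume "0 < eps"
  then have e3: "eps / 3 > 0" by simp
  from main[OF this] obtain k0 where k0: "!!k n. k >= k0 ==> n >= M k ==> dist_n n (t n) (\<beta> (M k) n (F k)) <= eps / 3" by blast
  have "\<forall>\<^sub>F k in sequentially. e k < eps / 3" using order_tendstoD(2)[OF e0 e3] by simp
  then obtain K' where K': "!!k. k >= K' ==> e k < eps / 3" unfolding eventually_sequentially by blast
  have "norm (nrm D (sub D (X k) (cls t)) - 0) < eps" if k: "k >= max k0 K'" for k
  proof -
   have le: "dist_n n (s k n) (t n) <= eps / 3 + eps / 3" if n: "n >= M k" for n
   proof -
    have "dist_n n (s k n) (t n) <= dist_n n (s k n) (\<beta> (M k) n (F k)) + dist_n n (\<beta> (M k) n (F k)) (t n)"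
     unfolding dist_n_def using tin n Fin s(1) by (intro A.nrm_sub_tri) auto
    also have "dist_n n (\<beta> (M k) n (F k)) (t n) = dist_n n (t n) (\<beta> (M k) n (F k))"
     unfolding dist_n_def using tin n Fin by (intro A.nrm_sub_commute) auto
    also have "dist_n n (s k n) (\<beta> (M k) n (F k)) <= e k" unfolding F_def by (intro less_imp_le N(1) MN n)
    finally show ?thesis using k0[of k n] K'[of k] k n by simp
   qed
   have c: "coh (%n. sub (A n) (s k n) (t n))" using s(1) tcoh by simp
   have "nrm D (sub D (X k) (cls t)) <= eps / 3 + eps / 3"
    unfolding s(2) sub_cls[OF s(1) tcoh] by (rule nrm_cls_le[OF c, of "M k"]) (use le in "simp add: dist_n_def")
   moreover have "0 <= nrm D (sub D (X k) (cls t))"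
    unfolding s(2) sub_cls[OF s(1) tcoh] by (rule LIMSEQ_le_const[OF nrm_cls[OF c]]) (use s(1) tin in auto)
   ultimately show ?thesis using e3 by simp
  qed
  then show "EX no. \<forall>n\<ge>no. norm (nrm D (sub D (X n) (cls t)) - 0) < eps" by blast
 qed
 then show "EX x:car D. (%k. nrm D (sub D (X k) x)) \<longlonglongrightarrow> 0" using tcoh by blast
qed

lemma D_cstar: "graded_cstar_algebra D"
 unfolding graded_cstar_algebra_def linear_map_def
proof (intro conjI ballI allI)
 show "complex_vector_space D" by (rule D_vs)
 show "norm_complete D (nrm D)" by (rule D_complete)
 fix X c assume "X \<in> car D"
 then obtain s where s: "coh s" and Xs: "X = cls s" by (rule D_cases)
 show "str D X \<in> car D" "str D (str D X) = X" "str D (scl D c X) = scl D (cnj c) (str D X)" "gra D X \<in> car D"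
  "gra D (gra D X) = X" "gra D (str D X) = str D (gra D X)" "gra D (scl D c X) = scl D c (gra D X)"
  using s unfolding Xs by (simp_all add: cls_ops A.str_str A.str_scl A.gra_gra A.gra_str A.gra_scl)
 show "0 <= nrm D X" unfolding Xs by (rule LIMSEQ_le_const[OF nrm_cls[OF s]]) (use s in auto)
 show "(nrm D X = 0) = (X = zer D)" unfolding Xs by (rule nrm_D_0[OF s])
 show "nrm D (scl D c X) = cmod c * nrm D X"
 proof -
  have "(%n. nrm (A n) (scl (A n) c (s n))) \<longlonglongrightarrow> nrm D (scl D c X)"
   unfolding Xs scl_cls[OF s] using s by (intro nrm_cls) simp
  moreover have "(%n. nrm (A n) (scl (A n) c (s n))) \<longlonglongrightarrow> cmod c * nrm D X"
   using s tendsto_mult_left[OF nrm_cls[OF s], of "cmod c"] by (simp add: A.nrm_scl Xs)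
  ultimately show ?thesis by (rule LIMSEQ_unique)
 qed
 show "nrm D (mul D (str D X) X) = (nrm D X)^2"
 proof -
  have "(%n. nrm (A n) (mul (A n) (str (A n) (s n)) (s n))) \<longlonglongrightarrow> nrm D (mul D (str D X) X)"
   using s nrm_cls[of "%n. mul (A n) (str (A n) (s n)) (s n)"] by (simp add: Xs cls_ops)
  moreover have "(%n. nrm (A n) (mul (A n) (str (A n) (s n)) (s n))) \<longlonglongrightarrow> (nrm D X)\<^sup>2"
   using s tendsto_power[OF nrm_cls[OF s], of 2] by (simp add: A.nrm_cstar Xs)
  ultimately show ?thesis by (rule LIMSEQ_unique)
 qed
 fix Y assume "Y \<in> car D"
 then obtain s' where s': "coh s'" and Ys: "Y = cls s'" by (rule D_cases)
 show "mul D X Y \<in> car D" "mul D Y X \<in> car D" "str D (add D X Y) = add D (str D X) (str D Y)"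
  "str D (mul D X Y) = mul D (str D Y) (str D X)" "gra D (add D X Y) = add D (gra D X) (gra D Y)"
  "gra D (mul D X Y) = mul D (gra D X) (gra D Y)"
  "mul D X (scl D c Y) = scl D c (mul D X Y)" "mul D (scl D c Y) X = scl D c (mul D Y X)"
  using s s' unfolding Xs Ys by (simp_all add: cls_ops A.str_add A.str_mul A.gra_add A.gra_mul A.mul_sclR A.mul_sclL)
 show "nrm D (add D X Y) <= nrm D X + nrm D Y"
  unfolding Xs Ys add_cls[OF s s']
  by (rule LIMSEQ_le[OF nrm_cls[OF coh_add[OF s s']] tendsto_add[OF nrm_cls[OF s] nrm_cls[OF s']]])
   (use s s' A.nrm_add in auto)
 show "nrm D (mul D X Y) <= nrm D X * nrm D Y"
  unfolding Xs Ys mul_cls[OF s s']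
  by (rule LIMSEQ_le[OF nrm_cls[OF coh_mul[OF s s']] tendsto_mult[OF nrm_cls[OF s] nrm_cls[OF s']]])
   (use s s' A.nrm_mul in auto)
 fix Z assume "Z \<in> car D"
 then obtain s'' where s'': "coh s''" and Zs: "Z = cls s''" by (rule D_cases)
 show "mul D X (add D Y Z) = add D (mul D X Y) (mul D X Z)" "mul D (add D Y Z) X = add D (mul D Y X) (mul D Z X)"
  "mul D (mul D X Y) Z = mul D X (mul D Y Z)"
  using s s' s'' unfolding Xs Ys Zs by (simp_all add: cls_ops A.mul_addR A.mul_addL A.mul_assoc)
qed

sublocale D: gca D by unfold_locales (rule D_cstar)

lemma D_dense:
 assumes X: "X \<in> car D" and e: "eps > 0"
 obtains N a where "a \<in> car (A N)" "nrm D (sub D X (incl N a)) <= eps"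
proof -
 obtain s where s: "coh s" "X = cls s" using X by (rule D_cases)
 obtain N where N: "!!n. n >= N ==> dist_n n (s n) (\<beta> N n (s N)) < eps" using dense_incl[OF s(1) e] by blast
 have i: "coh (isq N (s N))" using s(1) by (intro coh_isq) simp
 have "nrm D (sub D X (incl N (s N))) <= eps"
  unfolding s(2) incl_isq sub_cls[OF s(1) i]
  by (rule nrm_cls_le[of _ N]) (use s(1) i N in "auto simp: isq_def dist_n_def less_imp_le")
 then show ?thesis using s(1) by (intro that[of "s N" N]) auto
qed

lemma incl_add: "a \<in> car (A N) ==> b \<in> car (A N) ==>
  incl N (add (A N) a b) = add D (incl N a) (incl N b)"
proof -
 assume a: "a \<in> car (A N)" and b: "b \<in> car (A N)"
 show ?thesis unfolding incl_isq add_cls[OF coh_isq[OF a] coh_isq[OF b]]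
  by (rule cls_eqI) (simp add: isq_def \<beta>_add A.add_0 a b)
qed

lemma incl_scl: "a \<in> car (A N) ==> incl N (scl (A N) c a) = scl D c (incl N a)"
proof -
 assume a: "a \<in> car (A N)"
 show ?thesis unfolding incl_isq scl_cls[OF coh_isq[OF a]]
  by (rule cls_eqI) (simp add: isq_def \<beta>_scl A.scl_zero a)
qed

lemma incl_mul: "a \<in> car (A N) ==> b \<in> car (A N) ==>
  incl N (mul (A N) a b) = mul D (incl N a) (incl N b)"
proof -
 have "mul (A n) (zer (A n)) (zer (A n)) = zer (A n)" for n
  using A.mul_sclL[of "zer (A n)" n "zer (A n)" 0] by (simp add: A.scl_0)
 moreover assume a: "a \<in> car (A N)" and b: "b \<in> car (A N)"
 ultimately show ?thesis unfolding incl_isq mul_cls[OF coh_isq[OF a] coh_isq[OF b]]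
  by (intro cls_eqI) (simp add: isq_def \<beta>_mul a b)
qed

lemma incl_sub: "a \<in> car (A N) ==> b \<in> car (A N) ==>
  incl N (sub (A N) a b) = sub D (incl N a) (incl N b)"
 unfolding sub_def by (simp add: incl_add incl_scl)

lemma incl_nrm: "a \<in> car (A N) ==> nrm D (incl N a) <= nrm (A N) a"
 unfolding incl_isq by (rule nrm_cls_le[OF coh_isq, of _ _ N]) (auto intro: \<beta>_nrm simp: isq_def)

definition lift :: "(nat => 'a => 'a) => (nat => 'a) set => (nat => 'a) set" where
 "lift T X = cls (%n. T n (rep X n))"

lemma lift_cls:
 assumes "coh s" "!!s. coh s ==> coh (%n. T n (s n))"
  "!!n a b. a \<in> car (A n) ==> b \<in> car (A n) ==> dist_n n (T n a) (T n b) <= dist_n n a b"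
 shows "lift T (cls s) = cls (%n. T n (s n))"
 unfolding lift_def using assms by (intro lip_cls[where L = 1]) auto

end

section \<open>A graded C*-algebra as a Kasparov module over itself\<close>


lemma self_module_sel [simp]:
 "car (self_module A) = car A" "zer (self_module A) = zer A" "add (self_module A) = add A" "scl (self_module A) = scl A"
 "act (self_module A) = mul A" "inn (self_module A) = (%a b. mul A (str A a) b)" "hgr (self_module A) = gra A"
 by (simp_all add: self_module_def)

lemma sub_self_module [simp]: "sub (self_module A) = sub A"
 by (intro ext) (simp add: sub_def)

context gca begin

lemma hnorm_self: "x \<in> car A ==> hnorm A (self_module A) x = nrm A x"
 by (simp add: hnorm_def nrm_cstar real_sqrt_unique)

lemma self_hilbert_module: "graded_hilbert_module A (self_module A)"
proof -
 have "norm_complete (self_module A) (hnorm A (self_module A))"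
  unfolding norm_complete_def
 proof (intro allI impI, elim conjE)
  fix s :: "nat => 'a"
  assume s: "ALL k. s k \<in> car (self_module A)"
   and C: "\<forall>eps>0. EX K. \<forall>i\<ge>K. \<forall>j\<ge>K. hnorm A (self_module A) (sub (self_module A) (s i) (s j)) < eps"
  have s': "s k \<in> car A" for k using s by simp
  have C': "\<forall>eps>0. EX K. \<forall>i\<ge>K. \<forall>j\<ge>K. nrm A (sub A (s i) (s j)) < eps"
   using C s' by (simp add: hnorm_self)
  obtain x where "x \<in> car A" "(%k. nrm A (sub A (s k) x)) \<longlonglongrightarrow> 0"
   using complete C' s' unfolding norm_complete_def by blast
  then show "EX x:car (self_module A). (%k. hnorm A (self_module A) (sub (self_module A) (s k) x)) \<longlonglongrightarrow> 0"
   using s' by (intro bexI[of _ x]) (simp_all add: hnorm_self)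
 qed
 moreover have "complex_vector_space (self_module A)"
  unfolding complex_vector_space_def self_module_sel sub_self_module by (rule cvs[unfolded complex_vector_space_def])
 moreover have "x = zer A" if "x \<in> car A" "mul A (str A x) x = zer A" for x
  using nrm_cstar[OF that(1)] that by (simp add: nrm_0_iff)
 ultimately show ?thesis unfolding graded_hilbert_module_def linear_map_def
  by (auto simp: mul_addL mul_addR mul_sclL mul_sclR mul_assoc str_mul str_str gra_add gra_scl gra_mul gra_gra gra_str)
qed

text \<open>With operator \<open>0\<close> the only nontrivial analytic condition is that left multiplications are compact: \<open>a u\<^sup>*\<close> is close to
 \<open>a\<close> for \<open>u\<close> in a left approximate unit \<open>E\<close>, and \<open>x \<mapsto> a u\<^sup>* x\<close> is a rank one operator.  The same \<open>E\<close> generates the module.\<close>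

lemma kasparov_zero:
 assumes \<sigma>: "U_cstar_algebra A \<sigma>" and \<rho>: "twisted_action A (nrm A) \<rho>"
  and left: "!!g a x. g \<in> loop_group ==> a \<in> car A ==> x \<in> car A ==> \<rho> g (mul A a x) = mul A (\<sigma> g a) (\<rho> g x)"
  and right: "!!g a x. g \<in> loop_group ==> a \<in> car A ==> x \<in> car A ==> \<rho> g (mul A x a) = mul A (\<rho> g x) (\<sigma> g a)"
  and inner: "!!g x y. g \<in> loop_group ==> x \<in> car A ==> y \<in> car A ==> mul A (str A (\<rho> g x)) (\<rho> g y) = \<sigma> g (mul A (str A x) y)"
  and grading: "!!g x. g \<in> loop_group ==> x \<in> car A ==> \<rho> g (gra A x) = gra A (\<rho> g x)"
  and E: "countable E" "E <= car A" "!!x eps. x \<in> car A ==> eps > 0 ==> EX u:E. nrm A (sub A x (mul A u x)) < eps"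
 shows "twisted_kasparov_module A \<sigma> A \<sigma> (self_module A) \<rho> (mul A) (%x. zer A)"
  and "twisted_bimodule_action A \<sigma> \<rho>"
proof -
 let ?E = "self_module A"
 have \<rho>lin: "linear_map A A (\<rho> g)" if "g \<in> loop_group" for g using \<rho> that by (simp add: twisted_action_def)
 have \<rho>in: "\<rho> g x \<in> car A" if "g \<in> loop_group" "x \<in> car A" for g x using \<rho>lin that by (simp add: linear_map_def)
 have \<sigma>in: "\<sigma> g x \<in> car A" if "g \<in> loop_group" "x \<in> car A" for g x
  using \<sigma> that by (simp add: U_cstar_algebra_def star_hom_def linear_map_def)
 have \<rho>0: "\<rho> g (zer A) = zer A" if g: "g \<in> loop_group" for g
 proof -
  have "\<rho> g (scl A 0 (zer A)) = scl A 0 (\<rho> g (zer A))" using \<rho>lin[OF g] by (simp add: linear_map_def)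
  then show ?thesis using \<rho>in[OF g] by (simp add: scl_0)
 qed
 show "twisted_bimodule_action A \<sigma> \<rho>"
  unfolding twisted_bimodule_action_def
 proof (intro conjI ballI)
  fix g a x a' assume *: "g \<in> loop_group" "a \<in> car A" "x \<in> car A" "a' \<in> car A"
  have "\<rho> g (mul A (mul A a x) a') = mul A (\<rho> g (mul A a x)) (\<sigma> g a')" using * by (intro right) auto
  then show "\<rho> g (mul A (mul A a x) a') = mul A (mul A (\<sigma> g a) (\<rho> g x)) (\<sigma> g a')" using * by (simp add: left)
 qed (use \<rho> inner in auto)
 have sc: "strongly_continuous ?E (hnorm A ?E) \<rho>"
  unfolding strongly_continuous_def loop_continuous_def self_module_sel sub_self_module
 proof (intro ballI allI impI)
  fix x g and eps :: real assume x: "x \<in> car A" and g: "g \<in> loop_group" and e: "eps > 0"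
  then obtain W where W: "openin loop_topology W" "g \<in> W" "\<forall>g'\<in>W. nrm A (sub A (\<rho> g' x) (\<rho> g x)) <= eps"
   using \<rho> unfolding twisted_action_def strongly_continuous_def loop_continuous_def by blast
  have "W <= loop_group"
  proof -
   have "topspace loop_topology <= loop_group" unfolding loop_topology_def topology_generated_by_topspace by auto
   then show ?thesis using openin_subset[OF W(1)] by auto
  qed
  then have "\<forall>g'\<in>W. hnorm A ?E (sub A (\<rho> g' x) (\<rho> g x)) <= eps"
   using W(3) x g \<rho>in by (auto simp: hnorm_self)
  then show "EX W. openin loop_topology W & g \<in> W & (\<forall>g'\<in>W. hnorm A ?E (sub A (\<rho> g' x) (\<rho> g x)) <= eps)"
   using W by blast
 qed
 have tw: "twisted_hilbert_module A \<sigma> ?E \<rho>"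
  unfolding twisted_hilbert_module_def twisted_action_def
 proof (intro conjI ballI)
  show "strongly_continuous ?E (hnorm A ?E) \<rho>" by (rule sc)
  show "graded_hilbert_module A ?E" by (rule self_hilbert_module)
  fix g assume g: "g \<in> loop_group"
  show "linear_map ?E ?E (\<rho> g)" using \<rho>lin[OF g] by (simp add: linear_map_def)
 qed (use \<rho> in \<open>auto simp: grading right inner hnorm_self \<rho>in twisted_action_def\<close>)
 have cg: "countably_generated A ?E"
  unfolding countably_generated_def
 proof (intro exI[of _ E] conjI ballI allI impI)
  fix x and eps :: real assume x: "x \<in> car ?E" and e: "0 < eps"
  then obtain u where u: "u \<in> E" "nrm A (sub A x (mul A u x)) < eps" using E(3)[of x eps] by auto
  show "EX ps. set ps <= E \<times> car A & hnorm A ?E (sub ?E x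
    (foldr (%(s, b). add ?E (act ?E s b)) ps (zer ?E))) < eps"
   using u E(2) x by (intro exI[of _ "[(u, x)]"]) (auto simp: add_0R hnorm_self subset_iff)
 qed (use E in auto)
 have rep: "equivariant_representation A \<sigma> ?E \<rho> (mul A)"
  unfolding equivariant_representation_def linear_map_def adjointable_def
  by (auto simp: mul_addL mul_sclL mul_assoc str_mul gra_mul left intro: exI[of _ "mul A (str A _)"])
 have z: "mul A (zer A) y = zer A" "mul A y (zer A) = zer A" if "y \<in> car A" for y
  using mul_sclL[OF that zero_in, of 0] mul_sclR[OF that zero_in, of 0] that by (simp_all add: scl_0)
 have sz: "str A (zer A) = zer A" using nrm_str[of "zer A"] by (simp add: nrm_0_iff)
 have comp0: "compact_op A ?E T" if T: "!!x. x \<in> car A ==> T x = zer A" for T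
  unfolding compact_op_def
 proof (intro conjI allI impI)
  show "adjointable ?E T" unfolding adjointable_def using T by (auto simp: z sz intro!: exI[of _ "%x. zer A"])
  show "EX ps. set ps <= car ?E \<times> car ?E & op_dist_le A ?E eps T (finite_rank_op ?E ps)"
   if "eps > 0" for eps
   using that T by (intro exI[of _ "[]"]) (simp add: op_dist_le_def finite_rank_op_def sub_self hnorm_self)
 qed
 have adj0: "adjointable ?E (%x. zer A)" using comp0[of "%x. zer A"] by (simp add: compact_op_def)
 have compa: "compact_op A ?E T" if a: "a \<in> car A" and T: "!!x. x \<in> car A ==> T x = mul A a x" for a T
  unfolding compact_op_def
 proof (intro conjI allI impI)
  show "adjointable ?E T"
   unfolding adjointable_def using T a by (auto simp: str_mul mul_assoc intro!: exI[of _ "mul A (str A a)"])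
  fix eps :: real assume "eps > 0"
  then obtain u where u: "u \<in> E" "nrm A (sub A (str A a) (mul A u (str A a))) < eps" using E(3)[of "str A a"] a by auto
  have uA: "u \<in> car A" using u E by auto
  have "sub A a (mul A a (str A u)) = str A (sub A (str A a) (mul A u (str A a)))"
   using a uA by (simp add: sub_str[symmetric] str_mul str_str)
  then have le: "nrm A (sub A a (mul A a (str A u))) <= eps" using u(2) a uA by (simp add: nrm_str)
  show "EX ps. set ps <= car ?E \<times> car ?E & op_dist_le A ?E eps T (finite_rank_op ?E ps)"
  proof (intro exI[of _ "[(a, u)]"] conjI)
   show "op_dist_le A ?E eps T (finite_rank_op ?E [(a, u)])"
    unfolding op_dist_le_def
   proof
    fix x assume "x \<in> car ?E"
    then have x: "x \<in> car A" by simp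
    have "hnorm A ?E (sub ?E (T x) (finite_rank_op ?E [(a, u)] x)) =
     nrm A (mul A (sub A a (mul A a (str A u))) x)"
     using a uA x by (simp add: finite_rank_op_def T add_0R hnorm_self mul_subL mul_assoc)
    also have "... <= nrm A (sub A a (mul A a (str A u))) * nrm A x" using a uA x by (intro nrm_mul) auto
    also have "... <= eps * nrm A x" using le x by (intro mult_right_mono) auto
    finally show "hnorm A ?E (sub ?E (T x) (finite_rank_op ?E [(a, u)] x)) <= eps * hnorm A ?E x"
     using x by (simp add: hnorm_self)
   qed
  qed (use a uA in auto)
 qed
 have gz: "gra A (zer A) = zer A" using gra_scl[of "zer A" 0] by (simp add: scl_0)
 show "twisted_kasparov_module A \<sigma> A \<sigma> ?E \<rho> (mul A) (%x. zer A)"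
  unfolding twisted_kasparov_module_def
 proof (intro conjI ballI)
  fix a assume a: "a \<in> car A"
  show "compact_op A ?E (%x. mul A a (sub ?E x (zer A)))"
   by (rule compa[OF a]) (simp add: sub_zero)
  show "loop_continuous (op_dist_le A ?E) (%g. conj_op ?E \<rho> g (%x. mul A a (zer A)))"
   unfolding loop_continuous_def conj_op_def op_dist_le_def
  proof (intro ballI allI impI)
   fix g and eps :: real assume g: "g \<in> loop_group" and e: "eps > 0"
   let ?W = "{h \<in> loop_group. \<forall>j\<le>0. ALL th. \<bar>(deriv ^^ j) h th - (deriv ^^ j) g th\<bar> < 1}"
   have "openin loop_topology ?W"
    unfolding loop_topology_def using g
    by (intro topology_generated_by_Basis CollectI exI[of _ g] exI[of _ "0::nat"] exI[of _ "1::real"] conjI) simp_all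
   moreover have "\<forall>g'\<in>loop_group. ALL x:car ?E. hnorm A ?E
    (sub ?E (\<rho> g' (mul A a (zer A))) (\<rho> g (mul A a (zer A)))) <= eps * hnorm A ?E x"
    using a g e by (simp add: z \<rho>0 sub_self hnorm_self)
   ultimately show "EX W. openin loop_topology W & g \<in> W & (\<forall>g'\<in>W. ALL x:car ?E. hnorm A ?E
    (sub ?E (\<rho> g' (mul A a (zer A))) (\<rho> g (mul A a (zer A)))) <= eps * hnorm A ?E x)"
    using g by (intro exI[of _ ?W]) simp
  qed
 qed (use \<sigma> tw cg rep adj0 in \<open>auto simp: z sz gz scl_zero sub_self conj_op_def \<rho>0 intro!: comp0\<close>)
qed

end

section \<open>The loop group and its coordinates\<close>

definition smooth :: "(real => real) => bool" where
 "smooth f \<longleftrightarrow> (ALL j th. ((deriv ^^ j) f) differentiable (at th))"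

lemma smooth_DERIV: "smooth f ==> ((deriv ^^ j) f has_real_derivative (deriv ^^ Suc j) f th) (at th)"
 unfolding smooth_def by (simp add: DERIV_deriv_iff_real_differentiable)

lemma smooth_continuous: "smooth f ==> continuous_on A ((deriv ^^ j) f)"
 using smooth_DERIV by (meson DERIV_isCont continuous_at_imp_continuous_on)

lemma smooth_deriv: "smooth f ==> smooth (deriv f)"
 unfolding smooth_def by (metis funpow_simps_right(2) comp_apply)

lemma deriv_linear:
 assumes "smooth f" "smooth g"
 shows "(deriv ^^ j) (%th. f th + c * g th) = (%th. (deriv ^^ j) f th + c * (deriv ^^ j) g th)"
proof (induction j)
 case (Suc j)
 have "deriv (%th. (deriv ^^ j) f th + c * (deriv ^^ j) g th) th = (deriv ^^ Suc j) f th + c * (deriv ^^ Suc j) g th" for th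
  by (rule DERIV_imp_deriv) (intro derivative_intros DERIV_cmult smooth_DERIV assms)
 then show ?case using Suc by auto
qed simp

lemma smooth_linear:
 assumes "smooth f" "smooth g" shows "smooth (%th. f th + c * g th)"
 unfolding smooth_def deriv_linear[OF assms]
 using assms unfolding smooth_def by (intro allI derivative_intros) auto

lemma loop_group_alt: "g \<in> loop_group \<longleftrightarrow> smooth g & (ALL th. g (th + 2 * pi) = g th) & integral {0..2 * pi} g = 0"
 by (simp add: loop_group_def smooth_def)

lemma loop_smooth [simp]: "g \<in> loop_group ==> smooth g" by (simp add: loop_group_alt)

lemma loop_cont: "g \<in> loop_group ==> continuous_on A g"
 using smooth_continuous[of g A 0] by simp

lemma loop_deriv: assumes g: "g \<in> loop_group" shows "deriv g \<in> loop_group"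
 unfolding loop_group_alt
proof (intro conjI allI)
 have D: "(g has_real_derivative deriv g th) (at th)" for th using smooth_DERIV[of g 0 th] g by simp
 show "smooth (deriv g)" using g by (simp add: smooth_deriv)
 fix th
 have "((%t. g (t + 2 * pi)) has_real_derivative deriv g (th + 2 * pi)) (at th)"
  using DERIV_shift[of g "deriv g (th + 2 * pi)" th "2 * pi"] D by simp
 moreover have "(%t. g (t + 2 * pi)) = g" using g by (auto simp: loop_group_alt)
 ultimately show "deriv g (th + 2 * pi) = deriv g th" using D DERIV_unique by metis
next
 have D: "(g has_real_derivative deriv g th) (at th)" for th using smooth_DERIV[of g 0 th] g by simp
 have "(deriv g has_integral g (2 * pi) - g 0) {0..2 * pi}"
  by (intro fundamental_theorem_of_calculus)
   (auto intro: has_field_derivative_at_within[OF D] simp flip: has_real_derivative_iff_has_vector_derivative)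
 moreover have "g (2 * pi) = g 0" using g unfolding loop_group_alt by (metis add_0)
 ultimately show "integral {0..2 * pi} (deriv g) = 0" by (simp add: integral_unique)
qed

lemma loop_derivs: "g \<in> loop_group ==> (deriv ^^ j) g \<in> loop_group"
 by (induction j) (auto intro: loop_deriv)

lemma loop_linear:
 assumes "f \<in> loop_group" "g \<in> loop_group" shows "(%th. f th + c * g th) \<in> loop_group"
 unfolding loop_group_alt
proof (intro conjI allI)
 have "integral {0..2 * pi} (%th. f th + c * g th) = integral {0..2 * pi} f + integral {0..2 * pi} (%th. c * g th)"
  using assms by (intro integral_add continuous_integrable continuous_intros loop_cont)
 then show "integral {0..2 * pi} (%th. f th + c * g th) = 0" using assms by (simp add: loop_group_alt)
qed (use assms in "auto simp: loop_group_alt smooth_linear")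

lemma smooth_zero: "smooth (%th. 0)"
proof -
 have d: "deriv (%th::real. 0::real) = (%th. 0)" by (rule ext, rule DERIV_imp_deriv) simp
 have "(deriv ^^ j) (%th::real. 0::real) = (%th. 0)" for j by (induction j) (simp_all add: d)
 then show ?thesis by (simp add: smooth_def)
qed

lemma loop_zero [simp]: "(%th. 0) \<in> loop_group"
 by (simp add: loop_group_alt smooth_zero)

lemma loop_add_in [simp]: "f \<in> loop_group ==> g \<in> loop_group ==> loop_add f g \<in> loop_group"
 using loop_linear[of f g 1] by (simp add: loop_add_def)

lemma loop_diff_in [simp]: "f \<in> loop_group ==> g \<in> loop_group ==> loop_diff f g \<in> loop_group"
 using loop_linear[of f g "-1"] by (simp add: loop_diff_def)

lemma derivs_diff: "f \<in> loop_group ==> g \<in> loop_group ==> (deriv ^^ j) (loop_diff f g) th = (deriv ^^ j) f th - (deriv ^^ j) g th"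
 using deriv_linear[of f g j "-1"] by (simp add: loop_diff_def)

lemma crd_loop_diff: "f \<in> loop_group ==> g \<in> loop_group ==> crd i (loop_diff f g) = crd i f - crd i g"
 by (intro crd_diff loop_cont)


lemma periodic_int:
 assumes "!!th::real. f (th + 2 * pi) = (f th :: 'a)" shows "f (th + 2 * pi * of_int n) = f th"
proof -
 have nat: "f (th + 2 * pi * of_nat n) = f th" for th n
 proof (induction n)
  case (Suc n)
  have "th + 2 * pi * of_nat (Suc n) = (th + 2 * pi * of_nat n) + 2 * pi" by (simp add: algebra_simps)
  then show ?case using assms Suc by metis
 qed simp
 show ?thesis
 proof (cases "n >= 0")
  case True
  then show ?thesis using nat[of th "nat n"] by simp
 next
  case False
  then show ?thesis using nat[of "th + 2 * pi * of_int n" "nat (- n)"] by simp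
 qed
qed

lemma periodic_reduce:
 assumes "!!th::real. f (th + 2 * pi) = (f th :: 'a)"
 obtains r where "0 <= r" "r < 2 * pi" "f th = f r"
proof -
 let ?n = "\<lfloor>th / (2 * pi)\<rfloor>" and ?r = "th - 2 * pi * of_int \<lfloor>th / (2 * pi)\<rfloor>"
 have "of_int ?n * (2 * pi) <= th" by (subst pos_le_divide_eq[symmetric]) auto
 moreover have "th < (of_int ?n + 1) * (2 * pi)" by (subst pos_divide_less_eq[symmetric]) (simp, linarith)
 ultimately have "0 <= ?r" "?r < 2 * pi" by (simp_all add: algebra_simps)
 moreover have "f th = f ?r" using periodic_int[of f ?r ?n] assms by simp
 ultimately show ?thesis by (rule that)
qed

lemma loop_periodic: "g \<in> loop_group ==> g (th + 2 * pi) = g th" by (simp add: loop_group_alt)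

lemma loop_sup:
 assumes "g \<in> loop_group" obtains th0 where "!!th. \<bar>g th\<bar> <= \<bar>g th0\<bar>"
proof -
 have "EX x:{0..2 * pi}. ALL y:{0..2 * pi}. \<bar>g y\<bar> <= \<bar>g x\<bar>"
  using assms by (intro continuous_attains_sup continuous_intros loop_cont) auto
 then obtain x where x: "!!y. y \<in> {0..2 * pi} ==> \<bar>g y\<bar> <= \<bar>g x\<bar>" by blast
 have "\<bar>g th\<bar> <= \<bar>g x\<bar>" for th
 proof -
  obtain r where "0 <= r" "r < 2 * pi" "g th = g r" using periodic_reduce[of g th] loop_periodic[OF assms] by metis
  then show ?thesis using x[of r] by simp
 qed
 then show ?thesis by (rule that)
qed

text \<open>The mean of \<open>v\<close> is zero, so each value of \<open>v\<close> is the average of its differences to the other values, which the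
 derivative bounds.\<close>

lemma loop_mean_bound:
 assumes v: "v \<in> loop_group" and M: "!!th. \<bar>deriv v th\<bar> <= M" shows "\<bar>v th\<bar> <= 2 * pi * M"
proof -
 obtain r where r: "0 <= r" "r < 2 * pi" "v th = v r" using periodic_reduce[of v th] loop_periodic[OF v] by metis
 have D: "(v has_real_derivative deriv v x) (at x)" for x using smooth_DERIV[of v 0 x] v by simp
 have M0: "M >= 0" using M[of 0] by linarith
 have lip: "\<bar>v r - v s\<bar> <= 2 * pi * M" if s: "s \<in> {0..2 * pi}" for s
 proof -
  have "norm (v r - v s) <= M * norm (r - s)"
   using field_differentiable_bound[of UNIV v "deriv v" M r s] D M by simp
  also have "... <= M * (2 * pi)" using r s M0 by (intro mult_left_mono) auto
  finally show ?thesis by (simp add: mult.commute)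
 qed
 have int: "integral {0..2 * pi} (%s. v r - v s) = 2 * pi * v r"
 proof -
  have "integral {0..2 * pi} (%s. v r - v s) = integral {0..2 * pi} (%s. v r) - integral {0..2 * pi} v"
   using v by (intro integral_diff continuous_integrable loop_cont continuous_intros)
  then show ?thesis using v by (simp add: loop_group_alt)
 qed
 have "norm (integral {0..2 * pi} (%s. v r - v s)) <= integral {0..2 * pi} (%s. 2 * pi * M)"
  using lip v by (intro integral_norm_bound_integral continuous_integrable continuous_intros loop_cont) auto
 then have "2 * pi * \<bar>v r\<bar> <= 2 * pi * (2 * pi * M)" unfolding int by (simp add: abs_mult)
 then show ?thesis using r(3) by (simp add: mult.commute mult.left_commute)
qed


definition dcf :: "(nat => real) => nat => real" where
 "dcf c i = (if even i then real (i div 2) * c (Suc i) else - real (i div 2) * c (i - 1))"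

lemma DERIV_bfun: "(bfun i has_real_derivative (if even i then - real (i div 2) * bfun (Suc i) th else real (i div 2) * bfun (i - 1) th)) (at th)"
proof (cases "even i")
 case True
 then obtain k where i: "i = 2 * k" by (rule evenE)
 have "((%th. cos (real k * th) * inverse (sqrt (real k * pi))) has_real_derivative - real k * (sin (real k * th) * inverse (sqrt (real k * pi)))) (at th)"
  by (auto intro!: derivative_eq_intros)
 then show ?thesis unfolding i bfun_even bfun_odd e_fun_def[abs_def] f_fun_def divide_inverse by simp
next
 case False
 then obtain k where i: "i = Suc (2 * k)" by (metis oddE Suc_eq_plus1)
 have "((%th. sin (real k * th) * inverse (sqrt (real k * pi))) has_real_derivative real k * (cos (real k * th) * inverse (sqrt (real k * pi)))) (at th)"
  by (auto intro!: derivative_eq_intros)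
 then show ?thesis unfolding i bfun_odd f_fun_def[abs_def] divide_inverse using bfun_even[of k] by (simp add: e_fun_def divide_inverse)
qed

lemma DERIV_comb: assumes K: "finite K" shows "(comb K c has_real_derivative comb K (dcf c) th) (at th)"
proof -
 have "((%th. \<Sum>i\<in>idx K. c i * bfun i th) has_real_derivative
   (\<Sum>i\<in>idx K. c i * (if even i then - real (i div 2) * bfun (Suc i) th else real (i div 2) * bfun (i - 1) th))) (at th)"
  by (intro DERIV_sum DERIV_cmult DERIV_bfun)
 also have "(\<Sum>i\<in>idx K. c i * (if even i then - real (i div 2) * bfun (Suc i) th else real (i div 2) * bfun (i - 1) th)) = comb K (dcf c) th"
  using K by (simp add: comb_def sum_idx dcf_def algebra_simps)
 finally show ?thesis by (simp add: comb_def)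
qed

lemma deriv_comb: "finite K ==> deriv (comb K c) = comb K (dcf c)"
 by (rule ext, rule DERIV_imp_deriv, rule DERIV_comb)

lemma derivs_comb: "finite K ==> (deriv ^^ j) (comb K c) = comb K ((dcf ^^ j) c)"
 by (induction j) (simp_all add: deriv_comb)

lemma smooth_comb: "finite K ==> smooth (comb K c)"
 unfolding smooth_def derivs_comb using DERIV_comb real_differentiable_def by blast

lemma bfun_periodic: "bfun i (th + 2 * pi) = bfun i th"
proof -
 have "real k * (th + 2 * pi) = real k * th + of_int (int k) * (2 * pi)" for k by (simp add: algebra_simps)
 then have "cos (real k * (th + 2 * pi)) = cos (real k * th)" "sin (real k * (th + 2 * pi)) = sin (real k * th)" for k
  using cos_int_2pin[of "int k"] sin_int_2pin[of "int k"] by (simp_all add: cos_add sin_add mult.commute)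
 then show ?thesis by (simp add: bfun_def e_fun_def f_fun_def)
qed

lemma integral_bfun_zero: assumes "i div 2 >= 1" shows "integral {0..2 * pi} (bfun i) = 0"
proof -
 have "bfun i = (%th. (1 / sqrt (real (i div 2) * pi)) * (if even i then cos (of_int (int (i div 2)) * th) else sin (of_int (int (i div 2)) * th)))"
  by (auto simp: bfun_def e_fun_def f_fun_def)
 then show ?thesis using assms by (cases "even i") (simp_all only: integral_mult_right integral_cos_int integral_sin_int if_True if_False, auto)
qed

lemma modes_loop: assumes K: "good K" and x: "x \<in> modes K" shows "x \<in> loop_group"
proof -
 obtain c where x: "x = comb K c" using x K by (auto simp: modes_eq goodD)
 have "integral {0..2 * pi} (comb K c) = (\<Sum>i\<in>idx K. integral {0..2 * pi} (%th. c i * bfun i th))"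
  unfolding comb_def using K by (intro integral_sum continuous_integrable continuous_intros) (auto simp: goodD)
 also have "... = 0" using idx_div[OF K] by (intro sum.neutral) (auto simp: integral_bfun_zero)
 finally have int: "integral {0..2 * pi} (comb K c) = 0" .
 have "comb K c (th + 2 * pi) = comb K c th" for th by (simp add: comb_def bfun_periodic)
 then show ?thesis unfolding loop_group_alt x using int smooth_comb[OF goodD(1)[OF K]] by blast
qed


lemma crd_deriv:
 assumes g: "g \<in> loop_group"
 shows "crd (2 * k) (deriv g) = real k * crd (Suc (2 * k)) g" "crd (Suc (2 * k)) (deriv g) = - real k * crd (2 * k) g"
proof -
 have D: "(g has_real_derivative deriv g x) (at x)" for x using smooth_DERIV[of g 0 x] g by simp
 have parts: "integral {0..2 * pi} (%th. deriv g th * bfun i th) =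
  - integral {0..2 * pi} (%th. g th * (if even i then - real (i div 2) * bfun (Suc i) th else real (i div 2) * bfun (i - 1) th))" for i
 proof -
  let ?b = "%th. if even i then - real (i div 2) * bfun (Suc i) th else real (i div 2) * bfun (i - 1) th"
  have cb: "continuous_on UNIV ?b" by (cases "even i") (auto intro!: continuous_on_mult_left continuous_on_minus continuous_bfun)
  have "((%th. deriv g th * bfun i th + g th * ?b th) has_integral g (2 * pi) * bfun i (2 * pi) - g 0 * bfun i 0) {0..2 * pi}"
   by (intro fundamental_theorem_of_calculus)
    (simp, subst has_real_derivative_iff_has_vector_derivative[symmetric],
     rule has_field_derivative_at_within, rule DERIV_cong[OF DERIV_mult[OF D DERIV_bfun]], simp)
  moreover have "g (2 * pi) = g 0" "bfun i (2 * pi) = bfun i 0"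
   using loop_periodic[OF g, of 0] bfun_periodic[of i 0] by simp_all
  ultimately have "integral {0..2 * pi} (%th. deriv g th * bfun i th + g th * ?b th) = 0" by (simp add: integral_unique)
  moreover have "integral {0..2 * pi} (%th. deriv g th * bfun i th + g th * ?b th) =
   integral {0..2 * pi} (%th. deriv g th * bfun i th) + integral {0..2 * pi} (%th. g th * ?b th)"
   by (intro integral_add continuous_integrable continuous_on_mult cb loop_cont[OF g] loop_cont[OF loop_deriv[OF g]] continuous_bfun)
  ultimately show ?thesis by simp
 qed
 show "crd (2 * k) (deriv g) = real k * crd (Suc (2 * k)) g"
  unfolding crd_def parts by (simp add: mult.left_commute[of "g _"])
 show "crd (Suc (2 * k)) (deriv g) = - real k * crd (2 * k) g"
  unfolding crd_def parts by (simp add: mult.left_commute[of "g _"])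
qed

text \<open>The squared length of the component in mode \<open>k\<close>; each derivative multiplies it by \<open>k\<^sup>2\<close>.\<close>

definition Qk :: "nat => (real => real) => real" where "Qk k g = (crd (2 * k) g)^2 + (crd (Suc (2 * k)) g)^2"

lemma Qk_derivs: "g \<in> loop_group ==> Qk k ((deriv ^^ p) g) = real k ^ (2 * p) * Qk k g"
proof (induction p)
 case (Suc p)
 have "Qk k ((deriv ^^ Suc p) g) = (real k)^2 * Qk k ((deriv ^^ p) g)"
  using crd_deriv[OF loop_derivs[OF Suc(2), of p]] by (simp add: Qk_def power_mult_distrib distrib_left)
 then show ?case using Suc by (simp add: power2_eq_square)
qed simp

lemma Qk_le:
 assumes g: "g \<in> loop_group" and M: "!!th. \<bar>g th\<bar> <= M" and k: "k >= 1"
 shows "Qk k g <= 8 * pi * real k * M^2"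
proof -
 have M0: "M >= 0" using M[of 0] by linarith
 have b: "\<bar>bfun i th\<bar> <= 1 / sqrt (real (i div 2) * pi)" for i th
  unfolding bfun_def e_fun_def f_fun_def by (auto intro!: divide_right_mono)
 have c: "(crd i g)^2 <= 4 * pi * real k * M^2" if i: "i div 2 = k" for i
 proof -
  let ?s = "1 / sqrt (real k * pi)"
  have pt: "norm (g th * bfun i th) <= M * ?s" for th
   using M[of th] b[of i th] M0 i by (simp only: real_norm_def abs_mult) (intro mult_mono; simp)
  have nb: "norm (integral {0..2 * pi} (%th. g th * bfun i th)) <= integral {0..2 * pi} (%th. M * ?s)"
   by (intro integral_norm_bound_integral continuous_integrable continuous_on_mult continuous_on_const loop_cont g continuous_bfun pt)
  have "real k * \<bar>integral {0..2 * pi} (%th. g th * bfun i th)\<bar> <= real k * (2 * pi * (M * ?s))"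
   using nb by (intro mult_left_mono) auto
  then have "\<bar>crd i g\<bar> <= real k * (2 * pi * (M * ?s))" unfolding crd_def abs_mult i by simp
  then have "\<bar>crd i g\<bar>\<^sup>2 <= (real k * (2 * pi * (M * ?s)))^2" by (rule power_mono) simp
  also have "... = 4 * pi * real k * M^2"
   using k by (simp add: power_mult_distrib power_divide power2_eq_square field_simps)
  finally show ?thesis by simp
 qed
 show ?thesis using c[of "2 * k"] c[of "Suc (2 * k)"] unfolding Qk_def by simp
qed

text \<open>The weighted norm dual to the Bott-Dirac field: its weights are inverse to those of \<open>csq\<close>.\<close>

definition Wn :: "real => nat set => (real => real) => real" where
 "Wn l K g = (\<Sum>i\<in>idx K. (real (i div 2) powr l * crd i g)^2)"

lemma Wn_nonneg [simp]: "0 <= Wn l K g" by (simp add: Wn_def sum_nonneg)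

lemma Wn_Qk: "finite K ==> Wn l K g = (\<Sum>k\<in>K. (real k powr l)^2 * Qk k g)"
 unfolding Wn_def by (simp add: sum_idx Qk_def power_mult_distrib distrib_left)

lemma sum_inverse_squares: "(\<Sum>k\<in>{1..m}. 1 / (real k)^2) <= 2"
proof -
 have "(\<Sum>k\<in>{1..Suc m}. 1 / (real k)^2) <= 2 - 1 / real (Suc m)" for m
 proof (induction m)
  case (Suc m)
  have "1 / (real (Suc (Suc m)))^2 <= 1 / real (Suc m) - 1 / real (Suc (Suc m))"
  proof -
   have "1 / real (Suc m) - 1 / real (Suc (Suc m)) = 1 / (real (Suc m) * real (Suc (Suc m)))" by (simp add: field_simps)
   moreover have "real (Suc m) * real (Suc (Suc m)) <= (real (Suc (Suc m)))^2"
    unfolding power2_eq_square by (intro mult_right_mono) auto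
   ultimately show ?thesis by (simp add: divide_left_mono del: of_nat_Suc)
  qed
  then show ?case using Suc by (simp del: of_nat_Suc)
 qed simp
 then show ?thesis by (cases m) (simp, smt (verit) divide_nonneg_nonneg of_nat_0_le_iff)
qed

text \<open>Two derivatives more than the weight leave a factor \<open>k^(-2)\<close>, which is summable.\<close>

definition pord :: "real => nat" where "pord l = nat \<lceil>\<bar>l\<bar> + 2\<rceil>"

lemma Wn_bound:
 assumes g: "g \<in> loop_group" and M: "!!th. \<bar>(deriv ^^ pord l) g th\<bar> <= M"
 shows "Wn l {1..m} g <= 16 * pi * M^2"
proof -
 have "Wn l {1..m} g = (\<Sum>k\<in>{1..m}. (real k powr l)^2 * Qk k g)" by (simp add: Wn_Qk)
 also have "... <= (\<Sum>k\<in>{1..m}. 8 * pi * M^2 * (1 / (real k)^2))"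
 proof (intro sum_mono)
  fix k assume "k \<in> {1..m}"
  then have k: "k >= 1" by simp
  let ?p = "pord l"
  have Q: "Qk k g = Qk k ((deriv ^^ ?p) g) / real k ^ (2 * ?p)"
   using Qk_derivs[OF g, of k ?p] k by simp
  have lp: "\<bar>l\<bar> + 2 <= real ?p" unfolding pord_def by linarith
  have "(real k powr l)^2 * real k * (real k)^2 = real k powr (2 * l + 1 + 2)"
  proof -
   have "(real k powr l)^2 = real k powr (2 * l)" by (simp add: power2_eq_square flip: powr_add)
   moreover have "real k = real k powr 1" "(real k)^2 = real k powr 2" using k by simp_all
   ultimately show ?thesis by (simp only: powr_add)
  qed
  also have "... <= real k powr (2 * real ?p)" using k lp by (intro powr_mono) auto
  also have "... = real k ^ (2 * ?p)" using k by (simp flip: powr_realpow)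
  finally have key: "(real k powr l)^2 * real k * (real k)^2 <= real k ^ (2 * ?p)" .
  have "(real k powr l)^2 * Qk k g <= (real k powr l)^2 * (8 * pi * real k * M^2 / real k ^ (2 * ?p))"
   unfolding Q using Qk_le[OF loop_derivs[OF g] M k] by (intro mult_left_mono divide_right_mono) auto
  also have "... = (8 * pi * M^2) * ((real k powr l)^2 * real k / real k ^ (2 * ?p))" by simp
  also have "... <= (8 * pi * M^2) * (1 / (real k)^2)"
   using key k by (intro mult_left_mono) (simp_all add: field_simps)
  finally show "(real k powr l)^2 * Qk k g <= 8 * pi * M^2 * (1 / (real k)^2)" .
 qed
 also have "... = 8 * pi * M^2 * (\<Sum>k\<in>{1..m}. 1 / (real k)^2)" by (simp add: sum_distrib_left)
 also have "... <= 8 * pi * M^2 * 2" by (intro mult_left_mono sum_inverse_squares) auto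
 finally show ?thesis by simp
qed

definition nbh :: "(real => real) => nat => real => (real => real) set" where
 "nbh f k eps = {g \<in> loop_group. \<forall>j\<le>k. ALL th. \<bar>(deriv ^^ j) g th - (deriv ^^ j) f th\<bar> < eps}"

lemma openin_nbh: "f \<in> loop_group ==> eps > 0 ==> openin loop_topology (nbh f k eps)"
 unfolding loop_topology_def nbh_def by (rule topology_generated_by_Basis) blast

lemma nbh_self: "f \<in> loop_group ==> eps > 0 ==> f \<in> nbh f k eps" by (simp add: nbh_def)

lemma nbh_Wn:
 assumes "f \<in> loop_group" "g \<in> nbh f k eps" "pord l <= k" shows "Wn l {1..m} (loop_diff g f) <= 16 * pi * eps\<^sup>2"
proof (rule Wn_bound)
 have g: "g \<in> loop_group" using assms by (simp add: nbh_def)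
 then show "loop_diff g f \<in> loop_group" using assms by simp
 show "\<bar>(deriv ^^ pord l) (loop_diff g f) th\<bar> <= eps" for th
  unfolding derivs_diff[OF g assms(1)] using assms(2,3) by (simp add: nbh_def less_imp_le)
qed

section \<open>Density of the trigonometric polynomials\<close>

inductive trig :: "(real => real) => bool" where
 cos: "trig (%th. cos (of_int p * th))"
| sin: "trig (%th. sin (of_int p * th))"
| add: "trig u ==> trig v ==> trig (%th. u th + v th)"
| scl: "trig u ==> trig (%th. c * u th)"

lemma trig_cong: "trig u ==> (!!th. v th = u th) ==> trig v"
 by (metis ext)

lemma trig_product:
 "trig (%th. cos (of_int p * th) * cos (of_int q * th))" "trig (%th. sin (of_int p * th) * sin (of_int q * th))"
 "trig (%th. sin (of_int p * th) * cos (of_int q * th))"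
proof -
 note tr = trig.scl[OF trig.add[OF trig.cos trig.cos], of "1/2" "p - q" "p + q"]
  trig.scl[OF trig.add[OF trig.cos trig.scl[OF trig.cos]], of "1/2" "p - q" "-1" "p + q"]
  trig.scl[OF trig.add[OF trig.sin trig.sin], of "1/2" "p + q" "p - q"]
 show "trig (%th. cos (of_int p * th) * cos (of_int q * th))"
  by (rule trig_cong[OF tr(1)]) (simp add: cos_times_cos algebra_simps)
 show "trig (%th. sin (of_int p * th) * sin (of_int q * th))"
  by (rule trig_cong[OF tr(2)]) (simp add: sin_times_sin field_simps)
 show "trig (%th. sin (of_int p * th) * cos (of_int q * th))"
  by (rule trig_cong[OF tr(3)]) (simp add: sin_times_cos left_diff_distrib distrib_right)
qed

lemma trig_mult: assumes "trig u" "trig v" shows "trig (%th. u th * v th)"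
proof -
 have c: "trig (%th. cos (of_int p * th) * v th)" for p using assms(2)
  by induction (auto intro: trig_product trig.add trig.scl trig_cong[OF trig_product(3)]
   simp: distrib_left mult.left_commute mult.commute[of "cos _" "sin _"])
 have s: "trig (%th. sin (of_int p * th) * v th)" for p using assms(2)
  by induction (auto intro: trig_product trig.add trig.scl simp: distrib_left mult.left_commute)
 show ?thesis using assms(1)
  by induction (auto intro: c s trig.add trig.scl simp: distrib_right mult.assoc)
qed

lemma trig_const: "trig (%th. c)"
 using trig.scl[OF trig.cos[of 0], of c] by simp

lemma trig_polynomial: "real_polynomial_function g ==> trig (%th. g (cis th))"
proof (induction g rule: real_polynomial_function.induct)
 case (linear f)
 interpret f: bounded_linear f by (rule linear)
 have "f (cis th) = f 1 * cos (of_int 1 * th) + f \<i> * sin (of_int 1 * th)" for th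
 proof -
  have "cis th = cos th *\<^sub>R 1 + sin th *\<^sub>R \<i>" by (simp add: complex_eq_iff)
  then show ?thesis by (simp add: f.add f.scaleR)
 qed
 then show ?case by (rule trig_cong[OF trig.add[OF trig.scl[OF trig.cos] trig.scl[OF trig.sin]]])
qed (auto intro: trig_const trig.add trig_mult)

lemma modes_mono: assumes "finite L" "K <= L" shows "modes K <= modes L"
proof
 fix x assume "x \<in> modes K"
 then obtain c where x: "x = comb K c" using assms by (auto simp: modes_eq finite_subset)
 have "comb K c = comb L (%i. if i \<in> idx K then c i else 0)"
  unfolding comb_def using assms finite_idx[OF assms(1)]
  by (intro ext sum.mono_neutral_cong_left) (auto simp: idx_def)
 then show "x \<in> modes L" using assms x by (simp add: modes_eq)
qed

lemma modes_linear: assumes "finite K" "x \<in> modes K" "y \<in> modes K" shows "(%th. x th + c * y th) \<in> modes K"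
proof -
 obtain a b where ab: "x = comb K a" "y = comb K b" using assms by (auto simp: modes_eq)
 have "(%th. x th + c * y th) = comb K (%i. a i + c * b i)"
  by (simp add: ab comb_def sum.distrib sum_distrib_left distrib_right mult.assoc)
 then show ?thesis using assms by (simp add: modes_eq)
qed

lemma modes_zero: "finite K ==> (%th. 0) \<in> modes K"
 by (simp add: modes_eq comb_def image_iff) (rule exI[of _ "%i. 0"], simp)

lemma bfun_modes: assumes "i div 2 >= 1" shows "(%th. c * bfun i th) \<in> modes {1..i div 2}"
proof -
 have "i \<in> idx {1..i div 2}" using assms by (simp add: idx_def)
 then have "comb {1..i div 2} (%j. if j = i then c else 0) = (%th. c * bfun i th)"
  by (simp add: comb_def if_distrib[of "%c. c * _"] sum.delta' cong: if_cong)
 then show ?thesis unfolding modes_eq[OF finite_atLeastAtMost] by (metis rangeI)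
qed

lemma trig_modes: "trig u ==> EX n a. EX q:modes {1..n}. ALL th. u th = a + q th"
proof (induction rule: trig.induct)
 case (cos p)
 let ?k = "nat \<bar>p\<bar>"
 have e: "cos (of_int p * th) = cos (real ?k * th)" for th by (cases "p >= 0") simp_all
 show ?case
 proof (cases "p = 0")
  case True
  then show ?thesis using modes_zero[of "{1..1}"] by (intro exI[of _ 1] bexI[of _ "%th. 0"]) auto
 next
  case False
  then show ?thesis using bfun_modes[of "2 * ?k" "sqrt (?k * pi)"]
   by (intro exI[of _ ?k] exI[of _ 0] bexI[of _ "%th. sqrt (?k * pi) * bfun (2 * ?k) th"]) (simp_all add: e bfun_even e_fun_def)
 qed
next
 case (sin p)
 let ?k = "nat \<bar>p\<bar>"
 show ?case
 proof (cases "p = 0")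
  case True
  then show ?thesis using modes_zero[of "{1..1}"] by (intro exI[of _ 1] exI[of _ 0] bexI[of _ "%th. 0"]) auto
 next
  case False
  have e: "sin (of_int p * th) = of_int (sgn p) * sin (real ?k * th)" for th using False by (cases "p >= 0") simp_all
  show ?thesis using False bfun_modes[of "Suc (2 * ?k)" "sgn p * sqrt (?k * pi)"]
   by (intro exI[of _ ?k] exI[of _ 0] bexI[of _ "%th. sgn p * sqrt (?k * pi) * bfun (Suc (2 * ?k)) th"]) (simp_all add: e bfun_odd f_fun_def)
 qed
next
 case (add u v)
 then obtain n a q n' a' q' where q: "q \<in> modes {1..n}" "q' \<in> modes {1..n'}" "ALL th. u th = a + q th" "ALL th. v th = a' + q' th" by blast
 have "q \<in> modes {1..max n n'}" "q' \<in> modes {1..max n n'}"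
  using q(1,2) modes_mono[of "{1..max n n'}" "{1..n}"] modes_mono[of "{1..max n n'}" "{1..n'}"] by auto
 then have "(%th. q th + 1 * q' th) \<in> modes {1..max n n'}" by (intro modes_linear) auto
 then show ?case using q(3,4) by (intro exI[of _ "max n n'"] exI[of _ "a + a'"] bexI) auto
next
 case (scl u c)
 then obtain n a q where q: "q \<in> modes {1..n}" "ALL th. u th = a + q th" by blast
 have "(%th. 0 + c * q th) \<in> modes {1..n}" using q(1) modes_zero by (intro modes_linear) auto
 then show ?case using q(2) by (intro exI[of _ n] exI[of _ "c * a"] bexI) (auto simp: distrib_left)
qed

text \<open>A periodic function is a continuous function on the circle, where \<open>Arg\<close> and \<open>Arg2pi\<close> supply local coordinates away
 from \<open>-1\<close> and \<open>1\<close> respectively; Stone-Weierstrass gives a polynomial in \<open>cos\<close> and \<open>sin\<close>.\<close>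

lemma periodic_approx:
 assumes u: "continuous_on UNIV u" "!!th. u (th + 2 * pi) = u th" and e: "e > 0"
 obtains n a q where "q \<in> modes {1..n}" "!!th. \<bar>u th - (a + q th)\<bar> < e"
proof -
 let ?S = "sphere (0::complex) 1"
 have per: "u th = u \<phi>" if "cis th = cis \<phi>" for th \<phi>
 proof -
  have "sin th = sin \<phi> & cos th = cos \<phi>" using that by (simp add: complex_eq_iff)
  then obtain n where "th = \<phi> + 2 * pi * of_int n" unfolding sin_cos_eq_iff by auto
  then show ?thesis using periodic_int[of u \<phi> n] u(2) by simp
 qed
 have cA: "cis (Arg z) = z" if "z \<in> ?S" for z using that cis_Arg[of z] by (cases "z = 0") (auto simp: sgn_div_norm)
 have c2: "cis (Arg2pi z) = z" if "z \<in> ?S" for z using that Arg2pi[of z] by (auto simp: is_Arg_def cis_conv_exp)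
 have cont: "isCont u x" for x using u(1) by (simp add: continuous_on_eq_continuous_at)
 have "continuous_on ?S (%z. u (Arg z))"
  unfolding continuous_on_eq_continuous_within
 proof
  fix z assume z: "z \<in> ?S"
  show "continuous (at z within ?S) (%z. u (Arg z))"
  proof (cases "z \<in> \<real>\<^sub>\<le>\<^sub>0")
   case False
   show ?thesis by (rule continuous_at_imp_continuous_within[OF isCont_o2[OF continuous_at_Arg[OF False] cont]])
  next
   case True
   then have z2: "z ~: \<real>\<^sub>\<ge>\<^sub>0" using z by (auto simp: complex_nonpos_Reals_iff complex_nonneg_Reals_iff complex_eq_iff cmod_def)
   have "continuous (at z within ?S) (%z. u (Arg2pi z))"
    by (rule continuous_at_imp_continuous_within[OF isCont_o2[OF continuous_at_Arg2pi[OF z2] cont]])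
   then show ?thesis
    by (rule continuous_transform_within[where \<delta> = 1]) (use z per cA c2 in auto)
  qed
 qed
 then obtain g where g: "real_polynomial_function g" "!!z. z \<in> ?S ==> \<bar>u (Arg z) - g z\<bar> < e"
  using Stone_Weierstrass_real_polynomial_function[OF compact_sphere _ e] by metis
 obtain n a q where q: "q \<in> modes {1..n}" "!!th. g (cis th) = a + q th"
  using trig_modes[OF trig_polynomial[OF g(1)]] by blast
 have "\<bar>u th - (a + q th)\<bar> < e" for th
  using g(2)[of "cis th"] per[of "Arg (cis th)" th] cA[of "cis th"] q(2)[of th] by simp
 then show ?thesis using that q(1) by blast
qed

lemma good_N [simp]: "good {1..N}" "good {Suc 0..N}" using good_simps(2)[of 0 N] by simp_all

lemma modes_N_loop: "q \<in> modes {1..N} ==> q \<in> loop_group" by (rule modes_loop[OF good_N(1)])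

text \<open>Induction on the number of derivatives: a trigonometric polynomial close to the derivative has a periodic
 antiderivative of mean zero, and mean-zero loops are controlled by their derivative.\<close>

lemma modes_dense_aux:
 "g \<in> loop_group ==> e > 0 ==> EX N. EX q:modes {1..N}. \<forall>j\<le>k. ALL th. \<bar>(deriv ^^ j) g th - (deriv ^^ j) q th\<bar> < e"
proof (induction k arbitrary: g e)
 case 0
 obtain n a q where q: "q \<in> modes {1..n}" and a: "!!th. \<bar>g th - (a + q th)\<bar> < e / 2"
  using periodic_approx[of g "e / 2"] 0 by (metis loop_cont loop_periodic half_gt_zero)
 have ql: "q \<in> loop_group" using q by (rule modes_N_loop)
 let ?d = "loop_diff g q"
 have dl: "?d \<in> loop_group" using 0 ql by simp
 have "integral {0..2 * pi} (%th. ?d th - a) = integral {0..2 * pi} ?d - integral {0..2 * pi} (%th. a)"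
  by (intro integral_diff continuous_integrable loop_cont dl continuous_intros)
 then have i: "integral {0..2 * pi} (%th. ?d th - a) = - (2 * pi * a)" using dl by (simp add: loop_group_alt)
 have "norm (integral {0..2 * pi} (%th. ?d th - a)) <= integral {0..2 * pi} (%th. e / 2)"
  using a by (intro integral_norm_bound_integral continuous_integrable continuous_on_diff continuous_on_const loop_cont[OF dl])
   (auto simp: loop_diff_def less_imp_le algebra_simps)
 then have ae: "\<bar>a\<bar> <= e / 2" unfolding i by (simp add: abs_mult)
 have "\<bar>g th - q th\<bar> < e" for th using a[of th] ae by linarith
 then show ?case using q by auto
next
 case (Suc k)
 let ?e = "e / (2 * pi + 1)"
 have pi1: "2 * pi + 1 > 0" using pi_gt_zero by linarith
 have e': "?e > 0" "2 * pi * ?e < e" "?e <= e"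
  using Suc(3) pi1 by (simp_all add: field_simps)
 obtain N q where q: "q \<in> modes {1..N}" and a: "\<forall>j\<le>k. ALL th. \<bar>(deriv ^^ j) (deriv g) th - (deriv ^^ j) q th\<bar> < ?e"
  using Suc(1)[OF loop_deriv[OF Suc(2)] e'(1)] by blast
 obtain c where c: "q = comb {1..N} c" using q by (auto simp: modes_eq)
 let ?Q = "comb {1..N} (%i. if even i then - c (Suc i) / real (i div 2) else c (i - 1) / real (i div 2))"
 have dQ: "deriv ?Q = q" unfolding c
  by (simp add: deriv_comb) (auto simp: comb_def dcf_def sum_idx intro!: ext sum.cong)
 have Q: "?Q \<in> modes {1..N}" by (simp add: modes_eq)
 let ?v = "loop_diff g ?Q"
 have v: "?v \<in> loop_group" using Suc(2) modes_N_loop[OF Q] by simp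
 have dv: "\<bar>deriv ?v th\<bar> <= ?e" for th
  using derivs_diff[OF Suc(2) modes_N_loop[OF Q], of 1 th] a[rule_format, of 0 th] dQ by simp
 have "\<bar>(deriv ^^ j) g th - (deriv ^^ j) ?Q th\<bar> < e" if j: "j <= Suc k" for j th
 proof (cases j)
  case 0
  then show ?thesis using loop_mean_bound[OF v dv, of th] e'(2) by (simp add: loop_diff_def)
 next
  case (Suc i)
  then show ?thesis using a[rule_format, of i th] j e'(3) dQ by (simp add: funpow_swap1)
 qed
 then show ?case using Q by blast
qed

lemma modes_dense:
 assumes "g \<in> loop_group" "e > 0" obtains N q where "q \<in> modes {1..N}" "q \<in> nbh g k e"
proof -
 obtain N q where "q \<in> modes {1..N}" "\<forall>j\<le>k. ALL th. \<bar>(deriv ^^ j) g th - (deriv ^^ j) q th\<bar> < e"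
  using modes_dense_aux[OF assms, of k] by blast
 then show ?thesis using that[of q N] modes_N_loop[of q N] by (simp add: nbh_def abs_minus_commute)
qed

text \<open>A supremum over a period is attained, so a strict bound leaves room for a smaller neighbourhood of any member.\<close>

lemma openin_nbhE:
 assumes W: "openin loop_topology W" and g: "g \<in> W"
 obtains k eps where "eps > 0" "nbh g k eps <= W"
proof -
 have mono: "nbh g (max k k') (min e e') <= nbh g k e Int nbh g k' e'" for k k' e e' unfolding nbh_def by auto
 have "EX k eps. eps > 0 & nbh g k eps <= W"
  using W[unfolded loop_topology_def openin_topology_generated_by_iff] g
 proof (induction arbitrary: g rule: generate_topology_on.induct)
  case (Int a b)
  then obtain k e k' e' where "e > 0" "nbh g k e <= a" "e' > 0" "nbh g k' e' <= b" by (meson IntD1 IntD2)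
  moreover have "nbh g (max k k') (min e e') <= nbh g k e Int nbh g k' e'" unfolding nbh_def by auto
  ultimately show ?case by (intro exI[of _ "max k k'"] exI[of _ "min e e'"]) auto
 next
  case (UN K)
  then obtain V where "V \<in> K" "g \<in> V" by blast
  then show ?case using UN(2) by (meson Sup_upper subset_trans)
 next
  case (Basis s)
  then obtain f k e where f: "f \<in> loop_group" "e > 0" and s: "s = nbh f k e" unfolding nbh_def by blast
  have gl: "g \<in> loop_group" using Basis(2) s by (simp add: nbh_def)
  let ?P = "%j d. d > 0 & (ALL th. \<bar>(deriv ^^ j) g th - (deriv ^^ j) f th\<bar> <= e - d)"
  have "EX d. ?P j d" if j: "j <= k" for j
  proof -
   obtain th0 where "!!th. \<bar>loop_diff ((deriv ^^ j) g) ((deriv ^^ j) f) th\<bar> <= \<bar>loop_diff ((deriv ^^ j) g) ((deriv ^^ j) f) th0\<bar>"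
    using loop_sup[OF loop_diff_in[OF loop_derivs[OF gl] loop_derivs[OF f(1)]]] by blast
   moreover have "\<bar>(deriv ^^ j) g th0 - (deriv ^^ j) f th0\<bar> < e" using Basis(2) s j by (simp add: nbh_def)
   ultimately show ?thesis
    by (intro exI[of _ "e - \<bar>(deriv ^^ j) g th0 - (deriv ^^ j) f th0\<bar>"]) (auto simp: loop_diff_def)
  qed
  then obtain d where d: "!!j. j <= k ==> ?P j (d j)" by metis
  let ?m = "Min (d ` {..k})"
  have m: "?m > 0" "!!j. j <= k ==> ?m <= d j" using d by (auto simp: Min_gr_iff)
  have "nbh g k ?m <= s"
  proof
   fix h assume h: "h \<in> nbh g k ?m"
   have "\<bar>(deriv ^^ j) h th - (deriv ^^ j) f th\<bar> < e" if j: "j <= k" for j th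
   proof -
    have "\<bar>(deriv ^^ j) h th - (deriv ^^ j) g th\<bar> < ?m" using h j unfolding nbh_def by blast
    moreover have "\<bar>(deriv ^^ j) g th - (deriv ^^ j) f th\<bar> <= e - d j" using d[OF j] by blast
    ultimately show ?thesis using m(2)[OF j] by linarith
   qed
   then show "h \<in> s" using h unfolding s nbh_def by blast
  qed
  then show ?case using m(1) by blast
 qed simp
 then show ?thesis using that by blast
qed

section \<open>The symplectic form\<close>

definition om :: "nat set => (real => real) => (real => real) => real" where
 "om K g x = (\<Sum>k\<in>K. crd (2 * k) g * crd (Suc (2 * k)) x - crd (Suc (2 * k)) g * crd (2 * k) x)"

lemma om_idx:
 assumes "finite K"
 shows "om K g x = (\<Sum>i\<in>idx K. crd i g * (if even i then crd (Suc i) x else - crd (i - 1) x))"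
 using assms by (simp add: om_def sum_idx)

lemma om_cong:
 "(!!i. i \<in> idx K ==> crd i g = crd i g') ==> (!!i. i \<in> idx K ==> crd i x = crd i x') ==> om K g x = om K g' x'"
 unfolding om_def by (intro sum.cong) (auto simp: idx_def)

lemma om_swap: "om K g x = - om K x g"
 unfolding om_def sum_negf[symmetric] by (intro sum.cong) auto

lemma om_self [simp]: "om K g g = 0" by (simp add: om_def mult.commute)

lemma om_zero [simp]: "om K (%th. 0) x = 0" by (simp add: om_def crd_zero)

lemma om_add_crd:
 assumes "!!i. i \<in> idx K ==> crd i z = crd i x + c * crd i y" shows "om K g z = om K g x + c * om K g y" "om K z g = om K x g + c * om K y g"
proof -
 show "om K g z = om K g x + c * om K g y"
  using assms unfolding om_def sum_distrib_left sum.distrib[symmetric]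
  by (intro sum.cong) (auto simp: idx_def algebra_simps)
 then show "om K z g = om K x g + c * om K y g" using om_swap[of K z g] om_swap[of K x g] om_swap[of K y g] by simp
qed

text \<open>Cauchy-Schwarz with the weights \<open>k^l\<close> and \<open>k^(-l)\<close>.  The second factor is the length of the Bott-Dirac field at \<open>x\<close>, which is
 bounded wherever the image of a fixed element is not small.\<close>

lemma om_bound:
 assumes K: "good K" shows "\<bar>om K g x\<bar> <= sqrt (Wn l K g) * sqrt (csq l K x)"
proof -
 let ?J = "%i. if even i then crd (Suc i) x else - crd (i - 1) x"
 let ?a = "%i. real (i div 2) powr l * crd i g" and ?b = "%i. wt l i * ?J i"
 have ab: "?a i * ?b i = crd i g * ?J i" if "i \<in> idx K" for i
 proof -
  have "real (i div 2) powr l * wt l i = 1" using idx_div[OF K that] by (simp add: wt_def flip: powr_add)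
  then have "(real (i div 2) powr l * wt l i) * (crd i g * ?J i) = crd i g * ?J i" by simp
  then show ?thesis by (simp only: mult.assoc mult.left_commute)
 qed
 have "om K g x = (\<Sum>i\<in>idx K. ?a i * ?b i)"
  using K unfolding om_idx[OF goodD(1)[OF K]] by (intro sum.cong refl) (metis ab)
 then have "\<bar>om K g x\<bar> <= (\<Sum>i\<in>idx K. \<bar>?a i\<bar> * \<bar>?b i\<bar>)" by (simp only: abs_mult[symmetric] sum_abs)
 also have "... <= L2_set ?a (idx K) * L2_set ?b (idx K)" by (rule L2_set_mult_ineq)
 also have "L2_set ?a (idx K) = sqrt (Wn l K g)" by (simp add: L2_set_def Wn_def)
 also have "L2_set ?b (idx K) = sqrt (csq l K x)"
  using K by (simp add: L2_set_def csq_def sum_idx goodD wt_def power_mult_distrib add.commute)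
 finally show ?thesis .
qed

lemma csq_le_Wn: assumes K: "good K" and l: "l >= 0" and x: "x = g" shows "csq l K x <= Wn l K g"
 unfolding csq_def Wn_def x
proof (intro sum_mono)
 fix i assume "i \<in> idx K"
 then have i: "real (i div 2) >= 1" using idx_div[OF K] by simp
 have "wt l i <= real (i div 2) powr l" unfolding wt_def using i l by (intro powr_mono) auto
 then have "\<bar>wt l i * crd i g\<bar> <= \<bar>real (i div 2) powr l * crd i g\<bar>"
  unfolding abs_mult by (intro mult_right_mono) (auto simp: wt_def)
 then show "(wt l i * crd i g)^2 <= (real (i div 2) powr l * crd i g)^2" by (rule abs_le_square_iff[THEN iffD1])
qed

lemma crd_le_Wn: assumes K: "good K" and l: "l >= 0" and i: "i \<in> idx K" shows "\<bar>crd i g\<bar> <= sqrt (Wn l K g)"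
proof -
 have "1 <= real (i div 2) powr l" using idx_div[OF K i] l by (simp add: ge_one_powr_ge_zero)
 then have "1 * \<bar>crd i g\<bar> <= \<bar>real (i div 2) powr l\<bar> * \<bar>crd i g\<bar>" by (intro mult_right_mono) auto
 then have "(crd i g)^2 <= (real (i div 2) powr l * crd i g)^2" by (simp add: abs_mult flip: abs_le_square_iff)
 also have "... <= Wn l K g" unfolding Wn_def using K i by (intro member_le_sum) (auto simp: goodD)
 finally have "sqrt ((crd i g)^2) <= sqrt (Wn l K g)" by (rule real_sqrt_le_mono)
 then show ?thesis by simp
qed

lemma omega_modes:
 assumes K: "good K" and g: "continuous_on UNIV g" and x: "x \<in> modes K" shows "\<omega> g x = om K g x"
proof -
 let ?c = "%i. crd i x"
 have "deriv x = comb K (dcf ?c)"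
  using deriv_comb[OF goodD(1)[OF K], of ?c] comb_crd[of K x] K x by (simp add: goodD)
 then have "\<omega> g x = integral {0..2 * pi} (%th. \<Sum>i\<in>idx K. dcf ?c i * (g th * bfun i th))"
  by (simp add: \<omega>_def comb_def sum_distrib_left mult.left_commute)
 also have "... = (\<Sum>i\<in>idx K. dcf ?c i * integral {0..2 * pi} (%th. g th * bfun i th))"
  using K by (simp add: integral_sum goodD continuous_integrable continuous_on_mult continuous_bfun g)
 also have "... = om K g x"
  using K by (simp add: sum_idx goodD om_def dcf_def crd_def) (intro sum.cong, auto simp: algebra_simps)
 finally show ?thesis .
qed

lemma Wn_mono: "finite L ==> K <= L ==> Wn l K g <= Wn l L g"
 unfolding Wn_def by (intro sum_mono2) (auto simp: idx_def finite_idx[unfolded idx_def])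

lemma Wn_loop_bound: assumes "g \<in> loop_group" obtains B where "B > 0" "!!m. Wn l {1..m} g <= B"
proof -
 obtain th0 where "!!th. \<bar>(deriv ^^ pord l) g th\<bar> <= \<bar>(deriv ^^ pord l) g th0\<bar>"
  using loop_sup[OF loop_derivs[OF assms]] by blast
 then have "Wn l {1..m} g <= 16 * pi * \<bar>(deriv ^^ pord l) g th0\<bar>\<^sup>2" for m by (rule Wn_bound[OF assms])
 then show ?thesis using that[of "16 * pi * \<bar>(deriv ^^ pord l) g th0\<bar>\<^sup>2 + 1"] by (simp add: add_strict_increasing less_imp_le add_increasing2 add_nonneg_pos)
qed

lemma Wn_tail:
 assumes g: "g \<in> loop_group" and e: "e > 0" obtains N where "!!n m. N <= n ==> n <= m ==> Wn l {Suc n..m} g <= e"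
proof -
 obtain B where B: "!!m. Wn l {1..m} g <= B" using Wn_loop_bound[OF g] by metis
 have "incseq (%m. Wn l {1..m} g)" by (intro monoI Wn_mono) auto
 moreover have "bdd_above (range (%m. Wn l {1..m} g))" using B by (auto intro!: bdd_aboveI)
 ultimately have "Cauchy (%m. Wn l {1..m} g)" using LIMSEQ_imp_Cauchy[OF LIMSEQ_incseq_SUP] by blast
 then obtain N where N: "!!n m. N <= n ==> N <= m ==> \<bar>Wn l {1..m} g - Wn l {1..n} g\<bar> < e"
  using e unfolding Cauchy_def dist_real_def by blast
 have "Wn l {Suc n..m} g <= e" if nm: "N <= n" "n <= m" for n m
 proof -
  have u: "{1..m} = {1..n} Un {Suc n..m}" using nm by auto
  have "Wn l {1..m} g = Wn l {1..n} g + Wn l {Suc n..m} g"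
   unfolding Wn_def u idx_Un by (rule sum.union_disjoint) (auto simp: idx_disjoint)
  then show ?thesis using N[of n m] nm by simp
 qed
 then show ?thesis by (rule that)
qed

lemma omega_bound:
 assumes g: "g \<in> loop_group" and h: "h \<in> loop_group" and B: "!!th. \<bar>g th\<bar> <= B" "!!th. \<bar>deriv h th\<bar> <= e"
 shows "\<bar>\<omega> g h\<bar> <= 2 * pi * (B * e)"
proof -
 have "norm (integral {0..2 * pi} (%th. g th * deriv h th)) <= integral {0..2 * pi} (%th. B * e)"
  using B by (intro integral_norm_bound_integral continuous_integrable continuous_on_mult continuous_on_const loop_cont loop_deriv g h)
   (auto simp: abs_mult intro!: mult_mono order_trans[OF abs_ge_zero])
 then show ?thesis by (simp add: \<omega>_def algebra_simps)
qed

lemma omega_diff: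
 assumes "g \<in> loop_group" "h \<in> loop_group" "h' \<in> loop_group" shows "\<omega> g (loop_diff h h') = \<omega> g h - \<omega> g h'"
proof -
 have "deriv (loop_diff h h') = (%th. deriv h th - deriv h' th)" using derivs_diff[OF assms(2,3), of 1] by auto
 then show ?thesis unfolding \<omega>_def
  using assms by (simp add: right_diff_distrib integral_diff continuous_integrable continuous_on_mult loop_cont loop_deriv)
qed

text \<open>For a mode the truncated form is eventually exact; the error of replacing \<open>h\<close> by a nearby mode is bounded uniformly
 in \<open>n\<close>.\<close>

lemma om_tendsto_omega:
 assumes g: "g \<in> loop_group" and h: "h \<in> loop_group" shows "(%n. om {1..n} g h) \<longlonglongrightarrow> \<omega> g h"
proof (rule LIMSEQ_I)
 fix r :: real assume r: "r > 0"
 obtain th0 where B: "!!th. \<bar>g th\<bar> <= \<bar>g th0\<bar>" using loop_sup[OF g] by blast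
 obtain W where W: "W > 0" "!!m. Wn 0 {1..m} g <= W" using Wn_loop_bound[OF g] by metis
 let ?C = "2 * pi * \<bar>g th0\<bar> + sqrt W * sqrt (16 * pi) + 1"
 have C: "?C > 0" by (intro add_nonneg_pos add_nonneg_nonneg) (use W in auto)
 have half: "c * (r / (2 * c)) = r / 2" if "c > 0" for c using that by simp
 define e where "e = r / (2 * ?C)"
 have e: "e > 0" using r C by (simp add: e_def)
 obtain N p where p: "p \<in> modes {1..N}" "p \<in> nbh h (pord 0) e" by (rule modes_dense[OF h e])
 have pl: "p \<in> loop_group" using p by (simp add: nbh_def)
 define d where "d = loop_diff p h"
 have d: "d \<in> loop_group" using pl h by (simp add: d_def)
 have pord: "1 <= pord 0" by (simp add: pord_def)
 have "\<bar>deriv d th\<bar> <= e" for th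
 proof -
  have "\<bar>(deriv ^^ 1) p th - (deriv ^^ 1) h th\<bar> < e" using p(2) pord unfolding nbh_def by blast
  then show ?thesis using derivs_diff[OF pl h, of 1 th] by (simp add: d_def)
 qed
 then have 1: "\<bar>\<omega> g d\<bar> <= 2 * pi * (\<bar>g th0\<bar> * e)" by (rule omega_bound[OF g d B])
 have "norm (om {1..n} g h - \<omega> g h) < r" if n: "n >= N" for n
 proof -
  have pn: "p \<in> modes {1..n}" using p(1) modes_mono[of "{1..n}" "{1..N}"] n by auto
  have "om {1..n} g d = om {1..n} g p + (-1) * om {1..n} g h"
   by (rule om_add_crd) (simp add: d_def crd_loop_diff pl h)
  then have eq: "om {1..n} g h - \<omega> g h = \<omega> g d - om {1..n} g d"
   using omega_diff[OF g pl h] omega_modes[OF good_N(1) loop_cont[OF g] pn] by (simp add: d_def)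
  have "csq 0 {1..n} d <= Wn 0 {1..n} d" by (intro csq_le_Wn) auto
  also have "... <= 16 * pi * e^2" unfolding d_def by (rule nbh_Wn[OF h p(2)]) simp
  finally have "sqrt (csq 0 {1..n} d) <= sqrt (16 * pi) * e" using e by (simp add: real_le_lsqrt power_mult_distrib)
  then have "\<bar>om {1..n} g d\<bar> <= sqrt W * (sqrt (16 * pi) * e)"
   using W by (intro order_trans[OF om_bound[of "{1..n}" g d 0]] mult_mono real_sqrt_le_mono) auto
  then have "norm (om {1..n} g h - \<omega> g h) <= ?C * e - e"
   unfolding eq using 1 by (simp add: algebra_simps)
  also have "... < ?C * e" using e by simp
  also have "... = r / 2" unfolding e_def by (rule half[OF C])
  finally show ?thesis using r by simp
 qed
 then show "EX no. \<forall>n\<ge>no. norm (om {1..n} g h - \<omega> g h) < r" by blast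
qed


section \<open>Twisted translations at a finite level\<close>

text \<open>Translation by the truncation of \<open>g\<close>; the projection makes it meaningful for arbitrary loops.\<close>

definition sh :: "nat set => (real => real) => (real => real) => real => real" where
 "sh K g x = modes_proj K (loop_diff x g)"

lemma sh_in [simp]: "good K ==> sh K g x \<in> modes K" by (simp add: sh_def)

lemma crd_sh: "good K ==> x \<in> modes K ==> continuous_on UNIV g ==> i \<in> idx K ==> crd i (sh K g x) = crd i x - crd i g"
 unfolding sh_def using crd_diff[OF continuous_modes[OF goodD(1)]] by (simp add: crd_modes_proj)

lemma modes_eqI: "good K ==> x \<in> modes K ==> y \<in> modes K ==> (!!i. i \<in> idx K ==> crd i x = crd i y) ==> x = y"
 by (rule modes_crd_eqI) (auto simp: goodD)

lemma modes_norm_shift: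
 assumes K: "good K" and x: "x \<in> modes K" and g: "continuous_on UNIV g"
 shows "(modes_norm K x)^2 <= 2 * (modes_norm K (sh K g x))^2 + 2 * (modes_norm K g)^2"
proof -
 have sq: "(modes_norm K y)^2 = (\<Sum>i\<in>idx K. (crd i y)^2)" for y
  using K by (simp add: modes_norm_eq goodD sum_nonneg)
 have "a^2 <= 2 * (a - b)^2 + 2 * b^2" for a b :: real
  using zero_le_power2[of "a - 2 * b"] by (simp add: power2_eq_square algebra_simps)
 then show ?thesis unfolding sq sum_distrib_left sum.distrib[symmetric]
  by (intro sum_mono) (simp add: crd_sh[OF K x g])
qed

lemma continuous_sh:
 assumes K: "good K" and g: "continuous_on UNIV g" shows "continuous_on (modes K) (sh K g)"
proof -
 have "sh K g x = comb K (%i. crd i x - crd i g)" if x: "x \<in> modes K" for x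
  using crd_diff[OF continuous_modes[OF goodD(1)[OF K] x] g] K by (simp add: sh_def modes_proj_eq goodD)
 moreover have "continuous_on (modes K) (%x. comb K (%i. crd i x - crd i g))"
  using K by (intro continuous_on_comb continuous_on_diff continuous_on_crd continuous_on_const) (auto simp: goodD)
 ultimately show ?thesis using continuous_on_cong by force
qed

lemma C0_shift:
 assumes K: "good K" and g: "continuous_on UNIV g" and \<phi>: "C0 K \<phi>" shows "C0 K (%(t, x). \<phi> (t, sh K g x))"
 unfolding C0_def
proof (intro conjI allI impI)
 have "continuous_on (UNIV \<times> modes K) (%p. \<phi> (fst p, sh K g (snd p)))"
  by (rule continuous_on_compose2[OF C0_cont[OF \<phi>]])
   (auto intro!: continuous_on_Pair continuous_on_fst continuous_on_id continuous_on_compose2[OF continuous_sh[OF K g]] continuous_on_snd simp: K)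
 then show "continuous_on (UNIV \<times> modes K) (%(t, x). \<phi> (t, sh K g x))" by (simp add: case_prod_unfold)
 fix e :: real assume "e > 0"
 then obtain R where R: "!!t x. x \<in> modes K ==> nsq K t x > R ==> cmod (\<phi> (t, x)) < e"
  using C0_tail[OF \<phi>] by blast
 have "R < t^2 + (modes_norm K (sh K g x))^2" if "x \<in> modes K" "nsq K t x > 2 * R + 2 * (modes_norm K g)^2" for t x
  using modes_norm_shift[OF K that(1) g] that(2) zero_le_power2[of t] by linarith
 then show "EX R. ALL t. ALL x:modes K. R < nsq K t x --> cmod (case (t, x) of (t, x) => \<phi> (t, sh K g x)) < e"
  using R K by (intro exI[of _ "2 * R + 2 * (modes_norm K g)^2"]) auto
qed

text \<open>The charge \<open>q\<close> scales the twist.  Only \<open>q = 0, 1\<close> occur in the result, but the adjoint of charge \<open>q\<close> has charge \<open>-q\<close>.\<close>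

definition T :: "real => nat set => (real => real) => sc => sc" where
 "T q K g F = (%(t, x). if x \<in> modes K then (%S. cis (q / 2 * om K g x) * F (t, sh K g x) S) else (%S. 0))"

lemma atc_T: "good K ==> F \<in> SCc K ==> x \<in> modes K ==> atc (T q K g F) t x = cs (cis (q / 2 * om K g x)) * atc F t (sh K g x)"
 by (rule atc_eqI) (auto simp: T_def cf_atc)

lemma H_T: "good K ==> F \<in> SCc K ==> x \<in> modes K ==> H (T q K g F) t x = cs (cis (q / 2 * om K g x)) * H F t (sh K g x)"
 unfolding H_def by (simp add: atc_T hat_cs)

lemma T_SC: assumes K: "good K" and g: "continuous_on UNIV g" and F: "F \<in> SCc K" shows "T q K g F \<in> SCc K"
proof (rule SC_I[OF K])
 let ?a = "%t x. cs (cis (q / 2 * om K g x)) * atc F t (sh K g x)"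
 show "T q K g F (t, x) = cf (?a t x)" if "x \<in> modes K" for t x
  using that K F by (auto simp: T_def cf_atc)
 show "T q K g F (t, x) = (%S. 0)" if "x ~: modes K" for t x using that by (simp add: T_def)
 show "cin (idx K) (?a t x)" for t x using cin_mult[OF cin_cs cin_atc[OF K F]] by blast
 fix S
 have "continuous_on (modes K) (%x. om K g x)"
  unfolding om_def using K by (intro continuous_on_sum continuous_on_diff continuous_on_mult continuous_on_const continuous_on_crd) (auto simp: goodD)
 then have "continuous_on (UNIV \<times> modes K) (%p. cis (q / 2 * om K g (snd p)))"
  by (intro continuous_on_cis continuous_on_mult_left continuous_on_compose2[where g = "om K g" and f = snd] continuous_on_snd continuous_on_id) auto
 from C0_mult_bounded[OF C0_shift[OF K g C0_atc[OF K F, of S]] this, of 1]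
 show "C0 K (%(t, x). cf (?a t x) S)" by (simp add: case_prod_unfold)
qed

lemma T_mul:
 assumes K: "good K" and g: "continuous_on UNIV g" and F: "F \<in> SCc K" "G \<in> SCc K"
 shows "T (p + q) K g (sc_mult F G) = sc_mult (T p K g F) (T q K g G)"
proof (rule SC_eqI[OF K])
 note S = T_SC[OF K g] SC_mul[OF K]
 show "T (p + q) K g (sc_mult F G) \<in> SCc K" "sc_mult (T p K g F) (T q K g G) \<in> SCc K" using S F by blast+
 fix t x assume x: "x \<in> modes K"
 have "(p + q) / 2 * om K g x = p / 2 * om K g x + q / 2 * om K g x" by (simp add: add_divide_distrib distrib_right)
 then have "cs (cis ((p + q) / 2 * om K g x)) = cs (cis (p / 2 * om K g x)) * cs (cis (q / 2 * om K g x))"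
  by (simp only: cis_mult flip: cs_mult)
 moreover have "(cs c * cs d) * (a * b) = (cs c * a) * (cs d * b)" for c d a b
  using cs_commute[of a d] by (metis mult.assoc)
 ultimately show "H (T (p + q) K g (sc_mult F G)) t x = H (sc_mult (T p K g F) (T q K g G)) t x"
  using K x F S by (simp only: H_T H_mul sh_in)
qed

lemma T_star:
 assumes K: "good K" and g: "continuous_on UNIV g" and F: "F \<in> SCc K"
 shows "sc_star (T q K g F) = T (- q) K g (sc_star F)"
proof (rule SC_eqI[OF K])
 note S = T_SC[OF K g] SC_star[OF K]
 show "sc_star (T q K g F) \<in> SCc K" "T (- q) K g (sc_star F) \<in> SCc K" using S F by blast+
 fix t x assume x: "x \<in> modes K"
 show "H (sc_star (T q K g F)) t x = H (T (- q) K g (sc_star F)) t x"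
  using K x F S by (simp add: H_T H_star adj_mult cis_cnj cs_commute)
qed

lemma T_gra:
 assumes K: "good K" and g: "continuous_on UNIV g" and F: "F \<in> SCc K"
 shows "T q K g (gra (SC K) F) = gra (SC K) (T q K g F)"
proof (rule SC_eqI[OF K])
 note S = T_SC[OF K g] SC_gra[OF K]
 show "T q K g (gra (SC K) F) \<in> SCc K" "gra (SC K) (T q K g F) \<in> SCc K" using S F by blast+
 fix t x assume x: "x \<in> modes K"
 show "H (T q K g (gra (SC K) F)) t x = H (gra (SC K) (T q K g F)) t x"
  using K x F S by (simp add: H_T H_gra par_mult del: SC_sel)
qed

lemma T_linear:
 "T q K g (%p S. F p S + G p S) = (%p S. T q K g F p S + T q K g G p S)"
 "T q K g (%p S. c * F p S) = (%p S. c * T q K g F p S)"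
 "T q K g (%p S. F p S - G p S) = (%p S. T q K g F p S - T q K g G p S)"
 by (auto simp: T_def fun_eq_iff algebra_simps)

lemma T_norm:
 assumes K: "good K" and g: "continuous_on UNIV g" and F: "F \<in> SCc K" shows "sc_norm K (T q K g F) <= sc_norm K F"
 by (rule sc_norm_leI[OF K T_SC[OF K g F]]) (simp add: H_T K F norm_cs_mult norm_H_le)

lemma T_T:
 assumes K: "good K" and g: "continuous_on UNIV g" "continuous_on UNIV g'" and F: "F \<in> SCc K"
 shows "T q K g (T q K g' F) = (%p S. cis (q / 2 * om K g g') * T q K (loop_add g g') F p S)"
proof (rule SC_eqI[OF K])
 have ga: "continuous_on UNIV (loop_add g g')" unfolding loop_add_def by (intro continuous_intros g)
 show "T q K g (T q K g' F) \<in> SCc K" "(%p S. cis (q / 2 * om K g g') * T q K (loop_add g g') F p S) \<in> SCc K"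
  using K g ga F by (auto intro: T_SC SC_scl)
 fix t x assume x: "x \<in> modes K"
 have cadd: "crd i (loop_add g g') = crd i g + 1 * crd i g'" for i unfolding loop_add_def using crd_add[OF g] by simp
 have s: "sh K g' (sh K g x) = sh K (loop_add g g') x"
  using K x g ga by (intro modes_eqI[OF K]) (simp_all add: crd_sh cadd)
 have "om K g' (sh K g x) = om K g' x + (-1) * om K g' g" by (rule om_add_crd) (simp add: crd_sh K x g)
 moreover have "om K (loop_add g g') x = om K g x + 1 * om K g' x" by (rule om_add_crd) (rule cadd)
 ultimately have "om K g x + om K g' (sh K g x) = om K g g' + om K (loop_add g g') x" using om_swap[of K g' g] by simp
 then have "cis (q / 2 * om K g x) * cis (q / 2 * om K g' (sh K g x)) = cis (q / 2 * om K g g') * cis (q / 2 * om K (loop_add g g') x)"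
  unfolding cis_mult distrib_left[symmetric] by simp
 then have "cs (cis (q / 2 * om K g x)) * cs (cis (q / 2 * om K g' (sh K g x))) = cs (cis (q / 2 * om K g g')) * cs (cis (q / 2 * om K (loop_add g g') x))"
  by (simp flip: cs_mult)
 then show "H (T q K g (T q K g' F)) t x = H (%p S. cis (q / 2 * om K g g') * T q K (loop_add g g') F p S) t x"
  using K x F g ga by (simp add: H_T H_scl T_SC s del: mult.assoc flip: mult.assoc)
qed

lemma T_cong:
 assumes K: "good K" and g: "continuous_on UNIV g" "continuous_on UNIV g'" and F: "F \<in> SCc K"
  and eq: "!!i. i \<in> idx K ==> crd i g = crd i g'" shows "T q K g F = T q K g' F"
proof (rule SC_eqI[OF K T_SC[OF K g(1) F] T_SC[OF K g(2) F]])
 fix t x assume x: "x \<in> modes K"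
 have "sh K g x = sh K g' x" using K x g eq by (intro modes_eqI[OF K]) (simp_all add: crd_sh)
 moreover have "om K g x = om K g' x" using eq by (intro om_cong) auto
 ultimately show "H (T q K g F) t x = H (T q K g' F) t x" using K F x by (simp add: H_T)
qed

lemma T_zero: assumes K: "good K" and F: "F \<in> SCc K" shows "T q K (%th. 0) F = F"
proof (rule SC_eqI[OF K _ F])
 have c: "continuous_on UNIV (%th::real. 0::real)" by simp
 show "T q K (%th. 0) F \<in> SCc K" by (rule T_SC[OF K c F])
 fix t x assume x: "x \<in> modes K"
 have "sh K (%th. 0) x = x" using K x by (intro modes_eqI[OF K]) (simp_all add: crd_sh crd_zero)
 then show "H (T q K (%th. 0) F) t x = H F t x" using K F x by (simp add: H_T)
qed

section \<open>Equicontinuity in the dimension\<close>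

lemma norm_bvec: assumes L: "good L" shows "norm (t *\<^sub>R gen 0 + cvec l L x) = rad l L t x"
proof -
 let ?v = "t *\<^sub>R gen 0 + cvec l L x"
 have "adj ?v = ?v" by (simp add: adj_add adj_scaleR cvec_def)
 then have "(norm ?v)^2 = norm (?v * ?v)" using cstar_cl[of ?v] by simp
 also have "... = (rad l L t x)^2" unfolding bvec_sq[OF L] norm_of_real by simp
 finally show ?thesis by (rule power2_eq_imp_eq) simp_all
qed

lemma uvec_sgn: "good L ==> uvec l L t x = sgn (t *\<^sub>R gen 0 + cvec l L x)"
 by (simp add: uvec_def sgn_div_norm norm_bvec)

text \<open>Directions of long vectors vary slowly.\<close>

lemma sgn_diff_bound:
 fixes v w :: "'a::real_normed_vector" shows "norm v * norm (sgn w - sgn v) <= 2 * norm (w - v)"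
proof -
 have s: "norm v *\<^sub>R sgn v = v" for v :: 'a by (cases "v = 0") (simp_all add: sgn_div_norm)
 have "norm v *\<^sub>R (sgn w - sgn v) = (norm v - norm w) *\<^sub>R sgn w + (w - v)"
  by (simp add: scaleR_diff_right scaleR_diff_left s)
 then have "norm v * norm (sgn w - sgn v) = norm ((norm v - norm w) *\<^sub>R sgn w + (w - v))"
  by (metis norm_ge_zero abs_of_nonneg norm_scaleR)
 also have "... <= \<bar>norm v - norm w\<bar> * norm (sgn w) + norm (w - v)" by (metis norm_scaleR norm_triangle_ineq)
 also have "... <= norm (w - v) * 1 + norm (w - v)"
  using norm_triangle_ineq3[of v w] by (intro add_right_mono mult_mono) (auto simp: norm_sgn norm_minus_commute)
 finally show ?thesis by simp
qed

lemma cmod_cis_diff: "cmod (cis a - 1) <= \<bar>a\<bar>"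
 using dist_exp_i_1[of a] abs_sin_x_le_abs_x[of "a / 2"] by (simp add: cis_conv_exp)

lemma csq_le_modes_norm: assumes K: "good K" and l: "l >= 0" shows "csq l K x <= (modes_norm K x)^2"
proof -
 have "(wt l i * crd i x)^2 <= (crd i x)^2" if "i \<in> idx K" for i
 proof -
  have "real (i div 2) >= 1" using idx_div[OF K that] by simp
  then have "\<bar>wt l i\<bar> <= 1" using l unfolding wt_def by (simp add: powr_minus ge_one_powr_ge_zero inverse_le_1_iff)
  then have "\<bar>wt l i * crd i x\<bar> <= 1 * \<bar>crd i x\<bar>" unfolding abs_mult by (intro mult_right_mono) auto
  then show ?thesis by (simp flip: abs_le_square_iff)
 qed
 then have "csq l K x <= (\<Sum>i\<in>idx K. (crd i x)^2)" unfolding csq_def by (rule sum_mono)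
 then show ?thesis using K by (simp add: modes_norm_eq goodD sum_nonneg)
qed

lemma norm_EO:
 assumes "norm (atc F r y - atc F r' y') <= e" "norm (atc F (- r) y - atc F (- r') y') <= e"
 shows "norm (Evn F r y - Evn F r' y') <= e" "norm (Odn F r y - Odn F r' y') <= e"
proof -
 have "Evn F r y - Evn F r' y' = (1/2) *\<^sub>R ((atc F r y - atc F r' y') + (atc F (- r) y - atc F (- r') y'))"
  "Odn F r y - Odn F r' y' = (1/2) *\<^sub>R ((atc F r y - atc F r' y') - (atc F (- r) y - atc F (- r') y'))"
  by (simp_all add: Evn_def Odn_def algebra_simps)
 moreover have "norm ((1/2) *\<^sub>R (a + b)) <= e & norm ((1/2) *\<^sub>R (a - b)) <= e" if "norm a <= e" "norm b <= e" for a b :: cl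
  using norm_triangle_ineq[of a b] norm_triangle_ineq4[of a b] that by simp
 ultimately show "norm (Evn F r y - Evn F r' y') <= e" "norm (Odn F r y - Odn F r' y') <= e" using assms by simp_all
qed

lemma norm_H_bet_le:
 assumes L: "good L" and x: "x \<in> modes (L Un K)"
  and b: "norm (atc F (rad l L t x) (modes_proj K x)) <= b" "norm (atc F (- rad l L t x) (modes_proj K x)) <= b"
 shows "norm (H (bet l K L F) t x) <= 2 * b"
proof -
 let ?r = "rad l L t x" and ?y = "modes_proj K x"
 have z: "atc (%p S. 0) s y = 0" for s y by (rule atc_eqI) (simp add: zero_cl.rep_eq)
 have h: "norm ((1/2) *\<^sub>R (a + c)) <= b & norm ((1/2) *\<^sub>R (a - c)) <= b" if "norm a <= b" "norm c <= b" for a c :: cl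
  using norm_triangle_ineq[of a c] norm_triangle_ineq4[of a c] that by simp
 have E: "norm (Evn F ?r ?y) <= b" "norm (Odn F ?r ?y) <= b" using h[OF b] by (simp_all only: Evn_def Odn_def)
 have "norm (uvec l L t x) <= 1" by (simp add: uvec_sgn[OF L] norm_sgn)
 then have "norm (uvec l L t x * Odn F ?r ?y) <= 1 * b"
  using E(2) by (intro order_trans[OF norm_mult_ineq] mult_mono) auto
 then show ?thesis unfolding H_bet[OF x] using norm_triangle_mono[OF E(1)] by fastforce
qed

text \<open>The modulus \<open>s0\<close> depends on \<open>F\<close> but not on \<open>L\<close>.  The radius changes by at most the change of the vector \<open>v\<close>.  The unit
 vector \<open>sgn v\<close> is discontinuous at \<open>v = 0\<close>, but its coefficient is the odd part of \<open>F\<close>, which is small for small radius;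
 for larger radius \<open>sgn v\<close> varies slowly.\<close>

lemma bet_equicontinuous:
 assumes K: "good K" and F: "F \<in> SCc K" and e: "e > 0" and l: "l >= 0"
 obtains s0 where "s0 > 0" "!!L t x x'. good L ==> x \<in> modes (L Un K) ==> x' \<in> modes (L Un K) ==>
  norm (cvec l L x' - cvec l L x) <= s0 ==> (!!i. i \<in> idx K ==> \<bar>crd i x' - crd i x\<bar> <= s0) ==>
  norm (H (bet l K L F) t x' - H (bet l K L F) t x) <= 4 * e"
proof -
 obtain d where d: "d > 0" "!!t t' x x'. x \<in> modes K ==> x' \<in> modes K ==> \<bar>t - t'\<bar> <= d ==>
  (!!i. i \<in> idx K ==> \<bar>crd i x - crd i x'\<bar> <= d) ==> norm (atc F t x - atc F t' x') <= e"
  by (rule atc_uniform[OF K F e]) blast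
 obtain B where B: "B > 0" "!!t x. x \<in> modes K ==> norm (atc F t x) <= B" by (rule atc_bound[OF K F]) blast
 define \<eta> where "\<eta> = d / 2"
 define s0 where "s0 = min d (e * \<eta> / (2 * B))"
 have \<eta>: "\<eta> > 0" "2 * \<eta> <= d" using d(1) by (simp_all add: \<eta>_def)
 have s0: "s0 > 0" "s0 <= d" "s0 <= e * \<eta> / (2 * B)" using d(1) e B(1) \<eta>(1) by (simp_all add: s0_def)
 then have s0B: "2 * s0 * B <= \<eta> * e" using B(1) by (simp add: pos_le_divide_eq mult.commute mult.left_commute)
 have "norm (H (bet l K L F) t x' - H (bet l K L F) t x) <= 4 * e"
  if L: "good L" and x: "x \<in> modes (L Un K)" "x' \<in> modes (L Un K)" and c: "norm (cvec l L x' - cvec l L x) <= s0"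
   and k: "!!i. i \<in> idx K ==> \<bar>crd i x' - crd i x\<bar> <= s0" for L t x x'
 proof -
  define v v' where "v = t *\<^sub>R gen 0 + cvec l L x" and "v' = t *\<^sub>R gen 0 + cvec l L x'"
  define r r' where "r = norm v" and "r' = norm v'"
  define y y' where "y = modes_proj K x" and "y' = modes_proj K x'"
  have r: "rad l L t x = r" "rad l L t x' = r'" by (simp_all add: r_def r'_def v_def v'_def norm_bvec L)
  have vv: "norm (v' - v) <= s0" using c by (simp add: v_def v'_def)
  then have rr: "\<bar>r' - r\<bar> <= s0" using norm_triangle_ineq3[of v' v] by (simp add: r_def r'_def)
  have y: "y \<in> modes K" "y' \<in> modes K" using K by (simp_all add: y_def y'_def)
  have yk: "\<bar>crd i y' - crd i y\<bar> <= d" if "i \<in> idx K" for i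
   using k[OF that] s0(2) that K by (simp add: y_def y'_def crd_modes_proj)
  have a: "norm (atc F r' y' - atc F r y) <= e" "norm (atc F (- r') y' - atc F (- r) y) <= e"
   using rr s0(2) by (intro d(2) y yk; simp)+
  note EO = norm_EO[OF a]
  have H: "H (bet l K L F) t x = Evn F r y + sgn v * Odn F r y" "H (bet l K L F) t x' = Evn F r' y' + sgn v' * Odn F r' y'"
   using H_bet x uvec_sgn[OF L] by (simp_all add: r y_def y'_def v_def v'_def)
  have sg: "norm (sgn v') <= 1" "norm (sgn v) <= 1" by (simp_all add: norm_sgn)
  have 1: "norm (sgn v' * (Odn F r' y' - Odn F r y)) <= 1 * e"
   using EO(2) sg by (intro order_trans[OF norm_mult_ineq] mult_mono) auto
  have 2: "norm ((sgn v' - sgn v) * Odn F r y) <= 2 * e"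
  proof (cases "r <= \<eta>")
   case True
   have "norm (atc F r y - atc F (- r) y) <= e" using True \<eta> d(1) by (intro d(2) y) (auto simp: r_def)
   then have "norm (Odn F r y) <= e" by (simp add: Odn_def) (use e in linarith)
   moreover have "norm (sgn v' - sgn v) <= 2" using norm_triangle_ineq4[of "sgn v'" "sgn v"] sg by linarith
   ultimately show ?thesis by (intro order_trans[OF norm_mult_ineq] mult_mono) auto
  next
   case False
   have "\<eta> * norm (sgn v' - sgn v) <= r * norm (sgn v' - sgn v)" using False by (intro mult_right_mono) auto
   also have "... <= 2 * norm (v' - v)" unfolding r_def by (rule sgn_diff_bound)
   finally have s: "\<eta> * norm (sgn v' - sgn v) <= 2 * s0" using vv by simp
   have "norm (Odn F r y) <= B"
    using norm_triangle_ineq4[of "atc F r y" "atc F (- r) y"] B(2)[OF y(1), of r] B(2)[OF y(1), of "- r"] by (simp add: Odn_def)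
   then have "(\<eta> * norm (sgn v' - sgn v)) * norm (Odn F r y) <= (2 * s0) * B"
    using \<open>norm (Odn F r y) <= B\<close> s s0(1) by (intro mult_mono[OF s]) auto
   moreover have "\<eta> * norm ((sgn v' - sgn v) * Odn F r y) <= \<eta> * (norm (sgn v' - sgn v) * norm (Odn F r y))"
    using \<eta>(1) by (intro mult_left_mono norm_mult_ineq) auto
   ultimately have "\<eta> * norm ((sgn v' - sgn v) * Odn F r y) <= \<eta> * e" using s0B unfolding mult.assoc by linarith
   then have "norm ((sgn v' - sgn v) * Odn F r y) <= e" using \<eta>(1) by simp
   then show ?thesis using e by linarith
  qed
  have "H (bet l K L F) t x' - H (bet l K L F) t x = (Evn F r' y' - Evn F r y) + (sgn v' * (Odn F r' y' - Odn F r y) + (sgn v' - sgn v) * Odn F r y)"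
   unfolding H by (simp add: algebra_simps)
  then have "norm (H (bet l K L F) t x' - H (bet l K L F) t x) <= e + (1 * e + 2 * e)"
   using EO(1) 1 2 by (metis norm_triangle_mono)
  then show ?thesis by simp
 qed
 then show ?thesis using that s0(1) by blast
qed

text \<open>The translation part is \<open>bet_equicontinuous\<close>.  For the phase two regions are distinguished: where \<open>r\<^sup>2 + |y|\<^sup>2\<close>, with \<open>y\<close> the
 projection to \<open>modes K\<close>, exceeds \<open>R\<close> the function itself is small, and elsewhere \<open>om_bound\<close> makes the phase close to \<open>1\<close>, since \<open>csq l (L \<union> K) x \<le> r\<^sup>2 + |y|\<^sup>2\<close>.\<close>

lemma T_bet_small:
 assumes K: "good K" and F: "F \<in> SCc K" and e: "e > 0" and l: "l >= 0"
 obtains \<delta> where "\<delta> > 0" "!!L g. good L ==> K Int L = {} ==> continuous_on UNIV g ==> Wn l (L Un K) g <= \<delta> ==>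
  sc_norm (L Un K) (%p S. T q (L Un K) g (bet l K L F) p S - bet l K L F p S) <= e"
proof -
 have e8: "e / 8 > 0" using e by simp
 obtain s1 where s1: "s1 > 0" "!!L t x x'. good L ==> x \<in> modes (L Un K) ==> x' \<in> modes (L Un K) ==>
  norm (cvec l L x' - cvec l L x) <= s1 ==> (!!i. i \<in> idx K ==> \<bar>crd i x' - crd i x\<bar> <= s1) ==>
  norm (H (bet l K L F) t x' - H (bet l K L F) t x) <= 4 * (e / 8)"
  using bet_equicontinuous[OF K F e8 l] by metis
 obtain B where B: "B > 0" "!!t x. x \<in> modes K ==> norm (atc F t x) <= B"
  and tl: "!!e. e > 0 ==> \<exists>R\<ge>0. ALL t. ALL x:modes K. nsq K t x > R --> norm (atc F t x) <= e"
  by (rule atc_bound[OF K F]) blast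
 obtain R where R: "R >= 0" "!!t x. x \<in> modes K ==> nsq K t x > R ==> norm (atc F t x) <= e / 8"
  using tl[OF e8] by blast
 define C where "C = (\<bar>q\<bar> + 1) * (sqrt R + 1) * B"
 have C: "C > 0" using B(1) R(1) by (simp add: C_def add_nonneg_pos)
 define s0 where "s0 = min s1 (e / (2 * C))"
 have s0: "s0 > 0" "s0 <= s1" "s0 <= e / (2 * C)" using s1(1) e C by (simp_all add: s0_def)
 then have s0C: "s0 * C <= e / 2" using C by (simp add: pos_le_divide_eq mult.commute mult.left_commute)
 have "sc_norm (L Un K) (%p S. T q (L Un K) g (bet l K L F) p S - bet l K L F p S) <= e"
  if L: "good L" and dj: "K Int L = {}" and g: "continuous_on UNIV g" and W: "Wn l (L Un K) g <= s0^2" for L g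
 proof -
  let ?M = "L Un K" and ?b = "bet l K L F"
  have M: "good ?M" using K L by simp
  have b: "?b \<in> SCc ?M" by (rule SC_bet[OF K L F])
  have W': "sqrt (Wn l ?M g) <= s0" using W s0(1) by (simp add: real_le_lsqrt)
  have sub: "idx L <= idx ?M" "idx K <= idx ?M" by (auto simp: idx_def)
  show ?thesis
  proof (rule sc_norm_leI[OF M SC_sub[OF M T_SC[OF M g b] b]])
   fix t x assume x: "x \<in> modes ?M"
   define x' where "x' = sh ?M g x"
   have x': "x' \<in> modes ?M" using M by (simp add: x'_def)
   have cr: "crd i x' = crd i x - crd i g" if "i \<in> idx ?M" for i using crd_sh[OF M x g that] by (simp add: x'_def)
   have "cvec l L x' - cvec l L x = - cvec l L g"
    unfolding cvec_def vect_def sum_subtractf[symmetric] sum_negf[symmetric]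
   proof (intro sum.cong refl)
    fix i assume "i \<in> idx L"
    then have "crd i x' = crd i x - crd i g" using sub cr by blast
    then show "(wt l i * crd i x') *\<^sub>R gen i - (wt l i * crd i x) *\<^sub>R gen i = - ((wt l i * crd i g) *\<^sub>R gen i)"
     by (simp add: right_diff_distrib scaleR_diff_left)
   qed
   then have "norm (cvec l L x' - cvec l L x) = sqrt (csq l L g)"
    using L by (simp add: cvec_def norm_vect goodD csq_def)
   also have "... <= sqrt (Wn l ?M g)"
    using csq_le_Wn[OF L l refl, of g] Wn_mono[OF goodD(1)[OF M], of L l g] by (intro real_sqrt_le_mono) simp
   finally have "norm (cvec l L x' - cvec l L x) <= s1" using W' s0(2) by linarith
   moreover have "\<bar>crd i x' - crd i x\<bar> <= s1" if "i \<in> idx K" for i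
   proof -
    have i: "i \<in> idx ?M" using that sub by blast
    show ?thesis using cr[OF i] crd_le_Wn[OF M l i, of g] W' s0(2) by linarith
   qed
   ultimately have 1: "norm (H ?b t x' - H ?b t x) <= 4 * (e / 8)" by (rule s1(2)[OF L x x'])
   let ?o = "om ?M g x"
   have "om ?M g x' = ?o + (-1) * om ?M g g" by (rule om_add_crd) (simp add: cr)
   then have o: "?o = om ?M g x'" by simp
   let ?y = "modes_proj K x'" and ?r = "rad l L t x'"
   have y: "?y \<in> modes K" using K by simp
   have 2: "cmod (cis (q / 2 * ?o) - 1) * norm (H ?b t x') <= e / 2"
   proof (cases "?r\<^sup>2 + (modes_norm K ?y)^2 > R")
    case True
    have "norm (H ?b t x') <= 2 * (e / 8)"
     using True y by (intro norm_H_bet_le[OF L x'] R(2)) auto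
    moreover have "cmod (cis (q / 2 * ?o) - 1) <= 2" using norm_triangle_ineq4[of "cis (q / 2 * ?o)" 1] by simp
    ultimately have "cmod (cis (q / 2 * ?o) - 1) * norm (H ?b t x') <= 2 * (2 * (e / 8))" by (intro mult_mono) auto
    then show ?thesis by simp
   next
    case False
    have "csq l ?M x' = csq l L x' + csq l K ?y" using csq_Un[OF L K, of l x'] dj K by (simp add: csq_proj Int_commute)
    also have "... <= ?r\<^sup>2 + (modes_norm K ?y)^2" using csq_le_modes_norm[OF K l, of ?y] by (simp add: add_increasing)
    finally have "sqrt (csq l ?M x') <= sqrt R" using False by simp
    then have "\<bar>?o\<bar> <= s0 * sqrt R" unfolding o
     using W' s0(1) by (intro order_trans[OF om_bound[OF M]] mult_mono) auto
    then have "\<bar>q / 2\<bar> * \<bar>?o\<bar> <= \<bar>q / 2\<bar> * (s0 * sqrt R)" by (intro mult_left_mono) auto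
    then have "cmod (cis (q / 2 * ?o) - 1) <= \<bar>q\<bar> / 2 * (s0 * sqrt R)"
     using cmod_cis_diff[of "q / 2 * ?o"] by (simp add: abs_mult)
    also have "... <= (\<bar>q\<bar> + 1) / 2 * (s0 * (sqrt R + 1))" using s0(1) R(1) by (intro mult_mono) auto
    finally have c: "cmod (cis (q / 2 * ?o) - 1) <= (\<bar>q\<bar> + 1) / 2 * (s0 * (sqrt R + 1))" .
    have "norm (H ?b t x') <= 2 * B" using y by (intro norm_H_bet_le[OF L x'] B(2)) auto
    then have "cmod (cis (q / 2 * ?o) - 1) * norm (H ?b t x') <= ((\<bar>q\<bar> + 1) / 2 * (s0 * (sqrt R + 1))) * (2 * B)"
     using c s0(1) R(1) by (intro mult_mono) auto
    also have "... = s0 * C" by (simp add: C_def)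
    finally show ?thesis using s0C by simp
   qed
   have "H (%p S. T q ?M g ?b p S - ?b p S) t x = cs (cis (q / 2 * ?o) - 1) * H ?b t x' + (H ?b t x' - H ?b t x)"
   proof -
    have "cs (cis (q / 2 * ?o)) = cs (cis (q / 2 * ?o) - 1) + 1" using cs_add[of "cis (q / 2 * ?o) - 1" 1] by simp
    then show ?thesis using b x g by (simp add: H_sub[OF M] T_SC[OF M] H_T[OF M] x'_def algebra_simps)
   qed
   then have "norm (H (%p S. T q ?M g ?b p S - ?b p S) t x) <= e / 2 + 4 * (e / 8)"
    using 1 2 norm_triangle_mono[of "cs (cis (q / 2 * ?o) - 1) * H ?b t x'" "e / 2" "H ?b t x' - H ?b t x" "4 * (e / 8)"]
    by (simp add: norm_cs_mult)
   then show "norm (H (%p S. T q ?M g ?b p S - ?b p S) t x) <= e" by simp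
  qed
 qed
 then show ?thesis using that[of "s0^2"] s0(1) by simp
qed

text \<open>Continuity at a general \<open>g\<close> follows from continuity at \<open>0\<close> by the group law; the cocycle \<open>om K g (g' - g)\<close> is small by
 \<open>om_bound\<close>.\<close>

lemma T_bet_continuous:
 assumes F: "F \<in> SCc {1..N}" and e: "e > 0" and l: "l >= 0" and g: "g \<in> loop_group"
 obtains \<delta> where "\<delta> > 0" "!!m g'. N <= m ==> g' \<in> loop_group ==> Wn l {1..m} (loop_diff g' g) <= \<delta> ==>
  sc_norm {1..m} (%p S. T q {1..m} g' (bet l {1..N} {Suc N..m} F) p S - T q {1..m} g (bet l {1..N} {Suc N..m} F) p S) <= e"
proof -
 have e2: "e / 2 > 0" using e by simp
 obtain \<delta>1 where \<delta>1: "\<delta>1 > 0" "!!L d. good L ==> {1..N} Int L = {} ==> continuous_on UNIV d ==> Wn l (L Un {1..N}) d <= \<delta>1 ==>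
  sc_norm (L Un {1..N}) (%p S. T q (L Un {1..N}) d (bet l {1..N} L F) p S - bet l {1..N} L F p S) <= e / 2"
  by (rule T_bet_small[OF good_N(1) F e2 l, of q]) (rule that, assumption, blast)
 obtain W where W: "W > 0" "!!m. Wn l {1..m} g <= W" using Wn_loop_bound[OF g] by metis
 have n0: "0 <= sc_norm {1..N} F" by (rule sc_norm_nonneg[OF good_N(1) F])
 define C where "C = (\<bar>q\<bar> + 1) * sqrt W * (sc_norm {1..N} F + 1)"
 have C: "C > 0" using W(1) n0 by (simp add: C_def)
 define s where "s = e / (2 * C)"
 have s: "s > 0" "s * C <= e / 2" using e C by (simp_all add: s_def)
 have "sc_norm {1..m} (%p S. T q {1..m} g' (bet l {1..N} {Suc N..m} F) p S - T q {1..m} g (bet l {1..N} {Suc N..m} F) p S) <= e"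
  if m: "N <= m" and g': "g' \<in> loop_group" and Wd: "Wn l {1..m} (loop_diff g' g) <= min \<delta>1 (s^2)" for m g'
 proof -
  let ?M = "{1..m}" and ?L = "{Suc N..m}" and ?d = "loop_diff g' g"
  let ?b = "bet l {1..N} ?L F"
  have u: "?L Un {1..N} = ?M" using m by auto
  have dj: "{1..N} Int ?L = {}" by auto
  have M: "good ?M" by simp
  have b: "?b \<in> SCc ?M" using SC_bet[OF good_N(1) good_simps(2)[of N m] F, where l = l] unfolding u .
  have bn: "sc_norm ?M ?b <= sc_norm {1..N} F" using bet_star_hom(3)[OF good_N(1) good_simps(2)[of N m] dj F, where l = l] unfolding u .
  have c: "continuous_on UNIV g" "continuous_on UNIV g'" "continuous_on UNIV ?d" using g g' by (auto intro: loop_cont)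
  have ad: "loop_add g ?d = g'" by (auto simp: loop_add_def loop_diff_def)
  have 1: "sc_norm ?M (%p S. T q ?M ?d ?b p S - ?b p S) <= e / 2"
   using \<delta>1(2)[OF good_simps(2) dj c(3)] Wd unfolding u by simp
  define z where "z = cis (q / 2 * om ?M g ?d)"
  have "sqrt (Wn l ?M ?d) <= s" using Wd s(1) by (simp add: real_le_lsqrt)
  moreover have "sqrt (csq l ?M g) <= sqrt W" using csq_le_Wn[OF M l refl, of g] W(2)[of m] by simp
  ultimately have "\<bar>om ?M g ?d\<bar> <= s * sqrt W" unfolding om_swap[of ?M g] abs_minus_cancel
   using s(1) by (intro order_trans[OF om_bound[OF M]] mult_mono) auto
  then have "\<bar>q / 2\<bar> * \<bar>om ?M g ?d\<bar> <= (\<bar>q\<bar> + 1) * (s * sqrt W)" using s(1) W(1) by (intro mult_mono) auto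
  then have z: "cmod (z - 1) <= (\<bar>q\<bar> + 1) * (s * sqrt W)"
   using cmod_cis_diff[of "q / 2 * om ?M g ?d"] by (simp add: z_def abs_mult)
  note S = T_SC[OF M c(1)] T_SC[OF M c(2) b] T_SC[OF M c(3) b]
  have tt: "T q ?M g (T q ?M ?d ?b) = (%p S. z * T q ?M g' ?b p S)"
   unfolding T_T[OF M c(1,3) b] ad z_def ..
  show ?thesis
  proof (rule sc_norm_leI[OF M SC_sub[OF M S(2) S(1)[OF b]]])
   fix t x assume x: "x \<in> modes ?M"
   let ?D = "%p S. T q ?M ?d ?b p S - ?b p S"
   have "H (T q ?M g ?D) t x = cs z * H (T q ?M g' ?b) t x - H (T q ?M g ?b) t x"
    unfolding T_linear(3) tt H_sub[OF M SC_scl[OF M S(2)] S(1)[OF b]] H_scl[OF M S(2)] ..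
   moreover have "cs (z - 1) + 1 = cs z" using cs_add[of "z - 1" 1] by simp
   ultimately have eq: "H (%p S. T q ?M g' ?b p S - T q ?M g ?b p S) t x = H (T q ?M g ?D) t x - cs (z - 1) * H (T q ?M g' ?b) t x"
    unfolding H_sub[OF M S(2) S(1)[OF b]] by (simp add: algebra_simps flip: \<open>cs (z - 1) + 1 = cs z\<close>)
   have 2: "norm (H (T q ?M g ?D) t x) <= sc_norm ?M ?D"
    by (rule order_trans[OF norm_H_le[OF M S(1) x] T_norm[OF M c(1)]]) (rule SC_sub[OF M S(3) b])+
   have "norm (H (T q ?M g' ?b) t x) <= sc_norm {1..N} F + 1"
    using norm_H_le[OF M S(2)[of q] x, of t] T_norm[OF M c(2) b, of q] bn by linarith
   then have "norm (cs (z - 1) * H (T q ?M g' ?b) t x) <= ((\<bar>q\<bar> + 1) * (s * sqrt W)) * (sc_norm {1..N} F + 1)"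
    unfolding norm_cs_mult using z s(1) W(1) by (intro mult_mono) auto
   also have "... = s * C" by (simp add: C_def)
   finally show "norm (H (%p S. T q ?M g' ?b p S - T q ?M g ?b p S) t x) <= e"
    unfolding eq using 1 2 s(2) norm_triangle_ineq4[of "H (T q ?M g ?D) t x" "cs (z - 1) * H (T q ?M g' ?b) t x"] by linarith
  qed
 qed
 then show ?thesis using that[of "min \<delta>1 (s^2)"] \<delta>1(1) s(1) by simp
qed

section \<open>The action on the direct limit\<close>

text \<open>An opaque name for \<open>{1..n}\<close>, which keeps the lower bound from being rewritten to \<open>Suc 0\<close>.\<close>

definition iv :: "nat => nat set" where "iv n = {1..n}"

lemma good_iv [simp]: "good (iv n)" by (simp add: iv_def del: One_nat_def)

lemma iv_split: "n <= m ==> {Suc n..m} Un iv n = iv m" by (auto simp: iv_def)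

lemma iv_disjoint: "iv n Int {Suc n..m} = {}" by (auto simp: iv_def)

locale hkt = fixes l :: real assumes l: "l >= 0"
begin

lemma beta_bet: "n <= m ==> F \<in> SCc (iv n) ==> hkt_beta l n m F = bet l (iv n) {Suc n..m} F"
 using hkt_beta_bet[of n m F l] by (simp add: iv_def)

sublocale dsys "%N. SC (iv N)" "hkt_beta l"
proof
 fix n m :: nat
 show "graded_cstar_algebra (SC (iv n))" by (rule SC_cstar) simp
 show "nrm (SC (iv n)) (gra (SC (iv n)) a) = nrm (SC (iv n)) a" if "a \<in> SCc (iv n)" for a
 proof -
  have le: "sc_norm (iv n) (gra (SC (iv n)) a) <= sc_norm (iv n) a" if a: "a \<in> SCc (iv n)" for a
   by (rule sc_norm_leI[OF good_iv SC_gra[OF good_iv a]]) (simp add: H_gra[OF good_iv a] norm_H_le a del: SC_sel)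
  interpret gca "SC (iv n)" by unfold_locales (rule SC_cstar, simp)
  have "sc_norm (iv n) a <= sc_norm (iv n) (gra (SC (iv n)) a)" using le[OF gra_in[OF that]] gra_gra[OF that] by simp
  then show ?thesis using le[OF that] by simp
 qed
 show "hkt_beta l n n a = a" if "a \<in> SCc (iv n)" for a
  using beta_bet[of n n a] bet_id[OF good_iv that] that by simp
 assume nm: "n <= m"
 note B = bet_star_hom(1,2)[OF good_iv good_simps(2)[of n m] iv_disjoint, where l = l, unfolded iv_split[OF nm]]
 show "star_hom (SC (iv n)) (SC (iv m)) (hkt_beta l n m)"
  using B(1) beta_bet[OF nm] SC_cstar[OF good_iv[of n]]
  unfolding star_hom_def linear_map_def graded_cstar_algebra_def complex_vector_space_def by simp
 show "graded_map (SC (iv n)) (SC (iv m)) (hkt_beta l n m)"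
  using B(2) beta_bet[OF nm] SC_gra[OF good_iv[of n]] unfolding graded_map_def by simp
 fix p a assume mp: "m <= p" and a: "a \<in> SCc (iv n)"
 have b: "bet l (iv n) {Suc n..m} a \<in> SCc (iv m)" using SC_bet[OF good_iv good_simps(2) a, where l = l] iv_split[OF nm] by metis
 have u: "{Suc m..p} Un {Suc n..m} = {Suc n..p}" using nm mp by auto
 have d: "({Suc n..m} Un iv n) Int {Suc m..p} = {}" using nm by (auto simp: iv_def)
 show "hkt_beta l m p (hkt_beta l n m a) = hkt_beta l n p a"
  using bet_compose[OF good_iv good_simps(2)[of n m] good_simps(2)[of m p] iv_disjoint d a, where l = l]
  unfolding iv_split[OF nm] u beta_bet[OF nm a] beta_bet[OF mp b] beta_bet[OF le_trans[OF nm mp] a] .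
qed

lemma D_SCU: "SCU l = D" by (simp add: SCU_def iv_def)

lemma incl_SCU: "SCU_incl l = incl" by (simp add: SCU_incl_def iv_def)

lemma dist_SC: "dist_n n F G = sc_norm (iv n) (%p S. F p S - G p S)" by (simp add: dist_n_def)

lemma T_contraction:
 assumes g: "continuous_on UNIV g" and "F \<in> SCc (iv n)" "G \<in> SCc (iv n)"
 shows "dist_n n (T q (iv n) g F) (T q (iv n) g G) <= dist_n n F G"
 using T_norm[OF good_iv g SC_sub[OF good_iv assms(2,3)], of q] unfolding dist_SC T_linear(3) .

lemma T_beta_continuous:
 assumes F: "F \<in> SCc (iv N)" and e: "e > 0" and g: "g \<in> loop_group"
 obtains \<delta> where "\<delta> > 0" "!!m g'. N <= m ==> g' \<in> loop_group ==> Wn l (iv m) (loop_diff g' g) <= \<delta> ==>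
  dist_n m (T q (iv m) g' (hkt_beta l N m F)) (T q (iv m) g (hkt_beta l N m F)) <= e"
proof (rule T_bet_continuous[OF F[unfolded iv_def] e l g, of q])
 fix \<delta> assume "\<delta> > 0" and \<delta>: "!!m g'. N <= m ==> g' \<in> loop_group ==> Wn l {1..m} (loop_diff g' g) <= \<delta> ==>
  sc_norm {1..m} (%p S. T q {1..m} g' (bet l {1..N} {Suc N..m} F) p S - T q {1..m} g (bet l {1..N} {Suc N..m} F) p S) <= e"
 show thesis
  by (rule that[OF \<open>\<delta> > 0\<close>]) (use \<delta>[folded iv_def] beta_bet F in "simp add: dist_SC")
qed

text \<open>A loop without components beyond level \<open>n\<close> changes neither the vector \<open>v\<close> nor the added coordinates.\<close>

lemma T_beta:
 assumes nm: "n <= m" and F: "F \<in> SCc (iv n)" and g: "continuous_on UNIV g" and z: "!!i. i \<in> idx {Suc n..m} ==> crd i g = 0"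
 shows "T q (iv m) g (hkt_beta l n m F) = hkt_beta l n m (T q (iv n) g F)"
proof -
 let ?K = "iv n" and ?L = "{Suc n..m}" and ?M = "iv m"
 have TF: "T q ?K g F \<in> SCc ?K" by (rule T_SC[OF good_iv g F])
 have b: "bet l ?K ?L F \<in> SCc ?M" "bet l ?K ?L (T q ?K g F) \<in> SCc ?M"
  using SC_bet[OF good_iv good_simps(2) F, where l = l] SC_bet[OF good_iv good_simps(2) TF, where l = l] iv_split[OF nm] by metis+
 show ?thesis unfolding beta_bet[OF nm F] beta_bet[OF nm TF]
 proof (rule SC_eqI[OF good_iv T_SC[OF good_iv g b(1)] b(2)])
  fix t x assume x: "x \<in> modes ?M"
  let ?x = "sh ?M g x" and ?y = "modes_proj ?K x"
  have sub: "idx ?K <= idx ?M" "idx ?L <= idx ?M" using nm by (auto simp: idx_def iv_def)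
  have cL: "crd i ?x = crd i x" if "i \<in> idx ?L" for i using crd_sh[OF good_iv x g] sub that z by force
  have 1: "csq l ?L ?x = csq l ?L x" "cvec l ?L ?x = cvec l ?L x"
   unfolding csq_def cvec_def vect_def by (intro sum.cong refl, simp add: cL)+
  have y: "modes_proj ?K ?x = sh ?K g ?y"
  proof (rule modes_eqI[OF good_iv])
   fix i assume i: "i \<in> idx ?K"
   then have "i \<in> idx ?M" using sub by blast
   then show "crd i (modes_proj ?K ?x) = crd i (sh ?K g ?y)"
    using i crd_sh[OF good_iv x g] crd_sh[OF good_iv modes_proj_in[OF good_iv] g i] by (simp add: crd_modes_proj)
  qed simp_all
  have "om ?M g x = om ?K g x"
  proof -
   have "om ?L g x = 0" using z unfolding om_def by (intro sum.neutral) (auto simp: idx_def)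
   moreover have "om ?M g x = om ?L g x + om ?K g x"
    unfolding om_def iv_split[OF nm, symmetric] by (intro sum.union_disjoint) (auto simp: iv_def)
   ultimately show ?thesis by simp
  qed
  then have o: "om ?M g x = om ?K g ?y" using om_cong[of ?K g g x ?y] by (simp add: crd_modes_proj)
  have xx: "x \<in> modes (?L Un ?K)" "?x \<in> modes (?L Un ?K)" using x iv_split[OF nm] by simp_all
  have yK: "?y \<in> modes ?K" by simp
  have EO: "Evn (T q ?K g F) r ?y = cs (cis (q / 2 * om ?K g ?y)) * Evn F r (sh ?K g ?y)"
   "Odn (T q ?K g F) r ?y = cs (cis (q / 2 * om ?K g ?y)) * Odn F r (sh ?K g ?y)" for r
   unfolding Evn_def Odn_def atc_T[OF good_iv F yK] by (simp_all add: algebra_simps)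
  have r: "rad l ?L t ?x = rad l ?L t x" "uvec l ?L t ?x = uvec l ?L t x" by (simp_all add: rad_def uvec_def 1)
  show "H (T q ?M g (bet l ?K ?L F)) t x = H (bet l ?K ?L (T q ?K g F)) t x"
   unfolding H_T[OF good_iv b(1) x] H_bet[OF xx(1)] H_bet[OF xx(2)] EO r y o
   by (simp add: distrib_left mult.assoc[symmetric] cs_commute)
 qed
qed

text \<open>For large \<open>n\<close> the sequence is close to the image of a fixed element, and replacing \<open>g\<close> by its truncation at level \<open>n\<close>
 changes \<open>Wn\<close> only by a small tail.  The truncated loop acts compatibly with the connecting map.\<close>

lemma T_coh: assumes s: "coh s" and g: "g \<in> loop_group" shows "coh (%n. T q (iv n) g (s n))"
proof (rule cohI)
 have gc: "continuous_on UNIV g" using g by (rule loop_cont)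
 show "T q (iv n) g (s n) \<in> SCc (iv n)" for n using coh_in[OF s] by (intro T_SC gc good_iv)
 fix e :: real assume e: "e > 0"
 then have e3: "e / 3 > 0" by simp
 obtain N where N: "!!n. n >= N ==> dist_n n (s n) (hkt_beta l N n (s N)) < e / 3" by (rule dense_incl[OF s e3]) blast
 have F: "s N \<in> SCc (iv N)" by (rule coh_in[OF s])
 obtain \<delta> where \<delta>: "\<delta> > 0" "!!m g'. N <= m ==> g' \<in> loop_group ==> Wn l (iv m) (loop_diff g' g) <= \<delta> ==>
  dist_n m (T q (iv m) g' (hkt_beta l N m (s N))) (T q (iv m) g (hkt_beta l N m (s N))) <= e / 3"
  by (rule T_beta_continuous[OF F e3 g, of q]) blast
 obtain N' where N': "!!n m. N' <= n ==> n <= m ==> Wn l {Suc n..m} g <= \<delta>" by (rule Wn_tail[OF g \<delta>(1)]) blast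
 show "EX N. ALL n m. N <= n & n <= m --> dist_n m (T q (iv m) g (s m)) (hkt_beta l n m (T q (iv n) g (s n))) <= e"
 proof (intro exI[of _ "max N N'"] allI impI)
  fix n m assume "max N N' <= n & n <= m"
  then have nm: "N <= n" "N' <= n" "n <= m" "N <= m" by auto
  let ?T = "%n. T q (iv n)" and ?g = "modes_proj (iv n) g"
  let ?X = "hkt_beta l N n (s N)" and ?Y = "hkt_beta l N m (s N)"
  have gl: "?g \<in> loop_group" by (rule modes_loop[OF good_iv modes_proj_in[OF good_iv]])
  have gc': "continuous_on UNIV ?g" using gl by (rule loop_cont)
  have cr: "crd i ?g = (if i \<in> idx (iv n) then crd i g else 0)" if "i \<in> idx (iv m)" for i
   using idx_div[OF good_iv that] by (simp add: modes_proj_eq goodD crd_comb)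
  have "Wn l (iv m) (loop_diff ?g g) = (\<Sum>i\<in>idx {Suc n..m}. (real (i div 2) powr l * crd i (loop_diff ?g g))^2)"
   unfolding Wn_def
  proof (rule sum.mono_neutral_cong_right)
   show "finite (idx (iv m))" "idx {Suc n..m} <= idx (iv m)" using nm goodD(3)[of "iv m"] by (auto simp: idx_def iv_def)
   show "ALL i:idx (iv m) - idx {Suc n..m}. (real (i div 2) powr l * crd i (loop_diff ?g g))^2 = 0"
    using cr crd_loop_diff[OF gl g] nm by (auto simp: idx_def iv_def)
  qed simp
  also have "... = Wn l {Suc n..m} g"
   unfolding Wn_def
  proof (intro sum.cong refl)
   fix i assume i: "i \<in> idx {Suc n..m}"
   then have "i \<in> idx (iv m)" "i ~: idx (iv n)" using nm by (auto simp: idx_def iv_def)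
   then show "(real (i div 2) powr l * crd i (loop_diff ?g g))^2 = (real (i div 2) powr l * crd i g)^2"
    using cr[of i] crd_loop_diff[OF gl g, of i] by simp
  qed
  finally have 1: "dist_n m (?T m ?g ?Y) (?T m g ?Y) <= e / 3" using \<delta>(2)[OF nm(4) gl] N'[OF nm(2,3)] by simp
  have car: "s m \<in> SCc (iv m)" "s n \<in> SCc (iv n)" "?Y \<in> SCc (iv m)" "?X \<in> SCc (iv n)"
   using coh_in[OF s] \<beta>_in[OF nm(4) F] \<beta>_in[OF nm(1) F] by auto
  have 2: "dist_n m (?T m g (s m)) (?T m g ?Y) <= e / 3"
   using T_contraction[OF gc car(1,3), of q] N[OF nm(4)] by linarith
  have "?T m ?g ?Y = ?T m ?g (hkt_beta l n m ?X)" using comp[OF nm(1,3) F] by simp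
  also have "... = hkt_beta l n m (?T n ?g ?X)"
  proof (rule T_beta[OF nm(3) car(4) gc'])
   fix i assume "i \<in> idx {Suc n..m}"
   then have "i \<in> idx (iv m)" "i ~: idx (iv n)" using nm by (auto simp: idx_def iv_def)
   then show "crd i ?g = 0" using cr by simp
  qed
  also have "?T n ?g ?X = ?T n g ?X"
   by (rule T_cong[OF good_iv gc' gc car(4)]) (simp add: crd_modes_proj)
  finally have 3: "?T m ?g ?Y = hkt_beta l n m (?T n g ?X)" .
  note TX = T_SC[OF good_iv gc car(4), of q] T_SC[OF good_iv gc car(2), of q]
  have "dist_n m (hkt_beta l n m (?T n g ?X)) (hkt_beta l n m (?T n g (s n))) = nrm (SC (iv m)) (hkt_beta l n m (sub (SC (iv n)) (?T n g ?X) (?T n g (s n))))"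
   unfolding dist_n_def \<beta>_sub[OF nm(3) TX] ..
  also have "... <= dist_n n (?T n g ?X) (?T n g (s n))" unfolding dist_n_def by (rule \<beta>_nrm[OF nm(3)]) (use TX in blast)
  also have "... <= dist_n n ?X (s n)" by (rule T_contraction[OF gc car(4,2)])
  also have "... = dist_n n (s n) ?X" unfolding dist_n_def by (rule A.nrm_sub_commute) (use car in blast)+
  finally have 4: "dist_n m (?T m ?g ?Y) (hkt_beta l n m (?T n g (s n))) <= e / 3" unfolding 3 using N[OF nm(1)] by linarith
  let ?Z = "hkt_beta l n m (?T n g (s n))"
  have c: "?T m g (s m) \<in> SCc (iv m)" "?T m g ?Y \<in> SCc (iv m)" "?T m ?g ?Y \<in> SCc (iv m)" "?Z \<in> SCc (iv m)"
   using T_SC[OF good_iv gc car(1)] T_SC[OF good_iv gc car(3)] T_SC[OF good_iv gc' car(3)] \<beta>_in[OF nm(3) TX(2)] by blast+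
  have "dist_n m (?T m g (s m)) ?Z <= dist_n m (?T m g (s m)) (?T m g ?Y) + dist_n m (?T m g ?Y) ?Z"
   unfolding dist_n_def using c by (intro A.nrm_sub_tri)
  also have "dist_n m (?T m g ?Y) ?Z <= dist_n m (?T m g ?Y) (?T m ?g ?Y) + dist_n m (?T m ?g ?Y) ?Z"
   unfolding dist_n_def using c by (intro A.nrm_sub_tri)
  also have "dist_n m (?T m g ?Y) (?T m ?g ?Y) = dist_n m (?T m ?g ?Y) (?T m g ?Y)"
   unfolding dist_n_def using c by (intro A.nrm_sub_commute)
  finally show "dist_n m (?T m g (s m)) ?Z <= e" using 1 2 4 by linarith
 qed
qed

definition \<Phi> :: "real => (real => real) => (nat => sc) set => (nat => sc) set" where
 "\<Phi> q g = lift (%n. T q (iv n) g)"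

lemma \<Phi>_cls: "coh s ==> g \<in> loop_group ==> \<Phi> q g (cls s) = cls (%n. T q (iv n) g (s n))"
 unfolding \<Phi>_def by (rule lift_cls) (auto intro: T_coh T_contraction loop_cont)

lemma \<Phi>_in [simp]: assumes "X \<in> car D" "g \<in> loop_group" shows "\<Phi> q g X \<in> car D"
proof -
 obtain s where s: "coh s" "X = cls s" using assms(1) by (rule D_cases)
 show ?thesis using cls_in[OF T_coh[OF s(1) assms(2)]] \<Phi>_cls[OF s(1) assms(2)] s(2) by simp
qed

lemma \<Phi>_add: assumes "X \<in> car D" "Y \<in> car D" "g \<in> loop_group" shows "\<Phi> q g (add D X Y) = add D (\<Phi> q g X) (\<Phi> q g Y)"
proof -
 obtain s s' where s: "coh s" "X = cls s" "coh s'" "Y = cls s'" using assms(1,2) by (metis D_cases)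
 show ?thesis unfolding s add_cls[OF s(1,3)] \<Phi>_cls[OF s(1) assms(3)] \<Phi>_cls[OF s(3) assms(3)]
  add_cls[OF T_coh[OF s(1) assms(3)] T_coh[OF s(3) assms(3)]] \<Phi>_cls[OF coh_add[OF s(1,3)] assms(3)]
  by (simp add: T_linear)
qed

lemma \<Phi>_scl: assumes "X \<in> car D" "g \<in> loop_group" shows "\<Phi> q g (scl D c X) = scl D c (\<Phi> q g X)"
proof -
 obtain s where s: "coh s" "X = cls s" using assms(1) by (rule D_cases)
 show ?thesis unfolding s scl_cls[OF s(1)] \<Phi>_cls[OF s(1) assms(2)]
  scl_cls[OF T_coh[OF s(1) assms(2)]] \<Phi>_cls[OF coh_scl[OF s(1)] assms(2)] by (simp add: T_linear)
qed

lemma \<Phi>_mul: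
 assumes "X \<in> car D" "Y \<in> car D" "g \<in> loop_group" shows "\<Phi> (p + q) g (mul D X Y) = mul D (\<Phi> p g X) (\<Phi> q g Y)"
proof -
 obtain s s' where s: "coh s" "X = cls s" "coh s'" "Y = cls s'" using assms(1,2) by (metis D_cases)
 show ?thesis unfolding s mul_cls[OF s(1,3)] \<Phi>_cls[OF s(1) assms(3)] \<Phi>_cls[OF s(3) assms(3)]
  mul_cls[OF T_coh[OF s(1) assms(3)] T_coh[OF s(3) assms(3)]] \<Phi>_cls[OF coh_mul[OF s(1,3)] assms(3)]
  using coh_in[OF s(1)] coh_in[OF s(3)] assms(3) by (simp add: T_mul loop_cont)
qed

lemma \<Phi>_str: assumes "X \<in> car D" "g \<in> loop_group" shows "str D (\<Phi> q g X) = \<Phi> (- q) g (str D X)"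
proof -
 obtain s where s: "coh s" "X = cls s" using assms(1) by (rule D_cases)
 show ?thesis unfolding s str_cls[OF s(1)] \<Phi>_cls[OF s(1) assms(2)]
  str_cls[OF T_coh[OF s(1) assms(2)]] \<Phi>_cls[OF coh_str[OF s(1)] assms(2)]
  using coh_in[OF s(1)] assms(2) by (simp add: T_star loop_cont)
qed

lemma \<Phi>_gra: assumes "X \<in> car D" "g \<in> loop_group" shows "\<Phi> q g (gra D X) = gra D (\<Phi> q g X)"
proof -
 obtain s where s: "coh s" "X = cls s" using assms(1) by (rule D_cases)
 show ?thesis unfolding s gra_cls[OF s(1)] \<Phi>_cls[OF s(1) assms(2)]
  gra_cls[OF T_coh[OF s(1) assms(2)]] \<Phi>_cls[OF coh_gra[OF s(1)] assms(2)]
  using T_gra[OF good_iv loop_cont[OF assms(2)] coh_in[OF s(1)]] by (simp only:)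
qed

lemma \<Phi>_zero: assumes "X \<in> car D" shows "\<Phi> q (%th. 0) X = X"
proof -
 obtain s where s: "coh s" "X = cls s" using assms(1) by (rule D_cases)
 show ?thesis unfolding s \<Phi>_cls[OF s(1) loop_zero] T_zero[OF good_iv coh_in[OF s(1)]] ..
qed

lemma \<Phi>_contraction: assumes "X \<in> car D" "g \<in> loop_group" shows "nrm D (\<Phi> q g X) <= nrm D X"
proof -
 obtain s where s: "coh s" "X = cls s" using assms(1) by (rule D_cases)
 show ?thesis unfolding s \<Phi>_cls[OF s(1) assms(2)]
  by (rule nrm_cls_mono[OF T_coh[OF s(1) assms(2)] s(1)])
   (use T_norm[OF good_iv loop_cont[OF assms(2)] coh_in[OF s(1)]] in simp)
qed

text \<open>At level \<open>n\<close> the cocycle is \<open>om (iv n) g g'\<close>, which converges to \<open>\<omega> g g'\<close>.\<close>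

lemma \<Phi>_\<Phi>:
 assumes X: "X \<in> car D" and g: "g \<in> loop_group" "g' \<in> loop_group"
 shows "\<Phi> q g (\<Phi> q g' X) = scl D (cis (q / 2 * \<omega> g g')) (\<Phi> q (loop_add g g') X)"
proof -
 obtain s where s: "coh s" "X = cls s" using X by (rule D_cases)
 let ?h = "loop_add g g'" and ?z = "cis (q / 2 * \<omega> g g')" and ?zn = "%n. cis (q / 2 * om (iv n) g g')"
 have h: "?h \<in> loop_group" using g by simp
 have gc: "continuous_on UNIV g" "continuous_on UNIV g'" "continuous_on UNIV ?h" using g h by (auto intro: loop_cont)
 let ?u = "%n. T q (iv n) g (T q (iv n) g' (s n))" and ?v = "%n. T q (iv n) ?h (s n)"
 have u: "coh ?u" and v: "coh ?v" using T_coh[OF T_coh[OF s(1) g(2)] g(1)] T_coh[OF s(1) h] .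
 obtain B where B: "B > 0" "!!n. nrm (SC (iv n)) (?v n) <= B" by (rule coh_bounded[OF v]) blast
 have "nul ?u (%n. scl (SC (iv n)) ?z (?v n))"
 proof (rule nul_bound)
  have c: "(%n. scl (SC (iv n)) ?z (?v n)) n \<in> SCc (iv n)" for n using coh_in[OF coh_scl[OF v]] .
  show "0 <= dist_n n (?u n) (scl (SC (iv n)) ?z (?v n))" for n by (intro dist_nonneg coh_in[OF u] c)
  have "(%n. om (iv n) g g') \<longlonglongrightarrow> \<omega> g g'" using om_tendsto_omega[OF g] by (simp add: iv_def)
  then have "(%n. ?zn n) \<longlonglongrightarrow> ?z" by (intro tendsto_cis tendsto_mult_left)
  then have "(%n. cmod (?zn n - ?z)) \<longlonglongrightarrow> 0" by (simp add: tendsto_norm_zero LIM_zero)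
  then show "(%n. cmod (?zn n - ?z) * B) \<longlonglongrightarrow> 0" by (rule tendsto_mult_left_zero)
  show "dist_n n (?u n) (scl (SC (iv n)) ?z (?v n)) <= cmod (?zn n - ?z) * B" for n
  proof -
   have "sub (SC (iv n)) (?u n) (scl (SC (iv n)) ?z (?v n)) = scl (SC (iv n)) (?zn n - ?z) (?v n)"
    unfolding T_T[OF good_iv gc(1,2) coh_in[OF s(1)]] by (simp add: left_diff_distrib)
   then have "dist_n n (?u n) (scl (SC (iv n)) ?z (?v n)) = cmod (?zn n - ?z) * nrm (SC (iv n)) (?v n)"
    unfolding dist_n_def using A.nrm_scl[OF coh_in[OF v]] by simp
   then show ?thesis using B(2)[of n] by (simp only:) (intro mult_left_mono; simp)
  qed
 qed
 then have "cls ?u = cls (%n. scl (SC (iv n)) ?z (?v n))" using cls_eq[OF u coh_scl[OF v]] by simp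
 then show ?thesis
  unfolding s \<Phi>_cls[OF s(1) g(2)] \<Phi>_cls[OF T_coh[OF s(1) g(2)] g(1)] \<Phi>_cls[OF s(1) h] scl_cls[OF v] .
qed

end

lemma phase_cis: "phase f g = cis (1 / 2 * \<omega> f g)"
 by (simp add: phase_def cis_conv_exp)

lemma sh_modes: assumes "good K" "g \<in> modes K" "x \<in> modes K" shows "sh K g x = loop_diff x g"
proof -
 have "loop_diff x g \<in> modes K" using modes_linear[of K x g "-1"] assms by (simp add: loop_diff_def goodD)
 then show ?thesis using assms(1) by (simp add: sh_def modes_proj_id)
qed

lemma loop_diff_modes: assumes "good K" "g \<in> modes K" shows "loop_diff x g \<in> modes K \<longleftrightarrow> x \<in> modes K"
proof
 assume "loop_diff x g \<in> modes K"
 from modes_linear[OF goodD(1)[OF assms(1)] this assms(2), of 1] show "x \<in> modes K" by (simp add: loop_diff_def)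
next
 assume "x \<in> modes K"
 from modes_linear[OF goodD(1)[OF assms(1)] this assms(2), of "-1"] show "loop_diff x g \<in> modes K" by (simp add: loop_diff_def)
qed

lemma T_tensor:
 assumes K: "good K" and g: "g \<in> modes K" and h: "h \<in> Cl_tau K"
 shows "T 0 K g (tensor f h) = tensor f (translate g h)" "T 1 K g (tensor f h) = tensor f (twisted_translate g h)"
proof -
 have out: "h (loop_diff x g) = (%S. 0)" if "x ~: modes K" for x
  using h that loop_diff_modes[OF K g] unfolding Cl_tau_def by blast
 have "\<omega> g x = om K g x" if "x \<in> modes K" for x
  by (rule omega_modes[OF K continuous_modes[OF goodD(1)[OF K] g] that])
 then show "T 0 K g (tensor f h) = tensor f (translate g h)" "T 1 K g (tensor f h) = tensor f (twisted_translate g h)"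
  using out by (auto simp: fun_eq_iff T_def tensor_def translate_def twisted_translate_def phase_cis sh_modes[OF K g])
qed

text \<open>A cutoff in \<open>t\<^sup>2 + |x|\<^sup>2\<close>.  Being even in \<open>t\<close> it is central, and \<open>cut_one\<close> is an approximate unit as \<open>k\<close> grows.\<close>

definition cut :: "nat set => nat => real => (real => real) => real" where
 "cut K k t x = max 0 (min 1 (real k + 1 - (nsq K t x)))"

definition cut_one :: "nat set => nat => sc" where
 "cut_one K k = (%(t, x). if x \<in> modes K then cf (cs (of_real (cut K k t x))) else (%S. 0))"

lemma H_cut_one: "x \<in> modes K ==> H (cut_one K k) t x = cs (of_real (cut K k t x))"
proof -
 assume x: "x \<in> modes K"
 have "atc (cut_one K k) t x = cs (of_real (cut K k t x))" for t using x by (intro atc_eqI) (simp add: cut_one_def)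
 then show ?thesis by (simp add: H_def cut_def)
qed

lemma cut_one_SC: assumes K: "good K" shows "cut_one K k \<in> SCc K"
proof (rule SC_I[OF K])
 let ?a = "%t x. cs (of_real (cut K k t x))"
 show "cut_one K k (t, x) = cf (?a t x)" if "x \<in> modes K" for t x using that by (simp add: cut_one_def)
 show "cut_one K k (t, x) = (%S. 0)" if "x ~: modes K" for t x using that by (simp add: cut_one_def)
 show "cin (idx K) (?a t x)" for t x by simp
 fix S
 have n: "(modes_norm K x)^2 = (\<Sum>i\<in>idx K. (crd i x)^2)" for x using K by (simp add: modes_norm_eq goodD sum_nonneg)
 have "continuous_on (UNIV \<times> modes K) (%p. crd i (snd p))" for i
  by (rule continuous_on_compose2[OF continuous_on_crd[of K i]]) (use goodD[OF K] in "auto intro: continuous_on_snd continuous_on_id")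
 then have "continuous_on (UNIV \<times> modes K) (%p. complex_of_real (cut K k (fst p) (snd p)))"
  unfolding cut_def n by (intro continuous_intros)
 moreover have "EX R. ALL t. ALL x:modes K. R < nsq K t x --> cmod (complex_of_real (cut K k t x)) < e" if "e > 0" for e
  using that by (intro exI[of _ "real k + 1"]) (auto simp: cut_def)
 ultimately have "C0 K (%(t, x). complex_of_real (cut K k t x))" unfolding C0_def by (simp add: case_prod_unfold)
 then show "C0 K (%(t, x). cf (?a t x) S)"
  by (cases "S = {}") (simp_all add: cs.rep_eq case_prod_unfold)
qed

lemma cut_one_norm: "good K ==> sc_norm K (cut_one K k) <= 1"
 by (rule sc_norm_leI[OF _ cut_one_SC]) (use norm_cs_mult[of _ 1] in "auto simp: H_cut_one cut_def")

lemma cut_one_approx: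
 assumes K: "good K" and F: "F \<in> SCc K" and e: "e > 0"
 obtains k where "sc_norm K (%p S. F p S - sc_mult (cut_one K k) F p S) <= e"
proof -
 have e2: "e / 2 > 0" using e by simp
 have "\<exists>R\<ge>0. ALL t. ALL x:modes K. nsq K t x > R --> norm (atc F t x) <= e / 2"
  by (rule atc_bound[OF K F]) (use e2 in blast)
 then obtain R where R: "!!t x. x \<in> modes K ==> nsq K t x > R ==> norm (atc F t x) <= e / 2" by blast
 obtain k :: nat where k: "R <= real k" using real_arch_simple by blast
 note u = cut_one_SC[OF K, of k]
 have "sc_norm K (%p S. F p S - sc_mult (cut_one K k) F p S) <= e"
 proof (rule sc_norm_leI[OF K SC_sub[OF K F SC_mul[OF K u F]]])
  fix t x assume x: "x \<in> modes K"
  let ?c = "cut K k t x"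
  have "cs (of_real (1 - ?c)) + cs (of_real ?c) = 1" by (simp flip: cs_add)
  then have "1 - cs (of_real ?c) = cs (of_real (1 - ?c))" by (simp add: algebra_simps)
  moreover have "H (%p S. F p S - sc_mult (cut_one K k) F p S) t x = (1 - cs (of_real ?c)) * H F t x"
   unfolding H_sub[OF K F SC_mul[OF K u F]] H_mul[OF K u F] H_cut_one[OF x] by (simp add: left_diff_distrib)
  ultimately have n: "norm (H (%p S. F p S - sc_mult (cut_one K k) F p S) t x) = \<bar>1 - ?c\<bar> * norm (H F t x)"
   by (simp add: norm_cs_mult del: of_real_diff)
  show "norm (H (%p S. F p S - sc_mult (cut_one K k) F p S) t x) <= e"
  proof (cases "nsq K t x <= k")
   case True
   then have "?c = 1" by (simp add: cut_def)
   then show ?thesis unfolding n using e by simp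
  next
   case False
   have r: "rad 0 {} t x = \<bar>t\<bar>" by (simp add: rad_def csq_def)
   have b: "bet 0 K {} F = F" by (rule bet_id[OF K F])
   have "norm (atc F \<bar>t\<bar> x) <= e / 2" "norm (atc F (- \<bar>t\<bar>) x) <= e / 2" using False k by (intro R[OF x]; simp)+
   then have "norm (H (bet 0 K {} F) t x) <= 2 * (e / 2)"
    by (intro norm_H_bet_le) (use x K in "simp_all add: r modes_proj_id")
   then have "norm (H F t x) <= e" unfolding b by simp
   moreover have "\<bar>1 - ?c\<bar> <= 1" by (simp add: cut_def)
   ultimately have "\<bar>1 - ?c\<bar> * norm (H F t x) <= 1 * e" by (intro mult_mono) auto
   then show ?thesis unfolding n by simp
  qed
 qed
 then show ?thesis by (rule that)
qed

context hkt begin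

text \<open>The inverse loop acts as the inverse up to a phase, and both are contractive.\<close>

lemma \<Phi>_norm: assumes X: "X \<in> car D" and g: "g \<in> loop_group" shows "nrm D (\<Phi> q g X) = nrm D X"
proof (rule antisym[OF \<Phi>_contraction[OF X g]])
 let ?g = "loop_diff (%th. 0) g"
 have g': "?g \<in> loop_group" using g by simp
 have "loop_add ?g g = (%th. 0)" by (simp add: loop_add_def loop_diff_def)
 then have "\<Phi> q ?g (\<Phi> q g X) = scl D (cis (q / 2 * \<omega> ?g g)) X"
  using \<Phi>_\<Phi>[OF X g' g, of q] \<Phi>_zero[OF X] by simp
 then have "nrm D X = nrm D (\<Phi> q ?g (\<Phi> q g X))" using D.nrm_scl[OF X] by simp
 also have "... <= nrm D (\<Phi> q g X)" using X g g' by (intro \<Phi>_contraction) auto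
 finally show "nrm D X <= nrm D (\<Phi> q g X)" .
qed

lemma \<Phi>_linear: "g \<in> loop_group ==> linear_map D D (\<Phi> q g)"
 unfolding linear_map_def by (auto simp: \<Phi>_add \<Phi>_scl)

lemma \<Phi>_sub: "X \<in> car D ==> Y \<in> car D ==> g \<in> loop_group ==> \<Phi> q g (sub D X Y) = sub D (\<Phi> q g X) (\<Phi> q g Y)"
 unfolding sub_def by (simp add: \<Phi>_add \<Phi>_scl)

lemma \<Phi>_continuous: "strongly_continuous D (nrm D) (\<Phi> q)"
 unfolding strongly_continuous_def loop_continuous_def
proof (intro ballI allI impI)
 fix X g and e :: real assume X: "X \<in> car D" and g: "g \<in> loop_group" and e: "e > 0"
 then have e3: "e / 3 > 0" by simp
 obtain N a where a: "a \<in> SCc (iv N)" and Xa: "nrm D (sub D X (incl N a)) <= e / 3"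
  by (rule D_dense[OF X e3])
 let ?Y = "incl N a"
 have Y: "?Y \<in> car D" and i: "coh (isq N a)" using a coh_isq[OF a] by simp_all
 obtain \<delta> where \<delta>: "\<delta> > 0" "!!m g'. N <= m ==> g' \<in> loop_group ==> Wn l (iv m) (loop_diff g' g) <= \<delta> ==>
  dist_n m (T q (iv m) g' (hkt_beta l N m a)) (T q (iv m) g (hkt_beta l N m a)) <= e / 3"
  by (rule T_beta_continuous[OF a e3 g, of q]) blast
 define \<eta> where "\<eta> = sqrt (\<delta> / (16 * pi))"
 have \<eta>: "\<eta> > 0" "16 * pi * \<eta>\<^sup>2 = \<delta>" using \<delta>(1) by (simp_all add: \<eta>_def)
 let ?W = "nbh g (pord l) \<eta>"
 have "nrm D (sub D (\<Phi> q g' X) (\<Phi> q g X)) <= e" if g': "g' \<in> ?W" for g'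
 proof -
  have gl: "g' \<in> loop_group" using g' by (simp add: nbh_def)
  have "nrm D (sub D (\<Phi> q g' ?Y) (\<Phi> q g ?Y)) <= e / 3"
   unfolding incl_isq \<Phi>_cls[OF i gl] \<Phi>_cls[OF i g] sub_cls[OF T_coh[OF i gl] T_coh[OF i g]]
  proof (rule nrm_cls_le[OF coh_sub[OF T_coh[OF i gl] T_coh[OF i g]], of N])
   fix n assume n: "N <= n"
   have "Wn l (iv n) (loop_diff g' g) <= \<delta>" using nbh_Wn[OF g g' le_refl, of n] \<eta>(2) by (simp add: iv_def)
   from \<delta>(2)[OF n gl this]
   show "nrm (SC (iv n)) (sub (SC (iv n)) (T q (iv n) g' (isq N a n)) (T q (iv n) g (isq N a n))) <= e / 3"
    using n unfolding dist_n_def by (simp add: isq_def)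
  qed
  moreover have "nrm D (sub D (\<Phi> q g' X) (\<Phi> q g' ?Y)) <= e / 3"
   using Xa \<Phi>_contraction[OF D.sub_in[OF X Y] gl, of q] by (simp add: \<Phi>_sub X Y gl)
  moreover have "nrm D (sub D (\<Phi> q g ?Y) (\<Phi> q g X)) <= e / 3"
   using Xa \<Phi>_contraction[OF D.sub_in[OF X Y] g, of q] D.nrm_sub_commute[OF X Y] \<Phi>_contraction[OF D.sub_in[OF Y X] g, of q]
   by (simp add: \<Phi>_sub X Y g)
  moreover have "nrm D (sub D (\<Phi> q g' X) (\<Phi> q g X)) <= nrm D (sub D (\<Phi> q g' X) (\<Phi> q g' ?Y)) + nrm D (sub D (\<Phi> q g' ?Y) (\<Phi> q g X))"
   "nrm D (sub D (\<Phi> q g' ?Y) (\<Phi> q g X)) <= nrm D (sub D (\<Phi> q g' ?Y) (\<Phi> q g ?Y)) + nrm D (sub D (\<Phi> q g ?Y) (\<Phi> q g X))"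
   using X Y g gl by (auto intro!: D.nrm_sub_tri)
  ultimately show ?thesis by linarith
 qed
 then show "EX W. openin loop_topology W & g \<in> W & (\<forall>g'\<in>W. nrm D (sub D (\<Phi> q g' X) (\<Phi> q g X)) <= e)"
  using openin_nbh[OF g \<eta>(1)] nbh_self[OF g \<eta>(1)] by blast
qed

lemma cls_eq_eventually:
 assumes "coh s" "coh s'" "!!n. n >= N ==> s n = s' n" shows "cls s = cls s'"
 unfolding cls_eq[OF assms(1,2)] nul_def
proof (rule tendsto_eventually)
 show "\<forall>\<^sub>F n in sequentially. dist_n n (s n) (s' n) = 0"
  unfolding eventually_sequentially dist_n_def using assms(3) A.sub_self[OF coh_in[OF assms(2)]]
  by (intro exI[of _ N]) (simp del: sub_SC SC_sel add: A.nrm_zero)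
qed

lemma incl_beta:
 assumes nm: "N <= m" and a: "a \<in> SCc (iv N)"
 shows "incl m (hkt_beta l N m a) = incl N a"
 unfolding incl_isq
 by (rule cls_eq_eventually[of _ _ m]) (use nm comp[OF nm _ a] coh_isq[OF a] coh_isq[OF \<beta>_in[OF nm a]] in "auto simp: isq_def simp del: SC_sel")

lemma \<Phi>_incl:
 assumes g: "g \<in> modes (iv N)" and a: "a \<in> SCc (iv N)"
 shows "\<Phi> q g (incl N a) = incl N (T q (iv N) g a)"
proof -
 have gl: "g \<in> loop_group" by (rule modes_loop[OF good_iv g])
 have gc: "continuous_on UNIV g" using gl by (rule loop_cont)
 have Ta: "T q (iv N) g a \<in> SCc (iv N)" by (rule T_SC[OF good_iv gc a])
 have z: "crd i g = 0" if "i \<in> idx {Suc N..m}" for i m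
 proof -
  have "i \<in> idx (iv (max m N))" "i ~: idx (iv N)" using that by (auto simp: idx_def iv_def)
  then have "crd i (modes_proj (iv N) g) = 0" using idx_div[OF good_iv] by (simp add: modes_proj_eq goodD crd_comb)
  then show ?thesis using g by (simp add: modes_proj_id)
 qed
 show ?thesis unfolding incl_isq \<Phi>_cls[OF coh_isq[OF a] gl]
  by (rule cls_eq_eventually[of _ _ N]) (use T_coh[OF coh_isq[OF a] gl] coh_isq[OF Ta] T_beta[OF _ a gc z] in "simp_all add: isq_def")
qed

text \<open>The action is required to be extensional outside the loop group and the algebra.\<close>

definition rest :: "((real => real) => (nat => sc) set => (nat => sc) set) => (real => real) => (nat => sc) set => (nat => sc) set" where
 "rest \<phi> = (\<lambda>g\<in>loop_group. \<lambda>X\<in>car D. \<phi> g X)"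

lemma rest_apply [simp]: "g \<in> loop_group ==> X \<in> car D ==> rest \<phi> g X = \<phi> g X" by (simp add: rest_def)

lemma rest_linear: "g \<in> loop_group ==> linear_map D D (rest (\<Phi> q) g)"
 using \<Phi>_linear[of g q] unfolding linear_map_def by simp

lemma rest_continuous: "strongly_continuous D (nrm D) (rest (\<Phi> q))"
 unfolding strongly_continuous_def loop_continuous_def
proof (intro ballI allI impI)
 fix X g and e :: real assume X: "X \<in> car D" and g: "g \<in> loop_group" and e: "e > 0"
 obtain W where W: "openin loop_topology W" "g \<in> W" "!!g'. g' \<in> W ==> nrm D (sub D (\<Phi> q g' X) (\<Phi> q g X)) <= e"
  using \<Phi>_continuous[of q, unfolded strongly_continuous_def loop_continuous_def, rule_format, OF X g e] by blast
 have op: "openin loop_topology (nbh g 0 1)" "g \<in> nbh g 0 1" using openin_nbh[OF g] nbh_self[OF g] by simp_all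
 show "EX W. openin loop_topology W & g \<in> W & (\<forall>g'\<in>W. nrm D (sub D (rest (\<Phi> q) g' X) (rest (\<Phi> q) g X)) <= e)"
  using W op X g by (intro exI[of _ "W Int nbh g 0 1"]) (auto simp: nbh_def)
qed

lemma extends_\<Phi>:
 assumes \<tau>: "!!N g f h. g \<in> modes (iv N) ==> h \<in> Cl_tau (iv N) ==> T q (iv N) g (tensor f h) = tensor f (\<tau> g h)"
 shows "extends_by_continuity l \<tau> (rest (\<Phi> q))"
 unfolding extends_by_continuity_def D_SCU incl_SCU iv_def[symmetric]
proof (intro conjI ballI allI)
 show "rest (\<Phi> q) \<in> loop_group \<rightarrow>\<^sub>E car D \<rightarrow>\<^sub>E car D" by (auto simp: rest_def)
 show "strongly_continuous D (nrm D) (rest (\<Phi> q))" by (rule rest_continuous)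
 fix g assume "g \<in> loop_group"
 then show "linear_map D D (rest (\<Phi> q) g)" "EX c. ALL a:car D. nrm D (rest (\<Phi> q) g a) <= c * nrm D a"
  using rest_linear \<Phi>_contraction by (auto intro!: exI[of _ 1])
next
 fix N g f h assume *: "g \<in> modes (iv N)" "f \<in> car S_alg" "h \<in> Cl_tau (iv N)"
 have t: "tensor f h \<in> SCc (iv N)" by (rule tensor_SC[OF good_iv *(2,3)])
 show "rest (\<Phi> q) g (incl N (tensor f h)) = incl N (tensor f (\<tau> g h))"
  using \<Phi>_incl[OF *(1) t, of q] \<tau>[OF *(1,3)] modes_loop[OF good_iv *(1)] t by (simp del: SC_sel)
qed

text \<open>The values on modes and elementary tensors are prescribed.  Boundedness and linearity extend them to the whole algebra
 for each mode, strong continuity and density of the modes to all loops.\<close>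

lemma extends_unique:
 assumes \<phi>: "extends_by_continuity l \<tau> \<phi>" and \<psi>: "extends_by_continuity l \<tau> \<psi>" shows "\<phi> = \<psi>"
proof -
 note E = extends_by_continuity_def D_SCU incl_SCU iv_def[symmetric]
 have lin: "linear_map D D (\<phi> g)" "linear_map D D (\<psi> g)" if "g \<in> loop_group" for g
  using \<phi> \<psi> that unfolding E by blast+
 have lin_in: "f x \<in> car D" if "linear_map D D f" "x \<in> car D" for f x using that unfolding linear_map_def by blast
 have cont: "strongly_continuous D (nrm D) \<phi>" "strongly_continuous D (nrm D) \<psi>" using \<phi> \<psi> unfolding E by blast+
 have on_modes: "\<phi> g X = \<psi> g X" if g: "g \<in> modes (iv N)" and X: "X \<in> car D" for g X N
 proof -
  have gl: "g \<in> loop_group" by (rule modes_loop[OF good_iv g])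
  note L = lin(1)[OF gl, unfolded linear_map_def] lin(2)[OF gl, unfolded linear_map_def]
  obtain c c' where c: "!!a. a \<in> car D ==> nrm D (\<phi> g a) <= c * nrm D a" "!!a. a \<in> car D ==> nrm D (\<psi> g a) <= c' * nrm D a"
   using \<phi> \<psi> gl unfolding E by metis
  define C where "C = \<bar>c\<bar> + \<bar>c'\<bar> + 1"
  have C: "C > 0" by (simp add: C_def)
  have span: "\<phi> g (incl m G) = \<psi> g (incl m G)" if "tspan (iv m) G" and m: "N <= m" for m G
   using that(1)
  proof (induction rule: tspan.induct)
   case zero
   have "incl m (%p S. 0) = zer D"
    using incl_scl[of "%p S. 0" m 0] SC_zero[OF good_iv, of m] by (simp add: D.scl_0)
   moreover have "\<phi> g (zer D) = zer D" "\<psi> g (zer D) = zer D"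
    using L D.scl_0[OF D.zero_in] by (metis D.scl_0 D.zero_in)+
   ultimately show ?case by simp
  next
   case (tensor f h)
   have "g \<in> modes (iv m)" using g m modes_mono[of "iv m" "iv N"] by (auto simp: iv_def)
   then show ?case using \<phi> \<psi> tensor unfolding E by metis
  next
   case (add F G)
   have FG: "F \<in> SCc (iv m)" "G \<in> SCc (iv m)" using add tspan_SC[OF good_iv] by blast+
   show ?case using incl_add[OF FG] L add incl_in[OF FG(1)] incl_in[OF FG(2)] by (simp only: SC_sel)
  qed
  have "nrm D (sub D (\<phi> g X) (\<psi> g X)) <= C * e" if e: "e > 0" for e
  proof -
   have e2: "e / 2 > 0" using e by simp
   obtain n a where a: "a \<in> SCc (iv n)" "nrm D (sub D X (incl n a)) <= e / 2" by (rule D_dense[OF X e2])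
   let ?m = "max N n"
   have b: "hkt_beta l n ?m a \<in> SCc (iv ?m)" using a(1) by (intro \<beta>_in) auto
   obtain G where G: "tspan (iv ?m) G" "sc_norm (iv ?m) (%p S. hkt_beta l n ?m a p S - G p S) <= e / 2"
    using tspan_dense[OF good_iv b e2] by blast
   have GS: "G \<in> SCc (iv ?m)" by (rule tspan_SC[OF good_iv G(1)])
   let ?Y = "incl ?m G"
   have Y: "?Y \<in> car D" using incl_in[OF GS] .
   have "nrm D (sub D (incl ?m (hkt_beta l n ?m a)) ?Y) <= e / 2"
    using incl_nrm[OF A.sub_in[OF b GS]] G(2) incl_sub[OF b GS] by simp
   then have "nrm D (sub D (incl n a) ?Y) <= e / 2" using incl_beta[of n ?m a] a(1) by simp
   then have XY: "nrm D (sub D X ?Y) <= e" using D.nrm_sub_tri[OF X incl_in[OF a(1)] Y] a(2) by simp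
   have s: "sub D X ?Y \<in> car D" using X Y by simp
   have d: "\<phi> g (sub D X ?Y) = sub D (\<phi> g X) (\<phi> g ?Y)" "\<psi> g (sub D X ?Y) = sub D (\<psi> g X) (\<psi> g ?Y)"
    unfolding sub_def using L X Y by (simp_all add: D.scl_in)
   have m: "\<phi> g X \<in> car D" "\<psi> g X \<in> car D" "\<phi> g ?Y \<in> car D" using L X Y by blast+
   have "nrm D (sub D (\<phi> g X) (\<psi> g X)) <= nrm D (sub D (\<phi> g X) (\<phi> g ?Y)) + nrm D (sub D (\<phi> g ?Y) (\<psi> g X))"
    using m by (intro D.nrm_sub_tri)
   also have "sub D (\<phi> g X) (\<phi> g ?Y) = \<phi> g (sub D X ?Y)" by (simp only: d)
   also have "nrm D (sub D (\<phi> g ?Y) (\<psi> g X)) = nrm D (\<psi> g (sub D X ?Y))"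
    unfolding d using m D.nrm_sub_commute[of "\<phi> g ?Y" "\<psi> g X"] span[OF G(1)] by simp
   also have "nrm D (\<phi> g (sub D X ?Y)) + nrm D (\<psi> g (sub D X ?Y)) <= c * nrm D (sub D X ?Y) + c' * nrm D (sub D X ?Y)"
    by (intro add_mono c s)
   also have "... <= C * nrm D (sub D X ?Y)" unfolding distrib_right[symmetric] C_def using s by (intro mult_right_mono) auto
   also have "... <= C * e" using XY C by (intro mult_left_mono) auto
   finally show ?thesis .
  qed
  note nb = this
  have "nrm D (sub D (\<phi> g X) (\<psi> g X)) <= 0"
  proof (rule field_le_epsilon)
   fix e :: real assume "e > 0"
   then show "nrm D (sub D (\<phi> g X) (\<psi> g X)) <= 0 + e" using nb[of "e / C"] C by simp
  qed
  moreover have m: "\<phi> g X \<in> car D" "\<psi> g X \<in> car D" using L X by blast+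
  ultimately show ?thesis using D.nrm_0_iff[OF D.sub_in[OF m]] D.nrm_nonneg[OF D.sub_in[OF m]] D.sub_eq_0[OF m] by simp
 qed
 have all: "\<phi> g X = \<psi> g X" if g: "g \<in> loop_group" and X: "X \<in> car D" for g X
 proof -
  have "nrm D (sub D (\<phi> g X) (\<psi> g X)) <= 0 + e" if e: "e > 0" for e
  proof -
   have e2: "e / 2 > 0" using e by simp
   obtain W where W: "openin loop_topology W & g \<in> W & (\<forall>g'\<in>W. nrm D (sub D (\<phi> g' X) (\<phi> g X)) <= e / 2)"
    using cont(1)[unfolded strongly_continuous_def loop_continuous_def, rule_format, OF X g e2] by (rule exE)
   obtain W' where W': "openin loop_topology W' & g \<in> W' & (\<forall>g'\<in>W'. nrm D (sub D (\<psi> g' X) (\<psi> g X)) <= e / 2)"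
    using cont(2)[unfolded strongly_continuous_def loop_continuous_def, rule_format, OF X g e2] by (rule exE)
   obtain k d where k: "d > 0" "nbh g k d <= W Int W'" by (rule openin_nbhE[of "W Int W'" g]) (use W W' in auto)
   obtain N p where p: "p \<in> modes {1..N}" "p \<in> nbh g k d" by (rule modes_dense[OF g k(1)])
   have pl: "p \<in> loop_group" using p by (simp add: nbh_def)
   have m: "\<phi> g X \<in> car D" "\<psi> g X \<in> car D" "\<phi> p X \<in> car D" using lin_in[OF lin(1)[OF g] X] lin_in[OF lin(2)[OF g] X] lin_in[OF lin(1)[OF pl] X] .
   have "\<phi> p X = \<psi> p X" using on_modes[of p N X] p(1) X by (simp add: iv_def)
   then have "nrm D (sub D (\<phi> p X) (\<psi> g X)) <= e / 2" using W' p(2) k(2) by auto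
   moreover have "nrm D (sub D (\<phi> g X) (\<phi> p X)) <= e / 2" using W p(2) k(2) D.nrm_sub_commute[OF m(1,3)] by auto
   ultimately show ?thesis using D.nrm_sub_tri[OF m(1,3,2)] by simp
  qed
  then have "nrm D (sub D (\<phi> g X) (\<psi> g X)) <= 0" by (rule field_le_epsilon)
  moreover have m: "\<phi> g X \<in> car D" "\<psi> g X \<in> car D" using lin_in[OF lin(1)[OF g] X] lin_in[OF lin(2)[OF g] X] .
  ultimately show ?thesis using D.nrm_0_iff[OF D.sub_in[OF m]] D.nrm_nonneg[OF D.sub_in[OF m]] D.sub_eq_0[OF m] by simp
 qed
 have P: "\<phi> \<in> loop_group \<rightarrow>\<^sub>E car D \<rightarrow>\<^sub>E car D" "\<psi> \<in> loop_group \<rightarrow>\<^sub>E car D \<rightarrow>\<^sub>E car D" using \<phi> \<psi> unfolding E by blast+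
 show ?thesis
 proof (rule PiE_ext[OF P])
  fix g assume g: "g \<in> loop_group"
  show "\<phi> g = \<psi> g" by (rule PiE_ext[OF PiE_mem[OF P(1) g] PiE_mem[OF P(2) g]]) (rule all[OF g])
 qed
qed

end

context hkt begin

lemma rest_translation: "U_cstar_algebra D (rest (\<Phi> 0))"
 unfolding U_cstar_algebra_def star_hom_def graded_map_def
proof (intro conjI ballI)
 show "graded_cstar_algebra D" by (rule D_cstar)
 show "strongly_continuous D (nrm D) (rest (\<Phi> 0))" by (rule rest_continuous)
 show "rest (\<Phi> 0) (%th. 0) a = a" if "a \<in> car D" for a using that by (simp add: \<Phi>_zero)
 fix g assume g: "g \<in> loop_group"
 have comp: "rest (\<Phi> 0) h (rest (\<Phi> 0) h' a) = rest (\<Phi> 0) (loop_add h h') a" if "h \<in> loop_group" "h' \<in> loop_group" "a \<in> car D" for h h' a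
  using that \<Phi>_\<Phi>[of a h h' 0] by (simp add: D.scl_1)
 then show "rest (\<Phi> 0) g (rest (\<Phi> 0) g' a) = rest (\<Phi> 0) (loop_add g g') a" if "g' \<in> loop_group" "a \<in> car D" for g' a
  using g that by blast
 show "linear_map D D (rest (\<Phi> 0) g)" by (rule rest_linear[OF g])
 show "rest (\<Phi> 0) g (mul D a b) = mul D (rest (\<Phi> 0) g a) (rest (\<Phi> 0) g b)" if "a \<in> car D" "b \<in> car D" for a b
  using \<Phi>_mul[OF that g, of 0 0] that g by simp
 show "rest (\<Phi> 0) g (str D a) = str D (rest (\<Phi> 0) g a)" "nrm D (rest (\<Phi> 0) g a) <= nrm D a"
  "rest (\<Phi> 0) g (gra D a) = gra D (rest (\<Phi> 0) g a)" if "a \<in> car D" for a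
  using \<Phi>_str[OF that g, of 0] \<Phi>_gra[OF that g, of 0] \<Phi>_contraction[OF that g] that g by simp_all
 let ?g = "loop_diff (%th. 0) g"
 have g': "?g \<in> loop_group" using g by simp
 have "loop_add ?g g = (%th. 0)" "loop_add g ?g = (%th. 0)" by (simp_all add: loop_add_def loop_diff_def)
 then show "bij_betw (rest (\<Phi> 0) g) (car D) (car D)"
  using comp[OF g' g] comp[OF g g'] g g' by (intro bij_betw_byWitness[where f' = "rest (\<Phi> 0) ?g"]) (auto simp: \<Phi>_zero)
qed

lemma rest_twisted: "twisted_action D (nrm D) (rest (\<Phi> 1))"
 unfolding twisted_action_def
 using rest_continuous rest_linear by (auto simp: \<Phi>_norm \<Phi>_\<Phi> phase_cis)

text \<open>Every element is close to one at a finite level, where the cutoffs form an approximate unit.\<close>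

lemma countable_approximate_unit:
 obtains E where "countable E" "E <= car D" "!!X eps. X \<in> car D ==> eps > 0 ==> EX u:E. nrm D (sub D X (mul D u X)) < eps"
proof
 let ?u = "%(N, k). incl N (cut_one (iv N) k)"
 have uS: "cut_one (iv N) k \<in> SCc (iv N)" for N k by (rule cut_one_SC[OF good_iv])
 have uD: "incl N (cut_one (iv N) k) \<in> car D" for N k by (rule incl_in[OF uS])
 show "countable (range ?u)" by (rule countableI_type[THEN countable_image])
 show "range ?u <= car D" using uD by auto
 fix X and e :: real assume X: "X \<in> car D" and e: "e > 0"
 then have e4: "e / 4 > 0" by simp
 obtain N a where a: "a \<in> SCc (iv N)" "nrm D (sub D X (incl N a)) <= e / 4" by (rule D_dense[OF X e4])
 obtain k where k: "sc_norm (iv N) (%p S. a p S - sc_mult (cut_one (iv N) k) a p S) <= e / 4"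
  by (rule cut_one_approx[OF good_iv a(1) e4])
 let ?Y = "incl N a" and ?U = "incl N (cut_one (iv N) k)"
 have Y: "?Y \<in> car D" by (rule incl_in[OF a(1)])
 note U = uD[of N k]
 have m: "mul (SC (iv N)) (cut_one (iv N) k) a \<in> SCc (iv N)" by (rule A.mul_in[OF uS a(1)])
 have "nrm D (sub D ?Y (mul D ?U ?Y)) = nrm D (incl N (sub (SC (iv N)) a (mul (SC (iv N)) (cut_one (iv N) k) a)))"
  unfolding incl_mul[OF uS a(1), symmetric] incl_sub[OF a(1) m] ..
 also have "... <= e / 4" using incl_nrm[OF A.sub_in[OF a(1) m]] k by simp
 finally have 1: "nrm D (sub D ?Y (mul D ?U ?Y)) <= e / 4" .
 have "nrm D ?U <= 1" using incl_nrm[OF uS[of N k]] cut_one_norm[OF good_iv, of N k] by simp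
 then have "nrm D ?U * nrm D (sub D X ?Y) <= 1 * (e / 4)" using a(2) X Y by (intro mult_mono) auto
 then have "nrm D (mul D ?U (sub D X ?Y)) <= e / 4" using D.nrm_mul[OF U D.sub_in[OF X Y]] by linarith
 then have 2: "nrm D (sub D (mul D ?U ?Y) (mul D ?U X)) <= e / 4"
  using D.mul_subR[OF X Y U] D.nrm_sub_commute[OF D.mul_in[OF U Y] D.mul_in[OF U X]] by simp
 have "nrm D (sub D X (mul D ?U X)) <= nrm D (sub D X ?Y) + nrm D (sub D ?Y (mul D ?U X))"
  "nrm D (sub D ?Y (mul D ?U X)) <= nrm D (sub D ?Y (mul D ?U ?Y)) + nrm D (sub D (mul D ?U ?Y) (mul D ?U X))"
  using X Y U by (auto intro!: D.nrm_sub_tri)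
 then have "nrm D (sub D X (mul D ?U X)) < e" using 1 2 a(2) e by linarith
 then show "EX u:range ?u. nrm D (sub D X (mul D u X)) < e" by (intro bexI[of _ ?U]) auto
qed

lemma clifford_symbol_module:
 "twisted_kasparov_module D (rest (\<Phi> 0)) D (rest (\<Phi> 0)) (self_module D) (rest (\<Phi> 1)) (mul D) (%x. zer D)"
 "twisted_bimodule_action D (rest (\<Phi> 0)) (rest (\<Phi> 1))"
proof -
 obtain E where E: "countable E" "E <= car D" "!!X eps. X \<in> car D ==> eps > 0 ==> EX u:E. nrm D (sub D X (mul D u X)) < eps"
  by (rule countable_approximate_unit) blast
 have left: "rest (\<Phi> 1) g (mul D a x) = mul D (rest (\<Phi> 0) g a) (rest (\<Phi> 1) g x)"
  and right: "rest (\<Phi> 1) g (mul D x a) = mul D (rest (\<Phi> 1) g x) (rest (\<Phi> 0) g a)"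
  and inner: "mul D (str D (rest (\<Phi> 1) g x)) (rest (\<Phi> 1) g a) = rest (\<Phi> 0) g (mul D (str D x) a)"
  and grading: "rest (\<Phi> 1) g (gra D x) = gra D (rest (\<Phi> 1) g x)"
  if "g \<in> loop_group" "a \<in> car D" "x \<in> car D" for g a x
  using that \<Phi>_mul[of a x g 0 1] \<Phi>_mul[of x a g 1 0] \<Phi>_mul[of "str D x" a g "-1" 1] \<Phi>_str[of x g 1] \<Phi>_gra[of x g 1] by simp_all
 note K = D.kasparov_zero[OF rest_translation rest_twisted left right inner grading E]
 show "twisted_kasparov_module D (rest (\<Phi> 0)) D (rest (\<Phi> 0)) (self_module D) (rest (\<Phi> 1)) (mul D) (%x. zer D)"
  by (rule K(1)) auto
 show "twisted_bimodule_action D (rest (\<Phi> 0)) (rest (\<Phi> 1))"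
  by (rule K(2)) auto
qed

end

theorem mainTheorem5:
 fixes l :: real
 assumes "l > 3 / 2"
 shows "(\<exists>!\<sigma>. extends_by_continuity l translate \<sigma>) \<and>
  (\<exists>!\<rho>. extends_by_continuity l twisted_translate \<rho>) \<and>
  (\<forall>\<sigma> \<rho>. extends_by_continuity l translate \<sigma> \<and> extends_by_continuity l twisted_translate \<rho> \<longrightarrow>
    twisted_bimodule_action (SCU l) \<sigma> \<rho> \<and>
    twisted_kasparov_module (SCU l) \<sigma> (SCU l) \<sigma> (self_module (SCU l)) \<rho>
     (mul (SCU l)) (\<lambda>x. zer (SCU l)))"
proof -
 interpret hkt l using assms by unfold_locales simp
 have \<sigma>: "extends_by_continuity l translate (rest (\<Phi> 0))" by (rule extends_\<Phi>) (rule T_tensor(1)[OF good_iv])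
 have \<rho>: "extends_by_continuity l twisted_translate (rest (\<Phi> 1))" by (rule extends_\<Phi>) (rule T_tensor(2)[OF good_iv])
 have "\<sigma> = rest (\<Phi> 0)" if "extends_by_continuity l translate \<sigma>" for \<sigma> by (rule extends_unique[OF that \<sigma>])
 moreover have "\<rho> = rest (\<Phi> 1)" if "extends_by_continuity l twisted_translate \<rho>" for \<rho> by (rule extends_unique[OF that \<rho>])
 ultimately show ?thesis using \<sigma> \<rho> clifford_symbol_module unfolding D_SCU by blast
qed

end
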